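(* For every fixed $\alpha\in[0,1)$, FLaMECaST restricted to instances with exactly one intermediate layer (i.e., $\lambda=1$) and cost parameter $\alpha$ is NP-hard.
   Context: FLaMECaST: an instance $I=(S,T,C,\alpha)$ consists of a finite set $S$ of sources and a finite set $T$ of sinks, each with a fixed position in $\mathbb{R}^2$ (several sources may share a position), capacities $C=(c_0,\dots,c_{\lambda+1})$ with integers $c_0\ge c_1\ge\dots\ge c_{\lambda+1}\ge 1$ ($\lambda\ge 0$ is the number of intermediate layers), and a parameter $\alpha\in[0,1]$. A topology is a rooted forest (edges directed from child to parent) of height at most $\lambda+1$ whose leaves are exactly $S$ and whose roots form a subset of $T$; its other vertices are Steiner vertices. The layer of a vertex is the number of edges on its path to its root. The load $\ell(v)$ of a vertex is the number of sources in its subtree; the load of an edge $uv$ ($u$ child of $v$) is $\ell(u)$. A topology is valid if $\ell(v)\le c_i$ for every vertex $v$ in layer $i$. An embedding maps each vertex to a point of $\mathbb{R}^2$, sources and sinks to their given positions and Steiner vertices arbitrarily; a topology with an embedding is a layout (valid if its topology is valid). The cost of an edge $uv$ is $\|\mathrm{pos}(u)-\mathrm{pos}(v)\|\cdot\ell(uv)^\alpha$ and the cost of a layout is the sum of its edge costs. The goal is to find a valid layout of minimum cost. *)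

theory Defs
  imports "HOL-Analysis.Analysis" "HOL-Computational_Algebra.Polynomial"
begin

section \<open>FLaMECaST\<close>

text \<open>The number of intermediate layers is \<open>\<lambda> = length (capacities I) - 2\<close>; the product type
  \<^typ>\<open>real \<times> real\<close> carries the Euclidean distance.\<close>

record 'v flamecast =
  sources :: "'v set"
  sinks :: "'v set"
  position :: "'v \<Rightarrow> real \<times> real"
  capacities :: "nat list"
  exponent :: real

definition flamecast_instance :: "'v flamecast \<Rightarrow> bool" where
  "flamecast_instance I \<longleftrightarrow>
     finite (sources I) \<and> finite (sinks I) \<and> sources I \<inter> sinks I = {} \<and>
     length (capacities I) \<ge> 2 \<and> sorted_wrt (\<ge>) (capacities I) \<and>
     (\<forall>c \<in> set (capacities I). c \<ge> 1) \<and>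
     0 \<le> exponent I \<and> exponent I \<le> 1"

text \<open>A forest has vertex set \<open>V\<close> and edge set \<open>E\<close>, whose elements are pairs (child, parent).\<close>

definition rooted_forest :: "'v set \<Rightarrow> 'v rel \<Rightarrow> bool" where
  "rooted_forest V E \<longleftrightarrow> finite V \<and> E \<subseteq> V \<times> V \<and> single_valued E \<and> acyclic E"

definition leaves :: "'v set \<Rightarrow> 'v rel \<Rightarrow> 'v set" where
  "leaves V E = {v \<in> V. v \<notin> Range E}"

definition roots :: "'v set \<Rightarrow> 'v rel \<Rightarrow> 'v set" where
  "roots V E = {v \<in> V. v \<notin> Domain E}"

definition layer :: "'v set \<Rightarrow> 'v rel \<Rightarrow> 'v \<Rightarrow> nat" where
  "layer V E v = (THE n. \<exists>r \<in> roots V E. (v, r) \<in> E ^^ n)"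

text \<open>Vertices that are neither leaves nor roots are Steiner vertices, so a sink occurs in a
  topology only as a root: this is the clause \<open>V \<inter> sinks I = roots V E\<close>.\<close>

definition topology :: "'v flamecast \<Rightarrow> 'v set \<Rightarrow> 'v rel \<Rightarrow> bool" where
  "topology I V E \<longleftrightarrow>
     rooted_forest V E \<and> (\<forall>v \<in> V. layer V E v \<le> length (capacities I) - 1) \<and>
     leaves V E = sources I \<and> V \<inter> sinks I = roots V E"

definition load :: "'v flamecast \<Rightarrow> 'v rel \<Rightarrow> 'v \<Rightarrow> nat" where
  "load I E v = card {s \<in> sources I. (s, v) \<in> E\<^sup>*}"

definition valid_topology :: "'v flamecast \<Rightarrow> 'v set \<Rightarrow> 'v rel \<Rightarrow> bool" where
  "valid_topology I V E \<longleftrightarrow>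
     topology I V E \<and> (\<forall>v \<in> V. load I E v \<le> capacities I ! layer V E v)"

definition embedding :: "'v flamecast \<Rightarrow> 'v set \<Rightarrow> ('v \<Rightarrow> real \<times> real) \<Rightarrow> bool" where
  "embedding I V p \<longleftrightarrow> (\<forall>v \<in> V \<inter> (sources I \<union> sinks I). p v = position I v)"

definition valid_layout ::
    "'v flamecast \<Rightarrow> 'v set \<Rightarrow> 'v rel \<Rightarrow> ('v \<Rightarrow> real \<times> real) \<Rightarrow> bool" where
  "valid_layout I V E p \<longleftrightarrow> valid_topology I V E \<and> embedding I V p"

definition layout_cost :: "'v flamecast \<Rightarrow> 'v rel \<Rightarrow> ('v \<Rightarrow> real \<times> real) \<Rightarrow> real" where
  "layout_cost I E p = (\<Sum>(u, v) \<in> E. dist (p u) (p v) * real (load I E u) powr exponent I)"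

definition optimal_layout ::
    "'v flamecast \<Rightarrow> 'v set \<Rightarrow> 'v rel \<Rightarrow> ('v \<Rightarrow> real \<times> real) \<Rightarrow> bool" where
  "optimal_layout I V E p \<longleftrightarrow> valid_layout I V E p \<and>
     (\<forall>V' E' p'. valid_layout I V' E' p' \<longrightarrow> layout_cost I E p \<le> layout_cost I E' p')"


section \<open>Deterministic multi-tape Turing machines\<close>

text \<open>Tapes are one-way infinite. The symbol 0 is the blank, 1 marks the left end of a tape in
  \<open>contents\<close>, and 2 and 3 stand for the bits. A machine is its list of commands, indexed by states:
  0 is the initial state, and states beyond the list are halting. The input is on tape 0, the
  output on tape 1.\<close>

datatype head_move = Go_Left | Stay | Go_Right

type_synonym tape = "(nat \<Rightarrow> nat) \<times> nat"
type_synonym command = "nat list \<Rightarrow> nat \<times> (nat \<times> head_move) list"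
type_synonym machine = "command list"
type_synonym config = "nat \<times> tape list"

text \<open>\<open>turing_machine k G M\<close>: \<open>M\<close> has \<open>k\<close> tapes and tape alphabet \<open>{..<G}\<close>.\<close>

definition turing_machine :: "nat \<Rightarrow> nat \<Rightarrow> machine \<Rightarrow> bool" where
  "turing_machine k G M \<longleftrightarrow> k \<ge> 2 \<and> G \<ge> 4 \<and>
     (\<forall>cmd \<in> set M. \<forall>syms. length syms = k \<and> set syms \<subseteq> {..<G} \<longrightarrow>
        length (snd (cmd syms)) = k \<and> fst ` set (snd (cmd syms)) \<subseteq> {..<G})"

fun move_head :: "head_move \<Rightarrow> nat \<Rightarrow> nat" where
  "move_head Go_Left h = h - 1"
| "move_head Stay h = h"
| "move_head Go_Right h = h + 1"

definition act :: "nat \<times> head_move \<Rightarrow> tape \<Rightarrow> tape" where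
  "act a t = ((fst t)(snd t := fst a), move_head (snd a) (snd t))"

definition step :: "machine \<Rightarrow> config \<Rightarrow> config" where
  "step M cf =
     (if fst cf < length M
      then let r = (M ! fst cf) (map (\<lambda>t. fst t (snd t)) (snd cf))
           in (fst r, map2 act (snd r) (snd cf))
      else cf)"

definition contents :: "bool list \<Rightarrow> nat \<Rightarrow> nat" where
  "contents w i =
     (if i = 0 then 1 else if i \<le> length w then (if w ! (i - 1) then 3 else 2) else 0)"

definition initial_config :: "nat \<Rightarrow> bool list \<Rightarrow> config" where
  "initial_config k w = (0, (contents w, 0) # replicate (k - 1) (contents [], 0))"

definition polytime :: "(bool list \<Rightarrow> bool list) \<Rightarrow> bool" where
  "polytime f \<longleftrightarrow> (\<exists>k G M (p :: nat poly). turing_machine k G M \<and>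
     (\<forall>w. \<exists>t \<le> poly p (length w). \<exists>q tps.
        (step M ^^ t) (initial_config k w) = (q, tps) \<and>
        q \<ge> length M \<and> fst (tps ! 1) = contents (f w)))"


section \<open>Encodings\<close>

fun delimit :: "bool list \<Rightarrow> bool list" where
  "delimit [] = [False]"
| "delimit (b # w) = True # b # delimit w"

definition encode_list :: "bool list list \<Rightarrow> bool list" where
  "encode_list ws = concat (map delimit ws)"

fun encode_nat :: "nat \<Rightarrow> bool list" where
  "encode_nat n = (if n = 0 then [] else odd n # encode_nat (n div 2))"

declare encode_nat.simps [simp del]

definition encode_int :: "int \<Rightarrow> bool list" where
  "encode_int i = (i < 0) # encode_nat (nat \<bar>i\<bar>)"

definition encode_rat :: "rat \<Rightarrow> bool list" where
  "encode_rat q =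
     encode_list [encode_int (fst (quotient_of q)), encode_int (snd (quotient_of q))]"

definition encode_point :: "rat \<times> rat \<Rightarrow> bool list" where
  "encode_point z = encode_list [encode_rat (fst z), encode_rat (snd z)]"

definition encode_edge :: "nat \<times> nat \<Rightarrow> bool list" where
  "encode_edge e = encode_list [encode_nat (fst e), encode_nat (snd e)]"

lemma delimit_append_inject: "delimit v @ x = delimit w @ y \<longleftrightarrow> v = w \<and> x = y"
proof (induction v arbitrary: w)
  case Nil
  then show ?case by (cases w) auto
next
  case (Cons a v)
  then show ?case by (cases w) auto
qed

lemma inj_encode_list: "inj encode_list"
proof (rule injI)
  fix vs ws :: "bool list list"
  assume "encode_list vs = encode_list ws"
  then show "vs = ws"
  proof (induction vs arbitrary: ws)
    case Nil
    then show ?case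
      by (cases ws; cases "hd ws") (auto simp: encode_list_def)
  next
    case (Cons v vs)
    then show ?case
    proof (cases ws)
      case Nil
      with Cons.prems show ?thesis by (cases v) (auto simp: encode_list_def)
    next
      case (Cons w ws')
      with Cons.prems Cons.IH[of ws'] show ?thesis
        by (auto simp: encode_list_def delimit_append_inject)
    qed
  qed
qed


section \<open>NP and NP-hardness of search problems\<close>

definition polytime_decidable :: "bool list set \<Rightarrow> bool" where
  "polytime_decidable L \<longleftrightarrow> polytime (\<lambda>w. [w \<in> L])"

definition NP :: "bool list set set" where
  "NP = {L. \<exists>V (p :: nat poly). polytime_decidable V \<and>
     (\<forall>x. x \<in> L \<longleftrightarrow> (\<exists>u. length u \<le> poly p (length x) \<and> encode_list [x, u] \<in> V))}"

text \<open>A search problem is a relation between (encoded) instances and (encoded) solutions. A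
  language \<open>L\<close> reduces to it if \<open>x \<in> L\<close> can be decided in polynomial time by computing a solvable
  instance \<open>f x\<close>, obtaining an arbitrary solution \<open>y\<close> of it, and inspecting \<open>x\<close> and \<open>y\<close>. This is a
  Turing reduction with a single call of the solver.\<close>

definition reduces_to_search :: "bool list set \<Rightarrow> (bool list \<Rightarrow> bool list \<Rightarrow> bool) \<Rightarrow> bool" where
  "reduces_to_search L R \<longleftrightarrow> (\<exists>f D. polytime f \<and> polytime_decidable D \<and>
     (\<forall>x. (\<exists>y. R (f x) y) \<and>
          (\<forall>y. R (f x) y \<longrightarrow> (encode_list [x, y] \<in> D \<longleftrightarrow> x \<in> L))))"

definition NP_hard_search :: "(bool list \<Rightarrow> bool list \<Rightarrow> bool) \<Rightarrow> bool" where
  "NP_hard_search R \<longleftrightarrow> (\<forall>L \<in> NP. reduces_to_search L R)"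


section \<open>FLaMECaST as a search problem\<close>

text \<open>The sources at \<open>ss\<close> and the sinks at \<open>ts\<close> are numbered consecutively; all other natural
  numbers are available as Steiner vertices.\<close>

definition flamecast_of ::
    "real \<Rightarrow> (rat \<times> rat) list \<Rightarrow> (rat \<times> rat) list \<Rightarrow> nat list \<Rightarrow> nat flamecast" where
  "flamecast_of \<alpha> ss ts cs =
     \<lparr>sources = {..<length ss},
      sinks = {length ss..<length ss + length ts},
      position = (\<lambda>v. map_prod of_rat of_rat ((ss @ ts) ! v)),
      capacities = cs,
      exponent = \<alpha>\<rparr>"

definition encode_flamecast ::
    "(rat \<times> rat) list \<Rightarrow> (rat \<times> rat) list \<Rightarrow> nat list \<Rightarrow> bool list" where
  "encode_flamecast ss ts cs =
     encode_list [encode_list (map encode_point ss), encode_list (map encode_point ts),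
                  encode_list (map encode_nat cs)]"

text \<open>The problem of finding a minimum-cost valid layout for \<open>l\<close> intermediate layers and the fixed
  real parameter \<open>\<alpha>\<close>, which is therefore not part of the input. The optimal position of a Steiner
  vertex is in general irrational, so a solution is written down by its edge list only, and the
  embedding is existentially quantified. A topology has no isolated vertices (sources and sinks
  are disjoint), so its vertex set is the field of its edge set.\<close>

definition flamecast_problem :: "nat \<Rightarrow> real \<Rightarrow> bool list \<Rightarrow> bool list \<Rightarrow> bool" where
  "flamecast_problem l \<alpha> w y \<longleftrightarrow> (\<exists>ss ts cs es.
     w = encode_flamecast ss ts cs \<and> length cs = l + 2 \<and>
     flamecast_instance (flamecast_of \<alpha> ss ts cs) \<and>
     y = encode_list (map encode_edge es) \<and>
     (\<exists>p. optimal_layout (flamecast_of \<alpha> ss ts cs) (Field (set es)) (set es) p))"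

end

theory Submission
  imports Defs
begin

text \<open>Membership in a language in NP is the existence of an accepting tableau of a verifier, that is, of
  a tiling, and the local constraints of a tiling form a formula in conjunctive normal form.

  The formula becomes a grid of sources and sinks. The sources come in groups of at least \<open>g\<close> sources
  at the same point, where \<open>g\<close> is so large that \<open>4 w powr \<alpha> \<le> w\<close> for \<open>w \<ge> g\<close>: here \<open>\<alpha> < 1\<close> is used. A
  group then travels as one bundle to a sink at the minimal distance 8, or the layout is more
  expensive than a known bound. All sinks have room for \<open>4g\<close> sources, so the choices of the groups
  carry signals: a column carries the value of a literal and a row carries the demand for a true
  literal of its clause. One literal that occurs in every clause always permits such a layout, but it
  forces the two sources at an extra point to go to different sinks. They stay together, which saves
  \<open>2 - 2 powr \<alpha> > 0\<close>, if and only if the formula is satisfiable. Hence any optimal layout shows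
  whether the formula is satisfiable: one checks whether the first two sources have the same parent.

  Polynomial time is established in a loop language on registers that is compiled to Turing machines.\<close>

section \<open>A loop language on registers and its compilation to Turing machines\<close>

text \<open>Costs are irrational in general, so the reduction can neither compute an optimal cost
  nor compare with one. The answer has to be visible in the shape of every optimal layout, which is
  the purpose of the extra pair of sources.

  The obstacle is that Steiner vertices may lie anywhere and may mix sources of several groups. This
  is handled locally: groups are at least 8 apart, so a Steiner vertex is closer than 4 to at most
  one group, and a source whose parent is at distance 4 or more already pays 4, while by the choice
  of \<open>g\<close> a source of a complete bundle pays at most 2.

  Signals can cross because of the weights. In the intended layouts each hub receives exactly one of
  the two groups of its column, of weight \<open>3 * g\<close>, together with one row group of
  weight \<open>g\<close>, whatever the value of the column is. A row has one row group more than
  hubs, and only a lower column group of weight \<open>2 * g\<close> on its hub, that is, a true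
  literal of the clause, makes room for it.\<close>

datatype prog = Skip | App nat nat | Clr nat | Seq prog prog | For nat "nat \<Rightarrow> prog"

type_synonym store = "nat \<Rightarrow> nat list"

primrec sem :: "prog \<Rightarrow> store \<Rightarrow> store" where
  "sem Skip s = s"
| "sem (App r a) s = s(r := s r @ [a])"
| "sem (Clr r) s = s(r := [])"
| "sem (Seq P Q) s = sem Q (sem P s)"
| "sem (For r B) s = fold (\<lambda>a. sem (B a)) (s r) s"

text \<open>The 2 stands for the dispatch on the symbol and the move to the next cell, the final 1
  for the dispatch on the blank behind the last symbol. Steps are counted exactly, so that
  \<open>compile_correct\<close> can speak of a single iterate of \<open>step\<close>.\<close>

fun loop_cost :: "(nat \<Rightarrow> store \<Rightarrow> nat) \<Rightarrow> (nat \<Rightarrow> store \<Rightarrow> store) \<Rightarrow> nat list \<Rightarrow> store \<Rightarrow> nat" where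
  "loop_cost c f [] s = 1"
| "loop_cost c f (a # as) s = c a s + 2 + loop_cost c f as (f a s)"

primrec cost :: "prog \<Rightarrow> store \<Rightarrow> nat" where
  "cost Skip s = 0"
| "cost (App r a) s = 1"
| "cost (Clr r) s = length (s r) + 2"
| "cost (Seq P Q) s = cost P s + cost Q (sem P s)"
| "cost (For r B) s =
     length (s r) + 2 + loop_cost (\<lambda>a. cost (B a)) (\<lambda>a. sem (B a)) (s r) s"

text \<open>\<open>X\<close> collects the registers of the enclosing loops: their heads are in the middle of the tape,
  so the body of a loop must not touch them.\<close>

primrec wf_prog :: "nat \<Rightarrow> nat \<Rightarrow> nat set \<Rightarrow> prog \<Rightarrow> bool" where
  "wf_prog k S X Skip \<longleftrightarrow> True"
| "wf_prog k S X (App r a) \<longleftrightarrow> r < k \<and> r \<notin> X \<and> a < S"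
| "wf_prog k S X (Clr r) \<longleftrightarrow> r < k \<and> r \<notin> X"
| "wf_prog k S X (Seq P Q) \<longleftrightarrow> wf_prog k S X P \<and> wf_prog k S X Q"
| "wf_prog k S X (For r B) \<longleftrightarrow> r < k \<and> r \<notin> X \<and> (\<forall>a<S. wf_prog k S (insert r X) (B a))"

definition wf_store :: "nat \<Rightarrow> store \<Rightarrow> bool" where
  "wf_store S s \<longleftrightarrow> (\<forall>r. set (s r) \<subseteq> {..<S})"

lemma fold_invariant:
  assumes "I s" "\<And>a s. a \<in> set as \<Longrightarrow> I s \<Longrightarrow> I (f a s)"
  shows "I (fold f as s)"
  using assms by (induction as arbitrary: s) auto

lemma wf_store_sem: "wf_prog k S X P \<Longrightarrow> wf_store S s \<Longrightarrow> wf_store S (sem P s)"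
proof (induction P arbitrary: X s)
  case (For r B)
  have "set (s r) \<subseteq> {..<S}" using For.prems by (auto simp: wf_store_def)
  then have "wf_store S (fold (\<lambda>a. sem (B a)) (s r) s)"
    using For.prems by (intro fold_invariant[where I = "wf_store S"]) (auto intro!: For.IH)
  then show ?case by simp
next
  case (Seq P Q)
  then show ?case by auto
qed (auto simp: wf_store_def)

lemma sem_frame: "wf_prog k S X P \<Longrightarrow> wf_store S s \<Longrightarrow> r \<in> X \<Longrightarrow> sem P s r = s r"
proof (induction P arbitrary: X s)
  case (For q B)
  have "set (s q) \<subseteq> {..<S}" using For.prems by (auto simp: wf_store_def)
  then have "wf_store S (fold (\<lambda>a. sem (B a)) (s q) s) \<and> fold (\<lambda>a. sem (B a)) (s q) s r = s r"
    using For.prems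
    by (intro fold_invariant[where I = "\<lambda>s'. wf_store S s' \<and> s' r = s r"])
       (auto intro!: wf_store_sem simp: For.IH[where X = "insert q X"])
  then show ?case by simp
next
  case (Seq P Q)
  then show ?case using wf_store_sem[of k S X P s] Seq.IH(1)[of X s] Seq.IH(2)[of X "sem P s"] by simp
qed auto

text \<open>Only \<open>App\<close> lengthens a register, by one symbol at cost 1. This later bounds
  the output of a program by its running time.\<close>

lemma length_sem_le: "length (sem P s r) \<le> length (s r) + cost P s"
proof (induction P arbitrary: s)
  case (Seq P Q)
  show ?case using Seq(1)[of s] Seq(2)[of "sem P s"] by simp
next
  case (For q B)
  have "length (fold (\<lambda>a. sem (B a)) as s r)
      \<le> length (s r) + loop_cost (\<lambda>a. cost (B a)) (\<lambda>a. sem (B a)) as s" for as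
  proof (induction as arbitrary: s)
    case (Cons a as)
    show ?case using Cons[of "sem (B a) s"] For[of "B a" s] by simp
  qed simp
  from this[of "s q"] show ?case by simp
qed auto

subsection \<open>Compilation\<close>

definition single_cmd :: "nat \<Rightarrow> nat \<Rightarrow> (nat \<Rightarrow> nat \<times> nat \<times> head_move) \<Rightarrow> command" where
  "single_cmd k r F = (\<lambda>syms. (fst (F (syms ! r)),
     map (\<lambda>i. if i = r then snd (F (syms ! r)) else (syms ! i, Stay)) [0..<k]))"

primrec prog_len :: "nat \<Rightarrow> prog \<Rightarrow> nat" where
  "prog_len S Skip = 0"
| "prog_len S (App r a) = 1"
| "prog_len S (Clr r) = 1"
| "prog_len S (Seq P Q) = prog_len S P + prog_len S Q"
| "prog_len S (For r B) = 2 + (\<Sum>a<S. prog_len S (B a) + 1)"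

text \<open>Jumps are absolute, so the code depends on its first state \<open>q\<close>. A loop
  contains a copy of its body for every symbol; the control state remembers the symbol while the
  body runs. State \<open>q\<close> rewinds the head, state \<open>q + 1\<close> selects a copy, and
  the last command of a copy advances the head and returns to \<open>q + 1\<close>.\<close>

primrec compile :: "nat \<Rightarrow> nat \<Rightarrow> prog \<Rightarrow> nat \<Rightarrow> machine" where
  "compile k S Skip q = []"
| "compile k S (App r a) q = [single_cmd k r (\<lambda>_. (q + 1, a + 2, Go_Right))]"
| "compile k S (Clr r) q =
     [single_cmd k r (\<lambda>c. if c = 1 then (q + 1, 1, Go_Right) else (q, 0, Go_Left))]"
| "compile k S (Seq P Q) q = compile k S P q @ compile k S Q (q + prog_len S P)"
| "compile k S (For r B) q =
     [single_cmd k r (\<lambda>c. if c = 1 then (q + 1, 1, Go_Right) else (q, c, Go_Left)),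
      single_cmd k r (\<lambda>c.
        (if c = 0 then q + prog_len S (For r B)
         else q + 2 + (\<Sum>b<c - 2. prog_len S (B b) + 1), c, Stay))] @
     concat (map (\<lambda>a. compile k S (B a) (q + 2 + (\<Sum>b<a. prog_len S (B b) + 1)) @
                      [single_cmd k r (\<lambda>c. (q + 1, c, Go_Right))]) [0..<S])"

lemma length_compile: "length (compile k S P q) = prog_len S P"
  by (induction P arbitrary: q)
     (simp_all add: length_concat comp_def sum_list_sum_nth atLeast0LessThan)

definition loaded :: "machine \<Rightarrow> nat \<Rightarrow> machine \<Rightarrow> bool" where
  "loaded M q c \<longleftrightarrow> q + length c \<le> length M \<and> (\<forall>i<length c. M ! (q + i) = c ! i)"

lemma loaded_append:
  "loaded M q (c @ d) \<longleftrightarrow> loaded M q c \<and> loaded M (q + length c) d"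
proof
  assume a: "loaded M q (c @ d)"
  have "M ! (q + length c + i) = d ! i" if "i < length d" for i
    using a that unfolding loaded_def by (auto dest!: spec[of _ "length c + i"] simp: nth_append add.assoc)
  then show "loaded M q c \<and> loaded M (q + length c) d"
    using a unfolding loaded_def by (fastforce simp: nth_append split: if_splits)
next
  assume a: "loaded M q c \<and> loaded M (q + length c) d"
  have "M ! (q + i) = (c @ d) ! i" if "i < length c + length d" for i
  proof (cases "i < length c")
    case True
    then show ?thesis using a by (simp add: loaded_def nth_append)
  next
    case False
    then obtain j where "i = length c + j" by (metis le_Suc_ex not_less)
    then show ?thesis using a that by (simp add: loaded_def nth_append add.assoc[symmetric])
  qed
  then show "loaded M q (c @ d)"
    using a unfolding loaded_def by simp
qed

lemma loaded_concat:
  assumes "loaded M q (concat (map f [0..<S]))" "a < S"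
  shows "loaded M (q + (\<Sum>b<a. length (f b))) (f a)"
  using assms
proof (induction S)
  case (Suc S)
  have "length (concat (map f [0..<S])) = (\<Sum>b<S. length (f b))"
    by (simp add: length_concat comp_def sum_list_sum_nth atLeast0LessThan)
  with Suc show ?case by (cases "a = S") (auto simp: loaded_append)
qed simp

text \<open>The offset 2 keeps symbols apart from the blank and the end marker, and it turns bits
  into the symbols 2 and 3 of \<open>contents\<close>.\<close>

definition reg_tape :: "nat list \<Rightarrow> nat \<Rightarrow> nat" where
  "reg_tape l i = (if i = 0 then 1 else if i \<le> length l then l ! (i - 1) + 2 else 0)"

text \<open>Outside of loops over it, a register has its head on the first blank, so that appending
  a symbol takes one step.\<close>

definition represents :: "nat \<Rightarrow> nat set \<Rightarrow> store \<Rightarrow> tape list \<Rightarrow> bool" where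
  "represents k X s tps \<longleftrightarrow> length tps = k \<and>
     (\<forall>r<k. r \<notin> X \<longrightarrow> tps ! r = (reg_tape (s r), length (s r) + 1))"

lemma step_single_cmd:
  assumes "q < length M" "M ! q = single_cmd k r F" "r < k" "length tps = k"
    and "tps ! r = (tp, h)" "F (tp h) = (q', w, mv)" "tp(h := w) = tp'"
  shows "step M (q, tps) = (q', tps[r := (tp', move_head mv h)])"
proof -
  define syms where "syms = map (\<lambda>t. fst t (snd t)) tps"
  have 1: "syms ! r = tp h" and nth: "i < k \<Longrightarrow> syms ! i = fst (tps ! i) (snd (tps ! i))" for i
    using assms by (simp_all add: syms_def)
  have 2: "map2 act (map (\<lambda>i. if i = r then (w, mv) else (syms ! i, Stay)) [0..<k]) tps
     = tps[r := (tp', move_head mv h)]"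
    using assms(3-5,7) nth by (intro nth_equalityI) (auto simp: act_def nth_list_update)
  have "single_cmd k r F syms = (q', map (\<lambda>i. if i = r then (w, mv) else (syms ! i, Stay)) [0..<k])"
    unfolding single_cmd_def 1 assms(6) by simp
  then show ?thesis
    using assms(1,2) 2 by (simp add: step_def Let_def flip: syms_def)
qed

lemma loaded_single:
  "loaded M q [c] \<longleftrightarrow> q < length M \<and> M ! q = c"
  by (auto simp: loaded_def)

lemma loaded_Cons: "loaded M q (c # d) \<longleftrightarrow> q < length M \<and> M ! q = c \<and> loaded M (Suc q) d"
  using loaded_append[of M q "[c]" d] by (simp add: loaded_single)

text \<open>Covers both uses of a sweep: \<open>g\<close> is constantly 0 when a register is cleared
  and the identity when its head is rewound.\<close>

lemma sweep_left:
  assumes "q < length M" "M ! q = single_cmd k r (\<lambda>c. if c = 1 then (q1, 1, Go_Right) else (q, g c, Go_Left))"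
    and "r < k" "length tps = k" "tps ! r = (tp, h)" "tp 0 = 1" "\<forall>i\<in>{1..h}. tp i \<noteq> 1"
  shows "(step M ^^ (h + 1)) (q, tps) = (q1, tps[r := (\<lambda>i. if i \<in> {1..h} then g (tp i) else tp i, 1)])"
  using assms(4-)
proof (induction h arbitrary: tps tp)
  case 0
  have "(\<lambda>i. if i \<in> {1..0} then g (tp i) else tp i) = tp" by (auto simp: fun_eq_iff)
  moreover have "tp(0 := Suc 0) = tp" using 0 by (auto simp: fun_eq_iff)
  ultimately show ?case using step_single_cmd[OF assms(1,2,3) 0(1,2)] 0 by simp
next
  case (Suc h)
  let ?tp = "tp(Suc h := g (tp (Suc h)))"
  have s: "step M (q, tps) = (q, tps[r := (?tp, h)])"
    using step_single_cmd[OF assms(1,2,3) Suc.prems(1,2)] Suc.prems by simp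
  have "(step M ^^ (h + 1)) (q, tps[r := (?tp, h)]) =
      (q1, (tps[r := (?tp, h)])[r := (\<lambda>i. if i \<in> {1..h} then g (?tp i) else ?tp i, 1)])"
    using Suc.prems assms(3) by (intro Suc.IH) auto
  moreover have "(\<lambda>i. if i \<in> {1..h} then g (?tp i) else ?tp i)
     = (\<lambda>i. if i \<in> {1..Suc h} then g (tp i) else tp i)"
    by (auto simp: fun_eq_iff)
  moreover have "(step M ^^ (Suc h + 1)) (q, tps) = (step M ^^ (h + 1)) (step M (q, tps))"
    by (simp add: funpow_swap1)
  ultimately show ?case by (simp add: s)
qed

lemma funpow_add_apply: "(f ^^ (m + n)) x = (f ^^ n) ((f ^^ m) x)"
  by (metis add.commute comp_apply funpow_add)

text \<open>The clause on the tapes in \<open>X\<close> serves the case of loops: the body returns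
  the tape and the head of the enclosing loop unchanged, so the loop can continue with the next
  symbol.\<close>

lemma compile_correct:
  assumes "wf_prog k S X P" "wf_store S s" "represents k X s tps" "loaded M q (compile k S P q)"
  shows "\<exists>tps'. (step M ^^ cost P s) (q, tps) = (q + prog_len S P, tps') \<and>
     represents k X (sem P s) tps' \<and> (\<forall>r\<in>X. r < k \<longrightarrow> tps' ! r = tps ! r)"
  using assms
proof (induction P arbitrary: X s q tps)
  case Skip
  then show ?case by (intro exI[of _ tps]) auto
next
  case (App r a)
  let ?tps = "tps[r := (reg_tape (s r @ [a]), length (s r) + 2)]"
  have len: "length tps = k" and r: "r < k" "r \<notin> X" and tr: "tps ! r = (reg_tape (s r), length (s r) + 1)"
    using App by (auto simp: represents_def)
  have "(reg_tape (s r))(length (s r) + 1 := a + 2) = reg_tape (s r @ [a])"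
    by (auto simp: fun_eq_iff reg_tape_def nth_append)
  then have "step M (q, tps) = (q + 1, ?tps)"
    using App.prems step_single_cmd[OF _ _ r(1) len tr] by (simp add: loaded_single)
  then show ?case using App.prems r tr
    by (intro exI[of _ ?tps]) (auto simp: represents_def nth_list_update)
next
  case (Clr r)
  have len: "length tps = k" and r: "r < k" "r \<notin> X" and tr: "tps ! r = (reg_tape (s r), length (s r) + 1)"
    using Clr by (auto simp: represents_def)
  have "(step M ^^ (length (s r) + 1 + 1)) (q, tps) =
     (q + 1, tps[r := (\<lambda>i. if i \<in> {1..length (s r) + 1} then 0 else reg_tape (s r) i, 1)])"
    using Clr.prems len r tr
    by (intro sweep_left[where k = k]) (auto simp: loaded_single reg_tape_def)
  moreover have "(\<lambda>i. if i \<in> {1..length (s r) + 1} then 0 else reg_tape (s r) i) = reg_tape []"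
    by (auto simp: fun_eq_iff reg_tape_def)
  ultimately show ?case using Clr.prems r tr
    by (intro exI[of _ "tps[r := (reg_tape [], 1)]"]) (auto simp: represents_def nth_list_update)
next
  case (Seq P Q)
  from Seq.IH(1)[of X s tps q] Seq.prems obtain tps1 where
    1: "(step M ^^ cost P s) (q, tps) = (q + prog_len S P, tps1)" "represents k X (sem P s) tps1"
       "\<forall>r\<in>X. r < k \<longrightarrow> tps1 ! r = tps ! r"
    by (auto simp: loaded_append)
  have "wf_store S (sem P s)" using Seq.prems wf_store_sem by auto
  with Seq.IH(2)[of X "sem P s" tps1 "q + prog_len S P"] Seq.prems 1(2) obtain tps2 where
    2: "(step M ^^ cost Q (sem P s)) (q + prog_len S P, tps1) = (q + prog_len S P + prog_len S Q, tps2)"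
       "represents k X (sem Q (sem P s)) tps2" "\<forall>r\<in>X. r < k \<longrightarrow> tps2 ! r = tps1 ! r"
    by (auto simp: loaded_append length_compile)
  show ?case using 1 2 by (intro exI[of _ tps2]) (auto simp: funpow_add_apply add.assoc)
next
  case (For r B)
  define off where "off a = (\<Sum>b<a. prog_len S (B b) + 1)" for a
  define rew where "rew = single_cmd k r (\<lambda>c. if c = 1 then (q + 1, 1, Go_Right) else (q, c, Go_Left))"
  define disp where "disp = single_cmd k r (\<lambda>c.
        (if c = 0 then q + prog_len S (For r B) else q + 2 + off (c - 2), c, Stay))"
  define nxt where "nxt = single_cmd k r (\<lambda>c. (q + 1, c, Go_Right))"
  define bod where "bod a = compile k S (B a) (q + 2 + off a) @ [nxt]" for a
  have ld: "loaded M q ([rew, disp] @ concat (map bod [0..<S]))"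
    using For.prems(4) unfolding off_def rew_def disp_def nxt_def bod_def by (simp only: compile.simps)
  have len: "length tps = k" and r: "r < k" "r \<notin> X" and tr: "tps ! r = (reg_tape (s r), length (s r) + 1)"
    using For.prems by (auto simp: represents_def)
  have q0: "q < length M" "M ! q = rew" and q1: "q + 1 < length M" "M ! (q + 1) = disp"
    using ld by (auto simp: loaded_Cons)
  have lb: "loaded M (q + 2 + off a) (compile k S (B a) (q + 2 + off a))"
    and ln: "q + 2 + off a + prog_len S (B a) < length M"
       "M ! (q + 2 + off a + prog_len S (B a)) = nxt" if "a < S" for a
  proof -
    have "loaded M (q + 2 + (\<Sum>b<a. length (bod b))) (bod a)"
      using ld that by (intro loaded_concat[of _ _ _ S]) (auto simp: loaded_Cons)
    moreover have "(\<Sum>b<a. length (bod b)) = off a"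
      by (simp add: bod_def off_def length_compile)
    ultimately have "loaded M (q + 2 + off a) (bod a)" by simp
    then show "loaded M (q + 2 + off a) (compile k S (B a) (q + 2 + off a))"
       "q + 2 + off a + prog_len S (B a) < length M"
       "M ! (q + 2 + off a + prog_len S (B a)) = nxt"
      by (simp_all add: bod_def loaded_append loaded_single length_compile)
  qed
  have "(step M ^^ (length (s r) + 1 + 1)) (q, tps) =
     (q + 1, tps[r := (\<lambda>i. if i \<in> {1..length (s r) + 1} then reg_tape (s r) i else reg_tape (s r) i, 1)])"
    using q0 len r tr unfolding rew_def
    by (intro sweep_left[where k = k]) (auto simp: reg_tape_def)
  then have rewound: "(step M ^^ (length (s r) + 2)) (q, tps) = (q + 1, tps[r := (reg_tape (s r), 1)])"
    by simp
  \<comment> \<open>Loop invariant: \<open>xs\<close> has been processed, \<open>ys\<close> is left,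
    and the head of \<open>r\<close> is on the first symbol of \<open>ys\<close>, or on the blank if
    \<open>ys\<close> is empty.\<close>
  have loop: "\<exists>tps'. (step M ^^ loop_cost (\<lambda>a. cost (B a)) (\<lambda>a. sem (B a)) ys s') (q + 1, tp)
        = (q + prog_len S (For r B), tps')
     \<and> represents k (insert r X) (fold (\<lambda>a. sem (B a)) ys s') tps'
     \<and> tps' ! r = (reg_tape (s r), length (s r) + 1) \<and> (\<forall>r\<in>X. r < k \<longrightarrow> tps' ! r = tp ! r)"
    if "s r = xs @ ys" "wf_store S s'" "represents k (insert r X) s' tp"
       "tp ! r = (reg_tape (s r), length xs + 1)" for xs ys s' tp
    using that
  proof (induction ys arbitrary: xs s' tp)
    case Nil
    have "length tp = k" using Nil by (simp add: represents_def)
    then have "step M (q + 1, tp) = (q + prog_len S (For r B), tp[r := (reg_tape (s r), move_head Stay (length xs + 1))])"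
      by (rule step_single_cmd[OF q1(1) q1(2)[unfolded disp_def] r(1) _ Nil.prems(4)])
         (use Nil in \<open>auto simp: reg_tape_def fun_eq_iff\<close>)
    moreover have "tp[r := (reg_tape (s r), move_head Stay (length xs + 1))] = tp"
      using Nil by (metis list_update_id move_head.simps(2))
    ultimately have "step M (q + 1, tp) = (q + prog_len S (For r B), tp)" by simp
    then show ?case using Nil.prems by (intro exI[of _ tp]) (simp del: prog_len.simps)
  next
    case (Cons a ys)
    have aS: "a < S" 
    proof -
      have "a \<in> set (s r)" using Cons.prems(1) by simp
      then show ?thesis using For.prems(2) unfolding wf_store_def by blast
    qed
    have lt: "length tp = k" using Cons by (simp add: represents_def)
    have rd: "reg_tape (s r) (length xs + 1) = a + 2"
      using Cons.prems(1) by (simp add: reg_tape_def)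
    have "step M (q + 1, tp) = (q + 2 + off a, tp[r := (reg_tape (s r), move_head Stay (length xs + 1))])"
      by (rule step_single_cmd[OF q1(1) q1(2)[unfolded disp_def] r(1) lt Cons.prems(4)])
         (use rd in \<open>auto simp: fun_eq_iff\<close>)
    then have s1: "step M (q + 1, tp) = (q + 2 + off a, tp)"
      using Cons.prems(4) by (metis list_update_id move_head.simps(2))
    have wfB: "wf_prog k S (insert r X) (B a)" using For.prems aS by simp
    from For.IH[of "B a", OF _ wfB Cons.prems(2,3) lb[OF aS]] obtain tp1 where
      tp1: "(step M ^^ cost (B a) s') (q + 2 + off a, tp) = (q + 2 + off a + prog_len S (B a), tp1)"
        "represents k (insert r X) (sem (B a) s') tp1" "\<forall>r'\<in>insert r X. r' < k \<longrightarrow> tp1 ! r' = tp ! r'"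
      by auto
    define tp2 where "tp2 = tp1[r := (reg_tape (s r), length xs + 2)]"
    have l1: "length tp1 = k" and t1r: "tp1 ! r = (reg_tape (s r), length xs + 1)"
      using tp1 r Cons.prems by (auto simp: represents_def)
    have "step M (q + 2 + off a + prog_len S (B a), tp1) =
       (q + 1, tp1[r := (reg_tape (s r), move_head Go_Right (length xs + 1))])"
      by (rule step_single_cmd[OF ln(1)[OF aS] ln(2)[OF aS, unfolded nxt_def] r(1) l1 t1r]) auto
    then have s2: "step M (q + 2 + off a + prog_len S (B a), tp1) = (q + 1, tp2)"
      by (simp add: tp2_def)
    have r2: "represents k (insert r X) (sem (B a) s') tp2" "tp2 ! r = (reg_tape (s r), length (xs @ [a]) + 1)"
      using tp1 l1 r by (auto simp: represents_def tp2_def)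
    have X2: "\<forall>r\<in>X. r < k \<longrightarrow> tp2 ! r = tp ! r"
      using tp1(3) r(2) by (metis insertI2 nth_list_update_neq tp2_def)
    have w2: "wf_store S (sem (B a) s')" using wfB Cons.prems(2) wf_store_sem by blast
    from Cons.IH[of "xs @ [a]", OF _ w2 r2] Cons.prems(1) obtain tps' where
      fin: "(step M ^^ loop_cost (\<lambda>a. cost (B a)) (\<lambda>a. sem (B a)) ys (sem (B a) s')) (q + 1, tp2) =
         (q + prog_len S (For r B), tps')"
        "represents k (insert r X) (fold (\<lambda>a. sem (B a)) ys (sem (B a) s')) tps'"
        "tps' ! r = (reg_tape (s r), length (s r) + 1)" "\<forall>r\<in>X. r < k \<longrightarrow> tps' ! r = tp2 ! r"
      by auto
    have "(step M ^^ (1 + (cost (B a) s' + (1 + loop_cost (\<lambda>a. cost (B a)) (\<lambda>a. sem (B a)) ys (sem (B a) s'))))) (q + 1, tp)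
       = (q + prog_len S (For r B), tps')"
      unfolding funpow_add_apply using s1 tp1(1) s2 fin(1) by simp
    then show ?case using fin X2 by (intro exI[of _ tps']) (auto simp: add_ac)
  qed
  have "represents k (insert r X) s (tps[r := (reg_tape (s r), 1)])"
    using For.prems by (auto simp: represents_def)
  from loop[of "[]" "s r", OF _ For.prems(2) this] len r obtain tps' where
    tps': "(step M ^^ loop_cost (\<lambda>a. cost (B a)) (\<lambda>a. sem (B a)) (s r) s) (q + 1, tps[r := (reg_tape (s r), 1)])
        = (q + prog_len S (For r B), tps')"
     "represents k (insert r X) (sem (For r B) s) tps'"
     "tps' ! r = (reg_tape (s r), length (s r) + 1)" "\<forall>r'\<in>X. r' < k \<longrightarrow> tps' ! r' = tps ! r'"
    by (auto simp: nth_list_update)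
  have "sem (For r B) s r = s r"
  proof -
    have "set (s r) \<subseteq> {..<S}" using For.prems by (auto simp: wf_store_def)
    then have "wf_store S (fold (\<lambda>a. sem (B a)) (s r) s) \<and> fold (\<lambda>a. sem (B a)) (s r) s r = s r"
      using For.prems
      by (intro fold_invariant[where I = "\<lambda>s'. wf_store S s' \<and> s' r = s r"])
         (auto intro!: wf_store_sem simp: sem_frame[of k S "insert r X"])
    then show ?thesis by simp
  qed
  with tps' have "represents k X (sem (For r B) s) tps'" by (auto simp: represents_def)
  moreover have "(step M ^^ cost (For r B) s) (q, tps) = (q + prog_len S (For r B), tps')"
    using rewound tps'(1) by (simp only: cost.simps funpow_add_apply[of "length (s r) + 2"])
  ultimately show ?case using tps'(4) by blast
qed

subsection \<open>Polynomial time\<close>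

definition bits :: "bool list \<Rightarrow> nat list" where
  "bits w = map of_bool w"

definition init_store :: "bool list \<Rightarrow> store" where
  "init_store w = (\<lambda>r. if r = 0 then bits w else [])"

lemma reg_tape_bits: "reg_tape (bits w) = contents w"
  by (auto simp: fun_eq_iff reg_tape_def contents_def bits_def)

lemma set_bits: "set (bits w) \<subseteq> {0, 1}"
  by (auto simp: bits_def)

lemma single_cmd_wf:
  assumes "\<And>c. c < G \<Longrightarrow> fst (snd (F c)) < G" "r < k" "length syms = k" "set syms \<subseteq> {..<G}"
  shows "length (snd (single_cmd k r F syms)) = k \<and> fst ` set (snd (single_cmd k r F syms)) \<subseteq> {..<G}"
proof -
  have "syms ! i < G" if "i < k" for i using assms that by (metis lessThan_iff nth_mem subset_eq)
  then show ?thesis using assms(1,2) by (auto simp: single_cmd_def)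
qed

lemma compile_wf:
  assumes "wf_prog k S X P" "cmd \<in> set (compile k S P q)" "length syms = k" "set syms \<subseteq> {..<S + 2}"
  shows "length (snd (cmd syms)) = k \<and> fst ` set (snd (cmd syms)) \<subseteq> {..<S + 2}"
  using assms(1,2)
proof (induction P arbitrary: X q)
  case Skip
  then show ?case by simp
next
  case (App r a)
  then show ?case using assms(3,4) single_cmd_wf[where G = "S + 2" and r = r and k = k and syms = syms] by auto
next
  case (Clr r)
  then show ?case using assms(3,4) single_cmd_wf[where G = "S + 2" and r = r and k = k and syms = syms] by auto
next
  case (Seq P Q)
  then show ?case by (metis Un_iff compile.simps(4) set_append wf_prog.simps(4))
next
  case (For r B)
  have base: "cmd = single_cmd k r F \<Longrightarrow> (\<And>c. c < S + 2 \<Longrightarrow> fst (snd (F c)) < S + 2) \<Longrightarrow> ?case" for F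
    using single_cmd_wf[where G = "S + 2" and r = r and k = k and syms = syms] For.prems assms(3,4) by auto
  from For.prems(2) consider
      "cmd = single_cmd k r (\<lambda>c. if c = 1 then (q + 1, 1, Go_Right) else (q, c, Go_Left))"
    | "cmd = single_cmd k r (\<lambda>c.
        (if c = 0 then q + prog_len S (For r B)
         else q + 2 + (\<Sum>b<c - 2. prog_len S (B b) + 1), c, Stay))"
    | "cmd = single_cmd k r (\<lambda>c. (q + 1, c, Go_Right))"
    | a where "a < S" "cmd \<in> set (compile k S (B a) (q + 2 + (\<Sum>b<a. prog_len S (B b) + 1)))"
    by (auto split: if_splits)
  then show ?case
  proof cases
    case 1 then show ?thesis by (rule base) auto
  next
    case 2 then show ?thesis by (rule base) auto
  next
    case 3 then show ?thesis by (rule base) auto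
  next
    case 4 then show ?thesis using For.IH[of "B a" "insert r X"] For.prems(1) by (metis rangeI wf_prog.simps(5))
  qed
qed

lemma polytime_prog:
  fixes p :: "nat poly"
  assumes wf: "wf_prog k S {} P" and "2 \<le> k" "2 \<le> S"
    and out: "\<And>w. sem P (init_store w) 1 = bits (f w)"
    and time: "\<And>w. cost P (init_store w) \<le> poly p (length w)"
  shows "polytime f"
proof -
  \<comment> \<open>Initially all heads are on the end marker, whereas \<open>represents\<close>
    wants them behind the contents. The command \<open>i0\<close> moves every head off the marker
    and \<open>i1\<close> walks over the input; this takes the \<open>length w + 2\<close> steps
    that are added to the bound below.\<close>
  define i0 :: command where "i0 = (\<lambda>syms. (1, map (\<lambda>c. (c, Go_Right)) syms))"
  define i1 where "i1 = single_cmd k 0 (\<lambda>c. if c = 0 then (2, 0, Stay) else (1, c, Go_Right))"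
  define M where "M = [i0, i1] @ compile k S P 2"
  have tm: "turing_machine k (S + 2) M"
    unfolding turing_machine_def
  proof (intro conjI ballI allI impI)
    fix cmd and syms :: "nat list"
    assume "cmd \<in> set M" and sy: "length syms = k \<and> set syms \<subseteq> {..<S + 2}"
    then consider "cmd = i0" | "cmd = i1" | "cmd \<in> set (compile k S P 2)" by (auto simp: M_def)
    then have "length (snd (cmd syms)) = k \<and> fst ` set (snd (cmd syms)) \<subseteq> {..<S + 2}"
    proof cases
      case 1 then show ?thesis using sy by (auto simp: i0_def)
    next
      case 2
      show ?thesis unfolding 2 i1_def by (rule single_cmd_wf) (use sy \<open>2 \<le> k\<close> in auto)
    next
      case 3 then show ?thesis using compile_wf[OF wf] sy by blast
    qed
    then show "length (snd (cmd syms)) = k" "fst ` set (snd (cmd syms)) \<subseteq> {..<S + 2}" by auto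
  qed (use assms in auto)
  have run: "\<exists>t \<le> poly (p + [:2, 1:]) (length w). \<exists>q tps.
        (step M ^^ t) (initial_config k w) = (q, tps) \<and> q \<ge> length M \<and> fst (tps ! 1) = contents (f w)" for w
  proof -
    define t0 where "t0 = (contents w, 1::nat) # replicate (k - 1) (contents [], 1::nat)"
    have s0: "step M (initial_config k w) = (1, t0)"
      by (simp add: step_def M_def initial_config_def i0_def Let_def t0_def act_def map2_map_map
          zip_replicate map_replicate_const)
    have M1: "1 < length M" "M ! 1 = single_cmd k 0 (\<lambda>c. if c = 0 then (2, 0, Stay) else (1, c, Go_Right))"
      by (simp_all add: M_def i1_def)
    have walk: "(step M ^^ (length w - i + 1)) (1, (contents w, i + 1) # ts) = (2, (contents w, length w + 1) # ts)"
      if "i \<le> length w" "length ts = k - 1" for i ts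
      using that
    proof (induction "length w - i" arbitrary: i)
      case 0
      have "step M (1, (contents w, i + 1) # ts)
         = (2, ((contents w, i + 1) # ts)[0 := (contents w, move_head Stay (i + 1))])"
        by (rule step_single_cmd[OF M1, where tp = "contents w" and h = "i + 1" and w = 0])
           (use 0 \<open>2 \<le> k\<close> in \<open>auto simp: contents_def fun_eq_iff\<close>)
      then show ?case using 0 by simp
    next
      case (Suc d)
      let ?c = "contents w (i + 1)"
      have "?c \<noteq> 0" using Suc by (auto simp: contents_def)
      have "step M (1, (contents w, i + 1) # ts)
         = (1, ((contents w, i + 1) # ts)[0 := (contents w, move_head Go_Right (i + 1))])"
        by (rule step_single_cmd[OF M1, where tp = "contents w" and h = "i + 1" and w = ?c]) (use \<open>?c \<noteq> 0\<close> Suc \<open>2 \<le> k\<close> in \<open>auto simp: fun_eq_iff\<close>)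
      then have s1: "step M (1, (contents w, i + 1) # ts) = (1, (contents w, Suc i + 1) # ts)" by simp
      have "length w - i + 1 = Suc (length w - Suc i + 1)" using Suc by simp
      then have "(step M ^^ (length w - i + 1)) (1, (contents w, i + 1) # ts)
         = (step M ^^ (length w - Suc i + 1)) (1, (contents w, Suc i + 1) # ts)"
        by (simp only: funpow_Suc_right o_apply s1)
      also have "\<dots> = (2, (contents w, length w + 1) # ts)" using Suc by (intro Suc.hyps) auto
      finally show ?case .
    qed
    define t1 where "t1 = (contents w, length w + 1) # replicate (k - 1) (contents [], 1::nat)"
    have s1: "(step M ^^ (1 + (length w + 1))) (initial_config k w) = (2, t1)"
      unfolding funpow_add_apply using s0 walk[of 0 "replicate (k - 1) (contents [], 1)"] by (simp add: t0_def t1_def)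
    have rep: "represents k {} (init_store w) t1"
      unfolding represents_def
    proof (intro conjI allI impI)
      show "length t1 = k" using \<open>2 \<le> k\<close> by (simp add: t1_def)
      fix r assume "r < k"
      show "t1 ! r = (reg_tape (init_store w r), length (init_store w r) + 1)"
      proof (cases r)
        case 0
        then show ?thesis by (simp add: t1_def init_store_def reg_tape_bits) (simp add: bits_def)
      next
        case (Suc r')
        have "reg_tape [] = contents []" using reg_tape_bits[of "[]"] by (simp add: bits_def)
        then show ?thesis using Suc \<open>r < k\<close> by (simp add: t1_def init_store_def)
      qed
    qed
    have ws: "wf_store S (init_store w)"
      using set_bits[of w] \<open>2 \<le> S\<close> by (auto simp: wf_store_def init_store_def)
    have "loaded M 2 (compile k S P 2)" by (auto simp: loaded_def M_def)
    from compile_correct[OF wf ws rep this] obtain tps where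
      2: "(step M ^^ cost P (init_store w)) (2, t1) = (2 + prog_len S P, tps)"
         "represents k {} (sem P (init_store w)) tps" by auto
    have "(step M ^^ (1 + (length w + 1) + cost P (init_store w))) (initial_config k w) = (2 + prog_len S P, tps)"
      unfolding funpow_add_apply[of "1 + (length w + 1)"] s1 by (rule 2)
    moreover have "2 + prog_len S P \<ge> length M" by (simp add: M_def length_compile)
    moreover have "fst (tps ! 1) = contents (f w)"
      using 2(2) \<open>2 \<le> k\<close> out reg_tape_bits by (auto simp: represents_def)
    moreover have "1 + (length w + 1) + cost P (init_store w) \<le> poly (p + [:2, 1:]) (length w)"
      using time[of w] by simp
    ultimately show ?thesis by blast
  qed
  show ?thesis unfolding polytime_def using tm run by blast
qed

section \<open>Polynomial running time from bounds on the scanned registers\<close>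

fun loop_all :: "(nat \<Rightarrow> store \<Rightarrow> bool) \<Rightarrow> (nat \<Rightarrow> store \<Rightarrow> store) \<Rightarrow> nat list \<Rightarrow> store \<Rightarrow> bool" where
  "loop_all c f [] s = True"
| "loop_all c f (a # as) s \<longleftrightarrow> c a s \<and> loop_all c f as (f a s)"

text \<open>Lengths are bounded only at the moments when a register is scanned or cleared, the
  commands whose cost depends on the store. A register that is merely appended to may become longer
  than \<open>b\<close>.\<close>

primrec loop_bounded :: "nat \<Rightarrow> prog \<Rightarrow> store \<Rightarrow> bool" where
  "loop_bounded b Skip s = True"
| "loop_bounded b (App r a) s = True"
| "loop_bounded b (Clr r) s = (length (s r) \<le> b)"
| "loop_bounded b (Seq P Q) s = (loop_bounded b P s \<and> loop_bounded b Q (sem P s))"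
| "loop_bounded b (For r B) s = (length (s r) \<le> b \<and>
     loop_all (\<lambda>a. loop_bounded b (B a)) (\<lambda>a. sem (B a)) (s r) s)"

primrec prog_bound :: "nat \<Rightarrow> prog \<Rightarrow> nat poly" where
  "prog_bound S Skip = 0"
| "prog_bound S (App r a) = [:1:]"
| "prog_bound S (Clr r) = [:2, 1:]"
| "prog_bound S (Seq P Q) = prog_bound S P + prog_bound S Q"
| "prog_bound S (For r B) = [:3, 1:] + [:0, 1:] * ([:2:] + (\<Sum>a<S. prog_bound S (B a)))"

lemma cost_le_bound:
  "wf_prog k S X P \<Longrightarrow> wf_store S s \<Longrightarrow> loop_bounded b P s \<Longrightarrow> cost P s \<le> poly (prog_bound S P) b"
proof (induction P arbitrary: X s)
  case (Seq P Q)
  have "wf_store S (sem P s)" using Seq.prems wf_store_sem by auto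
  then show ?case using Seq.IH(1)[of X s] Seq.IH(2)[of X "sem P s"] Seq.prems by simp
next
  case (For r B)
  define w where "w = (\<Sum>a<S. poly (prog_bound S (B a)) b)"
  have "loop_cost (\<lambda>a. cost (B a)) (\<lambda>a. sem (B a)) as s' \<le> 1 + length as * (2 + w)"
    if "set as \<subseteq> {..<S}" "wf_store S s'" "loop_all (\<lambda>a. loop_bounded b (B a)) (\<lambda>a. sem (B a)) as s'" for as s'
    using that
  proof (induction as arbitrary: s')
    case (Cons a as)
    have a: "a < S" "wf_prog k S (insert r X) (B a)" using Cons.prems For.prems by auto
    have "cost (B a) s' \<le> poly (prog_bound S (B a)) b"
      using For.IH[of "B a"] a Cons.prems by auto
    also have "\<dots> \<le> w" unfolding w_def using a by (intro member_le_sum) auto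
    finally have "cost (B a) s' \<le> w" .
    then show ?case using Cons.IH[of "sem (B a) s'"] Cons.prems wf_store_sem[OF a(2)] by simp
  qed simp
  from this[of "s r" s] For.prems
  have "loop_cost (\<lambda>a. cost (B a)) (\<lambda>a. sem (B a)) (s r) s \<le> 1 + length (s r) * (2 + w)"
    by (auto simp: wf_store_def)
  also have "\<dots> \<le> 1 + b * (2 + w)" using For.prems by (intro add_left_mono mult_right_mono) auto
  finally show ?case using For.prems by (simp add: w_def poly_sum)
qed auto

section \<open>Layouts with one intermediate layer\<close>

lemma rooted_forest_root:
  assumes "rooted_forest V E" "v \<in> V"
  shows "\<exists>n. \<exists>r\<in>roots V E. (v, r) \<in> E ^^ n"
proof -
  have fin: "finite E" using assms(1) by (auto simp: rooted_forest_def intro: finite_subset)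
  then have "wf (E\<inverse>)" using assms(1) by (auto simp: rooted_forest_def intro: finite_acyclic_wf_converse)
  then show ?thesis using assms(2)
  proof (induction v rule: wf_induct_rule)
    case (less v)
    show ?case
    proof (cases "v \<in> Domain E")
      case True
      then obtain u where u: "(v, u) \<in> E" by auto
      then have "u \<in> V" using assms(1) by (auto simp: rooted_forest_def)
      then obtain n r where "r \<in> roots V E" "(u, r) \<in> E ^^ n"
        using less.IH[of u] u by blast
      then have "(v, r) \<in> E ^^ Suc n" using u by (meson relpow_Suc_I2)
      then show ?thesis using \<open>r \<in> roots V E\<close> by blast
    next
      case False
      then have "v \<in> roots V E" "(v, v) \<in> E ^^ 0" using less.prems by (auto simp: roots_def)
      then show ?thesis by blast
    qed
  qed
qed

lemma root_path_unique:
  assumes "single_valued E" "(v, r) \<in> E ^^ n" "(v, r') \<in> E ^^ n'" "r \<notin> Domain E" "r' \<notin> Domain E"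
  shows "n = n'"
  using assms(2,3)
proof (induction n arbitrary: v n')
  case 0
  then show ?case using assms(4) by (cases n') (auto dest!: relpow_Suc_D2 simp del: relpow.simps(2))
next
  case (Suc n)
  from Suc.prems(1) obtain u where u: "(v, u) \<in> E" "(u, r) \<in> E ^^ n" by (meson relpow_Suc_D2)
  then obtain m where m: "n' = Suc m" using Suc.prems(2) assms(5) by (cases n') auto
  then obtain u' where "(v, u') \<in> E" "(u', r') \<in> E ^^ m" using Suc.prems(2) by (meson relpow_Suc_D2)
  then show ?case using Suc.IH u m assms(1) by (metis single_valuedD)
qed

lemma layer_eq:
  assumes "rooted_forest V E" "r \<in> roots V E" "(v, r) \<in> E ^^ n"
  shows "layer V E v = n"
  unfolding layer_def
proof (rule the_equality)
  fix m assume "\<exists>r\<in>roots V E. (v, r) \<in> E ^^ m"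
  then show "m = n"
    using assms root_path_unique[of E v] by (auto simp: rooted_forest_def roots_def)
qed (use assms in blast)

definition par :: "'v rel \<Rightarrow> 'v \<Rightarrow> 'v" where
  "par E v = (SOME u. (v, u) \<in> E)"

text \<open>With one intermediate layer a source is at most two edges away from its root, so no
  recursion is required.\<close>

definition root_of :: "'v rel \<Rightarrow> 'v \<Rightarrow> 'v" where
  "root_of E s = (if par E s \<in> Domain E then par E (par E s) else par E s)"

lemma par_edge: "v \<in> Domain E \<Longrightarrow> (v, par E v) \<in> E"
  unfolding par_def by (metis Domain.cases someI_ex)

lemma par_unique: "single_valued E \<Longrightarrow> (v, u) \<in> E \<Longrightarrow> par E v = u"
  by (metis Domain.intros par_edge single_valuedD)

locale layout =
  fixes I :: "'v flamecast" and V E p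
  assumes valid: "valid_layout I V E p"
    and caps: "length (capacities I) = 3"
    and disj: "sources I \<inter> sinks I = {}"
begin

lemma forest: "rooted_forest V E" "finite V" "finite E" "single_valued E" "E \<subseteq> V \<times> V"
  using valid unfolding valid_layout_def valid_topology_def topology_def rooted_forest_def
  by (auto intro: finite_subset)

lemma roots_sinks: "roots V E = V \<inter> sinks I"
  using valid unfolding valid_layout_def valid_topology_def topology_def by auto

lemma source_edge: assumes "s \<in> sources I" shows "s \<in> V" "(s, par E s) \<in> E"
proof -
  have s: "s \<in> leaves V E"
    using assms valid by (auto simp: valid_layout_def valid_topology_def topology_def)
  then show "s \<in> V" by (simp add: leaves_def)
  then have "s \<notin> roots V E" using roots_sinks disj assms by auto
  then show "(s, par E s) \<in> E" using \<open>s \<in> V\<close> by (auto simp: roots_def intro: par_edge)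
qed

lemma root_of_root: assumes "s \<in> sources I" shows "root_of E s \<in> roots V E"
proof (cases "par E s \<in> Domain E")
  case False
  then show ?thesis using source_edge[OF assms] forest by (auto simp: root_of_def roots_def)
next
  case True
  let ?m = "par E s" and ?t = "par E (par E s)"
  have mt: "(?m, ?t) \<in> E" using True by (rule par_edge)
  have sm: "(s, ?m) \<in> E" using source_edge assms by auto
  have tV: "?t \<in> V" using mt forest by auto
  then obtain n r where r: "r \<in> roots V E" "(?t, r) \<in> E ^^ n" using rooted_forest_root forest by metis
  then have "(s, r) \<in> E ^^ Suc (Suc n)" using sm mt by (meson relpow_Suc_I2)
  then have "layer V E s = Suc (Suc n)" using layer_eq r forest by metis
  moreover have "layer V E s \<le> 2"
    using valid source_edge[OF assms] caps by (auto simp: valid_layout_def valid_topology_def topology_def)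
  ultimately have "n = 0" by simp
  then show ?thesis using r True by (simp add: root_of_def)
qed

lemma root_of_sink: "s \<in> sources I \<Longrightarrow> root_of E s \<in> sinks I"
  using root_of_root roots_sinks by auto

lemma finite_sources: "finite (sources I)"
  using forest(2) source_edge(1) by (meson finite_subset subsetI)

lemma embedded:
  "s \<in> sources I \<Longrightarrow> p s = position I s" "s \<in> sources I \<Longrightarrow> p (root_of E s) = position I (root_of E s)"
  using valid source_edge root_of_root roots_sinks
  by (auto simp: valid_layout_def embedding_def)

lemma sink_capacity: "card {s \<in> sources I. root_of E s = t} \<le> capacities I ! 0"
proof (cases "\<exists>s\<in>sources I. root_of E s = t")
  case True
  then have t: "t \<in> roots V E" using root_of_root by auto
  then have "layer V E t = 0" using layer_eq[OF forest(1) t, of t 0] by simp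
  then have "load I E t \<le> capacities I ! 0"
    using valid t by (auto simp: valid_layout_def valid_topology_def roots_def)
  moreover have "card {s \<in> sources I. root_of E s = t} \<le> load I E t"
    unfolding load_def
  proof (intro card_mono, use finite_sources in simp, safe)
    fix s assume s: "s \<in> sources I"
    have "(s, par E s) \<in> E" using s source_edge by auto
    then show "(s, root_of E s) \<in> E\<^sup>*"
      using par_edge[of "par E s" E] by (cases "par E s \<in> Domain E") (simp_all add: root_of_def)
  qed
  ultimately show ?thesis by simp
next
  case False
  then have "{s \<in> sources I. root_of E s = t} = {}" by auto
  then show ?thesis by (metis card.empty le0)
qed

definition steiner :: "'v set" where
  "steiner = par E ` sources I \<inter> Domain E"

definition kids :: "'v \<Rightarrow> 'v set" where
  "kids m = {s \<in> sources I. par E s = m}"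

text \<open>Edges that leave neither a source nor the parent of a source are dropped, and loads are
  replaced by lower bounds. Hence the whole lower bound works without classifying the edges of an
  arbitrary layout; exact costs are computed only for layouts that are constructed.\<close>

lemma layout_cost_ge:
  assumes "0 \<le> exponent I"
  shows "layout_cost I E p \<ge> (\<Sum>s\<in>sources I. dist (p s) (p (par E s))) +
     (\<Sum>m\<in>steiner. dist (p m) (p (par E m)) * real (card (kids m)) powr exponent I)"
proof -
  define w where "w = (\<lambda>(u, v). dist (p u) (p v) * real (load I E u) powr exponent I)"
  define E1 where "E1 = (\<lambda>s. (s, par E s)) ` sources I"
  define E2 where "E2 = (\<lambda>m. (m, par E m)) ` steiner"
  have leaf: "s \<notin> Range E" if "s \<in> sources I" for s
    using valid that by (auto simp: valid_layout_def valid_topology_def topology_def leaves_def)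
  have sub: "E1 \<subseteq> E" "E2 \<subseteq> E" using source_edge par_edge[of _ E] unfolding E1_def E2_def steiner_def by blast+
  have disj12: "E1 \<inter> E2 = {}"
  proof -
    have "par E s \<notin> sources I" if "s \<in> sources I" for s
      using leaf source_edge(2)[OF that] by blast
    then show ?thesis by (auto simp: E1_def E2_def steiner_def)
  qed
  have fin: "finite E1" "finite E2" using finite_sources by (auto simp: E1_def E2_def steiner_def)
  have "(\<Sum>e\<in>E1. w e) = (\<Sum>s\<in>sources I. w (s, par E s))"
    unfolding E1_def by (subst sum.reindex) (auto simp: inj_on_def)
  also have "\<dots> \<ge> (\<Sum>s\<in>sources I. dist (p s) (p (par E s)))"
  proof (rule sum_mono)
    fix s assume s: "s \<in> sources I"
    have "load I E s \<ge> card {s}" unfolding load_def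
      by (rule card_mono) (use finite_sources s in auto)
    then have "real (load I E s) powr exponent I \<ge> 1" using assms by (intro ge_one_powr_ge_zero) auto
    then show "dist (p s) (p (par E s)) \<le> w (s, par E s)"
      by (simp add: w_def mult_le_cancel_left1 order.trans[OF _ mult_left_mono])
  qed
  finally have 1: "(\<Sum>e\<in>E1. w e) \<ge> (\<Sum>s\<in>sources I. dist (p s) (p (par E s)))" .
  have "(\<Sum>e\<in>E2. w e) = (\<Sum>m\<in>steiner. w (m, par E m))"
    unfolding E2_def by (subst sum.reindex) (auto simp: inj_on_def)
  also have "\<dots> \<ge> (\<Sum>m\<in>steiner. dist (p m) (p (par E m)) * real (card (kids m)) powr exponent I)"
  proof (rule sum_mono)
    fix m assume m: "m \<in> steiner"
    have "card (kids m) \<le> load I E m" unfolding load_def kids_def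
      by (rule card_mono) (use finite_sources source_edge in auto)
    then have "real (card (kids m)) powr exponent I \<le> real (load I E m) powr exponent I"
      using assms by (intro powr_mono2) auto
    then show "dist (p m) (p (par E m)) * real (card (kids m)) powr exponent I \<le> w (m, par E m)"
      by (simp add: w_def mult_left_mono)
  qed
  finally have 2: "(\<Sum>e\<in>E2. w e) \<ge> (\<Sum>m\<in>steiner. dist (p m) (p (par E m)) * real (card (kids m)) powr exponent I)" .
  have "(\<Sum>e\<in>E1. w e) + (\<Sum>e\<in>E2. w e) = (\<Sum>e\<in>E1 \<union> E2. w e)"
    using fin disj12 by (simp add: sum.union_disjoint)
  also have "\<dots> \<le> (\<Sum>e\<in>E. w e)"
    using sub forest(3) by (intro sum_mono2) (auto simp: w_def)
  finally show ?thesis using 1 2 unfolding layout_cost_def w_def by linarith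
qed

end

subsection \<open>Lower bound for grouped sources\<close>

text \<open>Origin of the constants: by \<open>separated\<close>, the discs of radius 4 around the
  groups are disjoint. By \<open>large\<close>, a source of a group of size \<open>w\<close> that
  travels as a whole to a sink at distance 8 pays \<open>8 * w powr (\<alpha> - 1)\<close>, which is
  at most 2. The gap between 8 and 10 costs a piece at least 2. The value 5 makes both members of
  the pair \<open>z\<close> pay at least 2 even if they share an edge.\<close>

locale grouped_layout = layout I V E p for I :: "nat flamecast" and V E p +
  fixes lab :: "nat \<Rightarrow> 'i" and pt :: "'i \<Rightarrow> real \<times> real" and z :: 'i and \<alpha> :: real
  assumes exponent: "exponent I = \<alpha>" and \<alpha>: "0 \<le> \<alpha>" "\<alpha> < 1"
    and position: "\<And>s. s \<in> sources I \<Longrightarrow> position I s = pt (lab s)"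
    and separated: "\<And>i j. i \<in> lab ` sources I \<Longrightarrow> j \<in> lab ` sources I \<Longrightarrow> i \<noteq> j \<Longrightarrow> dist (pt i) (pt j) \<ge> 8"
    and large: "\<And>i. i \<in> lab ` sources I \<Longrightarrow> i \<noteq> z \<Longrightarrow>
       4 * real (card {s \<in> sources I. lab s = i}) powr \<alpha> \<le> real (card {s \<in> sources I. lab s = i})"
    and special: "{s \<in> sources I. lab s = z} = {0, 1}"
    and sink_dist: "\<And>i t. i \<in> lab ` sources I \<Longrightarrow> i \<noteq> z \<Longrightarrow> t \<in> sinks I \<Longrightarrow>
       dist (pt i) (position I t) = 8 \<or> dist (pt i) (position I t) \<ge> 10"
    and special_dist: "\<And>t. t \<in> sinks I \<Longrightarrow> dist (pt z) (position I t) = 1 \<or> dist (pt z) (position I t) \<ge> 5"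
begin

definition group :: "'i \<Rightarrow> nat set" where
  "group i = {s \<in> sources I. lab s = i}"

definition gsize :: "'i \<Rightarrow> real" where
  "gsize i = real (card (group i))"

definition base_cost :: real where
  "base_cost = (\<Sum>i\<in>lab ` sources I - {z}. 8 * gsize i powr \<alpha>) + 2 powr \<alpha>"

definition piece :: "nat \<Rightarrow> nat set" where
  "piece s = (if par E s \<in> Domain E then {s' \<in> sources I. par E s' = par E s \<and> lab s' = lab s} else {s})"

text \<open>Distributes the cost of a layout over the sources. A source pays its own edge; if its
  Steiner vertex is closer than 4, it also pays a share of the next edge, which is divided equally
  within its piece. A source farther away does not take part in the second edge, because its first
  edge is expensive enough.\<close>

definition charge :: "nat \<Rightarrow> real" where
  "charge s = dist (pt (lab s)) (p (par E s)) +
     (if par E s \<in> Domain E \<and> dist (pt (lab s)) (p (par E s)) < 4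
      then dist (p (par E s)) (p (root_of E s)) * real (card (kids (par E s))) powr \<alpha> / real (card (piece s))
      else 0)"

lemma piece_props:
  assumes "s \<in> sources I"
  shows "s \<in> piece s" "piece s \<subseteq> group (lab s)" "finite (piece s)" "card (piece s) \<ge> 1"
    "s' \<in> piece s \<Longrightarrow> root_of E s' = root_of E s \<and> piece s' = piece s"
proof -
  show 1: "s \<in> piece s" "piece s \<subseteq> group (lab s)" "finite (piece s)"
    using assms finite_sources by (auto simp: piece_def group_def)
  show "card (piece s) \<ge> 1" using 1 by (metis One_nat_def Suc_leI card_gt_0_iff empty_iff)
  show "s' \<in> piece s \<Longrightarrow> root_of E s' = root_of E s \<and> piece s' = piece s"
    by (auto simp: piece_def root_of_def split: if_splits)
qed

text \<open>By \<open>separated\<close>, the sources that share the edge above a given Steiner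
  vertex belong to one group, so they form a single piece and their shares add up to no more than
  the cost of that edge.\<close>

lemma sum_charge_le: "(\<Sum>s\<in>sources I. charge s) \<le> layout_cost I E p"
proof -
  define near where "near s \<longleftrightarrow> par E s \<in> Domain E \<and> dist (pt (lab s)) (p (par E s)) < 4" for s
  define ex where "ex s = (if near s
      then dist (p (par E s)) (p (root_of E s)) * real (card (kids (par E s))) powr \<alpha> / real (card (piece s))
      else 0)" for s
  have inner: "(\<Sum>s\<in>kids m. ex s) \<le> dist (p m) (p (par E m)) * real (card (kids m)) powr \<alpha>"
    if "m \<in> steiner" for m
  proof (cases "\<exists>s0\<in>kids m. near s0")
    case False
    then have "(\<Sum>s\<in>kids m. ex s) = 0" by (intro sum.neutral) (auto simp: ex_def)
    then show ?thesis by simp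
  next
    case True
    then obtain s0 where s0: "s0 \<in> kids m" "near s0" by auto
    have mD: "m \<in> Domain E" using that by (simp add: steiner_def)
    have *: "{s \<in> kids m. near s} = piece s0"
    proof (intro equalityI subsetI)
      fix s assume s: "s \<in> {s \<in> kids m. near s}"
      have "lab s = lab s0"
      proof (rule ccontr)
        assume "lab s \<noteq> lab s0"
        then have "dist (pt (lab s)) (pt (lab s0)) \<ge> 8" using s s0 by (intro separated) (auto simp: kids_def)
        moreover have "dist (pt (lab s)) (p m) < 4" "dist (pt (lab s0)) (p m) < 4"
          using s s0 by (auto simp: near_def kids_def)
        ultimately show False using dist_triangle2[of "pt (lab s)" "pt (lab s0)" "p m"] by linarith
      qed
      then show "s \<in> piece s0" using s s0 mD by (auto simp: piece_def kids_def)
    next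
      fix s assume "s \<in> piece s0"
      then show "s \<in> {s \<in> kids m. near s}" using s0 mD by (auto simp: piece_def kids_def near_def)
    qed
    have fin: "finite (kids m)" using finite_sources by (simp add: kids_def)
    have s0S: "s0 \<in> sources I" using s0 by (simp add: kids_def)
    have "(\<Sum>s\<in>kids m. ex s) = (\<Sum>s\<in>{s \<in> kids m. near s}. ex s)"
      using fin by (intro sum.mono_neutral_right) (auto simp: ex_def)
    also have "\<dots> = (\<Sum>s\<in>piece s0. dist (p m) (p (par E m)) * real (card (kids m)) powr \<alpha> / real (card (piece s0)))"
      unfolding *
    proof (rule sum.cong)
      fix s assume s: "s \<in> piece s0"
      then have "s \<in> kids m" "near s" using * by auto
      then show "ex s = dist (p m) (p (par E m)) * real (card (kids m)) powr \<alpha> / real (card (piece s0))"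
        using piece_props(5)[OF s0S s] mD by (simp add: ex_def kids_def root_of_def)
    qed simp
    also have "\<dots> = dist (p m) (p (par E m)) * real (card (kids m)) powr \<alpha>"
      using piece_props(4)[OF s0S] by simp
    finally show ?thesis by simp
  qed
  have "(\<Sum>s\<in>sources I. ex s) = (\<Sum>s\<in>{s \<in> sources I. par E s \<in> steiner}. ex s)"
    using finite_sources by (intro sum.mono_neutral_right) (auto simp: ex_def near_def steiner_def)
  also have "\<dots> = (\<Sum>m\<in>steiner. \<Sum>s\<in>kids m. ex s)"
    unfolding kids_def using finite_sources
    by (subst sum.group[of "{s \<in> sources I. par E s \<in> steiner}" steiner "par E" ex, symmetric])
       (auto simp: steiner_def intro!: sum.cong)
  also have "\<dots> \<le> (\<Sum>m\<in>steiner. dist (p m) (p (par E m)) * real (card (kids m)) powr \<alpha>)"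
    by (rule sum_mono) (rule inner)
  finally have "(\<Sum>s\<in>sources I. ex s) \<le> (\<Sum>m\<in>steiner. dist (p m) (p (par E m)) * real (card (kids m)) powr \<alpha>)" .
  moreover have "(\<Sum>s\<in>sources I. charge s) = (\<Sum>s\<in>sources I. dist (p s) (p (par E s))) + (\<Sum>s\<in>sources I. ex s)"
    unfolding sum.distrib[symmetric]
    by (rule sum.cong) (auto simp: charge_def ex_def near_def embedded position)
  ultimately show ?thesis using layout_cost_ge exponent \<alpha> by simp
qed

text \<open>For a near source the triangle inequality combines the two edges. Per unit of length the
  first one costs 1 and the second one \<open>N powr \<alpha> / n\<close>, where \<open>n\<close> is
  the size of the piece and \<open>N\<close> the number of all children; both are at least
  \<open>n powr (\<alpha> - 1)\<close>.\<close>

lemma charge_ge: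
  assumes "s \<in> sources I"
  shows "charge s \<ge> 4 \<or>
    charge s \<ge> dist (pt (lab s)) (position I (root_of E s)) * real (card (piece s)) powr (\<alpha> - 1)"
proof (cases "par E s \<in> Domain E")
  case False
  then have "root_of E s = par E s" "card (piece s) = 1" by (simp_all add: root_of_def piece_def)
  then show ?thesis using False embedded(2)[OF assms] by (simp add: charge_def)
next
  case True
  define d where "d = dist (pt (lab s)) (p (par E s))"
  define D where "D = dist (p (par E s)) (p (root_of E s))"
  define n where "n = real (card (piece s))"
  define N where "N = real (card (kids (par E s)))"
  show ?thesis
  proof (cases "d < 4")
    case False
    then show ?thesis by (simp add: charge_def d_def)
  next
    case d4: True
    have n1: "n \<ge> 1" using piece_props(4)[OF assms] by (simp add: n_def)
    have "piece s \<subseteq> kids (par E s)" "finite (kids (par E s))"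
      using True finite_sources by (auto simp: piece_def kids_def)
    then have nN: "n \<le> N" by (simp add: n_def N_def card_mono)
    have "n powr (\<alpha> - 1) = n powr \<alpha> / n" using n1 by (simp add: powr_diff)
    also have "\<dots> \<le> N powr \<alpha> / n" using n1 nN \<alpha> by (intro divide_right_mono powr_mono2) auto
    finally have a: "n powr (\<alpha> - 1) \<le> N powr \<alpha> / n" .
    have b: "n powr (\<alpha> - 1) \<le> 1" using n1 \<alpha> powr_mono[of "\<alpha> - 1" 0 n] by simp
    have "dist (pt (lab s)) (position I (root_of E s)) \<le> d + D"
      unfolding d_def D_def embedded(2)[OF assms, symmetric] by (rule dist_triangle)
    then have "dist (pt (lab s)) (position I (root_of E s)) * n powr (\<alpha> - 1) \<le> (d + D) * n powr (\<alpha> - 1)"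
      by (intro mult_right_mono) auto
    also have "\<dots> = d * n powr (\<alpha> - 1) + D * n powr (\<alpha> - 1)" by (simp add: algebra_simps)
    also have "\<dots> \<le> d * 1 + D * (N powr \<alpha> / n)"
      using a b by (intro add_mono mult_left_mono) (auto simp: d_def D_def)
    also have "\<dots> = charge s" using True d4 by (simp add: charge_def d_def D_def n_def N_def)
    finally show ?thesis by (simp add: n_def)
  qed
qed

definition perfect :: "'i \<Rightarrow> bool" where
  "perfect i \<longleftrightarrow> (\<exists>t\<in>sinks I. dist (pt i) (position I t) = 8 \<and> (\<forall>s\<in>group i. root_of E s = t))"

definition excess :: real where
  "excess = 2 - 2 powr \<alpha>"

lemma excess: "0 < excess" "excess \<le> 1"
proof -
  have "2 powr \<alpha> < 2 powr 1" using \<alpha> by (intro powr_less_mono) auto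
  then show "0 < excess" by (simp add: excess_def)
  show "excess \<le> 1" using \<alpha> by (simp add: excess_def ge_one_powr_ge_zero)
qed

text \<open>\<open>price\<close> is what each source pays if the group stays together, and no source
  pays less. A group can be imperfect in three ways, each with a surplus: a source with charge 4 or
  more pays at least 2 too much; a piece that goes to a sink at distance 10 or more pays at least 2
  too much; and if two sinks are used, some piece has at most half of the size of the group and
  misses part of the discount.\<close>

lemma group_charge:
  assumes i: "i \<in> lab ` sources I" "i \<noteq> z"
  shows "(\<Sum>s\<in>group i. charge s) \<ge> 8 * gsize i powr \<alpha>"
    and "\<not> perfect i \<Longrightarrow> (\<Sum>s\<in>group i. charge s) > 8 * gsize i powr \<alpha> + excess"
proof -
  define G where "G = gsize i"
  define price where "price = 8 * G powr (\<alpha> - 1)"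
  have fin: "finite (group i)" using finite_sources by (simp add: group_def)
  have ne: "group i \<noteq> {}" using i by (auto simp: group_def)
  have src: "s \<in> sources I" "lab s = i" if "s \<in> group i" for s using that by (auto simp: group_def)
  have G1: "G \<ge> 1" unfolding G_def gsize_def using fin ne by (simp add: Suc_le_eq card_gt_0_iff)
  have Gp: "G * G powr (\<alpha> - 1) = G powr \<alpha>" using G1 by (simp add: powr_diff)
  have "4 * G powr \<alpha> \<le> G" using large[OF i] by (simp add: G_def gsize_def group_def)
  then have "8 * G powr \<alpha> / G \<le> 2" using G1 by (simp add: field_simps)
  then have price2: "price \<le> 2" using G1 unfolding price_def by (simp add: powr_diff)
  have price0: "price \<ge> 0" by (simp add: price_def)
  have size: "card (group i) * price = 8 * G powr \<alpha>"
    using Gp by (simp add: price_def G_def gsize_def algebra_simps)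
  have dist8: "dist (pt i) (position I (root_of E s)) = 8 \<or> dist (pt i) (position I (root_of E s)) \<ge> 10"
    if "s \<in> group i" for s
    using sink_dist[OF i root_of_sink[OF src(1)[OF that]]] .
  have pieceG: "1 \<le> real (card (piece s))" "real (card (piece s)) \<le> G" "piece s \<subseteq> group i" if "s \<in> group i" for s
    using piece_props(2,4)[OF src(1)[OF that]] fin src(2)[OF that]
    by (simp_all add: G_def gsize_def card_mono)
  have ge: "charge s \<ge> price" if s: "s \<in> group i" for s
  proof -
    from charge_ge[OF src(1)[OF s]] show ?thesis
    proof
      assume "charge s \<ge> dist (pt (lab s)) (position I (root_of E s)) * real (card (piece s)) powr (\<alpha> - 1)"
      moreover have "G powr (\<alpha> - 1) \<le> real (card (piece s)) powr (\<alpha> - 1)"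
        using pieceG[OF s] \<alpha> by (intro powr_mono2') auto
      then have "8 * G powr (\<alpha> - 1) \<le> dist (pt (lab s)) (position I (root_of E s)) * real (card (piece s)) powr (\<alpha> - 1)"
        using dist8[OF s] src(2)[OF s] by (intro mult_mono) auto
      ultimately show ?thesis by (simp add: price_def)
    qed (use price2 in simp)
  qed
  \<comment> \<open>A surplus on a subset is a surplus of the group, as every other source pays at
    least \<open>price\<close>.\<close>
  have part: "(\<Sum>s\<in>group i. charge s) \<ge> 8 * G powr \<alpha> + x"
    if A: "A \<subseteq> group i" "(\<Sum>s\<in>A. charge s) \<ge> card A * price + x" for A x
  proof -
    have finA: "finite A" using A fin finite_subset by blast
    have "(\<Sum>s\<in>group i. charge s) = (\<Sum>s\<in>A. charge s) + (\<Sum>s\<in>group i - A. charge s)"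
      using A fin by (simp add: sum.subset_diff)
    moreover have "(\<Sum>s\<in>group i - A. charge s) \<ge> card (group i - A) * price"
      using ge by (intro sum_bounded_below[where K = price, simplified]) auto
    moreover have "real (card (group i)) = card A + card (group i - A)"
      using A fin finA by (metis card_Diff_subset card_mono le_add_diff_inverse of_nat_add)
    ultimately show ?thesis using A(2) size by (simp add: algebra_simps)
  qed
  from part[of "{}" 0] show "(\<Sum>s\<in>group i. charge s) \<ge> 8 * gsize i powr \<alpha>" by (simp add: G_def)
  assume np: "\<not> perfect i"
  show "(\<Sum>s\<in>group i. charge s) > 8 * gsize i powr \<alpha> + excess"
  proof (cases "\<exists>s\<in>group i. charge s \<ge> 4")
    case True
    then obtain s where "s \<in> group i" "charge s \<ge> 4" by auto
    then have "(\<Sum>s\<in>group i. charge s) \<ge> 8 * G powr \<alpha> + 2"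
      using price2 by (intro part[of "{s}"]) auto
    then show ?thesis using excess by (simp add: G_def)
  next
    case False
    then have near: "charge s \<ge> dist (pt i) (position I (root_of E s)) * real (card (piece s)) powr (\<alpha> - 1)"
      if "s \<in> group i" for s
      using charge_ge[OF src(1)[OF that]] src(2)[OF that] that by auto
    have psum: "(\<Sum>s'\<in>piece s. charge s') \<ge> dist (pt i) (position I (root_of E s)) * real (card (piece s)) powr \<alpha>"
      if s: "s \<in> group i" for s
    proof -
      let ?c = "dist (pt i) (position I (root_of E s)) * real (card (piece s)) powr (\<alpha> - 1)"
      have "charge s' \<ge> ?c" if "s' \<in> piece s" for s'
        using near[of s'] pieceG(3)[OF s] piece_props(5)[OF src(1)[OF s] that] that by auto
      then have "(\<Sum>s'\<in>piece s. charge s') \<ge> card (piece s) * ?c"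
        by (intro sum_bounded_below[where K = ?c, simplified]) auto
      moreover have "card (piece s) * ?c = dist (pt i) (position I (root_of E s)) * real (card (piece s)) powr \<alpha>"
        using pieceG(1)[OF s] by (simp add: powr_diff)
      ultimately show ?thesis by simp
    qed
    show ?thesis
    proof (cases "\<exists>s\<in>group i. dist (pt i) (position I (root_of E s)) \<ge> 10")
      case True
      then obtain s where s: "s \<in> group i" "dist (pt i) (position I (root_of E s)) \<ge> 10" by auto
      define n where "n = real (card (piece s))"
      have n: "1 \<le> n" "n \<le> G" using pieceG[OF s(1)] by (auto simp: n_def)
      have na: "n powr \<alpha> \<ge> 1" using n \<alpha> by (intro ge_one_powr_ge_zero) auto
      have "n * price \<le> n * (8 * n powr (\<alpha> - 1))"
        unfolding price_def using n \<alpha> by (intro mult_left_mono powr_mono2') auto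
      also have "\<dots> = 8 * n powr \<alpha>" using n by (simp add: powr_diff)
      finally have "n * price + 2 \<le> 10 * n powr \<alpha>" using na by linarith
      also have "\<dots> \<le> dist (pt i) (position I (root_of E s)) * n powr \<alpha>"
        using s by (intro mult_right_mono) auto
      also have "\<dots> \<le> (\<Sum>s'\<in>piece s. charge s')" using psum[OF s(1)] by (simp add: n_def)
      finally have "(\<Sum>s\<in>group i. charge s) \<ge> 8 * G powr \<alpha> + 2"
        using pieceG[OF s(1)] by (intro part[of "piece s"]) (auto simp: n_def)
      then show ?thesis using excess by (simp add: G_def)
    next
      case False
      then have d8: "dist (pt i) (position I (root_of E s)) = 8" if "s \<in> group i" for s
        using dist8[OF that] that by auto
      obtain s1 where s1: "s1 \<in> group i" using ne by auto
      from np s1 d8 root_of_sink[OF src(1)[OF s1]] obtain s2 where s2: "s2 \<in> group i" "root_of E s2 \<noteq> root_of E s1"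
        unfolding perfect_def by blast
      have "piece s1 \<inter> piece s2 = {}"
      proof (rule ccontr)
        assume "piece s1 \<inter> piece s2 \<noteq> {}"
        then obtain s' where "s' \<in> piece s1" "s' \<in> piece s2" by blast
        then have "root_of E s' = root_of E s1" "root_of E s' = root_of E s2"
          using piece_props(5) src(1) s1 s2(1) by auto
        then show False using s2(2) by simp
      qed
      then have "card (piece s1) + card (piece s2) = card (piece s1 \<union> piece s2)"
        using piece_props(3) src s1 s2 by (simp add: card_Un_disjoint)
      also have "\<dots> \<le> card (group i)" using fin pieceG s1 s2 by (intro card_mono) auto
      finally have "real (card (piece s1)) + real (card (piece s2)) \<le> G" by (simp add: G_def gsize_def)
      then have "real (card (piece s1)) \<le> G / 2 \<or> real (card (piece s2)) \<le> G / 2" by linarith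
      then obtain s where s: "s \<in> group i" "real (card (piece s)) \<le> G / 2" using s1 s2(1) by blast
      define n where "n = real (card (piece s))"
      have n: "1 \<le> n" "n \<le> G / 2" using pieceG[OF s(1)] s(2) by (auto simp: n_def)
      have na: "n powr \<alpha> \<ge> 1" using n \<alpha> by (intro ge_one_powr_ge_zero) auto
      have "G powr (\<alpha> - 1) \<le> (2 * n) powr (\<alpha> - 1)" using n \<alpha> by (intro powr_mono2') auto
      then have "n * price \<le> n * (8 * (2 * n) powr (\<alpha> - 1))"
        unfolding price_def using n by (intro mult_left_mono) auto
      also have "\<dots> = 4 * 2 powr \<alpha> * n powr \<alpha>" using n by (simp add: powr_diff powr_mult)
      \<comment> \<open>Since \<open>4 * 2 powr \<alpha> = 8 - 4 * excess\<close>, the constant of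
        the pair reappears: splitting a group loses at least four times what splitting the pair
        loses.\<close>
      also have "\<dots> = 8 * n powr \<alpha> - 4 * excess * n powr \<alpha>" by (simp add: excess_def algebra_simps)
      also have "\<dots> \<le> 8 * n powr \<alpha> - 4 * excess * 1" using na excess by (intro diff_left_mono mult_left_mono) auto
      also have "8 * n powr \<alpha> \<le> (\<Sum>s'\<in>piece s. charge s')" using psum[OF s(1)] d8[OF s(1)] by (simp add: n_def)
      finally have "(\<Sum>s\<in>group i. charge s) \<ge> 8 * G powr \<alpha> + 4 * excess"
        using pieceG[OF s(1)] by (intro part[of "piece s"]) (auto simp: n_def)
      then show ?thesis using excess by (simp add: G_def)
    qed
  qed
qed

text \<open>The pair pays \<open>2 powr \<alpha>\<close> together and 2 apart, and
  \<open>excess\<close> is the difference. Away from its two sinks the distance 5 outweighs the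
  discount factor, which is at least 1/2, so even a bundled pair pays more than 2.\<close>

lemma special_charge:
  shows "charge 0 + charge 1 \<ge> 2 powr \<alpha>"
    and "par E 0 \<noteq> par E 1 \<Longrightarrow> charge 0 + charge 1 \<ge> 2"
    and "par E 0 = par E 1 \<Longrightarrow> dist (pt z) (position I (root_of E 0)) \<noteq> 1 \<Longrightarrow> charge 0 + charge 1 > 2"
proof -
  have src: "s \<in> sources I" "lab s = z" if "s \<in> {0, 1}" for s using special that by auto
  have two: "2 powr \<alpha> = 2 * 2 powr (\<alpha> - 1)" by (simp add: powr_diff)
  have half: "2 powr (\<alpha> - 1) \<le> 1" "2 powr (\<alpha> - 1) \<ge> 1 / 2"
    using \<alpha> powr_mono[of "\<alpha> - 1" 0 2] powr_mono[of "-1" "\<alpha> - 1" 2] by (auto simp: powr_minus)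
  have grp: "group z = {0, 1}" using special by (simp add: group_def)
  have pc: "card (piece s) = 1 \<or> card (piece s) = 2" if "s \<in> {0, 1}" for s
  proof -
    have "card (piece s) \<le> card {0, 1 :: nat}"
      using piece_props(2)[OF src(1)[OF that]] src(2)[OF that] grp by (intro card_mono) auto
    then show ?thesis using piece_props(4)[OF src(1)[OF that]] by simp linarith
  qed
  have d: "dist (pt z) (position I (root_of E s)) = 1 \<or> dist (pt z) (position I (root_of E s)) \<ge> 5"
    if "s \<in> {0, 1}" for s
    using special_dist[OF root_of_sink[OF src(1)[OF that]]] .
  have w: "real (card (piece s)) powr (\<alpha> - 1) \<ge> 2 powr (\<alpha> - 1)" if "s \<in> {0, 1}" for s
    using pc[OF that] half by auto
  have ge: "charge s \<ge> 4 \<or> charge s \<ge> dist (pt z) (position I (root_of E s)) * real (card (piece s)) powr (\<alpha> - 1)"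
    if "s \<in> {0, 1}" for s
    using charge_ge[OF src(1)[OF that]] src(2)[OF that] by simp
  have ge1: "charge s \<ge> real (card (piece s)) powr (\<alpha> - 1)" if "s \<in> {0, 1}" for s
  proof -
    have "real (card (piece s)) powr (\<alpha> - 1) \<le> 1" using pc[OF that] half by auto
    moreover have "real (card (piece s)) powr (\<alpha> - 1) \<le> dist (pt z) (position I (root_of E s)) * real (card (piece s)) powr (\<alpha> - 1)"
      using d[OF that] by (auto simp: mult_le_cancel_right1)
    ultimately show ?thesis using ge[OF that] by linarith
  qed
  show "charge 0 + charge 1 \<ge> 2 powr \<alpha>"
    using ge1[of 0] ge1[of 1] w[of 0] w[of 1] two by simp
  show "charge 0 + charge 1 \<ge> 2" if "par E 0 \<noteq> par E 1"
  proof -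
    have "card (piece s) = 1" if "s \<in> {0, 1}" for s
    proof -
      have "piece s \<subseteq> {0, 1}" using piece_props(2)[OF src(1)[OF that]] src(2)[OF that] grp by simp
      moreover have "s' \<in> piece s \<Longrightarrow> par E s' = par E s" for s' by (auto simp: piece_def split: if_splits)
      ultimately have "piece s \<subseteq> {s}" using \<open>par E 0 \<noteq> par E 1\<close> that by auto
      then show ?thesis using piece_props(1)[OF src(1)[OF that]] by (metis card_1_singleton_iff empty_iff insert_iff subset_singletonD One_nat_def)
    qed
    then show ?thesis using ge1[of 0] ge1[of 1] by simp
  qed
  assume same: "par E 0 = par E 1" and far: "dist (pt z) (position I (root_of E 0)) \<noteq> 1"
  have "root_of E 1 = root_of E 0" using same by (simp add: root_of_def)
  then have d5: "dist (pt z) (position I (root_of E s)) \<ge> 5" if "s \<in> {0, 1}" for s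
    using d[OF that] far that by auto
  have "charge s \<ge> 2" if "s \<in> {0, 1}" for s
  proof -
    have "5 * (1 / 2) \<le> dist (pt z) (position I (root_of E s)) * real (card (piece s)) powr (\<alpha> - 1)"
      using d5[OF that] w[OF that] half by (intro mult_mono) auto
    then show ?thesis using ge[OF that] by linarith
  qed
  from this[of 0] this[of 1] show "charge 0 + charge 1 > 2" by simp
qed

text \<open>One imperfect group costs strictly more than \<open>excess\<close>. Hence the budget
  \<open>base_cost + excess\<close>, which just permits separating the pair, makes all other groups
  perfect.\<close>

theorem grouped_lower_bound:
  shows "layout_cost I E p \<ge> base_cost"
    and "par E 0 \<noteq> par E 1 \<Longrightarrow> layout_cost I E p \<ge> base_cost + excess"
    and "layout_cost I E p \<le> base_cost + excess \<Longrightarrow> i \<in> lab ` sources I \<Longrightarrow> i \<noteq> z \<Longrightarrow> perfect i"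
    and "layout_cost I E p \<le> base_cost + excess \<Longrightarrow> par E 0 = par E 1 \<Longrightarrow>
      dist (pt z) (position I (root_of E 0)) = 1"
proof -
  define J where "J = lab ` sources I - {z}"
  have finJ: "finite J" using finite_sources by (simp add: J_def)
  have "0 \<in> {s \<in> sources I. lab s = z}" unfolding special by simp
  then have z: "z \<in> lab ` sources I" by auto
  have grp: "group z = {0, 1}" using special by (simp add: group_def)
  have "(\<Sum>s\<in>sources I. charge s) = (\<Sum>i\<in>lab ` sources I. \<Sum>s\<in>group i. charge s)"
    unfolding group_def using finite_sources by (intro sum.group[symmetric]) auto
  also have "\<dots> = (\<Sum>i\<in>J. \<Sum>s\<in>group i. charge s) + (charge 0 + charge 1)"
    using finite_sources z by (simp add: J_def sum.remove[of _ z] grp)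
  finally have tot: "layout_cost I E p \<ge> (\<Sum>i\<in>J. \<Sum>s\<in>group i. charge s) + (charge 0 + charge 1)"
    using sum_charge_le by simp
  have base: "(\<Sum>i\<in>J. \<Sum>s\<in>group i. charge s) \<ge> base_cost - 2 powr \<alpha>"
    unfolding base_cost_def J_def[symmetric] by (simp, rule sum_mono) (auto simp: J_def intro: group_charge)
  show "layout_cost I E p \<ge> base_cost" using tot base special_charge(1) by linarith
  show "layout_cost I E p \<ge> base_cost + excess" if "par E 0 \<noteq> par E 1"
    using tot base special_charge(2)[OF that] by (simp add: excess_def)
  show "dist (pt z) (position I (root_of E 0)) = 1" if "layout_cost I E p \<le> base_cost + excess" "par E 0 = par E 1"
    using tot base special_charge(3)[OF that(2)] that(1) by (force simp: excess_def)
  show "perfect i" if le: "layout_cost I E p \<le> base_cost + excess" and i: "i \<in> lab ` sources I" "i \<noteq> z"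
  proof (rule ccontr)
    assume np: "\<not> perfect i"
    have iJ: "i \<in> J" using i by (simp add: J_def)
    have "(\<Sum>i\<in>J. \<Sum>s\<in>group i. charge s) = (\<Sum>s\<in>group i. charge s) + (\<Sum>i\<in>J - {i}. \<Sum>s\<in>group i. charge s)"
      using finJ iJ by (simp add: sum.remove)
    moreover have "(\<Sum>i\<in>J - {i}. \<Sum>s\<in>group i. charge s) \<ge> (\<Sum>i\<in>J - {i}. 8 * gsize i powr \<alpha>)"
      by (rule sum_mono) (auto simp: J_def intro: group_charge)
    moreover have "base_cost = 8 * gsize i powr \<alpha> + (\<Sum>i\<in>J - {i}. 8 * gsize i powr \<alpha>) + 2 powr \<alpha>"
      unfolding base_cost_def J_def[symmetric] using finJ iJ by (simp add: sum.remove)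
    ultimately show False using group_charge(2)[OF i np] tot special_charge(1) le by linarith
  qed
qed

end

subsection \<open>Layouts from assignments\<close>

text \<open>Each Steiner vertex is placed on top of the sources below it, so that only the edges
  from Steiner vertices to sinks have a cost. As the three capacities are equal, the loads of the
  sinks decide about validity.\<close>

lemma assignment_layout:
  fixes I :: "nat flamecast"
  assumes fin: "finite (sources I)" and disj: "sources I \<inter> sinks I = {}"
    and st: "st ` sources I \<inter> (sources I \<union> sinks I) = {}"
    and tau: "\<And>s. s \<in> sources I \<Longrightarrow> tau (st s) \<in> sinks I"
    and pos: "\<And>s. s \<in> sources I \<Longrightarrow> position I s = P (st s)"
    and caps: "capacities I = [c, c, c]" and c: "1 \<le> c"
    and cap: "\<And>t. card {s \<in> sources I. tau (st s) = t} \<le> c"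
  shows "\<exists>E p. finite E \<and> valid_layout I (Field E) E p \<and>
    layout_cost I E p = (\<Sum>g\<in>st ` sources I. dist (P g) (position I (tau g)) *
       real (card {s \<in> sources I. st s = g}) powr exponent I)"
proof -
  let ?S = "sources I" and ?T = "sinks I"
  define E where "E = (\<lambda>s. (s, st s)) ` ?S \<union> (\<lambda>g. (g, tau g)) ` st ` ?S"
  define p where "p v = (if v \<in> ?S \<union> ?T then position I v else P v)" for v
  define V where "V = Field E"
  have finE: "finite E" using fin by (simp add: E_def)
  have dom: "Domain E = ?S \<union> st ` ?S" by (simp add: E_def Domain_fst image_Un image_image)
  have ran: "Range E = st ` ?S \<union> tau ` st ` ?S" by (simp add: E_def Range_snd image_Un image_image)
  have V: "V = ?S \<union> st ` ?S \<union> tau ` st ` ?S" by (auto simp: V_def Field_def dom ran)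
  have stS: "st s \<notin> ?S" "st s \<notin> ?T" if "s \<in> ?S" for s using st that by auto
  have tauS: "tau (st s) \<notin> ?S" "tau (st s) \<notin> st ` ?S" if "s \<in> ?S" for s
    using tau[OF that] disj st by auto
  have sv: "single_valued E"
    by (auto simp: single_valued_def E_def dest: stS)
  have E2: "(v, w) \<in> E O E \<longleftrightarrow> (\<exists>s\<in>?S. v = s \<and> w = tau (st s))" for v w
    using stS tauS by (auto simp: E_def relcomp_unfold; blast?)
  have E3: "E O E O E = {}"
  proof -
    have "b \<notin> ?S" if "(a, b) \<in> E" for a b
    proof -
      have "b \<in> st ` ?S \<union> tau ` st ` ?S" using that ran by (metis Range.intros)
      then show ?thesis using stS(1) tauS(1) by auto
    qed
    then show ?thesis using E2 by blast
  qed
  have rt: "E\<^sup>* = Id \<union> E \<union> E O E"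
  proof
    show "E\<^sup>* \<subseteq> Id \<union> E \<union> E O E"
    proof (rule subrelI)
      fix v w assume "(v, w) \<in> E\<^sup>*"
      then show "(v, w) \<in> Id \<union> E \<union> E O E"
        by (induction rule: rtrancl_induct) (use E3 in blast)+
    qed
  qed auto
  have ac: "acyclic E"
  proof (rule acyclicI_order[where f = "\<lambda>v. if v \<in> ?S then 2 else if v \<in> st ` ?S then 1 else 0 :: nat"])
    fix v u assume "(v, u) \<in> E"
    then consider s where "s \<in> ?S" "v = s" "u = st s" | s where "s \<in> ?S" "v = st s" "u = tau (st s)"
      by (auto simp: E_def)
    then show "(if u \<in> ?S then 2 else if u \<in> st ` ?S then 1 else 0 :: nat)
       < (if v \<in> ?S then 2 else if v \<in> st ` ?S then 1 else 0)"
      by cases (use stS tauS in auto)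
  qed
  have forest: "rooted_forest V E"
    using finE sv ac fin unfolding rooted_forest_def V_def
    by (auto simp: finite_Field) (auto simp: Field_def)
  have dj: "tau ` st ` ?S \<inter> ?S = {}" "tau ` st ` ?S \<inter> st ` ?S = {}" "st ` ?S \<inter> ?S = {}"
    using tauS stS by auto
  have "roots V E = V - Domain E" "leaves V E = V - Range E" by (auto simp: roots_def leaves_def)
  moreover have "S \<union> A \<union> B - (S \<union> A) = B" "S \<union> A \<union> B - (A \<union> B) = S"
    if "B \<inter> S = {}" "B \<inter> A = {}" "A \<inter> S = {}" for S A B :: "nat set"
    using that by blast+
  from this[OF dj] have "V - Domain E = tau ` st ` ?S" "V - Range E = ?S" by (simp_all add: V dom ran)
  ultimately have rts: "roots V E = tau ` st ` ?S" and lvs: "leaves V E = ?S" by simp_all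
  have l0: "layer V E (tau (st s)) = 0" if "s \<in> ?S" for s
    by (rule layer_eq[OF forest, of "tau (st s)"]) (use that rts in auto)
  have l1: "layer V E (st s) = 1" if "s \<in> ?S" for s
    by (rule layer_eq[OF forest, of "tau (st s)"]) (use that rts in \<open>auto simp: E_def\<close>)
  have l2: "layer V E s = 2" if "s \<in> ?S" for s
    by (rule layer_eq[OF forest, of "tau (st s)"]) (use that rts E2 in \<open>auto simp: numeral_2_eq_2\<close>)
  have lay: "layer V E v \<le> 2" if "v \<in> V" for v
    using that l0 l1 l2 by (auto simp: V)
  have top: "topology I V E"
  proof -
    have "V \<inter> ?T = tau ` st ` ?S" unfolding V using disj st tau by auto
    then show ?thesis unfolding topology_def using forest lay lvs rts by (simp add: caps numeral_2_eq_2)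
  qed
  have edge_s: "(s, w) \<in> E \<longleftrightarrow> w = st s" if "s \<in> ?S" for s w
    using that stS(1) by (auto simp: E_def)
  have reach: "(s, w) \<in> E\<^sup>* \<longleftrightarrow> w = s \<or> w = st s \<or> w = tau (st s)" if "s \<in> ?S" for s w
    unfolding rt using that edge_s[OF that] E2[of s w] by (auto simp del: relcomp.simps)
  have ne: "st s \<noteq> s'" "tau (st s) \<noteq> s'" "tau (st s) \<noteq> st s'" if "s \<in> ?S" "s' \<in> ?S" for s s'
    using stS(1)[OF that(1)] tauS[OF that(1)] that(2) by auto
  have load_st: "load I E (st s) = card {s' \<in> ?S. st s' = st s}" if "s \<in> ?S" for s
  proof -
    have "{s' \<in> ?S. (s', st s) \<in> E\<^sup>*} = {s' \<in> ?S. st s' = st s}"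
      using that by (auto simp: reach dest: ne ne[symmetric])
    then show ?thesis by (simp add: load_def)
  qed
  have load_s: "load I E s = 1" if "s \<in> ?S" for s
  proof -
    have "{s' \<in> ?S. (s', s) \<in> E\<^sup>*} = {s}"
      using that by (auto simp: reach dest: ne ne[symmetric])
    then show ?thesis by (simp add: load_def)
  qed
  have load_t: "load I E (tau (st s)) = card {s' \<in> ?S. tau (st s') = tau (st s)}" if "s \<in> ?S" for s
  proof -
    have "{s' \<in> ?S. (s', tau (st s)) \<in> E\<^sup>*} = {s' \<in> ?S. tau (st s') = tau (st s)}"
      using that by (auto simp: reach dest: ne ne[symmetric])
    then show ?thesis by (simp add: load_def)
  qed
  have ld: "load I E v \<le> c" if v: "v \<in> V" for v
  proof -
    consider "v \<in> ?S" | s where "s \<in> ?S" "v = st s" | s where "s \<in> ?S" "v = tau (st s)"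
      using v by (auto simp: V)
    then show ?thesis
    proof cases
      case 1 then show ?thesis using load_s c by simp
    next
      case 2
      have "card {s' \<in> ?S. st s' = st s} \<le> card {s' \<in> ?S. tau (st s') = tau (st s)}"
        using fin by (intro card_mono) auto
      then show ?thesis using load_st[OF 2(1)] cap[of "tau (st s)"] 2(2) by simp
    next
      case 3 then show ?thesis using load_t cap by simp
    qed
  qed
  have "capacities I ! layer V E v = c" if "v \<in> V" for v
  proof -
    have "layer V E v = 0 \<or> layer V E v = 1 \<or> layer V E v = 2" using lay[OF that] by linarith
    then show ?thesis by (auto simp: caps)
  qed
  then have "valid_layout I V E p"
    using top ld by (auto simp: valid_layout_def valid_topology_def embedding_def p_def)
  moreover have "layout_cost I E p = (\<Sum>g\<in>st ` ?S. dist (P g) (position I (tau g)) *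
       real (card {s \<in> ?S. st s = g}) powr exponent I)"
  proof -
    let ?w = "\<lambda>(u, v). dist (p u) (p v) * real (load I E u) powr exponent I"
    have "layout_cost I E p = (\<Sum>e\<in>(\<lambda>s. (s, st s)) ` ?S. ?w e) + (\<Sum>e\<in>(\<lambda>g. (g, tau g)) ` st ` ?S. ?w e)"
      unfolding layout_cost_def using fin stS by (subst E_def, subst sum.union_disjoint) auto
    also have "(\<Sum>e\<in>(\<lambda>s. (s, st s)) ` ?S. ?w e) = (\<Sum>s\<in>?S. ?w (s, st s))"
      by (subst sum.reindex) (auto simp: inj_on_def)
    also have "\<dots> = 0"
      using pos stS by (intro sum.neutral) (auto simp: p_def)
    also have "(\<Sum>e\<in>(\<lambda>g. (g, tau g)) ` st ` ?S. ?w e) = (\<Sum>g\<in>st ` ?S. ?w (g, tau g))"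
      by (subst sum.reindex) (auto simp: inj_on_def)
    also have "\<dots> = (\<Sum>g\<in>st ` ?S. dist (P g) (position I (tau g)) *
       real (card {s \<in> ?S. st s = g}) powr exponent I)"
      using stS tau load_st by (intro sum.cong) (auto simp: p_def)
    finally show ?thesis by simp
  qed
  ultimately show ?thesis using finE unfolding V_def by blast
qed

section \<open>The grid instance of a formula in conjunctive normal form\<close>

text \<open>Column \<open>0\<close> belongs to an extra literal that occurs in every clause, the columns \<open>2q + 1\<close> and
  \<open>2q + 2\<close> to the positive and the negative literal of the variable \<open>q\<close>. Every source group chooses
  one of the sinks at distance 8, and every sink accepts \<open>4g\<close> sources. A literal is false if the
  groups \<open>Ti i j\<close> and \<open>Bi i j\<close> of its column all choose the lower sink. In row \<open>i\<close> the groups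
  \<open>Hi i h\<close> are pushed from the left to the right, until a hub \<open>Hu i j\<close> of a true literal of the
  clause, where \<open>Bi i j\<close> is lighter, has room for a second one.\<close>

datatype item = Zi | Fi | Ui | Ti nat nat | Bi nat nat | Hi nat nat | Ct nat | Cb nat

datatype sink = Es | Ss | Bo nat nat | Hu nat nat

instance item :: countable by countable_datatype

text \<open>All points except those of \<open>Zi\<close>, \<open>Fi\<close> and \<open>Es\<close>
  belong to the lattice of mesh 8, where an item and a sink are at distance 8 exactly if they are
  neighbours. The exceptions lie on the vertical line of column 0 next to the grid; they place the
  pair one unit from both of its sinks \<open>Es\<close> and \<open>Ss\<close> and still 9 units
  from the groups \<open>Fi\<close> and \<open>Ui\<close>.\<close>

primrec ipos :: "nat \<Rightarrow> item \<Rightarrow> nat \<times> nat" where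
  "ipos m Zi = (16, 15)"
| "ipos m Fi = (16, 6)"
| "ipos m Ui = (16, 24)"
| "ipos m (Ti i j) = (16 * (j + 1), 32 * (i + 1) + 8)"
| "ipos m (Bi i j) = (16 * (j + 1), 32 * (i + 1) + 24)"
| "ipos m (Hi i h) = (16 * h + 8, 32 * (i + 1) + 16)"
| "ipos m (Ct q) = (16 * (2 * q + 2) + 8, 32)"
| "ipos m (Cb q) = (16 * (2 * q + 2) + 8, 32 * (m + 1))"

primrec spos :: "sink \<Rightarrow> nat \<times> nat" where
  "spos Es = (16, 14)"
| "spos Ss = (16, 16)"
| "spos (Bo i j) = (16 * (j + 1), 32 * (i + 1))"
| "spos (Hu i j) = (16 * (j + 1), 32 * (i + 1) + 16)"

primrec adj :: "nat \<Rightarrow> item \<Rightarrow> sink \<Rightarrow> bool" where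
  "adj m Zi t \<longleftrightarrow> t = Ss \<or> t = Es"
| "adj m Fi t \<longleftrightarrow> t = Es"
| "adj m Ui t \<longleftrightarrow> t = Ss \<or> t = Bo 0 0"
| "adj m (Ti i j) t \<longleftrightarrow> t = Bo i j \<or> t = Hu i j"
| "adj m (Bi i j) t \<longleftrightarrow> t = Hu i j \<or> t = Bo (Suc i) j"
| "adj m (Hi i h) t \<longleftrightarrow> t = Hu i h \<or> (0 < h \<and> t = Hu i (h - 1))"
| "adj m (Ct q) t \<longleftrightarrow> t = Bo 0 (2 * q + 1) \<or> t = Bo 0 (2 * q + 2)"
| "adj m (Cb q) t \<longleftrightarrow> t = Bo m (2 * q + 1) \<or> t = Bo m (2 * q + 2)"

section \<open>Distances between points of the grid\<close>

definition rp :: "nat \<times> nat \<Rightarrow> real \<times> real" where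
  "rp z = (real (fst z), real (snd z))"

lemma dist_rp: "dist (rp (a, b)) (rp (c, d)) = sqrt ((real a - real c)\<^sup>2 + (real b - real d)\<^sup>2)"
  by (simp add: rp_def dist_Pair_Pair dist_real_def)

lemma dist_rp_ge:
  assumes "(int a - int c)\<^sup>2 + (int b - int d)\<^sup>2 \<ge> k\<^sup>2" "k \<ge> 0"
  shows "dist (rp (a, b)) (rp (c, d)) \<ge> real_of_int k"
proof -
  have "real_of_int (k\<^sup>2) \<le> real_of_int ((int a - int c)\<^sup>2 + (int b - int d)\<^sup>2)" using assms by (simp only: of_int_le_iff)
  then have "(real_of_int k)\<^sup>2 \<le> (real a - real c)\<^sup>2 + (real b - real d)\<^sup>2" by simp
  then show ?thesis unfolding dist_rp using assms(2) by (intro real_le_rsqrt) auto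
qed

lemma sq_sum_ge:
  fixes x y :: int
  shows "\<bar>x\<bar> \<ge> k \<or> \<bar>y\<bar> \<ge> k \<Longrightarrow> 0 \<le> k \<Longrightarrow> x\<^sup>2 + y\<^sup>2 \<ge> k\<^sup>2"
proof -
  assume a: "\<bar>x\<bar> \<ge> k \<or> \<bar>y\<bar> \<ge> k" and k: "0 \<le> k"
  then have "x\<^sup>2 \<ge> k\<^sup>2 \<or> y\<^sup>2 \<ge> k\<^sup>2" by (metis abs_le_square_iff abs_of_nonneg)
  then show ?thesis using zero_le_power2[of x] zero_le_power2[of y] by linarith
qed

lemma dist_far: "\<bar>int a - int c\<bar> \<ge> k \<or> \<bar>int b - int d\<bar> \<ge> k \<Longrightarrow> 0 \<le> k \<Longrightarrow>
    dist (rp (a, b)) (rp (c, d)) \<ge> real_of_int k"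
  by (rule dist_rp_ge) (auto intro: sq_sum_ge)

lemma dist_diagonal: "\<bar>int a - int c\<bar> \<ge> 8 \<Longrightarrow> \<bar>int b - int d\<bar> \<ge> 8 \<Longrightarrow> dist (rp (a, b)) (rp (c, d)) \<ge> 10"
proof -
  assume "\<bar>int a - int c\<bar> \<ge> 8" "\<bar>int b - int d\<bar> \<ge> 8"
  then have "(int a - int c)\<^sup>2 \<ge> 8\<^sup>2" "(int b - int d)\<^sup>2 \<ge> 8\<^sup>2"
    by (metis abs_le_square_iff abs_numeral)+
  then show ?thesis using dist_rp_ge[of 10 a c b d] by simp
qed

definition nearby :: "nat \<Rightarrow> nat \<Rightarrow> nat \<Rightarrow> nat \<Rightarrow> bool" where
  "nearby a b c d \<longleftrightarrow> (a = c \<and> (b = d + 8 \<or> d = b + 8)) \<or> (b = d \<and> (a = c + 8 \<or> c = a + 8))"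

lemma dist_nearby: "nearby a b c d \<Longrightarrow> dist (rp (a, b)) (rp (c, d)) = 8"
  by (auto simp: nearby_def dist_rp)

text \<open>Distinct points of the lattice that are not neighbours differ by at least 16 in one
  coordinate or by at least 8 in both, and 8 times the square root of 2 exceeds 10.\<close>

lemma dist_lattice:
  assumes "8 dvd int a - int c" "8 dvd int b - int d" "(a, b) \<noteq> (c, d)"
  shows "dist (rp (a, b)) (rp (c, d)) \<ge> 8"
    and "\<not> nearby a b c d \<Longrightarrow> dist (rp (a, b)) (rp (c, d)) \<ge> 10"
proof -
  obtain x y where xy: "int a - int c = 8 * x" "int b - int d = 8 * y" using assms by (auto elim!: dvdE)
  have nz: "x \<noteq> 0 \<or> y \<noteq> 0" using assms(3) xy by auto
  then have "\<bar>int a - int c\<bar> \<ge> 8 \<or> \<bar>int b - int d\<bar> \<ge> 8" unfolding xy by arith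
  then show "dist (rp (a, b)) (rp (c, d)) \<ge> 8" using dist_far[of 8 a c b d] by simp
  assume nn: "\<not> nearby a b c d"
  have "\<not> ((x = 0 \<and> (y = 1 \<or> y = -1)) \<or> (y = 0 \<and> (x = 1 \<or> x = -1)))"
    using nn xy unfolding nearby_def by auto
  then have "\<bar>x\<bar> \<ge> 2 \<or> \<bar>y\<bar> \<ge> 2 \<or> (\<bar>x\<bar> \<ge> 1 \<and> \<bar>y\<bar> \<ge> 1)" using nz by arith
  then have "\<bar>int a - int c\<bar> \<ge> 10 \<or> \<bar>int b - int d\<bar> \<ge> 10 \<or> (\<bar>int a - int c\<bar> \<ge> 8 \<and> \<bar>int b - int d\<bar> \<ge> 8)"
    unfolding xy by auto
  then show "dist (rp (a, b)) (rp (c, d)) \<ge> 10"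
    using dist_far[of 10 a c b d] dist_diagonal[of a c b d] by auto
qed

lemma dist_vertical: "dist (rp (a, b)) (rp (a, d)) = \<bar>real b - real d\<bar>"
  by (simp add: dist_rp)

lemma ipos_lattice: "it \<noteq> Zi \<Longrightarrow> it \<noteq> Fi \<Longrightarrow> 8 dvd fst (ipos m it) \<and> 8 dvd snd (ipos m it)"
  by (cases it; simp; presburger)

lemma spos_lattice: "t \<noteq> Es \<Longrightarrow> 8 dvd fst (spos t) \<and> 8 dvd snd (spos t)"
  by (cases t; simp; presburger)

lemma dvd_int_diff: "8 dvd a \<Longrightarrow> 8 dvd c \<Longrightarrow> (8 :: int) dvd int a - int c"
  by (intro dvd_diff) presburger+

lemma nearby_adj:
  assumes "it \<noteq> Zi" "it \<noteq> Fi" "t \<noteq> Es"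
  shows "nearby (fst (ipos m it)) (snd (ipos m it)) (fst (spos t)) (snd (spos t)) \<longleftrightarrow> adj m it t"
    and "ipos m it \<noteq> spos t"
  using assms unfolding nearby_def
  by (cases it; cases t; simp; (auto; presburger)?)+

lemma ipos_inj:
  assumes "1 \<le> m" "x \<noteq> Zi" "x \<noteq> Fi" "y \<noteq> Zi" "y \<noteq> Fi" "ipos m x = ipos m y"
  shows "x = y"
  using assms by (cases x; cases y; simp; (auto; presburger)?)

lemma item_sink_dist:
  assumes "it \<noteq> Zi"
  shows "adj m it t \<Longrightarrow> dist (rp (ipos m it)) (rp (spos t)) = 8"
    and "\<not> adj m it t \<Longrightarrow> dist (rp (ipos m it)) (rp (spos t)) \<ge> 10"
proof -
  obtain a b where i: "ipos m it = (a, b)" by fastforce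
  obtain c d where t: "spos t = (c, d)" by fastforce
  have "(adj m it t \<longrightarrow> dist (rp (a, b)) (rp (c, d)) = 8) \<and> (\<not> adj m it t \<longrightarrow> dist (rp (a, b)) (rp (c, d)) \<ge> 10)"
  proof (cases "it = Fi \<or> t = Es")
    case True
    then show ?thesis
    proof
      assume "it = Fi"
      then show ?thesis using i t dist_far[of 10 a c b d] by (cases t) (auto simp: dist_vertical)
    next
      assume "t = Es"
      then show ?thesis using assms i t dist_far[of 10 a c b d] by (cases it) (auto simp: dist_vertical)
    qed
  next
    case False
    have "8 dvd int a - int c" "8 dvd int b - int d"
      using False assms i t ipos_lattice[of it m] spos_lattice[of t] by (auto intro!: dvd_int_diff)
    moreover have "(a, b) \<noteq> (c, d)"
      using False assms i t nearby_adj(2)[of it t m] by simp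
    moreover have "nearby a b c d \<longleftrightarrow> adj m it t"
      using False assms i t nearby_adj(1)[of it t m] by simp
    ultimately show ?thesis using dist_lattice[of a c b d] dist_nearby by auto
  qed
  then show "adj m it t \<Longrightarrow> dist (rp (ipos m it)) (rp (spos t)) = 8"
    "\<not> adj m it t \<Longrightarrow> dist (rp (ipos m it)) (rp (spos t)) \<ge> 10"
    by (simp_all add: i t)
qed

lemma special_sink_dist:
  "adj m Zi t \<Longrightarrow> dist (rp (ipos m Zi)) (rp (spos t)) = 1"
  "\<not> adj m Zi t \<Longrightarrow> dist (rp (ipos m Zi)) (rp (spos t)) \<ge> 5"
proof -
  obtain c d where t: "spos t = (c, d)" by fastforce
  show "adj m Zi t \<Longrightarrow> dist (rp (ipos m Zi)) (rp (spos t)) = 1"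
    by (auto simp: dist_vertical)
  show "\<not> adj m Zi t \<Longrightarrow> dist (rp (ipos m Zi)) (rp (spos t)) \<ge> 5"
    using t dist_far[of 5 16 c 15 d] by (cases t) auto
qed

lemma items_separated:
  assumes "1 \<le> m" "x \<noteq> y"
  shows "dist (rp (ipos m x)) (rp (ipos m y)) \<ge> 8"
proof -
  obtain a b where x: "ipos m x = (a, b)" by fastforce
  obtain c d where y: "ipos m y = (c, d)" by fastforce
  have "dist (rp (a, b)) (rp (c, d)) \<ge> 8"
  proof (cases "x = Zi \<or> x = Fi \<or> y = Zi \<or> y = Fi")
    case True
    then have "\<bar>int b - int d\<bar> \<ge> 8"
      using assms x y by (cases x; cases y) auto
    then show ?thesis using dist_far[of 8 a c b d] by simp
  next
    case False
    have "8 dvd int a - int c" "8 dvd int b - int d"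
      using False x y ipos_lattice[of x m] ipos_lattice[of y m] by (auto intro!: dvd_int_diff)
    moreover have "(a, b) \<noteq> (c, d)"
      using False assms x y ipos_inj[of m x y] by auto
    ultimately show ?thesis using dist_lattice(1) by blast
  qed
  then show ?thesis by (simp add: x y)
qed

subsection \<open>Weights and satisfiability\<close>

text \<open>With capacity \<open>4 * g\<close>, consecutive groups of a column never fit into one
  sink; a column group of weight \<open>3 * g\<close> leaves room for one row group and one of
  weight \<open>2 * g\<close> for two; a group of weight \<open>4 * g - 1\<close> leaves room for
  one member of the pair but not for both.\<close>

primrec wgt :: "nat \<Rightarrow> (nat \<Rightarrow> nat \<Rightarrow> bool) \<Rightarrow> item \<Rightarrow> nat" where
  "wgt g inc Zi = 2"
| "wgt g inc Fi = 4 * g - 1"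
| "wgt g inc Ui = 4 * g - 1"
| "wgt g inc (Ti i j) = 3 * g"
| "wgt g inc (Bi i j) = (if inc i j then 2 * g else 3 * g)"
| "wgt g inc (Hi i h) = g"
| "wgt g inc (Ct q) = 3 * g"
| "wgt g inc (Cb q) = 3 * g"

text \<open>The order is the one in which the program prints the points. \<open>Zi\<close> is first,
  so the pair consists of the sources 0 and 1.\<close>

definition item_list :: "nat \<Rightarrow> nat \<Rightarrow> item list" where
  "item_list m v = [Zi, Fi, Ui] @ map Ct [0..<v] @
     concat (map (\<lambda>i. concat (map (\<lambda>j. [Hi i j, Ti i j, Bi i j]) [0..<2 * v + 1]) @ [Hi i (2 * v + 1)]) [0..<m]) @
     map Cb [0..<v]"

definition sink_list :: "nat \<Rightarrow> nat \<Rightarrow> sink list" where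
  "sink_list m v = [Es, Ss] @
     concat (map (\<lambda>i. concat (map (\<lambda>j. [Bo i j, Hu i j]) [0..<2 * v + 1])) [0..<m]) @
     map (Bo m) [0..<2 * v + 1]"

definition formula_sat :: "nat \<Rightarrow> nat \<Rightarrow> (nat \<Rightarrow> nat \<Rightarrow> bool) \<Rightarrow> bool" where
  "formula_sat m v inc \<longleftrightarrow> (\<exists>val. \<forall>i<m. \<exists>q<v. (inc i (2 * q + 1) \<and> val q) \<or> (inc i (2 * q + 2) \<and> \<not> val q))"

lemma set_item_list:
  "it \<in> set (item_list m v) \<longleftrightarrow> (case it of Zi \<Rightarrow> True | Fi \<Rightarrow> True | Ui \<Rightarrow> True
     | Ti i j \<Rightarrow> i < m \<and> j < 2 * v + 1 | Bi i j \<Rightarrow> i < m \<and> j < 2 * v + 1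
     | Hi i h \<Rightarrow> i < m \<and> h \<le> 2 * v + 1 | Ct q \<Rightarrow> q < v | Cb q \<Rightarrow> q < v)"
  by (cases it) (auto simp: item_list_def)

lemma set_sink_list:
  "t \<in> set (sink_list m v) \<longleftrightarrow> (case t of Es \<Rightarrow> True | Ss \<Rightarrow> True
     | Bo i j \<Rightarrow> i \<le> m \<and> j < 2 * v + 1 | Hu i j \<Rightarrow> i < m \<and> j < 2 * v + 1)"
  by (cases t) (auto simp: sink_list_def)

lemma distinct_concat_map:
  assumes "distinct xs" "\<And>x. x \<in> set xs \<Longrightarrow> distinct (f x)"
    "\<And>x y. x \<in> set xs \<Longrightarrow> y \<in> set xs \<Longrightarrow> x \<noteq> y \<Longrightarrow> set (f x) \<inter> set (f y) = {}"
  shows "distinct (concat (map f xs))"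
  using assms
proof (induction xs)
  case (Cons a xs)
  have "set (f a) \<inter> set (f x) = {}" if "x \<in> set xs" for x using Cons.prems that by auto
  then show ?case using Cons by auto
qed simp

lemma distinct_item_list: "distinct (item_list m v)"
proof -
  have "distinct (concat (map (\<lambda>i. concat (map (\<lambda>j. [Hi i j, Ti i j, Bi i j]) [0..<2 * v + 1]) @ [Hi i (2 * v + 1)]) [0..<m]))"
    by (intro distinct_concat_map)
       (auto intro!: distinct_concat_map simp del: upt_Suc)
  then show ?thesis unfolding item_list_def by (auto simp: distinct_map inj_on_def simp del: upt_Suc)
qed

text \<open>Call a column down in row \<open>i\<close> if \<open>Ti i j\<close> uses the hub. Down
  is inherited by the rows below, since consecutive groups of a column do not fit into one sink.
  \<open>Ct q\<close> forces one of the two columns of \<open>q\<close> down at the top and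
  \<open>Cb q\<close> prevents both from being down at the bottom, so exactly one of them is down,
  and it is so in all rows. As row \<open>i\<close> has more row groups than hubs, some hub takes
  two of them; its column is not down and its group \<open>Bi\<close> has weight
  \<open>2 * g\<close>. This is a true literal of the clause.\<close>

lemma assignment_sat:
  fixes sg :: "item \<Rightarrow> sink"
  assumes g: "1 \<le> g" and m: "1 \<le> m"
    and adj: "\<And>it. it \<in> set (item_list m v) \<Longrightarrow> sg it \<in> set (sink_list m v) \<and> adj m it (sg it)"
    and cap: "\<And>A t. A \<subseteq> set (item_list m v) \<Longrightarrow> (\<And>it. it \<in> A \<Longrightarrow> sg it = t) \<Longrightarrow> sum (wgt g inc) A \<le> 4 * g"
  shows "formula_sat m v inc"
proof -
  define n where "n = 2 * v + 1"
  have cap2: "sg x \<noteq> sg y"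
    if "x \<in> set (item_list m v)" "y \<in> set (item_list m v)" "x \<noteq> y" "wgt g inc x + wgt g inc y > 4 * g" for x y
    using cap[of "{x, y}" "sg x"] that by fastforce
  have cap3: "\<not> (sg x = t \<and> sg y = t \<and> sg w = t)"
    if "x \<in> set (item_list m v)" "y \<in> set (item_list m v)" "w \<in> set (item_list m v)"
      "x \<noteq> y" "x \<noteq> w" "y \<noteq> w" "wgt g inc x + wgt g inc y + wgt g inc w > 4 * g" for x y w t
    using cap[of "{x, y, w}" t] that by fastforce
  have T_adj: "sg (Ti i j) = Bo i j \<or> sg (Ti i j) = Hu i j"
    and B_adj: "sg (Bi i j) = Hu i j \<or> sg (Bi i j) = Bo (Suc i) j" if "i < m" "j < n" for i j
    using adj[of "Ti i j"] adj[of "Bi i j"] that by (auto simp: set_item_list n_def)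
  have down1: "sg (Bi i j) = Bo (Suc i) j" if "sg (Ti i j) = Hu i j" "i < m" "j < n" for i j
    using cap2[of "Ti i j" "Bi i j"] B_adj[of i j] that g by (cases "inc i j") (auto simp: set_item_list n_def)
  have down2: "sg (Ti (Suc i) j) = Hu (Suc i) j" if "sg (Bi i j) = Bo (Suc i) j" "Suc i < m" "j < n" for i j
    using cap2[of "Bi i j" "Ti (Suc i) j"] T_adj[of "Suc i" j] that g by (cases "inc i j") (auto simp: set_item_list n_def)
  have down: "sg (Ti i j) = Hu i j \<and> sg (Bi i j) = Bo (Suc i) j"
    if "sg (Ti i0 j) = Hu i0 j" "i0 \<le> i" "i < m" "j < n" for i0 i j
    using that(2,3)
  proof (induction i rule: dec_induct)
    case base
    then show ?case using that down1 by auto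
  next
    case (step i)
    then show ?case using that down1 down2 by auto
  qed
  have below: "sg (Bi (m - 1) j) = Bo m j" if "sg (Bi i j) = Bo (Suc i) j" "i < m" "j < n" for i j
  proof (cases "Suc i < m")
    case True
    then show ?thesis using down[of "Suc i" j "m - 1"] down2[of i j] that m by auto
  next
    case False
    then show ?thesis using that by (metis Suc_lessI diff_Suc_1)
  qed
  \<comment> \<open>Here the pair counts as one item of weight 2. It does not fit beside
    \<open>Fi\<close>, so it occupies \<open>Ss\<close> and drives \<open>Ui\<close> to
    \<open>Bo 0 0\<close>, which in turn pushes column 0 down: the extra literal is false.\<close>
  have zdown: "sg (Ti i 0) = Hu i 0" if "i < m" for i
  proof -
    have "sg Zi = Ss \<or> sg Zi = Es" using adj[of Zi] by (simp add: set_item_list)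
    moreover have "sg Zi \<noteq> Es" using cap2[of Zi Fi] adj[of Fi] g by (auto simp: set_item_list)
    ultimately have "sg Ui \<noteq> Ss" using cap2[of Zi Ui] g by (auto simp: set_item_list)
    then have "sg Ui = Bo 0 0" using adj[of Ui] by (auto simp: set_item_list)
    moreover have "wgt g inc Ui + wgt g inc (Ti 0 0) > 4 * g" using g by simp
    then have "sg Ui \<noteq> sg (Ti 0 0)" using m by (intro cap2) (auto simp: set_item_list)
    ultimately have "sg (Ti 0 0) \<noteq> Bo 0 0" by simp
    then have "sg (Ti 0 0) = Hu 0 0" using T_adj[of 0 0] m by (auto simp: n_def)
    then show ?thesis using down[of 0 0 i] that by (auto simp: n_def)
  qed
  have pair: "(sg (Ti 0 (2 * q + 1)) = Hu 0 (2 * q + 1) \<or> sg (Ti 0 (2 * q + 2)) = Hu 0 (2 * q + 2)) \<and>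
     \<not> (sg (Bi (m - 1) (2 * q + 1)) = Bo m (2 * q + 1) \<and> sg (Bi (m - 1) (2 * q + 2)) = Bo m (2 * q + 2))"
    if q: "q < v" for q
  proof -
    have "sg (Ct q) = Bo 0 (2 * q + 1) \<or> sg (Ct q) = Bo 0 (2 * q + 2)"
      using adj[of "Ct q"] q by (auto simp: set_item_list)
    moreover have "sg (Cb q) = Bo m (2 * q + 1) \<or> sg (Cb q) = Bo m (2 * q + 2)"
      using adj[of "Cb q"] q by (auto simp: set_item_list)
    moreover have ne: "sg (Ct q) \<noteq> sg (Ti 0 j)" "sg (Cb q) \<noteq> sg (Bi (m - 1) j)" if "j < n" for j
      using cap2[of "Ct q" "Ti 0 j"] cap2[of "Cb q" "Bi (m - 1) j"] that q m g by (auto simp: set_item_list n_def)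
    have j: "2 * q + 1 < n" "2 * q + 2 < n" using q by (auto simp: n_def)
    ultimately show ?thesis
      using T_adj[of 0, OF _ j(1)] T_adj[of 0, OF _ j(2)] ne[OF j(1)] ne[OF j(2)] m by force
  qed
  define val where "val q \<longleftrightarrow> sg (Ti 0 (2 * q + 1)) \<noteq> Hu 0 (2 * q + 1)" for q
  have up_pos: "val q" if "q < v" "i < m" "sg (Bi i (2 * q + 1)) = Hu i (2 * q + 1)" for q i
    using down[of 0 "2 * q + 1" i] that by (auto simp: val_def n_def)
  have up_neg: "\<not> val q" if "q < v" "i < m" "sg (Bi i (2 * q + 2)) = Hu i (2 * q + 2)" for q i
    using down[of 0 "2 * q + 2" i] pair[of q] that by (auto simp: val_def n_def)
  have "\<exists>q<v. (inc i (2 * q + 1) \<and> val q) \<or> (inc i (2 * q + 2) \<and> \<not> val q)" if i: "i < m" for i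
  proof (rule ccontr)
    assume no: "\<not> ?thesis"
    \<comment> \<open>Without a true literal no hub accepts two row groups, so every
      \<open>Hi i h\<close> is driven to the hub on its right. For the last one,
      \<open>h = n\<close>, there is no such hub.\<close>
    have push: "sg (Hi i h) = Hu i h" if "h \<le> n" for h
      using that
    proof (induction h)
      case 0
      show ?case using adj[of "Hi i 0"] i by (auto simp: set_item_list)
    next
      case (Suc h)
      then have IH: "sg (Hi i h) = Hu i h" and h: "h < n" by auto
      have mem: "Hi i h \<in> set (item_list m v)" "Hi i (Suc h) \<in> set (item_list m v)"
        "Ti i h \<in> set (item_list m v)" "Bi i h \<in> set (item_list m v)"
        using h i by (auto simp: set_item_list n_def)
      have "sg (Hi i (Suc h)) \<noteq> Hu i h"
      proof (cases "sg (Ti i h) = Hu i h")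
        case True
        then show ?thesis using cap3[of "Ti i h" "Hi i h" "Hi i (Suc h)" "Hu i h"] mem IH g by auto
      next
        case False
        have hpos: "h \<noteq> 0" using zdown[OF i] False by (metis)
        \<comment> \<open>Otherwise both columns of the variable are down at the bottom: this one by
          \<open>below\<close>, and its partner because one of the two is down at the top and this
          one is not.\<close>
        have B: "sg (Bi i h) = Hu i h"
        proof (rule ccontr)
          assume "sg (Bi i h) \<noteq> Hu i h"
          then have lo: "sg (Bi (m - 1) h) = Bo m h" using B_adj[of i h] below[of i h] i h by auto
          obtain q where q: "q < v" "h = 2 * q + 1 \<or> h = 2 * q + 2"
          proof
            show "(h - 1) div 2 < v" "h = 2 * ((h - 1) div 2) + 1 \<or> h = 2 * ((h - 1) div 2) + 2"
              using h hpos by (auto simp: n_def)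
          qed
          have other: "sg (Bi (m - 1) j) = Bo m j" if "sg (Ti 0 j) = Hu 0 j" "j < n" for j
            using down[of 0 j "m - 1"] that m by auto
          have "sg (Ti 0 h) \<noteq> Hu 0 h" using down[of 0 h i] False i h by auto
          then show False
            using pair[OF q(1)] q lo other[of "2 * q + 1"] other[of "2 * q + 2"] by (auto simp: n_def)
        qed
        obtain q where q: "q < v" "h = 2 * q + 1 \<or> h = 2 * q + 2"
        proof
          show "(h - 1) div 2 < v" "h = 2 * ((h - 1) div 2) + 1 \<or> h = 2 * ((h - 1) div 2) + 2"
            using h hpos by (auto simp: n_def)
        qed
        then have "\<not> inc i h" using no B up_pos[of q i] up_neg[of q i] i by blast
        then show ?thesis using cap3[of "Bi i h" "Hi i h" "Hi i (Suc h)" "Hu i h"] mem IH B g by auto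
      qed
      then show ?case using adj[OF mem(2)] by auto
    qed
    have "sg (Hi i n) \<in> set (sink_list m v)" using adj[of "Hi i n"] i by (auto simp: set_item_list n_def)
    then show False using push[of n] by (simp add: set_sink_list n_def)
  qed
  then show ?thesis unfolding formula_sat_def by blast
qed

subsection \<open>Assignments from truth values\<close>

text \<open>\<open>None\<close> stands for source 1 and \<open>Some Zi\<close> for source 0, which are separated if the literal of
  column 0 is true.\<close>

primrec asg :: "nat \<Rightarrow> (nat \<Rightarrow> bool) \<Rightarrow> (nat \<Rightarrow> nat) \<Rightarrow> item \<Rightarrow> sink" where
  "asg m up ja Zi = Ss"
| "asg m up ja Fi = Es"
| "asg m up ja Ui = (if up 0 then Ss else Bo 0 0)"
| "asg m up ja (Ti i j) = (if up j then Bo i j else Hu i j)"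
| "asg m up ja (Bi i j) = (if up j then Hu i j else Bo (Suc i) j)"
| "asg m up ja (Hi i h) = (if h \<le> ja i then Hu i h else Hu i (h - 1))"
| "asg m up ja (Ct q) = (if up (2 * q + 1) then Bo 0 (2 * q + 2) else Bo 0 (2 * q + 1))"
| "asg m up ja (Cb q) = (if up (2 * q + 1) then Bo m (2 * q + 1) else Bo m (2 * q + 2))"

definition asg' :: "nat \<Rightarrow> (nat \<Rightarrow> bool) \<Rightarrow> (nat \<Rightarrow> nat) \<Rightarrow> item option \<Rightarrow> sink" where
  "asg' m up ja x = (case x of None \<Rightarrow> if up 0 then Es else Ss | Some it \<Rightarrow> asg m up ja it)"

definition wgt' :: "nat \<Rightarrow> (nat \<Rightarrow> nat \<Rightarrow> bool) \<Rightarrow> item option \<Rightarrow> nat" where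
  "wgt' g inc x = (case x of None \<Rightarrow> 1 | Some it \<Rightarrow> if it = Zi then 1 else wgt g inc it)"

lemma sum_le_unique:
  fixes f :: "'a \<Rightarrow> nat"
  assumes "\<And>x y. x \<in> A \<Longrightarrow> y \<in> A \<Longrightarrow> x = y" "\<And>x. x \<in> A \<Longrightarrow> f x \<le> c"
  shows "sum f A \<le> c"
proof (cases "A = {}")
  case False
  then obtain x where "x \<in> A" by auto
  then have "A = {x}" using assms(1) by auto
  then show ?thesis using assms(2)[of x] by simp
qed simp

text \<open>\<open>up j\<close> says that the literal of column \<open>j\<close> is true, and
  \<open>ja i\<close> is the column of a true literal of clause \<open>i\<close>, where the hub
  takes two row groups. Column 0 is free to be true or false, so that the layouts for satisfiable
  and for unsatisfiable formulas are instances of one construction.\<close>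

locale truth_choice =
  fixes g m v :: nat and inc up ja
  assumes g: "1 \<le> g" and m: "1 \<le> m"
    and pair: "\<And>q. q < v \<Longrightarrow> up (2 * q + 1) \<longleftrightarrow> \<not> up (2 * q + 2)"
    and ja: "\<And>i. i < m \<Longrightarrow> ja i < 2 * v + 1 \<and> inc i (ja i) \<and> up (ja i)"
begin

lemma asg_adj:
  assumes "it \<in> set (item_list m v)"
  shows "adj m it (asg m up ja it)" "asg m up ja it \<in> set (sink_list m v)"
proof -
  show "adj m it (asg m up ja it)" by (cases it) auto
  show "asg m up ja it \<in> set (sink_list m v)"
  proof (cases it)
    case (Hi i h)
    then show ?thesis using assms ja[of i] by (auto simp: set_item_list set_sink_list)
  qed (use assms m in \<open>auto simp: set_item_list set_sink_list\<close>)
qed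

definition X :: "item option set" where
  "X = insert None (Some ` set (item_list m v))"

lemma asg_load: "sum (wgt' g inc) {x \<in> X. asg' m up ja x = t} \<le> 4 * g"
proof -
  let ?A = "{x \<in> X. asg' m up ja x = t}"
  have finX: "finite X" by (simp add: X_def)
  have sub: "sum (wgt' g inc) ?A \<le> sum (wgt' g inc) B" if "?A \<subseteq> B" "finite B" for B
    using that by (intro sum_mono2) auto
  show ?thesis
  proof (cases t)
    case Es
    have "?A \<subseteq> {None, Some Fi}"
    proof
      fix x assume "x \<in> ?A"
      then show "x \<in> {None, Some Fi}" using Es
        by (cases x; cases "the x") (auto simp: asg'_def split: if_splits)
    qed
    from sub[OF this] show ?thesis using g by (simp add: wgt'_def)
  next
    case Ss
    have "?A \<subseteq> (if up 0 then {Some Zi, Some Ui} else {None, Some Zi})"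
    proof
      fix x assume "x \<in> ?A"
      then show "x \<in> (if up 0 then {Some Zi, Some Ui} else {None, Some Zi})" using Ss
        by (cases x; cases "the x") (auto simp: asg'_def split: if_splits)
    qed
    from sub[OF this] show ?thesis using g by (cases "up 0") (simp_all add: wgt'_def)
  next
    case (Bo i j)
    show ?thesis
    proof (rule sum_le_unique)
      fix x y assume xy: "x \<in> ?A" "y \<in> ?A"
      \<comment> \<open>The two columns of a variable carry opposite values, so a boundary sink is
        used by at most one item and no sum has to be estimated.\<close>
      have form: "w \<in> (if up j then (if i < m then {Some (Ti i j)} else {Some (Cb ((j - 1) div 2))})
          else if 0 < i then {Some (Bi (i - 1) j)} else if j = 0 then {Some Ui} else {Some (Ct ((j - 1) div 2))})"
        if w: "w \<in> ?A" for w
      proof (cases w)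
        case None
        then show ?thesis using w Bo by (auto simp: asg'_def split: if_splits)
      next
        case (Some it)
        then have "it \<in> set (item_list m v)" "asg m up ja it = Bo i j" using w Bo by (auto simp: X_def asg'_def)
        then show ?thesis unfolding Some using pair m
          by (cases it rule: item.exhaust) (auto simp: set_item_list split: if_splits)
      qed
      show "x = y" using form[OF xy(1)] form[OF xy(2)] by (auto split: if_splits)
    next
      fix x assume "x \<in> ?A"
      then show "wgt' g inc x \<le> 4 * g" using g Bo
        by (cases x; cases "the x") (auto simp: wgt'_def asg'_def)
    qed
  next
    case (Hu i j)
    define B where "B = (if up j then {Some (Bi i j)} else {Some (Ti i j)}) \<union>
       (if j \<le> ja i then {Some (Hi i j)} else {}) \<union> (if ja i \<le> j then {Some (Hi i (Suc j))} else {})"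
    have sB: "?A \<subseteq> B"
    proof
      fix x assume x: "x \<in> ?A"
      show "x \<in> B"
      proof (cases x)
        case None
        then show ?thesis using x Hu by (auto simp: asg'_def split: if_splits)
      next
        case (Some it)
        then have "asg m up ja it = Hu i j" using x Hu by (auto simp: X_def asg'_def)
        then show ?thesis unfolding Some B_def by (cases it) (auto split: if_splits)
      qed
    qed
    show ?thesis
    proof (cases "i < m")
      case True
      \<comment> \<open>Both row groups are present only for \<open>j = ja i\<close>, and there the
        column group weighs \<open>2 * g\<close>.\<close>
      have "sum (wgt' g inc) B \<le> 4 * g"
        using ja[OF True] by (cases "j = ja i") (auto simp: B_def wgt'_def)
      moreover have "finite B" by (simp add: B_def)
      ultimately show ?thesis using sub[OF sB] by linarith
    next
      case False
      have "?A = {}"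
      proof (rule ccontr)
        assume "?A \<noteq> {}"
        then obtain x where x: "x \<in> ?A" by blast
        then have "x \<in> B" using sB by blast
        then show False using x False by (auto simp: B_def X_def set_item_list split: if_splits)
      qed
      then show ?thesis by (metis le0 sum.empty)
    qed
  qed
qed

end

subsection \<open>Optimal layouts of the grid instance\<close>

definition rat_pt :: "nat \<times> nat \<Rightarrow> rat \<times> rat" where
  "rat_pt z = (of_nat (fst z), of_nat (snd z))"

definition src_items :: "nat \<Rightarrow> nat \<Rightarrow> nat \<Rightarrow> (nat \<Rightarrow> nat \<Rightarrow> bool) \<Rightarrow> item list" where
  "src_items g m v inc = concat (map (\<lambda>it. replicate (wgt g inc it) it) (item_list m v))"

definition grid_sources :: "nat \<Rightarrow> nat \<Rightarrow> nat \<Rightarrow> (nat \<Rightarrow> nat \<Rightarrow> bool) \<Rightarrow> (rat \<times> rat) list" where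
  "grid_sources g m v inc = map (\<lambda>it. rat_pt (ipos m it)) (src_items g m v inc)"

definition grid_sinks :: "nat \<Rightarrow> nat \<Rightarrow> (rat \<times> rat) list" where
  "grid_sinks m v = map (\<lambda>t. rat_pt (spos t)) (sink_list m v)"

lemma card_nth_replicates:
  assumes "distinct L" "x \<in> set L"
  shows "card {s. s < length (concat (map (\<lambda>y. replicate (w y) y) L)) \<and> concat (map (\<lambda>y. replicate (w y) y) L) ! s = x} = w x"
proof -
  have "filter (\<lambda>y. y = x) (concat (map (\<lambda>y. replicate (w y) y) L)) = (if x \<in> set L then replicate (w x) x else [])"
    using assms(1) by (induction L) (auto simp: filter_replicate)
  then show ?thesis using assms(2) length_filter_conv_card[of "\<lambda>y. y = x"] by (metis length_replicate)
qed

lemma distinct_sink_list: "distinct (sink_list m v)"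
proof -
  have "distinct (concat (map (\<lambda>i. concat (map (\<lambda>j. [Bo i j, Hu i j]) [0..<2 * v + 1])) [0..<m]))"
    by (intro distinct_concat_map) (auto intro!: distinct_concat_map simp del: upt_Suc)
  then show ?thesis unfolding sink_list_def by (auto simp: distinct_map inj_on_def simp del: upt_Suc)
qed

locale grid =
  fixes \<alpha> :: real and g m v :: nat and inc :: "nat \<Rightarrow> nat \<Rightarrow> bool"
  assumes \<alpha>: "0 \<le> \<alpha>" "\<alpha> < 1" and g: "1 \<le> g" and m: "1 \<le> m"
    and big: "\<And>w. g \<le> w \<Longrightarrow> 4 * real w powr \<alpha> \<le> real w"
    and inc0: "\<And>i. i < m \<Longrightarrow> inc i 0"
begin

definition I :: "nat flamecast" where
  "I = flamecast_of \<alpha> (grid_sources g m v inc) (grid_sinks m v) [4 * g, 4 * g, 4 * g]"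

definition ns :: nat where "ns = length (src_items g m v inc)"

definition nt :: nat where "nt = length (sink_list m v)"

definition lab :: "nat \<Rightarrow> item" where "lab s = src_items g m v inc ! s"

definition pt :: "item \<Rightarrow> real \<times> real" where "pt it = rp (ipos m it)"

definition items :: "item set" where "items = set (item_list m v)"

definition base :: real where
  "base = (\<Sum>it\<in>items - {Zi}. 8 * real (wgt g inc it) powr \<alpha>) + 2 powr \<alpha>"

definition excess :: real where "excess = 2 - 2 powr \<alpha>"

lemma I_simps:
  "sources I = {..<ns}" "sinks I = {ns..<ns + nt}" "capacities I = [4 * g, 4 * g, 4 * g]" "exponent I = \<alpha>"
  by (simp_all add: I_def flamecast_of_def ns_def nt_def grid_sources_def grid_sinks_def)

lemma position_source: "s < ns \<Longrightarrow> position I s = pt (lab s)"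
  by (simp add: I_def flamecast_of_def ns_def grid_sources_def nth_append lab_def pt_def rp_def rat_pt_def
      map_prod_def split_beta)

lemma position_sink: "k < nt \<Longrightarrow> position I (ns + k) = rp (spos (sink_list m v ! k))"
  by (simp add: I_def flamecast_of_def ns_def nt_def grid_sources_def grid_sinks_def nth_append rp_def rat_pt_def
      map_prod_def split_beta)

lemma wgt_pos: "wgt g inc it > 0"
  using g by (cases it) auto

lemma lab_items: "lab ` {..<ns} = items"
proof -
  have "lab ` {..<ns} = set (src_items g m v inc)"
    by (auto simp: lab_def ns_def in_set_conv_nth)
  also have "\<dots> = items"
    using wgt_pos by (auto simp: src_items_def items_def)
  finally show ?thesis .
qed

lemma card_lab: "it \<in> items \<Longrightarrow> card {s \<in> {..<ns}. lab s = it} = wgt g inc it"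
  using card_nth_replicates[OF distinct_item_list, of it m v "wgt g inc"]
  by (simp add: lab_def ns_def src_items_def items_def)

lemma Zi_items: "Zi \<in> items"
  by (simp add: items_def item_list_def)

lemma special_sources: "{s \<in> {..<ns}. lab s = Zi} = {0, 1}"
proof -
  have src: "src_items g m v inc = Zi # Zi # concat (map (\<lambda>it. replicate (wgt g inc it) it) (tl (item_list m v)))"
    by (simp add: src_items_def item_list_def numeral_2_eq_2)
  have "{0, 1} \<subseteq> {s \<in> {..<ns}. lab s = Zi}"
    by (auto simp: lab_def ns_def src)
  moreover have "card {s \<in> {..<ns}. lab s = Zi} = card {0, 1 :: nat}"
    using card_lab[OF Zi_items] by simp
  ultimately show ?thesis using card_subset_eq[of "{s \<in> {..<ns}. lab s = Zi}" "{0, 1}"] by simp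
qed

lemma special_iff: "s < ns \<Longrightarrow> lab s = Zi \<longleftrightarrow> s = 0 \<or> s = 1"
proof -
  have "s \<in> {s \<in> {..<ns}. lab s = Zi} \<longleftrightarrow> s \<in> {0, 1}" by (simp only: special_sources)
  then show "s < ns \<Longrightarrow> ?thesis" by simp
qed

lemma lab01: "lab 0 = Zi" "lab 1 = Zi" "0 < ns" "1 < ns"
proof -
  have "0 \<in> {s \<in> {..<ns}. lab s = Zi}" "1 \<in> {s \<in> {..<ns}. lab s = Zi}" unfolding special_sources by auto
  then show "lab 0 = Zi" "lab 1 = Zi" "0 < ns" "1 < ns" by auto
qed

lemma grouped:
  assumes "valid_layout I V E p"
  shows "grouped_layout I V E p lab pt Zi \<alpha>"
proof
  show "valid_layout I V E p" by fact
  show "length (capacities I) = 3" by (simp add: I_simps)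
  show "sources I \<inter> sinks I = {}" by (auto simp: I_simps)
  show "exponent I = \<alpha>" "0 \<le> \<alpha>" "\<alpha> < 1" using \<alpha> by (simp_all add: I_simps)
  show "position I s = pt (lab s)" if "s \<in> sources I" for s
    using that position_source by (simp add: I_simps)
  show "dist (pt x) (pt y) \<ge> 8" if "x \<noteq> y" for x y
    unfolding pt_def using items_separated[OF m that] .
  show "4 * real (card {s \<in> sources I. lab s = it}) powr \<alpha> \<le> real (card {s \<in> sources I. lab s = it})"
    if "it \<in> lab ` sources I" "it \<noteq> Zi" for it
  proof -
    have "it \<in> items" using that(1) lab_items by (simp add: I_simps)
    moreover have "g \<le> wgt g inc it" using that(2) g by (cases it) auto
    ultimately show ?thesis using card_lab big by (simp add: I_simps)
  qed
  show "{s \<in> sources I. lab s = Zi} = {0, 1}" using special_sources by (simp add: I_simps)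
  fix t assume "t \<in> sinks I"
  then obtain k where k: "k < nt" "t = ns + k" by (auto simp: I_simps) (metis le_Suc_ex nat_add_left_cancel_less)
  show "dist (pt Zi) (position I t) = 1 \<or> dist (pt Zi) (position I t) \<ge> 5"
    using special_sink_dist[of m "sink_list m v ! k"] k position_sink by (auto simp: pt_def)
  show "dist (pt it) (position I t) = 8 \<or> dist (pt it) (position I t) \<ge> 10" if "it \<noteq> Zi" for it
    using item_sink_dist[OF that, of m "sink_list m v ! k"] k position_sink by (auto simp: pt_def)
qed

lemma layout_bounds:
  assumes "valid_layout I V E p"
  shows "layout_cost I E p \<ge> base"
    and "par E 0 \<noteq> par E 1 \<Longrightarrow> layout_cost I E p \<ge> base + excess"
    and "layout_cost I E p \<le> base + excess \<Longrightarrow> par E 0 = par E 1 \<Longrightarrow> formula_sat m v inc"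
proof -
  interpret L: grouped_layout I V E p lab pt Zi \<alpha> using grouped[OF assms] .
  have gs: "L.group it = {s \<in> {..<ns}. lab s = it}" for it by (simp add: L.group_def I_simps)
  have "L.gsize it = real (wgt g inc it)" if "it \<in> items" for it
    using card_lab[OF that] by (simp add: L.gsize_def gs)
  then have bc: "L.base_cost = base"
    unfolding L.base_cost_def base_def I_simps lab_items by simp
  have ex: "L.excess = excess" by (simp add: L.excess_def excess_def)
  show "layout_cost I E p \<ge> base" using L.grouped_lower_bound(1) bc by simp
  show "par E 0 \<noteq> par E 1 \<Longrightarrow> layout_cost I E p \<ge> base + excess" using L.grouped_lower_bound(2) bc ex by simp
  assume le: "layout_cost I E p \<le> base + excess" and eq: "par E 0 = par E 1"
  \<comment> \<open>A group goes to one sink as a whole, so any of its sources represents it: for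
    the pair by \<open>eq\<close>, for the other groups because they are perfect.\<close>
  define rep where "rep it = (SOME s. s < ns \<and> lab s = it)" for it
  have rep: "rep it < ns" "lab (rep it) = it" if "it \<in> items" for it
  proof -
    have "\<exists>s. s < ns \<and> lab s = it" using that unfolding lab_items[symmetric] by auto
    then show "rep it < ns" "lab (rep it) = it" unfolding rep_def by (metis (mono_tags, lifting) someI_ex)+
  qed
  have root: "root_of E s = root_of E (rep it)" if "it \<in> items" "s < ns" "lab s = it" for s it
  proof (cases "it = Zi")
    case True
    have "s \<in> {0, 1}" "rep it \<in> {0, 1}" using special_iff rep[OF that(1)] that True by auto
    then show ?thesis using eq by (auto simp: root_of_def)
  next
    case False
    then have "L.perfect it"
      using L.grouped_lower_bound(3)[of it] le bc ex that(1) lab_items by (simp add: I_simps)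
    then show ?thesis using that rep[OF that(1)] by (auto simp: L.perfect_def gs)
  qed
  define sg where "sg it = sink_list m v ! (root_of E (rep it) - ns)" for it
  have sink: "ns \<le> root_of E (rep it)" "root_of E (rep it) - ns < nt" if "it \<in> items" for it
    using L.root_of_sink[of "rep it"] rep[OF that] by (auto simp: I_simps)
  have pos_root: "position I (root_of E (rep it)) = rp (spos (sg it))" if "it \<in> items" for it
    using position_sink[OF sink(2)[OF that]] sink(1)[OF that] by (simp add: sg_def)
  have adj: "adj m it (sg it)" if it: "it \<in> items" for it
  proof (cases "it = Zi")
    case True
    have "dist (pt Zi) (position I (root_of E 0)) = 1"
      using L.grouped_lower_bound(4) le eq bc ex by simp
    moreover have "root_of E 0 = root_of E (rep Zi)" using root[of Zi 0] Zi_items lab01 by simp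
    ultimately show ?thesis using pos_root[OF it] special_sink_dist(2)[of m "sg it"] True by (force simp: pt_def)
  next
    case False
    then have "L.perfect it"
      using L.grouped_lower_bound(3)[of it] le bc ex it lab_items by (simp add: I_simps)
    then have "dist (pt it) (position I (root_of E (rep it))) = 8"
      using rep[OF it] by (auto simp: L.perfect_def gs)
    then show ?thesis using pos_root[OF it] item_sink_dist(2)[OF False, of m "sg it"] by (force simp: pt_def)
  qed
  have cap: "sum (wgt g inc) A \<le> 4 * g" if A: "A \<subseteq> items" "\<And>it. it \<in> A \<Longrightarrow> sg it = t" for A t
  proof (cases "A = {}")
    case False
    then obtain it0 where it0: "it0 \<in> A" by auto
    have same: "root_of E (rep it) = root_of E (rep it0)" if "it \<in> A" for it
    proof -
      have "sink_list m v ! (root_of E (rep it) - ns) = sink_list m v ! (root_of E (rep it0) - ns)"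
        using A(2)[OF that] A(2)[OF it0] by (simp add: sg_def)
      then have "root_of E (rep it) - ns = root_of E (rep it0) - ns"
        using sink(2)[of it] sink(2)[of it0] A(1) that it0 distinct_sink_list
        by (subst (asm) nth_eq_iff_index_eq) (auto simp: nt_def)
      then show ?thesis using sink(1)[of it] sink(1)[of it0] A(1) that it0 by (metis eq_diff_iff subsetD)
    qed
    have finA: "finite A" using A(1) finite_subset items_def by auto
    have "sum (wgt g inc) A = (\<Sum>it\<in>A. card {s \<in> {..<ns}. lab s = it})"
      using card_lab A(1) by (intro sum.cong) auto
    also have "\<dots> = card (\<Union>it\<in>A. {s \<in> {..<ns}. lab s = it})"
      using finA by (intro card_UN_disjoint[symmetric]) auto
    also have "\<dots> \<le> card {s \<in> sources I. root_of E s = root_of E (rep it0)}"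
    proof (rule card_mono)
      show "(\<Union>it\<in>A. {s \<in> {..<ns}. lab s = it}) \<subseteq> {s \<in> sources I. root_of E s = root_of E (rep it0)}"
        using root same A(1) by (auto simp: I_simps)
    qed (simp add: I_simps)
    also have "\<dots> \<le> 4 * g" using L.sink_capacity by (simp add: I_simps)
    finally show ?thesis .
  qed simp
  show "formula_sat m v inc"
  proof (rule assignment_sat[OF g m])
    show "sg it \<in> set (sink_list m v) \<and> adj m it (sg it)" if "it \<in> set (item_list m v)" for it
      using adj[of it] sink(2)[of it] that by (auto simp: items_def sg_def nt_def)
    show "sum (wgt g inc) A \<le> 4 * g"
      if "A \<subseteq> set (item_list m v)" "\<And>it. it \<in> A \<Longrightarrow> sg it = t" for A t
      using cap[of A t] that by (simp add: items_def)
  qed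
qed

text \<open>If \<open>up 0\<close> holds, the sources of the pair receive Steiner vertices of their
  own and cost 2 instead of \<open>2 powr \<alpha>\<close>; everything else costs the same in all of
  these layouts.\<close>

lemma layout_of_choice:
  assumes tc: "truth_choice g m v inc up ja"
  shows "\<exists>E p. finite E \<and> valid_layout I (Field E) E p \<and>
     layout_cost I E p = base + (if up 0 then excess else 0)"
proof -
  interpret T: truth_choice g m v inc up ja by (rule tc)
  \<comment> \<open>From \<open>N\<close> on, numbers denote neither sources nor sinks.
    \<open>N\<close> itself is the Steiner vertex of source 1 when that source travels
    alone.\<close>
  define N where "N = ns + nt"
  define h where "h it = N + Suc (to_nat it)" for it :: item
  define st where "st s = (if up 0 \<and> s = 1 then N else h (lab s))" for s
  define sidx where "sidx t = ns + (SOME k. k < nt \<and> sink_list m v ! k = t)" for t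
  have sidx: "ns \<le> sidx t" "sidx t < ns + nt" "sink_list m v ! (sidx t - ns) = t" if t: "t \<in> set (sink_list m v)" for t
  proof -
    have "\<exists>k. k < nt \<and> sink_list m v ! k = t" using t by (auto simp: in_set_conv_nth nt_def)
    from someI_ex[OF this] show "ns \<le> sidx t" "sidx t < ns + nt" "sink_list m v ! (sidx t - ns) = t"
      by (auto simp: sidx_def)
  qed
  have pos_sidx: "position I (sidx t) = rp (spos t)" if t: "t \<in> set (sink_list m v)" for t
    using position_sink[of "sidx t - ns"] sidx[OF t] by auto
  define tau where "tau u = sidx (if u = N then asg' m up ja None else asg m up ja (from_nat (u - N - 1)))" for u
  define P where "P u = (if u = N then pt Zi else pt (from_nat (u - N - 1)))" for u
  define lab2 where "lab2 s = (if s = 1 then None else Some (lab s))" for s :: nat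
  have P_N: "P N = pt Zi" by (simp add: P_def)
  have tau_h: "tau (h it) = sidx (asg m up ja it)" and P_h: "P (h it) = pt it" for it
    by (simp_all add: tau_def P_def h_def)
  have tau_st: "tau (st s) = sidx (asg' m up ja (lab2 s))" for s
    using lab01 by (auto simp: st_def tau_h lab2_def asg'_def) (simp add: tau_def asg'_def)
  have labI: "lab s \<in> items" if "s < ns" for s using that lab_items by auto
  have asgI: "asg' m up ja (lab2 s) \<in> set (sink_list m v)" if "s < ns" for s
    using T.asg_adj(2)[of "lab s"] labI[OF that] by (auto simp: lab2_def asg'_def items_def set_sink_list)
  have cap: "card {s \<in> sources I. tau (st s) = t} \<le> 4 * g" for t
  proof (cases "\<exists>s<ns. tau (st s) = t")
    case True
    then obtain s0 where s0: "s0 < ns" "t = sidx (asg' m up ja (lab2 s0))" using tau_st by auto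
    have finX: "finite T.X" by (simp add: T.X_def)
    define tt where "tt = asg' m up ja (lab2 s0)"
    have inj: "asg' m up ja (lab2 s) = tt" if "s < ns" "sidx (asg' m up ja (lab2 s)) = sidx tt" for s
      using sidx(3)[OF asgI[OF that(1)]] sidx(3)[OF asgI[OF s0(1)]] that(2) unfolding tt_def by metis
    have cardX: "card {s \<in> {..<ns}. lab2 s = x} = wgt' g inc x" if "x \<in> T.X" for x
    proof (cases x)
      case None
      then have "{s \<in> {..<ns}. lab2 s = x} = {1}" using lab01 by (auto simp: lab2_def)
      then show ?thesis by (simp add: None wgt'_def)
    next
      case (Some it)
      then have it: "it \<in> items" using that by (auto simp: T.X_def items_def)
      show ?thesis
      proof (cases "it = Zi")
        case True
        then have "{s \<in> {..<ns}. lab2 s = x} = {s \<in> {..<ns}. lab s = Zi} - {1}" using Some by (auto simp: lab2_def)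
        also have "\<dots> = {0}" unfolding special_sources by auto
        finally show ?thesis using True Some by (simp add: wgt'_def)
      next
        case False
        then have "{s \<in> {..<ns}. lab2 s = x} = {s \<in> {..<ns}. lab s = it}" using Some lab01 by (auto simp: lab2_def)
        then show ?thesis using False Some card_lab[OF it] by (simp add: wgt'_def)
      qed
    qed
    define Y where "Y = {x \<in> T.X. asg' m up ja x = tt}"
    define F where "F x = {s \<in> {..<ns}. lab2 s = x}" for x
    have finY: "finite Y" by (simp add: Y_def T.X_def)
    have "{s \<in> sources I. tau (st s) = t} = (\<Union>x\<in>Y. F x)"
    proof (intro equalityI subsetI)
      fix s assume s: "s \<in> {s \<in> sources I. tau (st s) = t}"
      then have "asg' m up ja (lab2 s) = tt" using inj s0 by (simp add: I_simps tau_st tt_def)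
      moreover have "lab2 s \<in> T.X" using labI s by (auto simp: I_simps lab2_def T.X_def items_def)
      ultimately show "s \<in> (\<Union>x\<in>Y. F x)" using s by (auto simp: Y_def F_def I_simps)
    next
      fix s assume "s \<in> (\<Union>x\<in>Y. F x)"
      then show "s \<in> {s \<in> sources I. tau (st s) = t}"
        using s0 by (auto simp: Y_def F_def I_simps tau_st tt_def)
    qed
    moreover have "card (\<Union>x\<in>Y. F x) \<le> (\<Sum>x\<in>Y. card (F x))" using finY by (rule card_UN_le)
    moreover have "(\<Sum>x\<in>Y. card (F x)) = sum (wgt' g inc) Y"
      using cardX by (intro sum.cong) (auto simp: Y_def F_def)
    ultimately have "card {s \<in> sources I. tau (st s) = t} \<le> sum (wgt' g inc) {x \<in> T.X. asg' m up ja x = tt}"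
      by (simp only: Y_def)
    also have "\<dots> \<le> 4 * g" by (rule T.asg_load)
    finally show ?thesis .
  next
    case False
    then have "{s \<in> sources I. tau (st s) = t} = {}" by (auto simp: I_simps)
    then show ?thesis by (metis card.empty le0)
  qed
  have "\<exists>E p. finite E \<and> valid_layout I (Field E) E p \<and>
    layout_cost I E p = (\<Sum>u\<in>st ` sources I. dist (P u) (position I (tau u)) *
       real (card {s \<in> sources I. st s = u}) powr exponent I)"
  proof (rule assignment_layout)
    show "finite (sources I)" "sources I \<inter> sinks I = {}" by (auto simp: I_simps)
    show "st ` sources I \<inter> (sources I \<union> sinks I) = {}" by (auto simp: I_simps st_def h_def N_def)
    show "tau (st s) \<in> sinks I" if "s \<in> sources I" for s
      using sidx asgI that by (auto simp: tau_st I_simps)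
    show "position I s = P (st s)" if "s \<in> sources I" for s
      using that lab01 position_source P_N by (auto simp: I_simps st_def P_h)
    show "capacities I = [4 * g, 4 * g, 4 * g]" by (simp add: I_simps)
    show "1 \<le> 4 * g" using g by simp
  qed (rule cap)
  then obtain E p where Ep: "finite E" "valid_layout I (Field E) E p"
    "layout_cost I E p = (\<Sum>u\<in>st ` {..<ns}. dist (P u) (position I (tau u)) *
       real (card {s \<in> {..<ns}. st s = u}) powr \<alpha>)" by (auto simp: I_simps)
  define J where "J = items - {Zi}"
  define Q where "Q = (if up 0 then {h Zi, N} else {h Zi})"
  define f where "f u = dist (P u) (position I (tau u)) * real (card {s \<in> {..<ns}. st s = u}) powr \<alpha>" for u
  have injh: "inj h" by (auto simp: h_def inj_def)
  have hN: "h it \<noteq> N" for it by (simp add: h_def)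
  have img: "st ` {..<ns} = h ` J \<union> Q"
  proof (intro equalityI subsetI)
    fix u assume "u \<in> st ` {..<ns}"
    then show "u \<in> h ` J \<union> Q" using labI by (auto simp: st_def J_def Q_def split: if_splits)
  next
    fix u assume "u \<in> h ` J \<union> Q"
    then consider it where "it \<in> J" "u = h it" | "u = h Zi" | "up 0" "u = N" by (auto simp: Q_def split: if_splits)
    then show "u \<in> st ` {..<ns}"
    proof cases
      case 1
      then obtain s where s: "s < ns" "lab s = it" unfolding J_def lab_items[symmetric] by auto
      then have "s \<noteq> 1" using lab01 1 by (auto simp: J_def)
      then show ?thesis using s 1 by (auto simp: st_def)
    next
      case 2
      then have "u = st 0" using lab01 by (simp add: st_def)
      then show ?thesis using lab01 by auto
    next
      case 3
      then have "u = st 1" by (simp add: st_def)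
      then show ?thesis using lab01 by auto
    qed
  qed
  have "(\<Sum>u\<in>st ` {..<ns}. f u) = (\<Sum>u\<in>h ` J. f u) + (\<Sum>u\<in>Q. f u)"
    unfolding img by (rule sum.union_disjoint) (use injh hN in \<open>auto simp: J_def Q_def items_def inj_eq\<close>)
  also have "(\<Sum>u\<in>h ` J. f u) = (\<Sum>it\<in>J. f (h it))"
    by (rule sum.reindex_cong[of h]) (use injh in \<open>auto intro: inj_on_subset\<close>)
  also have "\<dots> = (\<Sum>it\<in>J. 8 * real (wgt g inc it) powr \<alpha>)"
  proof (rule sum.cong)
    fix it assume it: "it \<in> J"
    have "{s \<in> {..<ns}. st s = h it} = {s \<in> {..<ns}. lab s = it}"
      using it lab01 injh hN[of it] by (auto simp: st_def J_def inj_eq)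
    moreover have "asg m up ja it \<in> set (sink_list m v)" "adj m it (asg m up ja it)"
      using T.asg_adj it by (auto simp: J_def items_def)
    ultimately show "f (h it) = 8 * real (wgt g inc it) powr \<alpha>"
      using it card_lab item_sink_dist(1)[of it m] pos_sidx by (auto simp: f_def P_h tau_h J_def pt_def)
  qed simp
  also have "(\<Sum>u\<in>Q. f u) = 2 powr \<alpha> + (if up 0 then excess else 0)"
  proof -
    have sS: "Ss \<in> set (sink_list m v)" "Es \<in> set (sink_list m v)" by (auto simp: set_sink_list)
    have d: "dist (P (h Zi)) (position I (tau (h Zi))) = 1"
      using special_sink_dist(1)[of m Ss] pos_sidx[OF sS(1)] by (simp add: P_h tau_h pt_def)
    note lz = special_iff
    show ?thesis
    proof (cases "up 0")
      case True
      have "{s \<in> {..<ns}. st s = h Zi} = {0}" "{s \<in> {..<ns}. st s = N} = {1}"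
        using True lab01 lz injh hN by (auto simp: st_def inj_eq)
      moreover have "dist (P N) (position I (tau N)) = 1"
        using special_sink_dist(1)[of m Es] pos_sidx[OF sS(2)] True by (simp add: P_def tau_def asg'_def pt_def)
      ultimately show ?thesis using True d hN[of Zi] by (simp add: Q_def f_def excess_def)
    next
      case False
      have "{s \<in> {..<ns}. st s = h Zi} = {0, 1}"
        using False lab01 lz injh by (auto simp: st_def inj_eq)
      then show ?thesis using False d by (simp add: Q_def f_def)
    qed
  qed
  finally have "(\<Sum>u\<in>st ` {..<ns}. f u) = base + (if up 0 then excess else 0)"
    by (simp add: base_def J_def)
  then show ?thesis using Ep unfolding f_def by (intro exI[of _ E] exI[of _ p]) simp
qed

text \<open>The optimum is \<open>base\<close> for a satisfiable formula and
  \<open>base + excess\<close> for an unsatisfiable one. In the first case separating the pair is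
  too expensive; in the second case a layout of this cost that keeps the pair together would yield a
  satisfying valuation.\<close>

theorem grid_optimal:
  "(\<exists>E p. finite E \<and> optimal_layout I (Field E) E p) \<and>
   (\<forall>V E p. optimal_layout I V E p \<longrightarrow> ((\<exists>u. (0, u) \<in> E \<and> (1, u) \<in> E) \<longleftrightarrow> formula_sat m v inc))"
proof -
  have ex0: "excess > 0"
  proof -
    have "2 powr \<alpha> < 2 powr 1" using \<alpha> by (intro powr_less_mono) auto
    then show ?thesis by (simp add: excess_def)
  qed
  have common: "(\<exists>u. (0, u) \<in> E \<and> (1, u) \<in> E) \<longleftrightarrow> par E 0 = par E 1" if "valid_layout I V E p" for V E p
  proof -
    interpret L: grouped_layout I V E p lab pt Zi \<alpha> using grouped[OF that] .
    have "0 \<in> sources I" "1 \<in> sources I" using lab01 by (auto simp: I_simps)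
    then show ?thesis using L.source_edge(2) par_unique[OF L.forest(4)] by metis
  qed
  show ?thesis
  proof (cases "formula_sat m v inc")
    case True
    then obtain val where val: "\<And>i. i < m \<Longrightarrow> \<exists>q<v. (inc i (2 * q + 1) \<and> val q) \<or> (inc i (2 * q + 2) \<and> \<not> val q)"
      unfolding formula_sat_def by blast
    define up where "up j = (j \<noteq> 0 \<and> (if odd j then val (j div 2) else \<not> val (j div 2 - 1)))" for j
    have up: "up (2 * q + 1) = val q" "up (2 * q + 2) = (\<not> val q)" for q by (simp_all add: up_def)
    have "\<forall>i. \<exists>j. i < m \<longrightarrow> j < 2 * v + 1 \<and> inc i j \<and> up j"
    proof
      fix i
      show "\<exists>j. i < m \<longrightarrow> j < 2 * v + 1 \<and> inc i j \<and> up j"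
      proof (cases "i < m")
        case True
        then obtain q where q: "q < v" "(inc i (2 * q + 1) \<and> val q) \<or> (inc i (2 * q + 2) \<and> \<not> val q)" using val by blast
        then have "2 * q + 1 < 2 * v + 1" "2 * q + 2 < 2 * v + 1" by auto
        then show ?thesis using q(2) up by blast
      qed simp
    qed
    then obtain ja where "\<And>i. i < m \<Longrightarrow> ja i < 2 * v + 1 \<and> inc i (ja i) \<and> up (ja i)" by metis
    then have "truth_choice g m v inc up ja" using g m up by unfold_locales auto
    from layout_of_choice[OF this] obtain E p where Ep: "finite E" "valid_layout I (Field E) E p" "layout_cost I E p = base"
      by (auto simp: up_def)
    have "par E' 0 = par E' 1" if "optimal_layout I V' E' p'" for V' E' p'
    proof (rule ccontr)
      assume "par E' 0 \<noteq> par E' 1"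
      then have "layout_cost I E' p' \<ge> base + excess" using layout_bounds(2) that by (auto simp: optimal_layout_def)
      moreover have "layout_cost I E' p' \<le> base" using that Ep unfolding optimal_layout_def by metis
      ultimately show False using ex0 by simp
    qed
    moreover have "optimal_layout I (Field E) E p"
      using Ep layout_bounds(1) by (auto simp: optimal_layout_def)
    ultimately show ?thesis using True Ep(1) common by (metis optimal_layout_def)
  next
    case False
    \<comment> \<open>The extra literal serves all clauses, so the variables can be given any
      values; here all are true.\<close>
    have "truth_choice g m v inc (\<lambda>j. j = 0 \<or> odd j) (\<lambda>_. 0)" using g m inc0 by unfold_locales auto
    from layout_of_choice[OF this] obtain E p where
      Ep: "finite E" "valid_layout I (Field E) E p" "layout_cost I E p = base + excess" by auto
    have lower: "layout_cost I E' p' \<ge> base + excess" if "valid_layout I V' E' p'" for V' E' p'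
      using layout_bounds(2,3)[OF that] False by force
    have "par E' 0 \<noteq> par E' 1" if "optimal_layout I V' E' p'" for V' E' p'
      using layout_bounds(3)[of V' E' p'] that Ep False unfolding optimal_layout_def by metis
    moreover have "optimal_layout I (Field E) E p"
      using Ep lower by (auto simp: optimal_layout_def)
    ultimately show ?thesis using False Ep(1) common by (metis optimal_layout_def)
  qed
qed

end

section \<open>Tilings as formulas\<close>

datatype row_type = Pos | Hc nat nat | Vc nat nat

text \<open>The cells of a tableau of width \<open>W\<close> are numbered row by row, so the right neighbour of \<open>c\<close> is
  \<open>c + 1\<close> and the cell below is \<open>c + W\<close>. A flag tells the position of a cell relative to \<open>c\<close>.\<close>

definition flag :: "nat \<Rightarrow> nat \<Rightarrow> nat \<Rightarrow> nat" where
  "flag W c c' = (if c' = c then 1 else if c' = c + 1 then 2 else if c' = c + W then 3 else 0)"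

text \<open>The variable \<open>c' * N + \<tau>\<close> says that cell \<open>c'\<close> may carry
  the tile \<open>\<tau>\<close>. For every cell, \<open>Pos\<close> demands an admissible tile, and
  \<open>Hc a b\<close> and \<open>Vc a b\<close> exclude \<open>a\<close> on this cell together
  with \<open>b\<close> on the right or on the lower neighbour; without such a neighbour,
  \<open>a\<close> itself is excluded. Whether a literal occurs depends on a cell only through its
  flag and its kind, so a program with a finite alphabet can print a clause in one pass over the
  cells.\<close>

primrec lit_inc :: "(nat \<Rightarrow> nat \<Rightarrow> bool) \<Rightarrow> row_type \<Rightarrow> nat \<Rightarrow> nat \<Rightarrow> nat \<Rightarrow> bool \<Rightarrow> bool" where
  "lit_inc ok Pos f kd \<tau> pos \<longleftrightarrow> pos \<and> f = 1 \<and> ok kd \<tau>"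
| "lit_inc ok (Hc a b) f kd \<tau> pos \<longleftrightarrow> \<not> pos \<and> (f = 1 \<and> \<tau> = a \<or> f = 2 \<and> \<tau> = b)"
| "lit_inc ok (Vc a b) f kd \<tau> pos \<longleftrightarrow> \<not> pos \<and> (f = 1 \<and> \<tau> = a \<or> f = 3 \<and> \<tau> = b)"

definition tile_inc :: "(nat \<Rightarrow> nat \<Rightarrow> bool) \<Rightarrow> row_type list \<Rightarrow> nat \<Rightarrow> nat \<Rightarrow> nat list \<Rightarrow> nat \<Rightarrow> nat \<Rightarrow> bool" where
  "tile_inc ok RT N W ks i j \<longleftrightarrow> j = 0 \<or>
     lit_inc ok (RT ! (i mod length RT)) (flag W (i div length RT) ((j - 1) div 2 div N))
       (ks ! ((j - 1) div 2 div N)) ((j - 1) div 2 mod N) (odd j)"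

text \<open>A tile that conflicts with any other tile must have a neighbour on that side.\<close>

definition tiling :: "'t set \<Rightarrow> (nat \<Rightarrow> 't \<Rightarrow> bool) \<Rightarrow> ('t \<Rightarrow> 't \<Rightarrow> bool) \<Rightarrow> ('t \<Rightarrow> 't \<Rightarrow> bool) \<Rightarrow>
    nat list \<Rightarrow> nat \<Rightarrow> (nat \<Rightarrow> 't) \<Rightarrow> bool" where
  "tiling S ok hcon vcon ks W a \<longleftrightarrow> (\<forall>c<length ks. a c \<in> S \<and> ok (ks ! c) (a c) \<and>
     (\<forall>y\<in>S. hcon (a c) y \<longrightarrow> c + 1 < length ks \<and> a (c + 1) \<noteq> y) \<and>
     (\<forall>y\<in>S. vcon (a c) y \<longrightarrow> c + W < length ks \<and> a (c + W) \<noteq> y))"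

definition conflict_rows :: "'t list \<Rightarrow> ('t \<Rightarrow> 't \<Rightarrow> bool) \<Rightarrow> ('t \<Rightarrow> 't \<Rightarrow> bool) \<Rightarrow> row_type list" where
  "conflict_rows tls hcon vcon = Pos #
     [Hc a b. a \<leftarrow> [0..<length tls], b \<leftarrow> [0..<length tls], hcon (tls ! a) (tls ! b)] @
     [Vc a b. a \<leftarrow> [0..<length tls], b \<leftarrow> [0..<length tls], vcon (tls ! a) (tls ! b)]"

lemma set_conflict_rows:
  "set (conflict_rows tls hcon vcon) = insert Pos
     ({Hc a b |a b. a < length tls \<and> b < length tls \<and> hcon (tls ! a) (tls ! b)} \<union>
      {Vc a b |a b. a < length tls \<and> b < length tls \<and> vcon (tls ! a) (tls ! b)})"
  by (auto simp: conflict_rows_def)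

text \<open>No clause makes the tile of a cell unique. As all conflict clauses are negative,
  choosing any admissible tile that is marked true in each cell gives a tiling. The condition
  \<open>2 \<le> W\<close> keeps the right and the lower neighbour distinct.\<close>

lemma tile_formula:
  fixes tls :: "'t list" and hcon vcon :: "'t \<Rightarrow> 't \<Rightarrow> bool"
  defines "N \<equiv> length tls" and "RT \<equiv> conflict_rows tls hcon vcon"
  assumes W: "2 \<le> W" and dist: "distinct tls" and ne: "tls \<noteq> []"
  shows "formula_sat (length ks * length RT) (length ks * N) (tile_inc (\<lambda>kd \<tau>. ok kd (tls ! \<tau>)) RT N W ks)
     \<longleftrightarrow> (\<exists>a. tiling (set tls) ok hcon vcon ks W a)"
proof -
  define C where "C = length ks"
  define ok' where "ok' = (\<lambda>kd \<tau>. ok kd (tls ! \<tau>))"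
  have N: "N > 0" using ne by (simp add: N_def)
  have R: "length RT > 0" by (simp add: RT_def conflict_rows_def)
  have clause: "(\<exists>q<C * N. (tile_inc ok' RT N W ks (c * length RT + r) (2 * q + 1) \<and> val q) \<or>
       (tile_inc ok' RT N W ks (c * length RT + r) (2 * q + 2) \<and> \<not> val q)) \<longleftrightarrow>
     (\<exists>c'<C. \<exists>\<tau><N. (lit_inc ok' (RT ! r) (flag W c c') (ks ! c') \<tau> True \<and> val (c' * N + \<tau>)) \<or>
       (lit_inc ok' (RT ! r) (flag W c c') (ks ! c') \<tau> False \<and> \<not> val (c' * N + \<tau>)))" (is "?L = ?R")
    if "r < length RT" for c r val
  proof -
   have dm: "(c * length RT + r) div length RT = c" "(c * length RT + r) mod length RT = r"
     using that by (auto intro: div_nat_eqI)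
   show ?thesis
   proof
    assume ?L
    then obtain q where q: "q < C * N" "(tile_inc ok' RT N W ks (c * length RT + r) (2 * q + 1) \<and> val q) \<or>
       (tile_inc ok' RT N W ks (c * length RT + r) (2 * q + 2) \<and> \<not> val q)" by blast
    have "q div N < C" using q(1) N by (simp add: less_mult_imp_div_less)
    moreover have "q mod N < N" using N by simp
    moreover have "(lit_inc ok' (RT ! r) (flag W c (q div N)) (ks ! (q div N)) (q mod N) True \<and> val (q div N * N + q mod N)) \<or>
       (lit_inc ok' (RT ! r) (flag W c (q div N)) (ks ! (q div N)) (q mod N) False \<and> \<not> val (q div N * N + q mod N))"
      using q(2) dm by (simp add: tile_inc_def)
    ultimately show ?R by blast
  next
    assume ?R
    then obtain c' \<tau> where c: "c' < C" "\<tau> < N" "(lit_inc ok' (RT ! r) (flag W c c') (ks ! c') \<tau> True \<and> val (c' * N + \<tau>)) \<or>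
       (lit_inc ok' (RT ! r) (flag W c c') (ks ! c') \<tau> False \<and> \<not> val (c' * N + \<tau>))" by blast
    have "c' * N + \<tau> < Suc c' * N" using c by simp
    also have "\<dots> \<le> C * N" using c by (intro mult_le_mono1) simp
    finally have "c' * N + \<tau> < C * N" .
    moreover have "(c' * N + \<tau>) div N = c'" "(c' * N + \<tau>) mod N = \<tau>"
      using c(2) by (auto intro: div_nat_eqI)
    ultimately show ?L using c(3) dm by (intro exI[of _ "c' * N + \<tau>"]) (simp add: tile_inc_def)
   qed
  qed
  have sat_iff: "formula_sat (C * length RT) (C * N) (tile_inc ok' RT N W ks) \<longleftrightarrow>
    (\<exists>val. \<forall>c<C. \<forall>rt\<in>set RT. \<exists>c'<C. \<exists>\<tau><N. (lit_inc ok' rt (flag W c c') (ks ! c') \<tau> True \<and> val (c' * N + \<tau>)) \<or>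
       (lit_inc ok' rt (flag W c c') (ks ! c') \<tau> False \<and> \<not> val (c' * N + \<tau>)))" (is "_ = (\<exists>val. ?S val)")
  proof -
    have "(\<forall>i<C * length RT. \<exists>q<C * N. (tile_inc ok' RT N W ks i (2 * q + 1) \<and> val q) \<or>
       (tile_inc ok' RT N W ks i (2 * q + 2) \<and> \<not> val q)) \<longleftrightarrow> ?S val" (is "?A = _") for val
    proof
      assume a: ?A
      show "?S val"
      proof (intro allI impI ballI)
        fix c rt assume c: "c < C" "rt \<in> set RT"
        then obtain r where r: "r < length RT" "rt = RT ! r" by (auto simp: in_set_conv_nth)
        have "c * length RT + r < Suc c * length RT" using r by simp
        also have "\<dots> \<le> C * length RT" using c by (intro mult_le_mono1) simp
        finally show "\<exists>c'<C. \<exists>\<tau><N. (lit_inc ok' rt (flag W c c') (ks ! c') \<tau> True \<and> val (c' * N + \<tau>)) \<or>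
          (lit_inc ok' rt (flag W c c') (ks ! c') \<tau> False \<and> \<not> val (c' * N + \<tau>))"
          using a clause[OF r(1), of c val] r(2) by blast
      qed
    next
      assume s: "?S val"
      show ?A
      proof (intro allI impI)
        fix i assume i: "i < C * length RT"
        have "i div length RT < C" using i R by (simp add: less_mult_imp_div_less)
        moreover have r: "i mod length RT < length RT" using R by simp
        moreover have "i div length RT * length RT + i mod length RT = i" by simp
        ultimately show "\<exists>q<C * N. (tile_inc ok' RT N W ks i (2 * q + 1) \<and> val q) \<or>
           (tile_inc ok' RT N W ks i (2 * q + 2) \<and> \<not> val q)"
          using s clause[OF r, of "i div length RT" val] by (metis nth_mem)
      qed
    qed
    then show ?thesis unfolding formula_sat_def by simp
  qed
  have "(\<exists>val. ?S val) \<longleftrightarrow> (\<exists>a. tiling (set tls) ok hcon vcon ks W a)"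
  proof
    assume "\<exists>val. ?S val"
    then obtain val where S: "?S val" by blast
    have SD: "\<exists>c' \<tau>. c' < C \<and> \<tau> < N \<and> ((lit_inc ok' rt (flag W c c') (ks ! c') \<tau> True \<and> val (c' * N + \<tau>)) \<or>
       (lit_inc ok' rt (flag W c c') (ks ! c') \<tau> False \<and> \<not> val (c' * N + \<tau>)))" if "c < C" "rt \<in> set RT" for c rt
      using S that by blast
    have "\<exists>\<tau><N. ok (ks ! c) (tls ! \<tau>) \<and> val (c * N + \<tau>)" if c: "c < C" for c
    proof -
      have "Pos \<in> set RT" by (simp add: RT_def set_conflict_rows)
      then obtain c' \<tau> where "c' < C" "\<tau> < N" "flag W c c' = 1" "ok' (ks ! c') \<tau>" "val (c' * N + \<tau>)"
        using SD[OF c, of Pos] by auto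
      moreover then have "c' = c" by (simp add: flag_def split: if_splits)
      ultimately show ?thesis by (auto simp: ok'_def)
    qed
    then obtain b where b: "\<And>c. c < C \<Longrightarrow> b c < N \<and> ok (ks ! c) (tls ! b c) \<and> val (c * N + b c)" by metis
    have "tiling (set tls) ok hcon vcon ks W (\<lambda>c. tls ! b c)"
      unfolding tiling_def C_def[symmetric]
    proof (intro allI impI conjI ballI)
      fix c assume c: "c < C"
      show "tls ! b c \<in> set tls" "ok (ks ! c) (tls ! b c)" using b[OF c] by (auto simp: N_def)
      {
        fix y assume y: "y \<in> set tls" "hcon (tls ! b c) y"
        then obtain i where i: "i < N" "y = tls ! i" by (auto simp: in_set_conv_nth N_def)
        have "Hc (b c) i \<in> set RT" using y i b[OF c] by (auto simp: RT_def set_conflict_rows N_def)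
        then obtain c' \<tau> where c': "c' < C" "\<tau> < N" "(flag W c c' = 1 \<and> \<tau> = b c) \<or> (flag W c c' = 2 \<and> \<tau> = i)" "\<not> val (c' * N + \<tau>)"
          using SD[OF c] by fastforce
        have "flag W c c' \<noteq> 1 \<or> \<tau> \<noteq> b c" using c' b[OF c] by (auto simp: flag_def split: if_splits)
        then have "c' = c + 1" "\<tau> = i" using c' by (auto simp: flag_def split: if_splits)
        moreover have "b (c + 1) \<noteq> i" using calculation c' b[of "c + 1"] by auto
        ultimately show "c + 1 < C" "tls ! b (c + 1) \<noteq> y"
          using c' i b[of "c + 1"] dist by (auto simp: nth_eq_iff_index_eq N_def)
      }
      {
        fix y assume y: "y \<in> set tls" "vcon (tls ! b c) y"
        then obtain i where i: "i < N" "y = tls ! i" by (auto simp: in_set_conv_nth N_def)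
        have "Vc (b c) i \<in> set RT" using y i b[OF c] by (auto simp: RT_def set_conflict_rows N_def)
        then obtain c' \<tau> where c': "c' < C" "\<tau> < N" "(flag W c c' = 1 \<and> \<tau> = b c) \<or> (flag W c c' = 3 \<and> \<tau> = i)" "\<not> val (c' * N + \<tau>)"
          using SD[OF c] by fastforce
        have "flag W c c' \<noteq> 1 \<or> \<tau> \<noteq> b c" using c' b[OF c] by (auto simp: flag_def split: if_splits)
        then have "c' = c + W" "\<tau> = i" using c' by (auto simp: flag_def split: if_splits)
        moreover have "b (c + W) \<noteq> i" using calculation c' b[of "c + W"] by auto
        ultimately show "c + W < C" "tls ! b (c + W) \<noteq> y"
          using c' i b[of "c + W"] dist by (auto simp: nth_eq_iff_index_eq N_def)
      }
    qed
    then show "\<exists>a. tiling (set tls) ok hcon vcon ks W a" by blast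
  next
    assume "\<exists>a. tiling (set tls) ok hcon vcon ks W a"
    then obtain a where a: "tiling (set tls) ok hcon vcon ks W a" by blast
    then have aS: "a c \<in> set tls" "ok (ks ! c) (a c)" if "c < C" for c
      using that by (auto simp: tiling_def C_def)
    define val where "val q \<longleftrightarrow> tls ! (q mod N) = a (q div N)" for q
    have val: "val (c * N + \<tau>) \<longleftrightarrow> tls ! \<tau> = a c" if "\<tau> < N" for c \<tau> using that by (simp add: val_def)
    have "?S val"
    proof (intro allI impI ballI)
      fix c rt assume c: "c < C" and rt: "rt \<in> set RT"
      from rt consider "rt = Pos"
        | x y where "rt = Hc x y" "x < N" "y < N" "hcon (tls ! x) (tls ! y)"
        | x y where "rt = Vc x y" "x < N" "y < N" "vcon (tls ! x) (tls ! y)"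
        by (auto simp: RT_def set_conflict_rows N_def)
      then show "\<exists>c'<C. \<exists>\<tau><N. (lit_inc ok' rt (flag W c c') (ks ! c') \<tau> True \<and> val (c' * N + \<tau>)) \<or>
          (lit_inc ok' rt (flag W c c') (ks ! c') \<tau> False \<and> \<not> val (c' * N + \<tau>))"
      proof cases
        case 1
        obtain \<tau> where "\<tau> < N" "tls ! \<tau> = a c" using aS(1)[OF c] by (auto simp: in_set_conv_nth N_def)
        then show ?thesis using 1 c aS(2)[OF c] val
          by (intro exI[of _ c] conjI exI[of _ \<tau>]) (auto simp: flag_def ok'_def)
      next
        case 2
        show ?thesis
        proof (cases "tls ! x = a c")
          case False
          then show ?thesis using 2 c val by (intro exI[of _ c] conjI exI[of _ x]) (auto simp: flag_def)
        next
          case True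
          then have "c + 1 < C" "a (c + 1) \<noteq> tls ! y"
            using a c 2 nth_mem[of y tls] unfolding tiling_def C_def N_def by metis+
          then show ?thesis using 2 val[of y "c + 1"] by (intro exI[of _ "c + 1"] conjI exI[of _ y]) (auto simp: flag_def)
        qed
      next
        case 3
        show ?thesis
        proof (cases "tls ! x = a c")
          case False
          then show ?thesis using 3 c val by (intro exI[of _ c] conjI exI[of _ x]) (auto simp: flag_def)
        next
          case True
          then have "c + W < C" "a (c + W) \<noteq> tls ! y"
            using a c 3 nth_mem[of y tls] unfolding tiling_def C_def N_def by metis+
          then show ?thesis using 3 W val[of y "c + W"] by (intro exI[of _ "c + W"] conjI exI[of _ y]) (auto simp: flag_def)
        qed
      qed
    qed
    then show "\<exists>val. ?S val" by blast
  qed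
  then show ?thesis using sat_iff unfolding C_def ok'_def by blast
qed

section \<open>Tableaux of Turing machines\<close>

text \<open>A tile records the tape cell number (up to 2), the phase of the input guess, the state, the
  symbols under the heads, the symbols of the cell, and for each head whether it is to the left (0), on
  (1), or to the right (2) of the cell. \<open>None\<close> is compatible with everything and separates the rows.\<close>

type_synonym tile = "(nat \<times> nat \<times> nat \<times> nat list \<times> nat list \<times> nat list) option"

text \<open>The phases of the first row are the encoding of the input (0), the marker (1) and the value (2) of a
  guessed bit of the certificate, the marker of its end (3), and the blanks (4). The kinds of cells are
  0 to 2 in the other rows (inner cell, left end, and inner cell of the accepting row), 3 for the left end
  of the first row, 4 and 5 for fixed bits, 6 to 9 for the guess, and 10 for the separators.\<close>

definition phase_steps :: "(nat \<times> nat) set" where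
  "phase_steps = {(0, 0), (0, 1), (0, 3), (1, 2), (2, 1), (2, 3), (3, 4), (4, 4)}"

definition phase_ok :: "nat \<Rightarrow> nat \<times> nat \<Rightarrow> bool" where
  "phase_ok kd z \<longleftrightarrow> (kd, z) \<in> {(4, (0, 2)), (5, (0, 3)), (6, (1, 3)), (6, (3, 2)), (6, (4, 0)),
     (7, (2, 2)), (7, (2, 3)), (7, (4, 0)), (8, (3, 2)), (8, (4, 0)), (9, (4, 0))}"

text \<open>A 2 is followed by 1 or 2, and 1 and 0 are followed by 0, so a row shows each head at
  most once. State and read symbols are repeated in every cell of a row; thus each cell knows the
  whole transition, and a step of the machine becomes a constraint between two tiles.\<close>

fun hcon :: "nat \<Rightarrow> tile \<Rightarrow> tile \<Rightarrow> bool" where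
  "hcon k (Some (cl, ph, q, rd, sy, hs)) (Some (cl', ph', q', rd', sy', hs')) \<longleftrightarrow>
     \<not> (cl' = min 2 (Suc cl) \<and> (ph, ph') \<in> phase_steps \<and> q' = q \<and> rd' = rd \<and>
        (\<forall>j<k. (hs ! j = 2 \<longrightarrow> hs' ! j \<noteq> 0) \<and> (hs ! j \<noteq> 2 \<longrightarrow> hs' ! j = 0)))"
| "hcon k None y \<longleftrightarrow> False"
| "hcon k x None \<longleftrightarrow> False"

definition trans_of :: "machine \<Rightarrow> nat \<Rightarrow> nat list \<Rightarrow> nat \<times> (nat \<times> head_move) list" where
  "trans_of M q rd = (if q < length M then (M ! q) rd else (q, map (\<lambda>c. (c, Stay)) rd))"

text \<open>The new position of a moving head is not determined by the tile above alone. Only one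
  side is fixed here: the cells to the left of the new position if the head moves right, and those
  to its right if it moves left. \<open>hcon\<close> then supplies the 1. On cell 0 a move to the
  left has no effect, as in \<open>move_head\<close>.\<close>

fun head_ok :: "head_move \<Rightarrow> nat \<Rightarrow> nat \<Rightarrow> nat \<Rightarrow> bool" where
  "head_ok Stay cl e e' \<longleftrightarrow> e' = e"
| "head_ok Go_Right cl e e' \<longleftrightarrow> (e' = 2 \<longleftrightarrow> e \<noteq> 0)"
| "head_ok Go_Left cl e e' \<longleftrightarrow> (if cl = 0 then e' \<noteq> 0 else (e' = 0 \<longleftrightarrow> e \<noteq> 2))"

text \<open>All halting states are merged into the state \<open>length M\<close>, which keeps the
  set of tiles finite.\<close>

fun vcon :: "machine \<Rightarrow> nat \<Rightarrow> tile \<Rightarrow> tile \<Rightarrow> bool" where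
  "vcon M k (Some (cl, ph, q, rd, sy, hs)) (Some (cl', ph', q', rd', sy', hs')) \<longleftrightarrow>
     \<not> (q' = min (fst (trans_of M q rd)) (length M) \<and>
        (\<forall>j<k. sy' ! j = (if hs ! j = 1 then fst (snd (trans_of M q rd) ! j) else sy ! j) \<and>
           head_ok (snd (snd (trans_of M q rd) ! j)) cl (hs ! j) (hs' ! j)))"
| "vcon M k None y \<longleftrightarrow> False"
| "vcon M k x None \<longleftrightarrow> False"

text \<open>The symbol 3 in cell 1 of tape 1 is the output \<open>True\<close>. The kinds 3 to 9
  together describe \<open>initial_config\<close> for a guessed certificate.\<close>

definition kind_ok :: "nat \<Rightarrow> nat \<Rightarrow> nat \<Rightarrow> nat \<Rightarrow> nat \<Rightarrow> nat list \<Rightarrow> nat list \<Rightarrow> bool" where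
  "kind_ok k kd cl ph q sy hs \<longleftrightarrow>
     (if kd = 0 then cl \<noteq> 0 \<and> ph = 4
      else if kd = 1 then cl = 0 \<and> ph = 4
      else if kd = 2 then cl \<noteq> 0 \<and> ph = 4 \<and> (cl = 1 \<longrightarrow> sy ! 1 = 3)
      else if kd = 3 then cl = 0 \<and> ph = 0 \<and> q = 0 \<and> (\<forall>j<k. sy ! j = 1 \<and> hs ! j = 1)
      else cl \<noteq> 0 \<and> q = 0 \<and> phase_ok kd (ph, sy ! 0) \<and> (\<forall>j<k. hs ! j = 0 \<and> (j \<noteq> 0 \<longrightarrow> sy ! j = 0)))"

definition tile_ok :: "nat \<Rightarrow> nat \<Rightarrow> tile \<Rightarrow> bool" where
  "tile_ok k kd x \<longleftrightarrow> (case x of None \<Rightarrow> kd = 10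
     | Some (cl, ph, q, rd, sy, hs) \<Rightarrow> kd \<noteq> 10 \<and> (\<forall>j<k. hs ! j = 1 \<longrightarrow> sy ! j = rd ! j) \<and>
         kind_ok k kd cl ph q sy hs)"

definition tile_set :: "nat \<Rightarrow> nat \<Rightarrow> nat \<Rightarrow> tile set" where
  "tile_set k G Q = insert None (Some ` ({..2} \<times> {..4} \<times> {..Q} \<times>
     {l. set l \<subseteq> {..<G} \<and> length l = k} \<times> {l. set l \<subseteq> {..<G} \<and> length l = k} \<times>
     {l. set l \<subseteq> {..<3} \<and> length l = k}))"

lemma finite_tile_set: "finite (tile_set k G Q)"
  unfolding tile_set_def by (intro finite.intros finite_imageI finite_cartesian_product finite_lists_length_eq) auto

subsection \<open>The first row\<close>

text \<open>The guess has the form \<open>delimit u\<close>: up to \<open>P\<close> pairs of a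
  marker and a bit, and then an end mark. It may occupy the first cell of any pair, and the cell of
  kind 8 is its place when all \<open>P\<close> bits are used. The \<open>r\<close> further blanks
  are space for the heads.\<close>

definition guess_kinds :: "nat \<Rightarrow> nat \<Rightarrow> nat list" where
  "guess_kinds P r = concat (replicate P [6, 7]) @ [8] @ replicate r 9"

definition input_kinds :: "bool list \<Rightarrow> nat list" where
  "input_kinds x = concat (map (\<lambda>b. [5, if b then 5 else 4]) x) @ [4]"

fun chain :: "nat \<Rightarrow> (nat \<times> nat) list \<Rightarrow> bool" where
  "chain p [] = True"
| "chain p (z # zs) \<longleftrightarrow> (p, fst z) \<in> phase_steps \<and> chain (fst z) zs"

definition syms :: "bool list \<Rightarrow> nat list" where
  "syms w = map (\<lambda>b. if b then 3 else 2) w"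

lemma chain_zeros: "list_all2 phase_ok ks zs \<Longrightarrow> chain 4 zs \<Longrightarrow> zs = replicate (length ks) (4, 0)"
proof (induction ks zs rule: list_all2_induct)
  case (Cons kd ks z zs)
  then have "fst z = 4" by (simp add: phase_steps_def)
  then have "z = (4, 0)" using Cons.hyps(1) by (cases z) (auto simp: phase_ok_def)
  then show ?case using Cons by simp
qed simp

text \<open>\<open>p\<close> is the phase of the cell to the left of the guess: 0 behind the input
  and 2 behind a guessed bit.\<close>

lemma guess_word:
  assumes "list_all2 phase_ok (guess_kinds P r) zs" "chain p zs" "p = 0 \<or> p = 2"
  shows "\<exists>u. length u \<le> P \<and> map snd zs = syms (delimit u) @ replicate (2 * P + r - 2 * length u) 0"
  using assms
proof (induction P arbitrary: zs p)
  case 0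
  then obtain z zs' where z: "zs = z # zs'" "phase_ok 8 z" "list_all2 phase_ok (replicate r 9) zs'"
    by (auto simp: guess_kinds_def list_all2_Cons1)
  then have "z = (3, 2)" using 0 by (cases z) (auto simp: phase_ok_def phase_steps_def)
  then have "chain 3 zs'" using 0 z by simp
  have zs': "zs' = replicate r (4, 0)"
  proof (cases zs')
    case Nil
    then show ?thesis using z by auto
  next
    case (Cons y ys)
    then have "chain 4 zs'" using \<open>chain 3 zs'\<close> by (auto simp: phase_steps_def)
    then show ?thesis using chain_zeros[OF z(3)] by simp
  qed
  show ?case using z \<open>z = (3, 2)\<close> zs' by (intro exI[of _ "[]"]) (simp add: syms_def)
next
  case (Suc P)
  have gk: "guess_kinds (Suc P) r = 6 # 7 # guess_kinds P r" by (simp add: guess_kinds_def)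
  then obtain y z zs' where z: "zs = y # z # zs'" "phase_ok 6 y" "phase_ok 7 z" "list_all2 phase_ok (guess_kinds P r) zs'"
    using Suc.prems(1) by (auto simp: list_all2_Cons1)
  have ph: "(p, fst y) \<in> phase_steps" "(fst y, fst z) \<in> phase_steps" "chain (fst z) zs'"
    using z(1) Suc.prems(2) by simp_all
  have y: "y = (1, 3) \<or> y = (3, 2)"
    using ph(1) z(2) Suc.prems(3) by (cases y) (auto simp: phase_ok_def phase_steps_def)
  then show ?case
  proof
    assume y: "y = (1, 3)"
    then have z2: "z = (2, 2) \<or> z = (2, 3)" using z(3) ph(2) by (cases z) (auto simp: phase_ok_def phase_steps_def)
    then have "chain 2 zs'" using ph(3) by auto
    then obtain u where u: "length u \<le> P" "map snd zs' = syms (delimit u) @ replicate (2 * P + r - 2 * length u) 0"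
      using Suc.IH[OF z(4)] by blast
    show ?thesis using u y z z2
      by (intro exI[of _ "(snd z = 3) # u"]) (auto simp: syms_def)
  next
    assume y: "y = (3, 2)"
    then have "z = (4, 0)" using z(3) ph(2) by (cases z) (auto simp: phase_ok_def phase_steps_def)
    then have "chain 4 zs'" using ph(3) by auto
    then have "zs' = replicate (length (guess_kinds P r)) (4, 0)" using chain_zeros[OF z(4)] by simp
    moreover have "length (guess_kinds P r) = 2 * P + 1 + r" by (induction P) (auto simp: guess_kinds_def)
    ultimately show ?thesis using y z \<open>z = (4, 0)\<close>
      by (intro exI[of _ "[]"]) (simp add: syms_def flip: replicate_Suc)
  qed
qed

lemma length_guess_kinds: "length (guess_kinds P r) = 2 * P + 1 + r"
  by (induction P) (auto simp: guess_kinds_def)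

lemma length_input_kinds: "length (input_kinds x) = 2 * length x + 1"
  by (induction x) (auto simp: input_kinds_def)

lemma guess_zeros: "list_all2 phase_ok (guess_kinds P r) (replicate (2 * P + 1 + r) (4, 0))"
proof (induction P)
  case 0
  have "phase_ok 8 (4, 0)" "phase_ok 9 (4, 0)" by (simp_all add: phase_ok_def)
  moreover from this have "list_all2 phase_ok (replicate r 9) (replicate r (4, 0))" by (induction r) auto
  ultimately show ?case by (simp add: guess_kinds_def)
next
  case (Suc P)
  have "phase_ok 6 (4, 0)" "phase_ok 7 (4, 0)" by (simp_all add: phase_ok_def)
  moreover have "guess_kinds (Suc P) r = 6 # 7 # guess_kinds P r" by (simp add: guess_kinds_def)
  ultimately show ?case using Suc by simp
qed

lemma chain_replicate: "p = 3 \<or> p = 4 \<Longrightarrow> chain p (replicate n (4, 0))"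
  by (induction n arbitrary: p) (auto simp: phase_steps_def)

lemma guess_word_ex:
  assumes "length u \<le> P" "p = 0 \<or> p = 2"
  shows "\<exists>zs. list_all2 phase_ok (guess_kinds P r) zs \<and> chain p zs \<and>
     map snd zs = syms (delimit u) @ replicate (2 * P + r - 2 * length u) 0"
  using assms
proof (induction P arbitrary: u p)
  case 0
  show ?case using 0
    by (intro exI[of _ "(3, 2) # replicate r (4, 0)"])
       (auto simp: guess_kinds_def phase_ok_def phase_steps_def syms_def list_all2_conv_all_nth nth_Cons
          chain_replicate split: nat.split)
next
  case (Suc P)
  have gk: "guess_kinds (Suc P) r = 6 # 7 # guess_kinds P r" by (simp add: guess_kinds_def)
  show ?case
  proof (cases u)
    case Nil
    have "list_all2 phase_ok (guess_kinds (Suc P) r) ((3, 2) # (4, 0) # replicate (2 * P + 1 + r) (4, 0))"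
      unfolding gk using guess_zeros[of P r] by (simp add: phase_ok_def)
    moreover have "chain p ((3, 2) # (4, 0) # replicate (2 * P + 1 + r) (4, 0))"
      using Suc.prems(2) chain_replicate[of 4] by (auto simp: phase_steps_def)
    ultimately show ?thesis using Nil
      by (intro exI[of _ "(3, 2) # (4, 0) # replicate (2 * P + 1 + r) (4, 0)"]) (simp add: syms_def flip: replicate_Suc)
  next
    case (Cons b u')
    then obtain zs where zs: "list_all2 phase_ok (guess_kinds P r) zs" "chain 2 zs"
       "map snd zs = syms (delimit u') @ replicate (2 * P + r - 2 * length u') 0"
      using Suc.IH[of u' 2] Suc.prems by auto
    have "phase_ok 6 (1, 3)" "phase_ok 7 (2, if b then 3 else 2)" "(p, 1) \<in> phase_steps" "(1, 2) \<in> phase_steps"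
      using Suc.prems(2) by (auto simp: phase_ok_def phase_steps_def)
    then show ?thesis unfolding gk using zs Suc.prems Cons
      by (intro exI[of _ "(1, 3) # (2, if b then 3 else 2) # zs"]) (auto simp: syms_def)
  qed
qed

lemma input_word:
  "list_all2 phase_ok (input_kinds x) zs \<longleftrightarrow> zs = map (Pair 0) (syms (delimit x))"
proof (induction x arbitrary: zs)
  case Nil
  show ?case by (auto simp: input_kinds_def list_all2_Cons1 phase_ok_def syms_def)
next
  case (Cons b x)
  have "input_kinds (b # x) = 5 # (if b then 5 else 4) # input_kinds x" by (simp add: input_kinds_def)
  then show ?case using Cons by (auto simp: list_all2_Cons1 phase_ok_def syms_def)
qed

lemma chain_append: "chain p (xs @ ys) \<longleftrightarrow> chain p xs \<and> chain (if xs = [] then p else fst (last xs)) ys"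
  by (induction xs arbitrary: p) auto

lemma chain_input: "chain 0 (map (Pair 0) l)"
  by (induction l) (auto simp: phase_steps_def)

lemma first_row:
  "(\<exists>zs. list_all2 phase_ok (input_kinds x @ guess_kinds P r) zs \<and> chain 0 zs \<and> map snd zs = ys) \<longleftrightarrow>
   (\<exists>u. length u \<le> P \<and> ys = syms (encode_list [x, u]) @ replicate (2 * P + r - 2 * length u) 0)"
proof
  assume "\<exists>zs. list_all2 phase_ok (input_kinds x @ guess_kinds P r) zs \<and> chain 0 zs \<and> map snd zs = ys"
  then obtain zs1 zs2 where z: "list_all2 phase_ok (input_kinds x) zs1" "list_all2 phase_ok (guess_kinds P r) zs2"
    "chain 0 (zs1 @ zs2)" "ys = map snd (zs1 @ zs2)" by (auto simp: list_all2_append1)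
  have z1: "zs1 = map (Pair 0) (syms (delimit x))" using z(1) input_word by blast
  have "zs1 \<noteq> []" using z(1) by (auto simp: input_kinds_def)
  then have "fst (last zs1) = 0" unfolding z1 by (simp add: last_map)
  then have "chain 0 zs2" using z(3) \<open>zs1 \<noteq> []\<close> by (simp add: chain_append)
  from guess_word[OF z(2) this] obtain u where "length u \<le> P"
     "map snd zs2 = syms (delimit u) @ replicate (2 * P + r - 2 * length u) 0" by blast
  then show "\<exists>u. length u \<le> P \<and> ys = syms (encode_list [x, u]) @ replicate (2 * P + r - 2 * length u) 0"
    using z(4) z1 by (auto simp: encode_list_def syms_def comp_def)
next
  assume "\<exists>u. length u \<le> P \<and> ys = syms (encode_list [x, u]) @ replicate (2 * P + r - 2 * length u) 0"
  then obtain u where u: "length u \<le> P" "ys = syms (encode_list [x, u]) @ replicate (2 * P + r - 2 * length u) 0" by blast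
  from guess_word_ex[OF u(1), of 0 r] obtain zs2 where z: "list_all2 phase_ok (guess_kinds P r) zs2" "chain 0 zs2"
     "map snd zs2 = syms (delimit u) @ replicate (2 * P + r - 2 * length u) 0" by auto
  define zs1 where "zs1 = map (Pair (0::nat)) (syms (delimit x))"
  have "list_all2 phase_ok (input_kinds x) zs1" using input_word zs1_def by blast
  moreover have "chain 0 (zs1 @ zs2)"
  proof -
    have ne: "syms (delimit x) \<noteq> []" by (cases x) (auto simp: syms_def)
    then have "fst (last zs1) = 0" by (simp add: zs1_def last_map)
    then show ?thesis using z(2) chain_input ne by (simp add: chain_append zs1_def)
  qed
  ultimately show "\<exists>zs. list_all2 phase_ok (input_kinds x @ guess_kinds P r) zs \<and> chain 0 zs \<and> map snd zs = ys"
    using z u by (intro exI[of _ "zs1 @ zs2"]) (auto simp: list_all2_appendI zs1_def encode_list_def syms_def comp_def)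
qed

lemma contents_syms:
  "i < length w + n \<Longrightarrow> contents w (Suc i) = (syms w @ replicate n 0) ! i"
  by (auto simp: contents_def syms_def nth_append)

subsection \<open>Runs and tilings\<close>

definition accepts :: "machine \<Rightarrow> nat \<Rightarrow> nat \<Rightarrow> bool list \<Rightarrow> bool" where
  "accepts M k t w \<longleftrightarrow> fst (snd ((step M ^^ t) (initial_config k w)) ! 1) 1 = 3"

text \<open>Rows 0 to \<open>T + 2\<close> hold configurations. The closing row of separators
  provides lower neighbours for the accepting row. The row after the first one is listed apart from
  the \<open>T\<close> similar rows because the program prints it differently: its separator carries
  the initial flag of the lower neighbour of cell 0.\<close>

definition tableau_rows :: "nat list \<Rightarrow> nat \<Rightarrow> nat list list" where
  "tableau_rows R T = [10 # 3 # R, 10 # 1 # replicate (length R) 0] @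
     replicate T (10 # 1 # replicate (length R) 0) @
     [10 # 1 # replicate (length R) 2, replicate (length R + 2) 10]"

lemma concat_uniform:
  assumes "\<And>l. l \<in> set L \<Longrightarrow> length l = W"
  shows "length (concat L) = length L * W"
    and "t < length L \<Longrightarrow> i < W \<Longrightarrow> concat L ! (t * W + i) = L ! t ! i"
  using assms
proof (induction L arbitrary: t)
  case (Cons l L)
  {
    case 1
    then show ?case using Cons.IH(1) by simp
  next
    case 2
    then show ?case using Cons.IH(2)[of "t - 1"] by (cases t) (auto simp: nth_append algebra_simps)
  }
qed auto

section \<open>Configurations as rows of tiles\<close>

definition reads :: "config \<Rightarrow> nat list" where
  "reads cf = map (\<lambda>tp. fst tp (snd tp)) (snd cf)"

definition cmp :: "nat \<Rightarrow> nat \<Rightarrow> nat" where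
  "cmp h i = (if h < i then 0 else if h = i then 1 else 2)"

definition config_tile :: "machine \<Rightarrow> config \<Rightarrow> nat \<Rightarrow> nat \<Rightarrow> tile" where
  "config_tile M cf i ph = Some (min 2 i, ph, min (fst cf) (length M), reads cf,
     map (\<lambda>tp. fst tp i) (snd cf), map (\<lambda>tp. cmp (snd tp) i) (snd cf))"

lemma chain_hd: "chain p zs \<Longrightarrow> zs \<noteq> [] \<Longrightarrow> (p, fst (zs ! 0)) \<in> phase_steps"
  by (cases zs) auto

lemma chain_nth: "chain p zs \<Longrightarrow> Suc i < length zs \<Longrightarrow> (fst (zs ! i), fst (zs ! Suc i)) \<in> phase_steps"
proof (induction zs arbitrary: p i)
  case (Cons z zs)
  then show ?case using chain_hd[of "fst z" zs] by (cases i) auto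
qed simp

lemma chainI:
  assumes "zs \<noteq> [] \<Longrightarrow> (p, fst (zs ! 0)) \<in> phase_steps"
    "\<And>i. Suc i < length zs \<Longrightarrow> (fst (zs ! i), fst (zs ! Suc i)) \<in> phase_steps"
  shows "chain p zs"
  using assms
proof (induction zs arbitrary: p)
  case (Cons z zs)
  have "chain (fst z) zs"
  proof (rule Cons.IH)
    show "zs \<noteq> [] \<Longrightarrow> (fst z, fst (zs ! 0)) \<in> phase_steps" using Cons.prems(2)[of 0] by simp
    show "Suc i < length zs \<Longrightarrow> (fst (zs ! i), fst (zs ! Suc i)) \<in> phase_steps" for i
      using Cons.prems(2)[of "Suc i"] by simp
  qed
  then show ?case using Cons.prems(1) by simp
qed simp

text \<open>Up to time \<open>T + 2\<close> a head has moved by at most \<open>T + 2\<close> cells.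
  With \<open>T + 5\<close> blanks at the end, it and the two cells to its right stay within the
  row.\<close>

locale tableau =
  fixes k G :: nat and M :: machine and x :: "bool list" and P r T :: nat
  assumes tm: "turing_machine k G M" and r: "T + 5 \<le> r"
begin

definition R :: "nat list" where "R = input_kinds x @ guess_kinds P r"

definition W :: nat where "W = length R + 2"

definition ks :: "nat list" where "ks = concat (tableau_rows R T)"

lemma k: "2 \<le> k" "4 \<le> G"
  using tm by (auto simp: turing_machine_def)

lemma W: "T + 7 \<le> W"
  using r by (simp add: W_def R_def length_guess_kinds)

lemma rows: "length (tableau_rows R T) = T + 4" "l \<in> set (tableau_rows R T) \<Longrightarrow> length l = W"
  by (auto simp: tableau_rows_def W_def split: if_splits)

lemma length_ks: "length ks = (T + 4) * W"
  using concat_uniform(1)[of "tableau_rows R T" W] rows by (simp add: ks_def)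

lemma row_nth:
  assumes "t < T + 4"
  shows "tableau_rows R T ! t = (if t = 0 then 10 # 3 # R else if t \<le> T + 1 then 10 # 1 # replicate (length R) 0
     else if t = T + 2 then 10 # 1 # replicate (length R) 2 else replicate (length R + 2) 10)"
proof -
  consider "t = 0" | "t = 1" | t' where "t = t' + 2" "t' < T" | "t = T + 2" | "t = T + 3"
    using assms by atomize_elim presburger
  then show ?thesis by cases (simp_all add: tableau_rows_def nth_append)
qed

lemma ks_row: "t < T + 4 \<Longrightarrow> i < W \<Longrightarrow> ks ! (t * W + i) = tableau_rows R T ! t ! i"
  unfolding ks_def using rows by (intro concat_uniform(2)) auto

lemma ks_separator: "t < T + 4 \<Longrightarrow> ks ! (t * W) = 10"
  using ks_row[of t 0] row_nth[of t] W by simp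

lemma ks_nth:
  assumes "t < T + 4" "i < W - 1"
  shows "ks ! (t * W + i + 1) = (if t = 0 then if i = 0 then 3 else R ! (i - 1)
     else if t \<le> T + 1 then if i = 0 then 1 else 0
     else if t = T + 2 then if i = 0 then 1 else 2 else 10)"
proof -
  have "i + 1 < W" using assms(2) by simp
  then show ?thesis
    using ks_row[OF assms(1), of "i + 1"] row_nth[OF assms(1)] assms(2)
    by (cases i) (auto simp: W_def)
qed

lemma config_inv:
  "length (snd ((step M ^^ t) (initial_config k w))) = k \<and>
   (\<forall>j<k. snd (snd ((step M ^^ t) (initial_config k w)) ! j) \<le> t \<and>
      (\<forall>i. fst (snd ((step M ^^ t) (initial_config k w)) ! j) i < G))"
proof (induction t)
  case 0
  show ?case using k by (auto simp: initial_config_def contents_def nth_Cons' )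
next
  case (Suc t)
  define cf where "cf = (step M ^^ t) (initial_config k w)"
  have IH: "length (snd cf) = k" "\<And>j. j < k \<Longrightarrow> snd (snd cf ! j) \<le> t" "\<And>j i. j < k \<Longrightarrow> fst (snd cf ! j) i < G"
    using Suc by (auto simp: cf_def)
  show ?case
  proof (cases "fst cf < length M")
    case False
    then have "step M cf = cf" by (simp add: step_def)
    then show ?thesis using IH by (simp add: cf_def[symmetric] le_SucI)
  next
    case True
    have rd: "length (reads cf) = k" "set (reads cf) \<subseteq> {..<G}"
      using IH(1,3) by (auto simp: reads_def in_set_conv_nth) (metis fst_conv)
    have "M ! fst cf \<in> set M" using True by simp
    then have ac: "length (snd ((M ! fst cf) (reads cf))) = k" "fst ` set (snd ((M ! fst cf) (reads cf))) \<subseteq> {..<G}"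
      using tm rd by (auto simp: turing_machine_def)
    have st: "snd (step M cf) = map2 act (snd ((M ! fst cf) (reads cf))) (snd cf)"
      using True by (simp add: step_def Let_def reads_def)
    have "snd (snd (step M cf) ! j) \<le> Suc t \<and> (\<forall>i. fst (snd (step M cf) ! j) i < G)" if j: "j < k" for j
    proof -
      define z where "z = snd ((M ! fst cf) (reads cf)) ! j"
      have "z \<in> set (snd ((M ! fst cf) (reads cf)))" using ac(1) j by (simp add: z_def)
      then have "fst z < G" using ac(2) by auto
      moreover have "snd (step M cf) ! j = act z (snd cf ! j)" using st ac(1) IH(1) j by (simp add: z_def)
      ultimately show ?thesis using IH(2,3)[OF j] by (cases "snd z") (auto simp: act_def)
    qed
    moreover have "length (snd (step M cf)) = k" using st ac(1) IH(1) by simp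
    ultimately show ?thesis by (simp add: cf_def)
  qed
qed

definition cf :: "bool list \<Rightarrow> nat \<Rightarrow> config" where
  "cf w t = (step M ^^ t) (initial_config k w)"

lemma cf_inv: "length (snd (cf w t)) = k" "j < k \<Longrightarrow> snd (snd (cf w t) ! j) \<le> t" "j < k \<Longrightarrow> fst (snd (cf w t) ! j) i < G"
  using config_inv[of t w] by (auto simp: cf_def)

lemma reads_props: "length (reads (cf w t)) = k" "set (reads (cf w t)) \<subseteq> {..<G}"
  "j < k \<Longrightarrow> reads (cf w t) ! j = fst (snd (cf w t) ! j) (snd (snd (cf w t) ! j))"
  using cf_inv(1)[of w t] cf_inv(3)[where w = w and t = t]
  by (auto simp: reads_def in_set_conv_nth) (metis fst_conv)

lemma cf_Suc:
  shows "min (fst (trans_of M (min (fst (cf w t)) (length M)) (reads (cf w t)))) (length M) = min (fst (cf w (Suc t))) (length M)"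
    and "j < k \<Longrightarrow> snd (cf w (Suc t)) ! j =
      act (snd (trans_of M (min (fst (cf w t)) (length M)) (reads (cf w t))) ! j) (snd (cf w t) ! j)"
proof -
  define c where "c = cf w t"
  have S: "cf w (Suc t) = step M c" by (simp add: c_def cf_def)
  have "min (fst (trans_of M (min (fst c) (length M)) (reads c))) (length M) = min (fst (step M c)) (length M) \<and>
    (j < k \<longrightarrow> snd (step M c) ! j = act (snd (trans_of M (min (fst c) (length M)) (reads c)) ! j) (snd c ! j))"
  proof (cases "fst c < length M")
    case False
    have "act (reads c ! j, Stay) (snd c ! j) = snd c ! j" if "j < k"
      using reads_props(3)[OF that, of w t] by (simp add: act_def c_def)
    then show ?thesis using False reads_props(1)[of w t] by (simp add: step_def trans_of_def c_def)
  next
    case True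
    have "M ! fst c \<in> set M" using True by simp
    then have "length (snd ((M ! fst c) (reads c))) = k"
      using tm reads_props(1,2)[of w t] by (auto simp: turing_machine_def c_def)
    then show ?thesis using True cf_inv(1)[of w t] by (simp add: step_def trans_of_def Let_def reads_def c_def)
  qed
  then show "min (fst (trans_of M (min (fst (cf w t)) (length M)) (reads (cf w t)))) (length M) = min (fst (cf w (Suc t))) (length M)"
    "j < k \<Longrightarrow> snd (cf w (Suc t)) ! j =
      act (snd (trans_of M (min (fst (cf w t)) (length M)) (reads (cf w t))) ! j) (snd (cf w t) ! j)"
    unfolding S c_def by auto
qed

lemma cf_0: "fst (cf w 0) = 0" "j < k \<Longrightarrow> snd (cf w 0) ! j = (if j = 0 then (contents w, 0) else (contents [], 0))"
  using k by (auto simp: cf_def initial_config_def nth_Cons')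

lemma config_tile_in: "ph \<le> 4 \<Longrightarrow> config_tile M (cf w t) i ph \<in> tile_set k G (length M)"
proof -
  have "set (map (\<lambda>tp. fst tp i) (snd (cf w t))) \<subseteq> {..<G}"
    using cf_inv(1)[of w t] cf_inv(3)[where w = w and t = t] by (auto simp: in_set_conv_nth) (metis fst_conv)
  moreover have "set (map (\<lambda>tp. cmp (snd tp) i) (snd (cf w t))) \<subseteq> {..<3}" by (auto simp: cmp_def)
  ultimately show "ph \<le> 4 \<Longrightarrow> ?thesis" using reads_props(1,2)[of w t] cf_inv(1)[of w t]
    by (auto simp: config_tile_def tile_set_def)
qed

lemma config_tile_hcon:
  assumes "(ph, ph') \<in> phase_steps"
  shows "\<not> hcon k (config_tile M (cf w t) i ph) (config_tile M (cf w t) (Suc i) ph')"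
  using assms cf_inv(1)[of w t] by (auto simp: config_tile_def cmp_def)

lemma config_tile_vcon: "\<not> vcon M k (config_tile M (cf w t) i ph) (config_tile M (cf w (Suc t)) i ph')"
proof -
  define tr where "tr = trans_of M (min (fst (cf w t)) (length M)) (reads (cf w t))"
  have "fst (snd (cf w (Suc t)) ! j) i = (if cmp (snd (snd (cf w t) ! j)) i = 1 then fst (snd tr ! j) else fst (snd (cf w t) ! j) i)
     \<and> head_ok (snd (snd tr ! j)) (min 2 i) (cmp (snd (snd (cf w t) ! j)) i) (cmp (snd (snd (cf w (Suc t)) ! j)) i)"
    if "j < k" for j
  proof -
    obtain tp h where tp: "snd (cf w t) ! j = (tp, h)" by fastforce
    obtain s mv where tr: "snd tr ! j = (s, mv)" by fastforce
    have "snd (cf w (Suc t)) ! j = (tp(h := s), move_head mv h)"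
      using cf_Suc(2)[OF that] tp tr by (simp add: tr_def act_def)
    then show ?thesis using tp tr by (cases mv) (auto simp: cmp_def)
  qed
  then show ?thesis using cf_inv(1)[of w t] cf_inv(1)[of w "Suc t"] cf_Suc(1)[of w t]
    by (simp add: config_tile_def tr_def)
qed

lemma run_tiling:
  assumes u: "length u \<le> P" and acc: "accepts M k (T + 2) (encode_list [x, u])"
  shows "\<exists>a. tiling (tile_set k G (length M)) (tile_ok k) (hcon k) (vcon M k) ks W a"
proof -
  define w where "w = encode_list [x, u]"
  define ys where "ys = syms w @ replicate (2 * P + r - 2 * length u) 0"
  obtain zs where zs: "list_all2 phase_ok R zs" "chain 0 zs" "map snd zs = ys"
    using first_row[of x P r ys] u unfolding R_def ys_def w_def by blast
  have lz: "length zs = W - 2" using zs(1) by (simp add: list_all2_lengthD[symmetric] W_def)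
  have ly: "length ys = W - 2" using zs(3) lz by (metis length_map)
  define ph where "ph t i = (if t = 0 then if i = 0 then 0 else fst (zs ! (i - 1)) else 4)" for t i :: nat
  define a where "a c = (if c mod W = 0 \<or> T + 3 \<le> c div W then None
     else config_tile M (cf w (c div W)) (c mod W - 1) (ph (c div W) (c mod W - 1)))" for c
  have W0: "W > 0" using W by simp
  have a_sep: "a (t * W) = None" for t by (simp add: a_def)
  have a_low: "a (t * W + i) = None" if "T + 3 \<le> t" "i < W" for t i
    using that by (simp add: a_def)
  have a_tile: "a (t * W + i + 1) = config_tile M (cf w t) i (ph t i)" if "t \<le> T + 2" "i < W - 1" for t i
  proof -
    have "(t * W + (i + 1)) div W = t" "(t * W + (i + 1)) mod W = i + 1"
      using that W0 by (auto intro: div_nat_eqI)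
    then show ?thesis using that by (simp add: a_def)
  qed
  have ph_ok: "ph t i \<le> 4" if "i < W - 1" for t i
  proof (cases "t = 0 \<and> i \<noteq> 0")
    case True
    then have "i - 1 < length R" using that by (auto simp: W_def)
    then have "phase_ok (R ! (i - 1)) (zs ! (i - 1))" using zs(1) by (simp add: list_all2_conv_all_nth)
    then show ?thesis using True by (auto simp: ph_def phase_ok_def)
  qed (auto simp: ph_def)
  have ph_step: "(ph t i, ph t (Suc i)) \<in> phase_steps" if "Suc i < W - 1" for t i
  proof (cases "t = 0")
    case True
    show ?thesis
    proof (cases "i = 0")
      case i0: True
      have "zs \<noteq> []" using lz that by auto
      then have "(0, fst (zs ! 0)) \<in> phase_steps" using chain_hd[OF zs(2)] by simp
      then show ?thesis using True i0 by (simp add: ph_def)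
    next
      case False
      then have "Suc (i - 1) < length zs" using lz that by simp
      then have "(fst (zs ! (i - 1)), fst (zs ! Suc (i - 1))) \<in> phase_steps"
        by (rule chain_nth[OF zs(2)])
      then show ?thesis using True False by (simp add: ph_def)
    qed
  qed (simp add: ph_def phase_steps_def)
  have ok: "tile_ok k (ks ! (t * W + i + 1)) (config_tile M (cf w t) i (ph t i))" if ti: "t \<le> T + 2" "i < W - 1" for t i
  proof -
    define sy where "sy = map (\<lambda>tp. fst tp i) (snd (cf w t))"
    define hs where "hs = map (\<lambda>tp. cmp (snd tp) i) (snd (cf w t))"
    define kd where "kd = ks ! (t * W + i + 1)"
    have sy: "sy ! j = fst (snd (cf w t) ! j) i" and hs: "hs ! j = cmp (snd (snd (cf w t) ! j)) i" if "j < k" for j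
      using that cf_inv(1)[of w t] by (simp_all add: sy_def hs_def)
    have kd: "kd = (if t = 0 then if i = 0 then 3 else R ! (i - 1)
     else if t \<le> T + 1 then if i = 0 then 1 else 0 else if i = 0 then 1 else 2)"
      unfolding kd_def using ks_nth[of t i] ti by auto
    have base: "hs ! j = 1 \<longrightarrow> sy ! j = reads (cf w t) ! j" if "j < k" for j
      using reads_props(3)[OF that, of w t] that by (simp add: sy hs cmp_def)
    have "kind_ok k kd (min 2 i) (ph t i) (min (fst (cf w t)) (length M)) sy hs \<and> kd \<noteq> 10"
    proof (cases "t = 0")
      case True
      show ?thesis
      proof (cases "i = 0")
        case i0: True
        have kd3: "kd = 3" using kd True i0 by simp
        show ?thesis unfolding kd3 kind_ok_def using True i0 cf_0(1)[of w] cf_0(2)[of _ w]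
          by (simp add: sy hs cmp_def contents_def ph_def)
      next
        case False
        have pk: "phase_ok kd (zs ! (i - 1))"
        proof -
          have "i - 1 < length R" using False ti by (auto simp: W_def)
          then show ?thesis using zs(1) kd True False by (simp add: list_all2_conv_all_nth)
        qed
        then have kdr: "kd \<noteq> 0" "kd \<noteq> 1" "kd \<noteq> 2" "kd \<noteq> 3" "kd \<noteq> 10" by (auto simp: phase_ok_def)
        have "sy ! 0 = contents w i" using True k cf_0(2)[of 0 w] by (simp add: sy)
        also have "\<dots> = ys ! (i - 1)"
          using contents_syms[of "i - 1" w "2 * P + r - 2 * length u"] False ti ly
          by (simp add: ys_def syms_def)
        also have "\<dots> = snd (zs ! (i - 1))" using lz ti False zs(3)[symmetric] by simp
        finally have "phase_ok kd (ph t i, sy ! 0)" using pk True False by (simp add: ph_def)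
        then show ?thesis using kdr True False cf_0(1)[of w] cf_0(2)[of _ w] unfolding kind_ok_def
          by (auto simp: sy hs cmp_def contents_def)
      qed
    next
      case False
      have "sy ! 1 = 3" if "i = 1" "t = T + 2" using acc k that by (simp add: sy accepts_def cf_def w_def)
      then show ?thesis using False kd ti by (auto simp: kind_ok_def ph_def)
    qed
    then show ?thesis using base by (simp add: tile_ok_def config_tile_def sy_def hs_def kd_def)
  qed
  have "tiling (tile_set k G (length M)) (tile_ok k) (hcon k) (vcon M k) ks W a"
    unfolding tiling_def
  proof (intro allI impI)
    fix c assume c: "c < length ks"
    define t where "t = c div W"
    define m where "m = c mod W"
    have cm: "c = t * W + m" "m < W" using W0 by (simp_all add: t_def m_def)
    have t4: "t < T + 4" using c W0 unfolding length_ks t_def by (simp add: less_mult_imp_div_less)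
    show "a c \<in> tile_set k G (length M) \<and> tile_ok k (ks ! c) (a c) \<and>
     (\<forall>y\<in>tile_set k G (length M). hcon k (a c) y \<longrightarrow> c + 1 < length ks \<and> a (c + 1) \<noteq> y) \<and>
     (\<forall>y\<in>tile_set k G (length M). vcon M k (a c) y \<longrightarrow> c + W < length ks \<and> a (c + W) \<noteq> y)"
    proof (cases "m = 0 \<or> T + 3 \<le> t")
      case True
      then have "a c = None" using cm a_sep a_low by auto
      moreover have "ks ! c = 10"
      proof (cases "m = 0")
        case True
        then show ?thesis using cm ks_separator[OF t4] by simp
      next
        case False
        then show ?thesis using cm True t4 ks_nth[of t "m - 1"] by auto
      qed
      ultimately show ?thesis by (simp add: tile_set_def tile_ok_def)
    next
      case False
      define i where "i = m - 1"
      have ti: "t \<le> T + 2" "i < W - 1" "c = t * W + i + 1" using False cm by (auto simp: i_def)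
      have ac: "a c = config_tile M (cf w t) i (ph t i)" using a_tile[OF ti(1,2)] ti(3) by simp
      have "Suc (Suc t) * W \<le> length ks" unfolding length_ks using ti by (intro mult_le_mono1) simp
      then have len: "c + W < length ks" using cm by simp
      have "\<not> hcon k (a c) (a (c + 1))"
      proof (cases "Suc i < W - 1")
        case True
        then have "a (c + 1) = config_tile M (cf w t) (Suc i) (ph t (Suc i))" using a_tile[of t "Suc i"] ti by simp
        then show ?thesis using config_tile_hcon[OF ph_step[OF True]] ac by simp
      next
        case False
        then have "c + 1 = Suc t * W" using ti W by simp
        then have "a (c + 1) = None" using a_sep[of "Suc t"] by simp
        then show ?thesis by (cases "a c") auto
      qed
      moreover have "\<not> vcon M k (a c) (a (c + W))"
      proof (cases "Suc t \<le> T + 2")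
        case True
        then have "a (c + W) = config_tile M (cf w (Suc t)) i (ph (Suc t) i)" using a_tile[of "Suc t" i] ti by (simp add: algebra_simps)
        then show ?thesis using config_tile_vcon ac by simp
      next
        case False
        then have "a (c + W) = None" using a_low[of "Suc t" m] cm by (simp add: algebra_simps)
        then show ?thesis by (cases "a c") auto
      qed
      ultimately show ?thesis using ok[OF ti(1,2)] config_tile_in[OF ph_ok[OF ti(2)]] ac ti(3) len W by auto
    qed
  qed
  then show ?thesis by blast
qed

text \<open>The tiles are forced row by row: the first row is known from \<open>first_row\<close>,
  and each later row follows from the one above, once the read symbols claimed by the tiles are
  known to be the true ones.\<close>

lemma tiling_run:
  assumes til: "tiling (tile_set k G (length M)) (tile_ok k) (hcon k) (vcon M k) ks W a"
  shows "\<exists>u. length u \<le> P \<and> accepts M k (T + 2) (encode_list [x, u])"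
proof -
  define cell where "cell t i = t * W + i + 1" for t i
  have cell_lt: "cell t i < length ks" if "t \<le> T + 2" "i < W - 1" for t i
  proof -
    have "cell t i < Suc t * W" using that by (simp add: cell_def)
    also have "\<dots> \<le> length ks" unfolding length_ks using that by (intro mult_le_mono1) simp
    finally show ?thesis .
  qed
  define cl where "cl t i = fst (the (a (cell t i)))" for t i
  define ph where "ph t i = fst (snd (the (a (cell t i))))" for t i
  define q where "q t i = fst (snd (snd (the (a (cell t i)))))" for t i
  define rd where "rd t i = fst (snd (snd (snd (the (a (cell t i))))))" for t i
  define sy where "sy t i = fst (snd (snd (snd (snd (the (a (cell t i)))))))" for t i
  define hs where "hs t i = snd (snd (snd (snd (snd (the (a (cell t i)))))))" for t i
  have R_kinds: "R ! i \<in> {4..9}" if "i < length R" for i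
  proof -
    have "set R \<subseteq> {4..9}" by (auto simp: R_def input_kinds_def guess_kinds_def split: if_splits)
    then show ?thesis using that nth_mem by blast
  qed
  have kind10: "ks ! cell t i \<noteq> 10" if "t \<le> T + 2" "i < W - 1" for t i
  proof -
    have "i \<noteq> 0 \<Longrightarrow> i - 1 < length R" using that by (auto simp: W_def)
    then show ?thesis unfolding cell_def using ks_nth[of t i] that R_kinds[of "i - 1"] by auto
  qed
  have tile: "a (cell t i) = Some (cl t i, ph t i, q t i, rd t i, sy t i, hs t i)"
    and tset: "a (cell t i) \<in> tile_set k G (length M)"
    and okk: "kind_ok k (ks ! cell t i) (cl t i) (ph t i) (q t i) (sy t i) (hs t i)"
    and base: "j < k \<Longrightarrow> hs t i ! j = 1 \<Longrightarrow> sy t i ! j = rd t i ! j"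
    and len: "length (rd t i) = k"
    if ti: "t \<le> T + 2" "i < W - 1" for t i j
  proof -
    have o: "a (cell t i) \<in> tile_set k G (length M)" "tile_ok k (ks ! cell t i) (a (cell t i))"
      using til cell_lt[OF ti] by (auto simp: tiling_def)
    have nn: "a (cell t i) \<noteq> None" using o(2) kind10[OF ti] by (cases "a (cell t i)") (simp_all add: tile_ok_def)
    then show 1: "a (cell t i) = Some (cl t i, ph t i, q t i, rd t i, sy t i, hs t i)"
      by (auto simp: cl_def ph_def q_def rd_def sy_def hs_def)
    show "a (cell t i) \<in> tile_set k G (length M)" by (rule o(1))
    show "kind_ok k (ks ! cell t i) (cl t i) (ph t i) (q t i) (sy t i) (hs t i)"
      "j < k \<Longrightarrow> hs t i ! j = 1 \<Longrightarrow> sy t i ! j = rd t i ! j"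
      using o(2) unfolding 1 by (auto simp: tile_ok_def)
    show "length (rd t i) = k" using o(1) unfolding 1 by (auto simp: tile_set_def)
  qed
  have hs3: "hs t i ! j < 3" if "t \<le> T + 2" "i < W - 1" "j < k" for t i j
  proof -
    have "set (hs t i) \<subseteq> {..<3}" "length (hs t i) = k"
      using tset[OF that(1,2)] unfolding tile[OF that(1,2)] by (auto simp: tile_set_def)
    then show ?thesis using that(3) by (metis lessThan_iff nth_mem subsetD)
  qed
  have H: "cl t (Suc i) = min 2 (Suc (cl t i)) \<and> (ph t i, ph t (Suc i)) \<in> phase_steps \<and> q t (Suc i) = q t i \<and>
      rd t (Suc i) = rd t i \<and>
      (\<forall>j<k. (hs t i ! j = 2 \<longrightarrow> hs t (Suc i) ! j \<noteq> 0) \<and> (hs t i ! j \<noteq> 2 \<longrightarrow> hs t (Suc i) ! j = 0))"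
    if ti: "t \<le> T + 2" "Suc i < W - 1" for t i
  proof -
    have "i < W - 1" using ti by simp
    moreover have "\<not> hcon k (a (cell t i)) (a (cell t (Suc i)))"
      using til cell_lt[OF ti(1) \<open>i < W - 1\<close>] tset[OF ti] unfolding tiling_def by (auto simp: cell_def)
    ultimately show ?thesis using tile[OF ti(1), of i] tile[OF ti] by auto
  qed
  have V: "q (Suc t) i = min (fst (trans_of M (q t i) (rd t i))) (length M) \<and>
      (\<forall>j<k. sy (Suc t) i ! j = (if hs t i ! j = 1 then fst (snd (trans_of M (q t i) (rd t i)) ! j) else sy t i ! j) \<and>
         head_ok (snd (snd (trans_of M (q t i) (rd t i)) ! j)) (cl t i) (hs t i ! j) (hs (Suc t) i ! j))"
    if ti: "Suc t \<le> T + 2" "i < W - 1" for t i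
  proof -
    have t: "t \<le> T + 2" using ti by simp
    have "cell t i + W = cell (Suc t) i" by (simp add: cell_def)
    then have "\<not> vcon M k (a (cell t i)) (a (cell (Suc t) i))"
      using til cell_lt[OF t ti(2)] tset[OF ti] unfolding tiling_def by metis
    then show ?thesis using tile[OF t ti(2)] tile[OF ti] by simp
  qed
  have lenR: "length R = W - 2" by (simp add: W_def)
  have okk0: "cl 0 0 = 0 \<and> ph 0 0 = 0 \<and> q 0 0 = 0 \<and> (\<forall>j<k. sy 0 0 ! j = 1 \<and> hs 0 0 ! j = 1)"
    using okk[of 0 0] ks_nth[of 0 0] W by (simp add: cell_def kind_ok_def)
  have okk1: "q 0 (Suc i) = 0 \<and> phase_ok (R ! i) (ph 0 (Suc i), sy 0 (Suc i) ! 0) \<and>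
     (\<forall>j<k. hs 0 (Suc i) ! j = 0 \<and> (j \<noteq> 0 \<longrightarrow> sy 0 (Suc i) ! j = 0))" if "i < W - 2" for i
  proof -
    have "ks ! cell 0 (Suc i) = R ! i" using ks_nth[of 0 "Suc i"] that by (simp add: cell_def)
    moreover have "R ! i \<in> {4..9}" using R_kinds[of i] that lenR by simp
    moreover have "kind_ok k (ks ! cell 0 (Suc i)) (cl 0 (Suc i)) (ph 0 (Suc i)) (q 0 (Suc i)) (sy 0 (Suc i)) (hs 0 (Suc i))"
      using that by (intro okk) auto
    ultimately show ?thesis by (auto simp: kind_ok_def split: if_splits)
  qed
  define zs where "zs = map (\<lambda>i. (ph 0 (Suc i), sy 0 (Suc i) ! 0)) [0..<W - 2]"
  have "list_all2 phase_ok R zs"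
    using okk1 lenR by (auto simp: list_all2_conv_all_nth zs_def)
  moreover have "chain 0 zs"
  proof (rule chainI)
    show "(0, fst (zs ! 0)) \<in> phase_steps" if "zs \<noteq> []"
      using H[of 0 0] okk0 W by (simp add: zs_def)
    show "(fst (zs ! i), fst (zs ! Suc i)) \<in> phase_steps" if "Suc i < length zs" for i
      using H[of 0 "Suc i"] that by (simp add: zs_def)
  qed
  ultimately obtain u where u: "length u \<le> P"
     "map snd zs = syms (encode_list [x, u]) @ replicate (2 * P + r - 2 * length u) 0"
    using first_row[of x P r "map snd zs"] unfolding R_def by blast
  define w where "w = encode_list [x, u]"
  have sy0: "sy 0 (Suc i) ! 0 = contents w (Suc i)" if "i < W - 2" for i
  proof -
    have "length (map snd zs) = W - 2" by (simp add: zs_def)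
    then have "W - 2 = length w + (2 * P + r - 2 * length u)" using u(2) by (simp add: w_def syms_def)
    then have "contents w (Suc i) = map snd zs ! i"
      using contents_syms[of i w "2 * P + r - 2 * length u"] that u(2) by (simp add: w_def)
    also have "\<dots> = sy 0 (Suc i) ! 0" using that by (simp add: zs_def)
    finally show ?thesis by simp
  qed
  have cl: "cl t i = min 2 i" if "t \<le> T + 2" "i < W - 1" for t i
    using that(2)
  proof (induction i)
    case 0
    show ?case using okk[of t 0] ks_nth[of t 0] that(1) W
      by (auto simp: cell_def kind_ok_def split: if_splits)
  next
    case (Suc i)
    then show ?case using H[OF that(1), of i] by simp
  qed
  define A where "A t i \<longleftrightarrow> q t i = min (fst (cf w t)) (length M) \<and>
     (\<forall>j<k. sy t i ! j = fst (snd (cf w t) ! j) i \<and> hs t i ! j = cmp (snd (snd (cf w t) ! j)) i)" for t i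
  \<comment> \<open>The claimed symbols are constant along the row, and \<open>base\<close> makes
    the entry for head \<open>j\<close> correct in the cell that carries this head. That this cell
    lies inside the row follows from \<open>cf_inv\<close>.\<close>
  have rd: "rd t i = reads (cf w t)" if t: "t \<le> T + 2" and A: "\<And>i. i < W - 1 \<Longrightarrow> A t i" and i: "i < W - 1" for t i
  proof -
    have const: "rd t i = rd t 0" if "i < W - 1" for i
      using that
    proof (induction i)
      case (Suc i)
      then show ?case using H[OF t, of i] by simp
    qed simp
    show ?thesis
    proof (rule nth_equalityI)
      show "length (rd t i) = length (reads (cf w t))" using len[OF t i] reads_props(1) by simp
      fix j assume "j < length (rd t i)"
      then have j: "j < k" using len[OF t i] by simp
      define h where "h = snd (snd (cf w t) ! j)"
      have h: "h < W - 1" using cf_inv(2)[OF j, of w t] t W by (simp add: h_def)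
      have "rd t i ! j = rd t h ! j" using const[OF i] const[OF h] by simp
      also have "\<dots> = sy t h ! j" using A[OF h] j base[OF t h j] by (simp add: A_def cmp_def h_def)
      also have "\<dots> = reads (cf w t) ! j" using A[OF h] j reads_props(3)[OF j] by (simp add: A_def h_def)
      finally show "rd t i ! j = reads (cf w t) ! j" .
    qed
  qed
  have A: "A t i" if "t \<le> T + 2" "i < W - 1" for t i
    using that
  proof (induction t arbitrary: i)
    case 0
    show ?case
    proof (cases i)
      case 0
      then show ?thesis using okk0 cf_0(1)[of w] cf_0(2)[of _ w] by (auto simp: A_def cmp_def contents_def)
    next
      case (Suc i')
      then have i': "i' < W - 2" using 0 by simp
      show ?thesis using okk1[OF i'] sy0[OF i'] cf_0(1)[of w] cf_0(2)[of _ w] Suc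
        by (auto simp: A_def cmp_def) (auto simp: contents_def)
    qed
  next
    case (Suc t)
    have t: "t \<le> T + 2" using Suc.prems by simp
    have IH: "A t i" if "i < W - 1" for i using Suc.IH[of i] that t by simp
    define tr where "tr = trans_of M (min (fst (cf w t)) (length M)) (reads (cf w t))"
    have V': "q (Suc t) i = min (fst tr) (length M)"
      "j < k \<Longrightarrow> sy (Suc t) i ! j = (if hs t i ! j = 1 then fst (snd tr ! j) else sy t i ! j)"
      "j < k \<Longrightarrow> head_ok (snd (snd tr ! j)) (cl t i) (hs t i ! j) (hs (Suc t) i ! j)" if "i < W - 1" for i j
      using V[OF Suc.prems(1) that] IH[OF that] rd[OF t IH that] by (auto simp: tr_def A_def)
    have qn: "q (Suc t) i = min (fst (cf w (Suc t))) (length M)"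
      using V'(1)[OF Suc.prems(2)] cf_Suc(1)[of w t] by (simp add: tr_def)
    have "sy (Suc t) i ! j = fst (snd (cf w (Suc t)) ! j) i \<and> hs (Suc t) i ! j = cmp (snd (snd (cf w (Suc t)) ! j)) i"
      if j: "j < k" for j
    proof -
      obtain tp h where tp: "snd (cf w t) ! j = (tp, h)" by fastforce
      obtain s mv where tr: "snd tr ! j = (s, mv)" by fastforce
      have nx: "snd (cf w (Suc t)) ! j = (tp(h := s), move_head mv h)"
        using cf_Suc(2)[OF j] tp tr by (simp add: tr_def act_def)
      define e where "e i = hs (Suc t) i ! j" for i
      have hse: "hs t i ! j = cmp h i" "sy t i ! j = tp i" if "i < W - 1" for i using IH[OF that] j tp by (auto simp: A_def)
      have hd: "head_ok mv (min 2 i) (cmp h i) (e i)" if "i < W - 1" for i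
        using V'(3)[OF that j] hse[OF that] tr cl[OF t that] by (simp add: e_def)
      have e3: "e i < 3" if "i < W - 1" for i using hs3[OF Suc.prems(1) that j] by (simp add: e_def)
      have eH: "(e i = 2 \<longrightarrow> e (Suc i) \<noteq> 0) \<and> (e i \<noteq> 2 \<longrightarrow> e (Suc i) = 0)" if "Suc i < W - 1" for i
        using H[OF Suc.prems(1) that] j by (simp add: e_def)
      have hT: "h + 2 < W - 1" using cf_inv(2)[OF j, of w t] tp t Suc.prems(1) W by simp
      \<comment> \<open>For a moving head the vertical constraint determines the cells with mark 2
        (move to the right) or with mark 0 (move to the left); the horizontal one places the 1
        beside them and fills in the rest.\<close>
      have "e i = cmp (move_head mv h) i" if i: "i < W - 1" for i
      proof (cases mv)
        case Stay
        then show ?thesis using hd[OF i] by simp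
      next
        case Go_Right
        then have e2: "e i = 2 \<longleftrightarrow> i \<le> h" if "i < W - 1" for i using hd[OF that] by (auto simp: cmp_def)
        have mid: "e (Suc h) = 1" using eH[of h] e2[of h] e2[of "Suc h"] e3[of "Suc h"] hT by simp
        have "e i = 0" if "h + 2 \<le> i" "i < W - 1" for i
        proof -
          obtain i' where i': "i = Suc i'" using \<open>h + 2 \<le> i\<close> by (cases i) auto
          then have "e i' \<noteq> 2" using e2[of i'] that by simp
          then show ?thesis using eH[of i'] that i' by simp
        qed
        then show ?thesis using e2[OF i] mid i Go_Right
          by (cases "i = Suc h"; cases "i \<le> h") (auto simp: cmp_def)
      next
        case Go_Left
        have e0: "e i = 0 \<longleftrightarrow> h - 1 < i" if "i < W - 1" for i using hd[OF that] Go_Left by (cases i) (auto simp: cmp_def split: if_splits)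
        consider "h - 1 < i" | "i = h - 1" | "i < h - 1" by linarith
        then show ?thesis
        proof cases
          case 1
          then show ?thesis using e0[OF i] Go_Left by (simp add: cmp_def)
        next
          case 2
          have "e (Suc i) = 0" using e0[of "Suc i"] 2 hT by simp
          then have "e i \<noteq> 2" using eH[of i] 2 hT by auto
          then have "e i = 1" using e0[OF i] e3[OF i] 2 by simp
          then show ?thesis using 2 Go_Left by (simp add: cmp_def)
        next
          case 3
          then have "e (Suc i) \<noteq> 0" using e0[of "Suc i"] hT by simp
          then have "e i = 2" using eH[of i] 3 hT by auto
          then show ?thesis using 3 Go_Left by (simp add: cmp_def)
        qed
      qed
      moreover have "sy (Suc t) i ! j = (tp(h := s)) i"
        using V'(2)[OF Suc.prems(2) j] hse[OF Suc.prems(2)] tr by (auto simp: cmp_def split: if_splits)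
      ultimately show ?thesis using nx Suc.prems(2) by (simp add: e_def)
    qed
    then show ?case using qn by (simp add: A_def)
  qed
  have "sy (T + 2) 1 ! 1 = 3"
    using okk[of "T + 2" 1] ks_nth[of "T + 2" 1] cl[of "T + 2" 1] W by (simp add: cell_def kind_ok_def)
  moreover have "sy (T + 2) 1 ! 1 = fst (snd (cf w (T + 2)) ! 1) 1" using A[of "T + 2" 1] W k by (auto simp: A_def)
  ultimately have "accepts M k (T + 2) w" by (simp add: accepts_def cf_def)
  then show ?thesis using u(1) w_def by blast
qed

theorem tiling_iff:
  "(\<exists>a. tiling (tile_set k G (length M)) (tile_ok k) (hcon k) (vcon M k) ks W a) \<longleftrightarrow>
   (\<exists>u. length u \<le> P \<and> accepts M k (T + 2) (encode_list [x, u]))"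
  using run_tiling tiling_run by blast

end

section \<open>Programming in the loop language\<close>

text \<open>A judgement in the style of Hoare logic that also bounds the registers when they are
  scanned; composing such judgements gives the result and the running time together.\<close>

definition ex :: "nat \<Rightarrow> prog \<Rightarrow> store \<Rightarrow> store \<Rightarrow> bool" where
  "ex b P s s' \<longleftrightarrow> sem P s = s' \<and> loop_bounded b P s"

lemma ex_Skip: "ex b Skip s s"
  by (simp add: ex_def)

lemma ex_App: "s(r := s r @ [a]) = s' \<Longrightarrow> ex b (App r a) s s'"
  by (simp add: ex_def)

lemma ex_Clr: "length (s r) \<le> b \<Longrightarrow> s(r := []) = s' \<Longrightarrow> ex b (Clr r) s s'"
  by (simp add: ex_def)

lemma ex_Seq: "ex b P s s1 \<Longrightarrow> ex b Q s1 s' \<Longrightarrow> ex b (Seq P Q) s s'"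
  by (auto simp: ex_def)

text \<open>\<open>F xs\<close> is the store after the prefix \<open>xs\<close> has been processed.
  Giving it as a function of the prefix replaces a loop invariant.\<close>

lemma ex_For:
  assumes "length (s r) \<le> b" "F [] = s"
    and step: "\<And>xs a ys. s r = xs @ a # ys \<Longrightarrow> ex b (B a) (F xs) (F (xs @ [a]))"
    and "F (s r) = s'"
  shows "ex b (For r B) s s'"
proof -
  have "fold (\<lambda>a. sem (B a)) ys (F xs) = F (s r) \<and>
     loop_all (\<lambda>a. loop_bounded b (B a)) (\<lambda>a. sem (B a)) ys (F xs)" if "s r = xs @ ys" for xs ys
    using that
  proof (induction ys arbitrary: xs)
    case (Cons a ys)
    then show ?case using step[of xs a ys] Cons.IH[of "xs @ [a]"] by (simp add: ex_def)
  qed simp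
  from this[of "[]" "s r"] show ?thesis using assms by (simp add: ex_def)
qed

primrec seqs :: "prog list \<Rightarrow> prog" where
  "seqs [] = Skip"
| "seqs (P # Ps) = Seq P (seqs Ps)"

lemma wf_seqs [simp]: "wf_prog k S X (seqs Ps) \<longleftrightarrow> (\<forall>P\<in>set Ps. wf_prog k S X P)"
  by (induction Ps) auto

lemma ex_Nil: "s = s' \<Longrightarrow> ex b (seqs []) s s'"
  by (simp add: ex_Skip)

lemma ex_Cons: "ex b P s s1 \<Longrightarrow> ex b (seqs Ps) s1 s' \<Longrightarrow> ex b (seqs (P # Ps)) s s'"
  by (simp add: ex_Seq)

lemma ex_append: "ex b (seqs Ps) s s1 \<Longrightarrow> ex b (seqs Qs) s1 s' \<Longrightarrow> ex b (seqs (Ps @ Qs)) s s'"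
  by (induction Ps arbitrary: s) (auto simp: ex_def)

lemma ex_seqs:
  assumes "\<And>i. i < length Ps \<Longrightarrow> ex b (Ps ! i) (F i) (F (Suc i))"
  shows "ex b (seqs Ps) (F 0) (F (length Ps))"
  using assms
proof (induction Ps arbitrary: F)
  case (Cons P Ps)
  have "ex b (seqs Ps) (F (Suc 0)) (F (Suc (length Ps)))"
    using Cons.IH[of "\<lambda>i. F (Suc i)"] Cons.prems by fastforce
  then show ?case using Cons.prems[of 0] ex_Cons by fastforce
qed (simp add: ex_Skip)

definition emits :: "nat \<Rightarrow> nat list \<Rightarrow> prog" where
  "emits r ws = seqs (map (App r) ws)"

lemma wf_emits [simp]: "wf_prog k S X (emits r ws) \<longleftrightarrow> (\<forall>a\<in>set ws. r < k \<and> r \<notin> X \<and> a < S)"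
  by (simp add: emits_def)

lemma ex_emits: "s(r := s r @ ws) = s' \<Longrightarrow> ex b (emits r ws) s s'"
proof -
  have "ex b (seqs (map (App r) ws)) s (s(r := s r @ ws))"
  proof (induction ws arbitrary: s)
    case Nil
    show ?case by (simp add: ex_Skip)
  next
    case (Cons a ws)
    have "ex b (seqs (map (App r) ws)) (s(r := s r @ [a])) (s(r := s r @ a # ws))"
      using Cons[of "s(r := s r @ [a])"]
      by (simp only: fun_upd_upd fun_upd_same append_assoc append_Cons append_Nil)
    then show ?case by (simp only: list.map) (rule ex_Cons[OF ex_App[OF refl]])
  qed
  then show "s(r := s r @ ws) = s' \<Longrightarrow> ?thesis" by (simp add: emits_def)
qed

definition each :: "nat \<Rightarrow> nat \<Rightarrow> (nat \<Rightarrow> nat list) \<Rightarrow> prog" where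
  "each r r' f = For r (\<lambda>a. emits r' (f a))"

lemma wf_each [simp]: "wf_prog k S X (each r r' f) \<longleftrightarrow>
    r < k \<and> r \<notin> X \<and> (\<forall>a<S. \<forall>c\<in>set (f a). r' < k \<and> r' \<notin> insert r X \<and> c < S)"
  by (simp add: each_def)

lemma ex_each:
  assumes "length (s r) \<le> b" "r \<noteq> r'" "s(r' := s r' @ concat (map f (s r))) = s'"
  shows "ex b (each r r' f) s s'"
  unfolding each_def
  by (rule ex_For[where F = "\<lambda>xs. s(r' := s r' @ concat (map f xs))"])
     (use assms in \<open>auto intro!: ex_emits\<close>)

subsection \<open>Transducers\<close>

primrec out_of :: "(nat \<Rightarrow> nat \<Rightarrow> nat \<times> nat list) \<Rightarrow> nat \<Rightarrow> nat list \<Rightarrow> nat list" where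
  "out_of \<delta> q [] = []"
| "out_of \<delta> q (a # as) = snd (\<delta> q a) @ out_of \<delta> (fst (\<delta> q a)) as"

primrec state_of :: "(nat \<Rightarrow> nat \<Rightarrow> nat \<times> nat list) \<Rightarrow> nat \<Rightarrow> nat list \<Rightarrow> nat" where
  "state_of \<delta> q [] = q"
| "state_of \<delta> q (a # as) = state_of \<delta> (fst (\<delta> q a)) as"

definition run :: "(nat \<Rightarrow> nat \<Rightarrow> nat \<times> nat list) \<Rightarrow> (nat \<Rightarrow> nat list) \<Rightarrow> nat \<Rightarrow> nat list \<Rightarrow> nat list" where
  "run \<delta> fin q w = out_of \<delta> q w @ fin (state_of \<delta> q w)"

lemma run_simps [simp]:
  "run \<delta> fin q [] = fin q" "run \<delta> fin q (a # w) = snd (\<delta> q a) @ run \<delta> fin (fst (\<delta> q a)) w"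
  by (simp_all add: run_def)

lemma out_of_snoc: "out_of \<delta> q (w @ [a]) = out_of \<delta> q w @ snd (\<delta> (state_of \<delta> q w) a)"
  by (induction w arbitrary: q) auto

lemma state_of_snoc: "state_of \<delta> q (w @ [a]) = fst (\<delta> (state_of \<delta> q w) a)"
  by (induction w arbitrary: q) auto

text \<open>Registers 13 and 14 hold the old and the new state.\<close>

definition trans :: "(nat \<Rightarrow> nat \<Rightarrow> nat \<times> nat list) \<Rightarrow> (nat \<Rightarrow> nat list) \<Rightarrow> nat \<Rightarrow> nat \<Rightarrow> nat \<Rightarrow> prog" where
  "trans \<delta> fin q0 r out = seqs
     [App 13 q0,
      For r (\<lambda>a. seqs [For 13 (\<lambda>q. seqs [emits out (snd (\<delta> q a)), App 14 (fst (\<delta> q a))]),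
        Clr 13, each 14 13 (\<lambda>q. [q]), Clr 14]),
      For 13 (\<lambda>q. emits out (fin q)),
      Clr 13]"

lemma wf_trans:
  assumes "15 < k" "r < k" "out < k" "r \<notin> {13, 14, out}" "out \<notin> {13, 14}" "X \<inter> {13, 14, r, out} = {}" "q0 < S"
    "\<And>q a. q < S \<Longrightarrow> a < S \<Longrightarrow> fst (\<delta> q a) < S \<and> set (snd (\<delta> q a)) \<subseteq> {..<S}"
    "\<And>q. q < S \<Longrightarrow> set (fin q) \<subseteq> {..<S}"
  shows "wf_prog k S X (trans \<delta> fin q0 r out)"
  using assms(1-7)
  by (simp add: trans_def) (intro conjI allI impI ballI; use assms(8,9) in blast)

lemma ex_trans:
  assumes b: "length (s r) \<le> b" "1 \<le> b" and e: "s 13 = []" "s 14 = []"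
    and r: "r \<noteq> 13" "r \<noteq> 14" "r \<noteq> out" "out \<noteq> 13" "out \<noteq> 14"
    and s': "s(out := s out @ run \<delta> fin q0 (s r)) = s'"
  shows "ex b (trans \<delta> fin q0 r out) s s'"
proof -
  define F where "F xs = s(out := s out @ out_of \<delta> q0 xs, 13 := [state_of \<delta> q0 xs])" for xs
  have inner: "ex b (seqs [For 13 (\<lambda>q. seqs [emits out (snd (\<delta> q a)), App 14 (fst (\<delta> q a))]),
        Clr 13, each 14 13 (\<lambda>q. [q]), Clr 14]) (F xs) (F (xs @ [a]))" for xs a
  proof -
    define q where "q = state_of \<delta> q0 xs"
    define s1 where "s1 = (F xs)(out := s out @ out_of \<delta> q0 (xs @ [a]), 14 := [fst (\<delta> q a)])"
    \<comment> \<open>Register 13 holds a single symbol, so this loop is a case distinction on the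
      state.\<close>
    have "ex b (For 13 (\<lambda>q. seqs [emits out (snd (\<delta> q a)), App 14 (fst (\<delta> q a))])) (F xs) s1"
    proof (rule ex_For[where F = "\<lambda>ys. if ys = [] then F xs else s1"])
      fix ys c zs assume "F xs 13 = ys @ c # zs"
      then have c: "ys = []" "c = q" by (auto simp: F_def q_def Cons_eq_append_conv)
      show "ex b (seqs [emits out (snd (\<delta> c a)), App 14 (fst (\<delta> c a))]) (if ys = [] then F xs else s1)
          (if ys @ [c] = [] then F xs else s1)"
        using c r e
        by (auto intro!: ex_Cons[OF ex_emits[OF refl]] ex_Cons[OF ex_App[OF refl]] ex_Nil
            simp: s1_def F_def out_of_snoc q_def fun_eq_iff simp del: seqs.simps)
    qed (use b in \<open>auto simp: F_def s1_def\<close>)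
    then show ?thesis
    proof (rule ex_Cons)
      show "ex b (seqs [Clr 13, each 14 13 (\<lambda>q. [q]), Clr 14]) s1 (F (xs @ [a]))"
      proof (rule ex_Cons[OF ex_Clr[OF _ refl]])
        show "length (s1 13) \<le> b" using r b by (simp add: s1_def F_def)
        show "ex b (seqs [each 14 13 (\<lambda>q. [q]), Clr 14]) (s1(13 := [])) (F (xs @ [a]))"
          by (intro ex_Cons[OF ex_each[OF _ _ refl]] ex_Cons[OF ex_Clr[OF _ refl]] ex_Nil)
             (use r b e in \<open>auto simp: s1_def F_def state_of_snoc q_def fun_eq_iff\<close>)
      qed
    qed
  qed
  show ?thesis unfolding trans_def
  proof (rule ex_Cons[OF ex_App[OF refl]], rule ex_Cons)
    show "ex b (For r (\<lambda>a. seqs [For 13 (\<lambda>q. seqs [emits out (snd (\<delta> q a)), App 14 (fst (\<delta> q a))]),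
        Clr 13, each 14 13 (\<lambda>q. [q]), Clr 14])) (s(13 := s 13 @ [q0])) (F (s r))"
      by (rule ex_For[where F = F]) (use b r e inner in \<open>auto simp: F_def\<close>)
    show "ex b (seqs [For 13 (\<lambda>q. emits out (fin q)), Clr 13]) (F (s r)) s'"
    proof (rule ex_Cons)
      show "ex b (For 13 (\<lambda>q. emits out (fin q))) (F (s r)) ((F (s r))(out := s out @ run \<delta> fin q0 (s r)))"
        unfolding each_def[symmetric]
        by (rule ex_each) (use b r in \<open>auto simp: F_def run_def fun_eq_iff\<close>)
      show "ex b (seqs [Clr 13]) ((F (s r))(out := s out @ run \<delta> fin q0 (s r))) s'"
        unfolding s'[symmetric]
        by (intro ex_Cons[OF ex_Clr[OF _ refl]] ex_Nil) (use b r e in \<open>auto simp: F_def fun_eq_iff\<close>)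
    qed
  qed
qed

text \<open>A loop must not write to the register that it scans, hence the detour through register
  15.\<close>

definition upd :: "(nat \<Rightarrow> nat \<Rightarrow> nat \<times> nat list) \<Rightarrow> (nat \<Rightarrow> nat list) \<Rightarrow> nat \<Rightarrow> nat \<Rightarrow> prog" where
  "upd \<delta> fin q0 r = seqs [trans \<delta> fin q0 r 15, Clr r, each 15 r (\<lambda>a. [a]), Clr 15]"

lemma wf_upd:
  assumes "15 < k" "r < k" "r \<notin> {13, 14, 15}" "X \<inter> {13, 14, 15, r} = {}" "q0 < S"
    "\<And>q a. q < S \<Longrightarrow> a < S \<Longrightarrow> fst (\<delta> q a) < S \<and> set (snd (\<delta> q a)) \<subseteq> {..<S}"
    "\<And>q. q < S \<Longrightarrow> set (fin q) \<subseteq> {..<S}"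
  shows "wf_prog k S X (upd \<delta> fin q0 r)"
proof -
  have "wf_prog k S X (trans \<delta> fin q0 r 15)"
  proof (rule wf_trans)
    show "fst (\<delta> q a) < S \<and> set (snd (\<delta> q a)) \<subseteq> {..<S}" if "q < S" "a < S" for q a
      using assms(6) that by blast
    show "set (fin q) \<subseteq> {..<S}" if "q < S" for q using assms(7) that by blast
  qed (use assms(1-5) in auto)
  then show ?thesis using assms(1-5) by (auto simp: upd_def)
qed

lemma ex_upd:
  assumes "length (s r) \<le> b" "1 \<le> b" "length (run \<delta> fin q0 (s r)) \<le> b" "s 13 = []" "s 14 = []" "s 15 = []"
    and "r \<noteq> 13" "r \<noteq> 14" "r \<noteq> 15" "s(r := run \<delta> fin q0 (s r)) = s'"
  shows "ex b (upd \<delta> fin q0 r) s s'"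
  unfolding upd_def assms(10)[symmetric]
  by (intro ex_Cons[OF ex_trans[OF _ _ _ _ _ _ _ _ _ refl]] ex_Cons[OF ex_Clr[OF _ refl]]
       ex_Cons[OF ex_each[OF _ _ refl]] ex_Nil)
     (use assms(1-9) in \<open>auto simp: fun_eq_iff\<close>)

subsection \<open>Binary counters\<close>

definition enc :: "nat \<Rightarrow> nat list" where
  "enc n = bits (encode_nat n)"

text \<open>State 1 is the carry; the least significant digit comes first.\<close>

definition inc_step :: "nat \<Rightarrow> nat \<Rightarrow> nat \<times> nat list" where
  "inc_step q a = (if q = 0 then (0, [a]) else if a = 0 then (0, [1]) else (1, [0]))"

definition inc_fin :: "nat \<Rightarrow> nat list" where
  "inc_fin q = (if q = 0 then [] else [1])"

lemma run_inc0: "run inc_step inc_fin 0 w = w"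
  by (induction w) (auto simp: inc_step_def inc_fin_def)

lemma run_inc: "run inc_step inc_fin 1 (enc n) = enc (Suc n)"
proof (induction n rule: less_induct)
  case (less n)
  show ?case
  proof (cases "n = 0")
    case True
    then show ?thesis by (simp add: enc_def bits_def encode_nat.simps inc_fin_def)
  next
    case False
    have e: "enc n = of_bool (odd n) # enc (n div 2)"
      using False by (simp add: enc_def bits_def encode_nat.simps[of n])
    have e': "enc (Suc n) = of_bool (even n) # enc (Suc n div 2)"
      by (simp add: enc_def bits_def encode_nat.simps[of "Suc n"])
    have st: "inc_step (Suc 0) 0 = (0, [1])" "inc_step (Suc 0) (Suc 0) = (1, [0])" by (simp_all add: inc_step_def)
    show ?thesis
    proof (cases "even n")
      case True
      then show ?thesis by (simp add: e e' st run_inc0)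
    next
      case odd: False
      then have "Suc n div 2 = Suc (n div 2)" by presburger
      moreover have "n div 2 < n" using False by simp
      ultimately show ?thesis using odd less[of "n div 2"] by (simp add: e e' st)
    qed
  qed
qed

lemma length_enc: "length (enc n) \<le> n"
proof (induction n rule: less_induct)
  case (less n)
  show ?case
  proof (cases "n = 0")
    case True
    then show ?thesis by (simp add: enc_def bits_def encode_nat.simps)
  next
    case False
    have "enc n = of_bool (odd n) # enc (n div 2)"
      using False by (simp add: enc_def bits_def encode_nat.simps[of n])
    moreover have "n div 2 < n" using False by simp
    ultimately show ?thesis using less[of "n div 2"] by simp
  qed
qed

lemma set_enc: "set (enc n) \<subseteq> {0, 1}"
  unfolding enc_def by (rule set_bits)

definition incr :: "nat \<Rightarrow> prog" where
  "incr r = upd inc_step inc_fin 1 r"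

lemma wf_incr:
  "15 < k \<Longrightarrow> r < k \<Longrightarrow> r \<notin> {13, 14, 15} \<Longrightarrow> X \<inter> {13, 14, 15, r} = {} \<Longrightarrow> 2 \<le> S \<Longrightarrow> wf_prog k S X (incr r)"
  unfolding incr_def by (rule wf_upd) (auto simp: inc_step_def inc_fin_def)

lemma ex_incr:
  assumes "s r = enc n" "Suc n \<le> b" "s 13 = []" "s 14 = []" "s 15 = []" "r \<noteq> 13" "r \<noteq> 14" "r \<noteq> 15"
    "s(r := enc (Suc n)) = s'"
  shows "ex b (incr r) s s'"
  unfolding incr_def using assms length_enc[of n] length_enc[of "Suc n"] run_inc[of n]
  by (intro ex_upd) auto

subsection \<open>Printing points\<close>

definition stuff :: "nat list \<Rightarrow> nat list" where
  "stuff w = concat (map (\<lambda>a. [1, a]) w)"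

lemma stuff_append [simp]: "stuff (u @ w) = stuff u @ stuff w"
  by (simp add: stuff_def)

lemma stuff_Cons: "stuff (a # w) = 1 # a # stuff w" and stuff_Nil: "stuff [] = []"
  by (simp_all add: stuff_def)

lemma bits_append [simp]: "bits (u @ w) = bits u @ bits w"
  by (simp add: bits_def)

lemma bits_delimit: "bits (delimit w) = stuff (bits w) @ [0]"
  by (induction w) (auto simp: bits_def stuff_def)

text \<open>A binary digit of a coordinate lies below three levels of \<open>delimit\<close>: the
  integer in its rational number, this number in the point, and the point in the list. Stuffing acts
  on each symbol separately, so a counter can be printed digit by digit.\<close>

definition stuff3 :: "nat list \<Rightarrow> nat list" where
  "stuff3 w = stuff (stuff (stuff w))"

lemma stuff3_append: "stuff3 (u @ w) = stuff3 u @ stuff3 w"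
  by (simp add: stuff3_def)

lemma stuff3_concat: "stuff3 w = concat (map (\<lambda>a. stuff3 [a]) w)"
proof (induction w)
  case Nil
  show ?case by (simp add: stuff3_def stuff_def)
next
  case (Cons a w)
  then show ?case using stuff3_append[of "[a]" w] by simp
qed

lemma set_stuff: "set (stuff w) \<subseteq> insert 1 (set w)"
  by (auto simp: stuff_def)

lemma set_stuff3: "set (stuff3 w) \<subseteq> insert 1 (set w)"
  unfolding stuff3_def using set_stuff[of w] set_stuff[of "stuff w"] set_stuff[of "stuff (stuff w)"] by blast

text \<open>The end mark of a numerator, the denominator 1, and the end mark of the
  coordinate.\<close>

definition point_sep :: "nat list" where
  "point_sep = stuff (stuff (0 # bits (delimit [False, True]))) @ stuff [0]"

lemma set_point_sep: "set point_sep \<subseteq> {0, 1}"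
  by (auto simp: point_sep_def bits_def stuff_def)

definition point_code :: "nat \<times> nat \<Rightarrow> nat list" where
  "point_code z = bits (delimit (encode_point (rat_pt z)))"

lemma point_code_eq:
  assumes "bits (encode_nat x) = px @ cx" "bits (encode_nat y) = py @ cy"
  shows "point_code (x, y) = stuff3 (0 # px) @ stuff3 cx @ point_sep @ stuff3 (0 # py) @ stuff3 cy @ point_sep @ [0]"
proof -
  have q: "quotient_of (of_nat n) = (int n, 1)" for n
    using quotient_of_int[of "int n"] by simp
  have rat: "bits (encode_rat (of_nat n)) = stuff (0 # bits (encode_nat n)) @ [0] @ bits (delimit [False, True])" for n
  proof -
    have one: "encode_nat 1 = [True]"
      by (subst encode_nat.simps, simp, subst encode_nat.simps, simp)
    have "encode_rat (of_nat n) = delimit (False # encode_nat n) @ delimit [False, True]"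
      using one by (simp add: encode_rat_def q encode_list_def encode_int_def del: delimit.simps)
    moreover have "bits (False # w) = 0 # bits w" for w by (simp add: bits_def)
    ultimately show ?thesis by (simp add: bits_delimit del: delimit.simps)
  qed
  show ?thesis
    unfolding point_code_def rat_pt_def encode_point_def fst_conv snd_conv bits_delimit encode_list_def
    using assms by (simp add: bits_delimit rat stuff3_def point_sep_def stuff_Cons stuff_Nil del: delimit.simps)
qed

text \<open>Registers 9 and 10 contain the leading binary digits of the two coordinates.\<close>

definition print_pt :: "nat \<Rightarrow> nat list \<Rightarrow> nat list \<Rightarrow> prog" where
  "print_pt out px py = seqs [emits out (stuff3 (0 # px)), each 9 out (\<lambda>a. stuff3 [a]), emits out point_sep,
     emits out (stuff3 (0 # py)), each 10 out (\<lambda>a. stuff3 [a]), emits out (point_sep @ [0])]"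

lemma wf_print_pt:
  assumes "15 < k" "out < k" "out \<notin> {9, 10}" "X \<inter> {9, 10, out} = {}" "2 \<le> S" "set px \<subseteq> {0, 1}" "set py \<subseteq> {0, 1}"
  shows "wf_prog k S X (print_pt out px py)"
proof -
  have "c < S" if "c \<in> set (stuff3 (0 # px)) \<union> set (stuff3 (0 # py)) \<union> set point_sep" for c
    using that set_stuff3[of "0 # px"] set_stuff3[of "0 # py"] set_point_sep assms(5-7) by fastforce
  moreover have "c < S" if "c \<in> set (stuff3 [a])" "a < S" for c a
    using that set_stuff3[of "[a]"] assms(5) by fastforce
  ultimately show ?thesis using assms by (auto simp: print_pt_def)
qed

lemma ex_print_pt:
  assumes "bits (encode_nat x) = px @ s 9" "bits (encode_nat y) = py @ s 10"
    "length (s 9) \<le> b" "length (s 10) \<le> b" "out \<noteq> 9" "out \<noteq> 10" "s(out := s out @ point_code (x, y)) = s'"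
  shows "ex b (print_pt out px py) s s'"
  unfolding print_pt_def assms(7)[symmetric]
  by (intro ex_Cons[OF ex_emits[OF refl]] ex_Cons[OF ex_each[OF _ _ refl]] ex_Nil)
     (use assms(1-6) point_code_eq[OF assms(1,2)] stuff3_concat[of "s 9"] stuff3_concat[of "s 10"] in
       \<open>auto simp: fun_eq_iff\<close>)

definition print_many :: "nat \<Rightarrow> nat \<Rightarrow> nat list \<Rightarrow> nat list \<Rightarrow> prog" where
  "print_many n out px py = seqs (replicate n (print_pt out px py))"

lemma wf_print_many:
  assumes "15 < k" "out < k" "out \<notin> {9, 10}" "X \<inter> {9, 10, out} = {}" "2 \<le> S" "set px \<subseteq> {0, 1}" "set py \<subseteq> {0, 1}"
  shows "wf_prog k S X (print_many n out px py)"
  using wf_print_pt[OF assms] by (simp add: print_many_def)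

lemma ex_print_many:
  assumes "bits (encode_nat x) = px @ s 9" "bits (encode_nat y) = py @ s 10"
    "length (s 9) \<le> b" "length (s 10) \<le> b" "out \<noteq> 9" "out \<noteq> 10"
    "s(out := s out @ concat (replicate n (point_code (x, y)))) = s'"
  shows "ex b (print_many n out px py) s s'"
proof -
  define F where "F i = s(out := s out @ concat (replicate i (point_code (x, y))))" for i
  have "ex b (print_pt out px py) (F i) (F (Suc i))" for i
  proof -
    have "concat (replicate i (point_code (x, y))) @ point_code (x, y) = point_code (x, y) @ concat (replicate i (point_code (x, y)))"
      by (induction i) auto
    then show ?thesis using assms(1-6) by (intro ex_print_pt) (auto simp: F_def)
  qed
  then have "ex b (seqs (replicate n (print_pt out px py))) (F 0) (F n)"
    using ex_seqs[of "replicate n (print_pt out px py)" b F] by simp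
  then show ?thesis using assms(7) by (simp add: print_many_def F_def)
qed

lemma encode_nat_double: "m = 2 * n \<Longrightarrow> 0 < n \<Longrightarrow> encode_nat m = False # encode_nat n"
  "m = Suc (2 * n) \<Longrightarrow> encode_nat m = True # encode_nat n"
  by (simp_all add: encode_nat.simps[of "2 * n"] encode_nat.simps[of "Suc (2 * n)"])

text \<open>The spacings 16 and 32 are powers of two and the least significant digit comes first.
  Hence every coordinate that depends on a row or a column is a fixed prefix followed by a counter,
  and printing it takes no arithmetic.\<close>

lemma encode_prefixes:
  "bits (encode_nat (16 * j + 8)) = [0, 0, 0, 1] @ enc j"
  "bits (encode_nat (16 * (j + 1))) = [0, 0, 0, 0] @ enc (Suc j)"
  "bits (encode_nat (32 * (j + 1))) = [0, 0, 0, 0, 0] @ enc (Suc j)"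
  "bits (encode_nat (32 * (j + 1) + 8)) = [0, 0, 0, 1, 0] @ enc (Suc j)"
  "bits (encode_nat (32 * (j + 1) + 16)) = [0, 0, 0, 0, 1] @ enc (Suc j)"
  "bits (encode_nat (32 * (j + 1) + 24)) = [0, 0, 0, 1, 1] @ enc (Suc j)"
proof -
  have "encode_nat (16 * j + 8) = False # encode_nat (8 * j + 4)" by (rule encode_nat_double(1)) simp_all
  moreover have "encode_nat (8 * j + 4) = False # encode_nat (4 * j + 2)" by (rule encode_nat_double(1)) simp_all
  moreover have "encode_nat (4 * j + 2) = False # encode_nat (2 * j + 1)" by (rule encode_nat_double(1)) simp_all
  moreover have "encode_nat (2 * j + 1) = True # encode_nat (j)" by (rule encode_nat_double(2)) simp_all
  ultimately show "bits (encode_nat (16 * j + 8)) = [0, 0, 0, 1] @ enc j" by (simp add: bits_def enc_def)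
  have "encode_nat (16 * (j + 1)) = False # encode_nat (8 * (j + 1))" by (rule encode_nat_double(1)) simp_all
  moreover have "encode_nat (8 * (j + 1)) = False # encode_nat (4 * (j + 1))" by (rule encode_nat_double(1)) simp_all
  moreover have "encode_nat (4 * (j + 1)) = False # encode_nat (2 * (j + 1))" by (rule encode_nat_double(1)) simp_all
  moreover have "encode_nat (2 * (j + 1)) = False # encode_nat ((j + 1))" by (rule encode_nat_double(1)) simp_all
  ultimately show "bits (encode_nat (16 * (j + 1))) = [0, 0, 0, 0] @ enc (Suc j)" by (simp add: bits_def enc_def)
  have "encode_nat (32 * (j + 1)) = False # encode_nat (16 * (j + 1))" by (rule encode_nat_double(1)) simp_all
  moreover have "encode_nat (16 * (j + 1)) = False # encode_nat (8 * (j + 1))" by (rule encode_nat_double(1)) simp_all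
  moreover have "encode_nat (8 * (j + 1)) = False # encode_nat (4 * (j + 1))" by (rule encode_nat_double(1)) simp_all
  moreover have "encode_nat (4 * (j + 1)) = False # encode_nat (2 * (j + 1))" by (rule encode_nat_double(1)) simp_all
  moreover have "encode_nat (2 * (j + 1)) = False # encode_nat ((j + 1))" by (rule encode_nat_double(1)) simp_all
  ultimately show "bits (encode_nat (32 * (j + 1))) = [0, 0, 0, 0, 0] @ enc (Suc j)" by (simp add: bits_def enc_def)
  have "encode_nat (32 * (j + 1) + 8) = False # encode_nat (16 * (j + 1) + 4)" by (rule encode_nat_double(1)) simp_all
  moreover have "encode_nat (16 * (j + 1) + 4) = False # encode_nat (8 * (j + 1) + 2)" by (rule encode_nat_double(1)) simp_all
  moreover have "encode_nat (8 * (j + 1) + 2) = False # encode_nat (4 * (j + 1) + 1)" by (rule encode_nat_double(1)) simp_all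
  moreover have "encode_nat (4 * (j + 1) + 1) = True # encode_nat (2 * (j + 1))" by (rule encode_nat_double(2)) simp_all
  moreover have "encode_nat (2 * (j + 1)) = False # encode_nat ((j + 1))" by (rule encode_nat_double(1)) simp_all
  ultimately show "bits (encode_nat (32 * (j + 1) + 8)) = [0, 0, 0, 1, 0] @ enc (Suc j)" by (simp add: bits_def enc_def)
  have "encode_nat (32 * (j + 1) + 16) = False # encode_nat (16 * (j + 1) + 8)" by (rule encode_nat_double(1)) simp_all
  moreover have "encode_nat (16 * (j + 1) + 8) = False # encode_nat (8 * (j + 1) + 4)" by (rule encode_nat_double(1)) simp_all
  moreover have "encode_nat (8 * (j + 1) + 4) = False # encode_nat (4 * (j + 1) + 2)" by (rule encode_nat_double(1)) simp_all
  moreover have "encode_nat (4 * (j + 1) + 2) = False # encode_nat (2 * (j + 1) + 1)" by (rule encode_nat_double(1)) simp_all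
  moreover have "encode_nat (2 * (j + 1) + 1) = True # encode_nat ((j + 1))" by (rule encode_nat_double(2)) simp_all
  ultimately show "bits (encode_nat (32 * (j + 1) + 16)) = [0, 0, 0, 0, 1] @ enc (Suc j)" by (simp add: bits_def enc_def)
  have "encode_nat (32 * (j + 1) + 24) = False # encode_nat (16 * (j + 1) + 12)" by (rule encode_nat_double(1)) simp_all
  moreover have "encode_nat (16 * (j + 1) + 12) = False # encode_nat (8 * (j + 1) + 6)" by (rule encode_nat_double(1)) simp_all
  moreover have "encode_nat (8 * (j + 1) + 6) = False # encode_nat (4 * (j + 1) + 3)" by (rule encode_nat_double(1)) simp_all
  moreover have "encode_nat (4 * (j + 1) + 3) = True # encode_nat (2 * (j + 1) + 1)" by (rule encode_nat_double(2)) simp_all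
  moreover have "encode_nat (2 * (j + 1) + 1) = True # encode_nat ((j + 1))" by (rule encode_nat_double(2)) simp_all
  ultimately show "bits (encode_nat (32 * (j + 1) + 24)) = [0, 0, 0, 1, 1] @ enc (Suc j)" by (simp add: bits_def enc_def)
qed

section \<open>Printing the grid instance\<close>

definition clean :: "store \<Rightarrow> bool" where
  "clean s \<longleftrightarrow> s 13 = [] \<and> s 14 = [] \<and> s 15 = []"

text \<open>Register 7 holds the cells of the tableau, register 9 the column number, register 10 the row
  number plus one, and registers 11 and 12 collect the encoded sources and sinks.\<close>

definition col :: "nat \<Rightarrow> bool \<Rightarrow> prog" where
  "col g w = seqs [print_many g 11 [0, 0, 0, 1] [0, 0, 0, 0, 1], incr 9,
     print_many (3 * g) 11 [0, 0, 0, 0] [0, 0, 0, 1, 0],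
     print_many (if w then 2 * g else 3 * g) 11 [0, 0, 0, 0] [0, 0, 0, 1, 1],
     print_pt 12 [0, 0, 0, 0] [0, 0, 0, 0, 0], print_pt 12 [0, 0, 0, 0] [0, 0, 0, 0, 1]]"

text \<open>\<open>ipos 0\<close> can stand for \<open>ipos m\<close> here, since only the position
  of \<open>Cb\<close> depends on \<open>m\<close>.\<close>

definition blk_src :: "nat \<Rightarrow> nat \<Rightarrow> nat \<Rightarrow> bool \<Rightarrow> nat list" where
  "blk_src g i j w = concat (replicate g (point_code (ipos 0 (Hi i j)))) @
     concat (replicate (3 * g) (point_code (ipos 0 (Ti i j)))) @
     concat (replicate (if w then 2 * g else 3 * g) (point_code (ipos 0 (Bi i j))))"

definition blk_snk :: "nat \<Rightarrow> nat \<Rightarrow> nat list" where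
  "blk_snk i j = point_code (spos (Bo i j)) @ point_code (spos (Hu i j))"

lemma wf_col: "15 < k \<Longrightarrow> X \<inter> {9, 10, 11, 12, 13, 14, 15} = {} \<Longrightarrow> 2 \<le> S \<Longrightarrow> wf_prog k S X (col g w)"
  by (auto simp: col_def intro!: wf_print_many wf_print_pt wf_incr)

lemma ex_many:
  assumes "bits (encode_nat x) = px @ cx" "bits (encode_nat y) = py @ cy" "s 9 = cx" "s 10 = cy"
    "length cx \<le> b" "length cy \<le> b" "out \<noteq> 9" "out \<noteq> 10"
    "s(out := s out @ concat (replicate n (point_code (x, y)))) = s'"
  shows "ex b (print_many n out px py) s s'"
  by (rule ex_print_many[of x px s y py]) (use assms in auto)

lemma ex_one:
  assumes "bits (encode_nat x) = px @ cx" "bits (encode_nat y) = py @ cy" "s 9 = cx" "s 10 = cy"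
    "length cx \<le> b" "length cy \<le> b" "out \<noteq> 9" "out \<noteq> 10" "s(out := s out @ point_code (x, y)) = s'"
  shows "ex b (print_pt out px py) s s'"
  by (rule ex_print_pt[of x px s y py]) (use assms in auto)

lemma ex_col:
  assumes "clean s" "s 9 = enc j" "s 10 = enc (Suc i)" "Suc j \<le> b" "Suc i \<le> b"
    "s(9 := enc (Suc j), 11 := s 11 @ blk_src g i j w, 12 := s 12 @ blk_snk i j) = s'"
  shows "ex b (col g w) s s'"
proof -
  have len: "length (enc j) \<le> b" "length (enc (Suc j)) \<le> b" "length (enc (Suc i)) \<le> b"
    using length_enc[of j] length_enc[of "Suc j"] length_enc[of "Suc i"] assms by auto
  let ?H = "concat (replicate g (point_code (ipos 0 (Hi i j))))"
  let ?T = "concat (replicate (3 * g) (point_code (ipos 0 (Ti i j))))"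
  let ?B = "concat (replicate (if w then 2 * g else 3 * g) (point_code (ipos 0 (Bi i j))))"
  have 1: "ex b (print_many g 11 [0, 0, 0, 1] [0, 0, 0, 0, 1]) s (s(11 := s 11 @ ?H))"
    by (rule ex_many[OF encode_prefixes(1)[of j] encode_prefixes(5)[of i]])
       (use assms(1-5) len in \<open>auto simp:  fun_eq_iff\<close>)
  \<comment> \<open>\<open>Hi i j\<close> has the abscissa \<open>16 * j + 8\<close> and the other
    points of the column have \<open>16 * (j + 1)\<close>, so the counter is raised between
    them.\<close>
  have 2: "ex b (incr 9) (s(11 := s 11 @ ?H)) (s(9 := enc (Suc j), 11 := s 11 @ ?H))"
    by (rule ex_incr[where n = j]) (use assms in \<open>auto simp: clean_def fun_eq_iff\<close>)
  have 3: "ex b (print_many (3 * g) 11 [0, 0, 0, 0] [0, 0, 0, 1, 0]) (s(9 := enc (Suc j), 11 := s 11 @ ?H))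
      (s(9 := enc (Suc j), 11 := s 11 @ ?H @ ?T))"
    by (rule ex_many[OF encode_prefixes(2)[of j] encode_prefixes(4)[of i]])
       (use assms(1-5) len in \<open>auto simp:  fun_eq_iff\<close>)
  have 4: "ex b (print_many (if w then 2 * g else 3 * g) 11 [0, 0, 0, 0] [0, 0, 0, 1, 1]) (s(9 := enc (Suc j), 11 := s 11 @ ?H @ ?T))
      (s(9 := enc (Suc j), 11 := s 11 @ blk_src g i j w))"
    by (rule ex_many[OF encode_prefixes(2)[of j] encode_prefixes(6)[of i]])
       (use assms(1-5) len in \<open>auto simp:  blk_src_def fun_eq_iff\<close>)
  have 5: "ex b (print_pt 12 [0, 0, 0, 0] [0, 0, 0, 0, 0]) (s(9 := enc (Suc j), 11 := s 11 @ blk_src g i j w))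
      (s(9 := enc (Suc j), 11 := s 11 @ blk_src g i j w, 12 := s 12 @ point_code (spos (Bo i j))))"
    by (rule ex_one[OF encode_prefixes(2)[of j] encode_prefixes(3)[of i]])
       (use assms(1-5) len in \<open>auto simp:  fun_eq_iff\<close>)
  have 6: "ex b (print_pt 12 [0, 0, 0, 0] [0, 0, 0, 0, 1])
      (s(9 := enc (Suc j), 11 := s 11 @ blk_src g i j w, 12 := s 12 @ point_code (spos (Bo i j)))) s'"
    unfolding assms(6)[symmetric]
    by (rule ex_one[OF encode_prefixes(2)[of j] encode_prefixes(5)[of i]])
       (use assms(1-5) len in \<open>auto simp:  blk_snk_def fun_eq_iff\<close>)
  show ?thesis unfolding col_def
    by (rule ex_Cons[OF 1] ex_Cons[OF 2] ex_Cons[OF 3] ex_Cons[OF 4] ex_Cons[OF 5] ex_Cons[OF 6] ex_Nil refl)+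
qed

primrec cols_src :: "nat \<Rightarrow> nat \<Rightarrow> nat \<Rightarrow> bool list \<Rightarrow> nat list" where
  "cols_src g i j [] = []"
| "cols_src g i j (w # ws) = blk_src g i j w @ cols_src g i (Suc j) ws"

primrec cols_snk :: "nat \<Rightarrow> nat \<Rightarrow> nat \<Rightarrow> nat list" where
  "cols_snk i j 0 = []"
| "cols_snk i j (Suc n) = blk_snk i j @ cols_snk i (Suc j) n"

lemma cols_src_append: "cols_src g i j (us @ ws) = cols_src g i j us @ cols_src g i (j + length us) ws"
  by (induction us arbitrary: j) auto

lemma cols_snk_append: "cols_snk i j (m + n) = cols_snk i j m @ cols_snk i (j + m) n"
  by (induction m arbitrary: j) auto

lemma cols_src_nth: "cols_src g i j ws = concat (map (\<lambda>l. blk_src g i (j + l) (ws ! l)) [0..<length ws])"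
proof (induction ws arbitrary: j)
  case (Cons w ws)
  have "[0..<length (w # ws)] = 0 # map Suc [0..<length ws]"
    by (simp add: upt_conv_Cons map_Suc_upt del: upt_Suc)
  then show ?case using Cons[of "Suc j"] by (simp add: comp_def)
qed simp

lemma cols_snk_nth: "cols_snk i j n = concat (map (\<lambda>l. blk_snk i (j + l)) [0..<n])"
proof (induction n arbitrary: j)
  case (Suc n)
  have "[0..<Suc n] = 0 # map Suc [0..<n]"
    by (simp add: upt_conv_Cons map_Suc_upt del: upt_Suc)
  then show ?case using Suc[of "Suc j"] by (simp add: comp_def)
qed simp

lemma ex_cols:
  assumes "clean s" "s 9 = enc j" "s 10 = enc (Suc i)" "j + length ws \<le> b" "Suc i \<le> b"
    "s(9 := enc (j + length ws), 11 := s 11 @ cols_src g i j ws, 12 := s 12 @ cols_snk i j (length ws)) = s'"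
  shows "ex b (seqs (map (col g) ws)) s s'"
  using assms
proof (induction ws arbitrary: s j)
  case Nil
  have "s = s'" unfolding Nil.prems(6)[symmetric] using Nil.prems(2) by (auto simp: fun_eq_iff)
  then show ?case by (simp add: ex_Skip)
next
  case (Cons w ws)
  define s1 where "s1 = s(9 := enc (Suc j), 11 := s 11 @ blk_src g i j w, 12 := s 12 @ blk_snk i j)"
  have "ex b (col g w) s s1" by (rule ex_col[of s j i]) (use Cons.prems s1_def in auto)
  moreover have "ex b (seqs (map (col g) ws)) s1 s'"
  proof (rule Cons.IH)
    show "s1(9 := enc (Suc j + length ws), 11 := s1 11 @ cols_src g i (Suc j) ws, 12 := s1 12 @ cols_snk i (Suc j) (length ws)) = s'"
      unfolding Cons.prems(6)[symmetric] by (auto simp: s1_def fun_eq_iff)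
  qed (use Cons.prems(1-5) in \<open>auto simp: s1_def clean_def\<close>)
  ultimately show ?case by (simp add: ex_Seq)
qed

text \<open>The leading \<open>col g True\<close> is the extra literal, which occurs in every
  clause. The group printed behind the loop is the row group in excess of the hubs.\<close>

definition row :: "nat \<Rightarrow> (nat \<Rightarrow> bool list) \<Rightarrow> prog" where
  "row g f = seqs [col g True, For 7 (\<lambda>a. seqs (map (col g) (f a))),
     print_many g 11 [0, 0, 0, 1] [0, 0, 0, 0, 1], Clr 9, incr 10]"

definition row_src :: "nat \<Rightarrow> nat \<Rightarrow> bool list \<Rightarrow> nat list" where
  "row_src g i ws = cols_src g i 0 ws @ concat (replicate g (point_code (ipos 0 (Hi i (length ws)))))"

lemma wf_row: "15 < k \<Longrightarrow> X \<inter> {7, 9, 10, 11, 12, 13, 14, 15} = {} \<Longrightarrow> 2 \<le> S \<Longrightarrow> wf_prog k S X (row g f)"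
  by (auto simp: row_def intro!: wf_print_many wf_incr wf_col)

lemma ex_row:
  assumes "clean s" "s 9 = []" "s 10 = enc (Suc i)" "ws = True # concat (map f (s 7))"
    "length ws \<le> b" "length (s 7) \<le> b" "Suc (Suc i) \<le> b"
    "s(10 := enc (Suc (Suc i)), 11 := s 11 @ row_src g i ws, 12 := s 12 @ cols_snk i 0 (length ws)) = s'"
  shows "ex b (row g f) s s'"
proof -
  define F where "F xs = s(9 := enc (length (True # concat (map f xs))),
     11 := s 11 @ cols_src g i 0 (True # concat (map f xs)),
     12 := s 12 @ cols_snk i 0 (length (True # concat (map f xs))))" for xs
  have e0: "enc 0 = []" by (simp add: enc_def bits_def encode_nat.simps)
  have 1: "ex b (col g True) s (F [])"
    by (rule ex_col[of s 0 i]) (use assms e0 in \<open>auto simp: F_def\<close>)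
  have F7: "F [] 7 = s 7" by (simp add: F_def)
  have 2: "ex b (For 7 (\<lambda>a. seqs (map (col g) (f a)))) (F []) (F (s 7))"
  proof (rule ex_For[where F = F])
    fix xs a ys assume "F [] 7 = xs @ a # ys"
    then have sp: "s 7 = xs @ a # ys" using F7 by simp
    have l: "length (True # concat (map f xs)) + length (f a) \<le> b"
      using assms(5) unfolding assms(4) sp by simp
    show "ex b (seqs (map (col g) (f a))) (F xs) (F (xs @ [a]))"
    proof (rule ex_cols)
      show "(F xs)(9 := enc (length (True # concat (map f xs)) + length (f a)),
         11 := F xs 11 @ cols_src g i (length (True # concat (map f xs))) (f a),
         12 := F xs 12 @ cols_snk i (length (True # concat (map f xs))) (length (f a))) = F (xs @ [a])"
        using cols_src_append[of g i 0 "True # concat (map f xs)" "f a"]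
          cols_snk_append[of i 0 "length (True # concat (map f xs))" "length (f a)"]
        by (auto simp: F_def fun_eq_iff)
    qed (use assms l in \<open>auto simp: F_def clean_def\<close>)
  qed (use F7 assms in auto)
  have len: "length (enc (length ws)) \<le> b" "length (enc (Suc i)) \<le> b"
    using length_enc[of "length ws"] length_enc[of "Suc i"] assms by auto
  define s3 where "s3 = s(9 := enc (length ws), 11 := s 11 @ row_src g i ws, 12 := s 12 @ cols_snk i 0 (length ws))"
  have 3: "ex b (print_many g 11 [0, 0, 0, 1] [0, 0, 0, 0, 1]) (F (s 7)) s3"
    by (rule ex_many[OF encode_prefixes(1)[of "length ws"] encode_prefixes(5)[of i]])
       (use assms(1-7) len in \<open>auto simp: F_def s3_def assms(4)[symmetric] row_src_def  fun_eq_iff\<close>)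
  have 4: "ex b (Clr 9) s3 (s3(9 := []))" by (rule ex_Clr) (use len in \<open>simp_all add: s3_def\<close>)
  have 5: "ex b (incr 10) (s3(9 := [])) s'"
    unfolding assms(8)[symmetric]
    by (rule ex_incr[where n = "Suc i"]) (use assms(1-7) in \<open>auto simp: s3_def clean_def fun_eq_iff\<close>)
  show ?thesis unfolding row_def
    by (rule ex_Cons[OF 1] ex_Cons[OF 2] ex_Cons[OF 3] ex_Cons[OF 4] ex_Cons[OF 5] ex_Nil refl)+
qed

lemma ex_rows:
  assumes "clean s" "s 9 = []" "s 10 = enc (Suc i0)" "\<And>r. r < length fs \<Longrightarrow> length (concat (map (fs ! r) (s 7))) = n"
    "Suc n \<le> b" "length (s 7) \<le> b" "Suc (i0 + length fs) \<le> b"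
    "s(10 := enc (Suc (i0 + length fs)),
       11 := s 11 @ concat (map (\<lambda>r. row_src g (i0 + r) (True # concat (map (fs ! r) (s 7)))) [0..<length fs]),
       12 := s 12 @ concat (map (\<lambda>r. cols_snk (i0 + r) 0 (Suc n)) [0..<length fs])) = s'"
  shows "ex b (seqs (map (row g) fs)) s s'"
proof -
  define F where "F l = s(10 := enc (Suc (i0 + l)),
       11 := s 11 @ concat (map (\<lambda>r. row_src g (i0 + r) (True # concat (map (fs ! r) (s 7)))) [0..<l]),
       12 := s 12 @ concat (map (\<lambda>r. cols_snk (i0 + r) 0 (Suc n)) [0..<l]))" for l
  have "ex b (seqs (map (row g) fs)) (F 0) (F (length (map (row g) fs)))"
  proof (rule ex_seqs)
    fix l assume "l < length (map (row g) fs)"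
    then have l: "l < length fs" by simp
    have "ex b (row g (fs ! l)) (F l) (F (Suc l))"
    proof (rule ex_row)
      show "True # concat (map (fs ! l) (s 7)) = True # concat (map (fs ! l) (F l 7))" by (simp add: F_def)
      show "(F l)(10 := enc (Suc (Suc (i0 + l))), 11 := F l 11 @ row_src g (i0 + l) (True # concat (map (fs ! l) (s 7))),
        12 := F l 12 @ cols_snk (i0 + l) 0 (length (True # concat (map (fs ! l) (s 7))))) = F (Suc l)"
        using assms(4)[OF l] by (auto simp: F_def fun_eq_iff)
    qed (use assms(1-7) l in \<open>auto simp: F_def clean_def\<close>)
    then show "ex b (map (row g) fs ! l) (F l) (F (Suc l))" using l by simp
  qed
  moreover have "F 0 = s" using assms by (auto simp: F_def fun_eq_iff)
  moreover have "F (length (map (row g) fs)) = s'" unfolding assms(8)[symmetric] by (simp add: F_def)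
  ultimately show ?thesis by simp
qed

subsection \<open>Moving the flags\<close>

text \<open>A symbol is a kind plus 11 times a flag, and the state is the flag of the previous cell.
  Moving all flags by one cell leads from the clauses of \<open>c\<close> to those of
  \<open>c + 1\<close> without computing any address. The term \<open>q mod 4\<close> keeps the
  output below 44 for every state, as \<open>wf_shift\<close> requires.\<close>

definition shift_step :: "nat \<Rightarrow> nat \<Rightarrow> nat \<times> nat list" where
  "shift_step q a = (a div 11, [a mod 11 + 11 * (q mod 4)])"

definition shift :: prog where
  "shift = upd shift_step (\<lambda>_. []) 0 7"

lemma wf_shift: "15 < k \<Longrightarrow> X \<inter> {7, 13, 14, 15} = {} \<Longrightarrow> 44 \<le> S \<Longrightarrow> wf_prog k S X shift"
  unfolding shift_def
proof (rule wf_upd)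
  show "fst (shift_step q a) < S \<and> set (snd (shift_step q a)) \<subseteq> {..<S}" if "44 \<le> S" "q < S" "a < S" for q a
  proof -
    have "a mod 11 + 11 * (q mod 4) < 44" using mod_less_divisor[of 11 a] mod_less_divisor[of 4 q] by linarith
    then show ?thesis using that by (auto simp: shift_step_def intro: le_less_trans[OF div_le_dividend])
  qed
qed auto

text \<open>Kinds are less than 11, so the kind and the flag of a cell share a symbol.\<close>

definition flagged :: "nat list \<Rightarrow> nat \<Rightarrow> nat \<Rightarrow> nat list" where
  "flagged ks W c = map (\<lambda>c'. ks ! c' + 11 * flag W c c') [0..<length ks]"

lemma flag_lt: "flag W c c' < 4"
  by (simp add: flag_def)

lemma run_shift:
  assumes "set ks \<subseteq> {..<11}" "1 \<le> W"
  shows "run shift_step (\<lambda>_. []) 0 (flagged ks W c) = flagged ks W (Suc c)"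
proof -
  have "out_of shift_step 0 (map (\<lambda>c'. ks ! c' + 11 * flag W c c') [0..<n]) = map (\<lambda>c'. ks ! c' + 11 * flag W (Suc c) c') [0..<n]
      \<and> state_of shift_step 0 (map (\<lambda>c'. ks ! c' + 11 * flag W c c') [0..<n]) = (if n = 0 then 0 else flag W c (n - 1))"
    if "n \<le> length ks" for n
    using that
  proof (induction n)
    case (Suc n)
    have k: "ks ! n < 11" using assms(1) Suc.prems by (metis Suc_le_lessD lessThan_iff nth_mem subsetD)
    have "flag W (Suc c) n = (if n = 0 then 0 else flag W c (n - 1))" using assms(2) by (auto simp: flag_def)
    then show ?case using Suc k flag_lt[of W c "n - 1"]
      by (auto simp: out_of_snoc state_of_snoc shift_step_def)
  qed simp
  from this[of "length ks"] show ?thesis by (simp add: run_def flagged_def)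
qed

subsection \<open>All rows\<close>

text \<open>There is one round for each cell. Register 8 has as many symbols as register 7 and
  counts the rounds, because \<open>shift\<close> changes register 7 in the body.\<close>

definition all_rows :: "nat \<Rightarrow> (nat \<Rightarrow> bool list) list \<Rightarrow> prog" where
  "all_rows g fs = For 8 (\<lambda>_. seqs [seqs (map (row g) fs), shift])"

definition row_bits :: "(nat \<Rightarrow> bool list) list \<Rightarrow> nat list \<Rightarrow> nat \<Rightarrow> nat \<Rightarrow> bool list" where
  "row_bits fs ks W i = True # concat (map (fs ! (i mod length fs)) (flagged ks W (i div length fs)))"

lemma wf_all_rows: "15 < k \<Longrightarrow> 44 \<le> S \<Longrightarrow> wf_prog k S {} (all_rows g fs)"
  unfolding all_rows_def by (auto intro!: wf_row wf_shift)

lemma concat_map_blocks: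
  "concat (map f [0..<c * n]) @ concat (map (\<lambda>r. f (c * n + r)) [0..<n]) = concat (map f [0..<Suc c * n])"
proof -
  have "[0..<Suc c * n] = [0..<c * n] @ map (\<lambda>r. c * n + r) [0..<n]"
  proof -
    have "[0..<c * n + n] = [0..<c * n] @ [c * n..<c * n + n]" by (rule upt_add_eq_append) simp
    then show ?thesis by (simp add: map_add_upt add.commute)
  qed
  then show ?thesis by (simp add: comp_def)
qed

lemma ex_all_rows:
  assumes "clean s" "s 9 = []" "s 10 = enc 1" "s 7 = flagged ks W 0" "length (s 8) = length ks"
    and ks: "set ks \<subseteq> {..<11}" "1 \<le> W" and fs: "fs \<noteq> []" "\<And>f a. f \<in> set fs \<Longrightarrow> length (f a) = L"
    and b: "Suc (length ks * L) \<le> b" "length ks \<le> b" "Suc (length ks * length fs) \<le> b" "1 \<le> b"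
    and s': "s(7 := flagged ks W (length ks), 10 := enc (Suc (length ks * length fs)),
       11 := s 11 @ concat (map (\<lambda>i. row_src g i (row_bits fs ks W i)) [0..<length ks * length fs]),
       12 := s 12 @ concat (map (\<lambda>i. cols_snk i 0 (Suc (length ks * L))) [0..<length ks * length fs])) = s'"
  shows "ex b (all_rows g fs) s s'"
proof -
  define n where "n = length fs"
  define F where "F xs = s(7 := flagged ks W (length xs), 10 := enc (Suc (length xs * n)),
       11 := s 11 @ concat (map (\<lambda>i. row_src g i (row_bits fs ks W i)) [0..<length xs * n]),
       12 := s 12 @ concat (map (\<lambda>i. cols_snk i 0 (Suc (length ks * L))) [0..<length xs * n]))" for xs :: "nat list"
  have n0: "0 < n" using fs(1) by (simp add: n_def)
  have lenfl: "length (flagged ks W c) = length ks" for c by (simp add: flagged_def)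
  have lenf: "length (concat (map f zs)) = length zs * L" if "f \<in> set fs" for f zs
    using fs(2)[OF that] by (induction zs) auto
  show ?thesis unfolding all_rows_def
  proof (rule ex_For[where F = F])
    fix xs a ys assume sp: "s 8 = xs @ a # ys"
    define c where "c = length xs"
    have c: "c < length ks" using assms(5) sp by (simp add: c_def)
    define s1 where "s1 = (F xs)(10 := enc (Suc (Suc c * n)),
       11 := s 11 @ concat (map (\<lambda>i. row_src g i (row_bits fs ks W i)) [0..<Suc c * n]),
       12 := s 12 @ concat (map (\<lambda>i. cols_snk i 0 (Suc (length ks * L))) [0..<Suc c * n]))"
    have 1: "ex b (seqs (map (row g) fs)) (F xs) s1"
    proof (rule ex_rows[of "F xs" "c * n" fs "length ks * L"])
      have le: "Suc c * n \<le> length ks * n" using c by (intro mult_le_mono1) simp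
      show "Suc (c * n + length fs) \<le> b" using le b(3) by (simp add: n_def)
      show "length (concat (map (fs ! r) (F xs 7))) = length ks * L" if "r < length fs" for r
        using lenf[of "fs ! r"] that lenfl by (simp add: F_def)
      have "row_bits fs ks W (c * n + r) = True # concat (map (fs ! r) (F xs 7))" if "r < n" for r
        using that by (simp add: row_bits_def F_def c_def n_def[symmetric])
      then have rb: "map (\<lambda>r. row_src g (c * n + r) (True # concat (map (fs ! r) (F xs 7)))) [0..<n]
         = map (\<lambda>r. row_src g (c * n + r) (row_bits fs ks W (c * n + r))) [0..<n]" by auto
      show "(F xs)(10 := enc (Suc (c * n + length fs)),
         11 := F xs 11 @ concat (map (\<lambda>r. row_src g (c * n + r) (True # concat (map (fs ! r) (F xs 7)))) [0..<length fs]),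
         12 := F xs 12 @ concat (map (\<lambda>r. cols_snk (c * n + r) 0 (Suc (length ks * L))) [0..<length fs])) = s1"
        unfolding n_def[symmetric] rb
        using concat_map_blocks[of "\<lambda>i. row_src g i (row_bits fs ks W i)" c n]
          concat_map_blocks[of "\<lambda>i. cols_snk i 0 (Suc (length ks * L))" c n]
        by (auto simp: s1_def F_def fun_eq_iff c_def add.commute)
    qed (use assms(1-5) b lenfl in \<open>auto simp: F_def clean_def c_def n_def\<close>)
    have 2: "ex b shift s1 (F (xs @ [a]))"
      unfolding shift_def
      by (rule ex_upd)
         (use assms(1-5) b lenfl run_shift[OF ks] in \<open>auto simp: F_def s1_def clean_def c_def fun_eq_iff\<close>)
    show "ex b (seqs [seqs (map (row g) fs), shift]) (F xs) (F (xs @ [a]))"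
      by (rule ex_Cons[OF 1 ex_Cons[OF 2 ex_Nil[OF refl]]])
  next
    show "F [] = s" using assms(3,4) by (auto simp: F_def fun_eq_iff)
    show "F (s 8) = s'" unfolding s'[symmetric] using assms(5) by (simp add: F_def n_def)
  qed (use assms(5) b in simp)
qed

subsection \<open>The first and the last row\<close>

text \<open>A row prints the boundary sinks above it. Those below the last row are printed along
  with the groups \<open>Cb\<close>, which is the case \<open>lst\<close>.\<close>

definition edge_sinks :: "bool \<Rightarrow> prog list" where
  "edge_sinks lst = (if lst then [print_pt 12 [0, 0, 0, 0] [0, 0, 0, 0, 0]] else [])"

definition edge_var :: "nat \<Rightarrow> bool \<Rightarrow> prog" where
  "edge_var g lst = seqs ([incr 9] @ edge_sinks lst @ [print_many (3 * g) 11 [0, 0, 0, 1] [0, 0, 0, 0, 0], incr 9] @ edge_sinks lst)"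

definition edge :: "nat \<Rightarrow> nat \<Rightarrow> bool \<Rightarrow> prog" where
  "edge g N lst = seqs ([incr 9] @ edge_sinks lst @ [For 7 (\<lambda>_. seqs (replicate N (edge_var g lst))), Clr 9])"

definition edge_src :: "nat \<Rightarrow> nat \<Rightarrow> nat \<Rightarrow> nat list" where
  "edge_src g i q = concat (replicate (3 * g) (point_code (16 * (2 * q + 2) + 8, 32 * (i + 1))))"

definition edge_snk :: "bool \<Rightarrow> nat \<Rightarrow> nat \<Rightarrow> nat list" where
  "edge_snk lst i q = (if lst then point_code (spos (Bo i (2 * q + 1))) @ point_code (spos (Bo i (2 * q + 2))) else [])"

lemma wf_edge_sinks: "15 < k \<Longrightarrow> X \<inter> {9, 10, 12} = {} \<Longrightarrow> 2 \<le> S \<Longrightarrow> P \<in> set (edge_sinks lst) \<Longrightarrow> wf_prog k S X P"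
  by (auto simp: edge_sinks_def intro!: wf_print_pt split: if_splits)

lemma wf_edge: "15 < k \<Longrightarrow> 2 \<le> S \<Longrightarrow> wf_prog k S {} (edge g N lst)"
proof -
  assume a: "15 < k" "2 \<le> S"
  have es: "\<forall>P\<in>set (edge_sinks lst). wf_prog k S X P" if "X \<inter> {9, 10, 12} = {}" for X
    using wf_edge_sinks[OF a(1) that a(2)] by blast
  have ev: "wf_prog k S {7} (edge_var g lst)"
  proof -
    have "wf_prog k S {7} (incr 9)" "wf_prog k S {7} (print_many (3 * g) 11 [0, 0, 0, 1] [0, 0, 0, 0, 0])"
      using a by (auto intro!: wf_print_many wf_incr)
    then show ?thesis using es[of "{7}"] by (simp add: edge_var_def)
  qed
  have "wf_prog k S {} (incr 9)" using a by (auto intro!: wf_incr)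
  then show ?thesis using a es[of "{}"] ev by (simp add: edge_def)
qed

lemma ex_edge_sinks:
  assumes "s 9 = enc (Suc j)" "s 10 = enc (Suc i)" "Suc j \<le> b" "Suc i \<le> b"
    "s(12 := s 12 @ (if lst then point_code (spos (Bo i j)) else [])) = s'"
  shows "ex b (seqs (edge_sinks lst)) s s'"
proof (cases lst)
  case True
  have "ex b (print_pt 12 [0, 0, 0, 0] [0, 0, 0, 0, 0]) s s'"
    using assms length_enc[of "Suc j"] length_enc[of "Suc i"] True
    by (intro ex_one[OF encode_prefixes(2)[of j] encode_prefixes(3)[of i]]) auto
  then show ?thesis using True by (simp add: edge_sinks_def ex_Seq ex_Skip)
next
  case False
  then have "s = s'" using assms(5) by simp
  then show ?thesis using False by (simp add: edge_sinks_def ex_Skip)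
qed

lemma ex_edge_var:
  assumes "clean s" "s 9 = enc (2 * q + 1)" "s 10 = enc (Suc i)" "2 * q + 3 \<le> b" "Suc i \<le> b"
    "s(9 := enc (2 * q + 3), 11 := s 11 @ edge_src g i q, 12 := s 12 @ edge_snk lst i q) = s'"
  shows "ex b (edge_var g lst) s s'"
proof -
  let ?B = "\<lambda>j. if lst then point_code (spos (Bo i j)) else []"
  define s1 where "s1 = s(9 := enc (2 * q + 2))"
  define s2 where "s2 = s(9 := enc (2 * q + 2), 12 := s 12 @ ?B (2 * q + 1))"
  define s3 where "s3 = s2(11 := s 11 @ edge_src g i q)"
  define s4 where "s4 = s3(9 := enc (2 * q + 3))"
  have 1: "ex b (incr 9) s s1" by (rule ex_incr[where n = "2 * q + 1"]) (use assms in \<open>auto simp: s1_def clean_def\<close>)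
  have 2: "ex b (seqs (edge_sinks lst)) s1 s2"
    by (rule ex_edge_sinks[where j = "2 * q + 1" and i = i]) (use assms in \<open>auto simp: s1_def s2_def\<close>)
  have len: "length (enc (2 * q + 2)) \<le> b" "length (enc (Suc i)) \<le> b"
    using length_enc[of "2 * q + 2"] length_enc[of "Suc i"] assms by auto
  have 3: "ex b (print_many (3 * g) 11 [0, 0, 0, 1] [0, 0, 0, 0, 0]) s2 s3"
    by (rule ex_many[OF encode_prefixes(1)[of "2 * q + 2"] encode_prefixes(3)[of i]])
       (use assms(1-5) len in \<open>auto simp: s2_def s3_def edge_src_def fun_eq_iff\<close>)
  have 4: "ex b (incr 9) s3 s4"
    by (rule ex_incr[where n = "2 * q + 2"]) (use assms in \<open>auto simp: s2_def s3_def s4_def clean_def numeral_3_eq_3\<close>)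
  have 5: "ex b (seqs (edge_sinks lst)) s4 s'"
    unfolding assms(6)[symmetric]
    by (rule ex_edge_sinks[where j = "2 * q + 2" and i = i])
       (use assms(1-5) in \<open>auto simp: s2_def s3_def s4_def edge_snk_def numeral_3_eq_3 fun_eq_iff\<close>)
  show ?thesis unfolding edge_var_def append_Cons append_Nil
    by (rule ex_Cons[OF 1], rule ex_append[OF 2], rule ex_Cons[OF 3], rule ex_Cons[OF 4], rule 5)
qed

lemma ex_edge:
  assumes "clean s" "s 9 = []" "s 10 = enc (Suc i)" "2 * (length (s 7) * N) + 1 \<le> b" "length (s 7) \<le> b" "Suc i \<le> b"
    "s(11 := s 11 @ concat (map (edge_src g i) [0..<length (s 7) * N]),
       12 := s 12 @ (if lst then point_code (spos (Bo i 0)) else []) @ concat (map (edge_snk lst i) [0..<length (s 7) * N])) = s'"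
  shows "ex b (edge g N lst) s s'"
proof -
  define G where "G q = s(9 := enc (2 * q + 1), 11 := s 11 @ concat (map (edge_src g i) [0..<q]),
     12 := s 12 @ (if lst then point_code (spos (Bo i 0)) else []) @ concat (map (edge_snk lst i) [0..<q]))" for q
  have e0: "enc 0 = []" by (simp add: enc_def bits_def encode_nat.simps)
  have b1: "1 \<le> b" using assms(4) by simp
  have 1: "ex b (incr 9) s (s(9 := enc 1))" by (rule ex_incr[where n = 0]) (use assms e0 b1 in \<open>auto simp: clean_def\<close>)
  have 2: "ex b (seqs (edge_sinks lst)) (s(9 := enc 1)) (G 0)"
    by (rule ex_edge_sinks[where j = 0 and i = i]) (use assms b1 in \<open>auto simp: G_def fun_eq_iff\<close>)
  have var: "ex b (edge_var g lst) (G q) (G (Suc q))" if "q < length (s 7) * N" for q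
  proof (rule ex_edge_var[where q = q and i = i])
    have "2 * Suc q \<le> 2 * (length (s 7) * N)" using that by simp
    then show "2 * q + 3 \<le> b" using assms(4) by simp
  qed (use assms(1-6) in \<open>auto simp: G_def clean_def fun_eq_iff numeral_3_eq_3\<close>)
  have 3: "ex b (For 7 (\<lambda>_. seqs (replicate N (edge_var g lst)))) (G 0) (G (length (s 7) * N))"
  proof (rule ex_For[where F = "\<lambda>xs. G (length xs * N)"])
    fix xs a ys assume "G 0 7 = xs @ a # ys"
    then have sp: "s 7 = xs @ a # ys" by (simp add: G_def)
    have "Suc (length xs) * N \<le> length (s 7) * N" unfolding sp by (intro mult_le_mono1) simp
    then have "ex b (replicate N (edge_var g lst) ! l) (G (length xs * N + l)) (G (length xs * N + Suc l))"
      if "l < length (replicate N (edge_var g lst))" for l using var[of "length xs * N + l"] that by simp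
    from ex_seqs[of "replicate N (edge_var g lst)" b "\<lambda>l. G (length xs * N + l)", OF this]
    show "ex b (seqs (replicate N (edge_var g lst))) (G (length xs * N)) (G (length (xs @ [a]) * N))"
      by (simp add: add.commute)
  qed (use assms in \<open>auto simp: G_def\<close>)
  have 4: "ex b (Clr 9) (G (length (s 7) * N)) s'"
    unfolding assms(7)[symmetric]
    by (rule ex_Clr) (use length_enc[of "2 * (length (s 7) * N) + 1"] assms(1-6) in \<open>auto simp: G_def fun_eq_iff\<close>)
  show ?thesis unfolding edge_def append_Cons append_Nil
    by (rule ex_Cons[OF 1], rule ex_append[OF 2], rule ex_Cons[OF 3], rule ex_Cons[OF 4], rule ex_Nil[OF refl])
qed

section \<open>The reduction runs in polynomial time\<close>

primrec hval :: "nat \<Rightarrow> nat list \<Rightarrow> nat" where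
  "hval n [] = 0"
| "hval n (c # cs) = c + n * hval n cs"

lemma hval_coeffs: "hval n (coeffs p) = poly p n"
  by (induction p) (auto simp: cCons_def)

lemma hval_mono: "n \<le> n' \<Longrightarrow> hval n cs \<le> hval n' cs"
  by (induction cs) (auto intro!: mult_le_mono)

text \<open>Horner's scheme in unary: a number is the length of a register.\<close>

primrec peval :: "nat list \<Rightarrow> nat \<Rightarrow> prog" where
  "peval [] A = Skip"
| "peval (c # cs) A = seqs [peval cs A, For 0 (\<lambda>_. each A 4 (\<lambda>_. [1])), Clr A, each 4 A (\<lambda>_. [1]), Clr 4,
     emits A (replicate c 1)]"

lemma wf_peval: "15 < k \<Longrightarrow> 2 \<le> S \<Longrightarrow> A < k \<Longrightarrow> A \<noteq> 0 \<Longrightarrow> A \<noteq> 4 \<Longrightarrow> wf_prog k S {} (peval cs A)"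
  by (induction cs) auto

lemma concat_map_const: "concat (map (\<lambda>_. [a]) w) = replicate (length w) a"
  by (induction w) auto

text \<open>The bound is taken at \<open>Suc n\<close> because for \<open>n = 0\<close> the final
  value does not dominate the intermediate values of Horner's scheme.\<close>

lemma ex_peval:
  assumes "s A = []" "s 4 = []" "length (s 0) = n" "A \<noteq> 0" "A \<noteq> 4" "n \<le> b" "hval (Suc n) cs \<le> b"
    "s(A := replicate (hval n cs) 1) = s'"
  shows "ex b (peval cs A) s s'"
  using assms(7,8)
proof (induction cs arbitrary: s')
  case Nil
  have "s = s'" unfolding Nil(2)[symmetric] using assms(1) by (auto simp: fun_eq_iff)
  then show ?case by (simp add: ex_Skip)
next
  case (Cons c cs)
  define v where "v = hval n cs"
  have v: "v \<le> hval (Suc n) cs" unfolding v_def by (rule hval_mono) simp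
  have nv: "v \<le> b" "n * v \<le> b" "hval (Suc n) cs \<le> b"
  proof -
    have "c + (hval (Suc n) cs + n * hval (Suc n) cs) \<le> b" using Cons.prems(1) by simp
    then show "v \<le> b" "n * v \<le> b" "hval (Suc n) cs \<le> b" using v mult_le_mono2[OF v, of n] by linarith+
  qed
  define s1 where "s1 = s(A := replicate v 1)"
  define s2 where "s2 = s1(4 := replicate (n * v) 1)"
  have 1: "ex b (peval cs A) s s1" by (rule Cons.IH) (use nv s1_def v_def in auto)
  have 2: "ex b (For 0 (\<lambda>_. each A 4 (\<lambda>_. [1]))) s1 s2"
  proof (rule ex_For[where F = "\<lambda>xs. s1(4 := replicate (length xs * v) 1)"])
    show "ex b (each A 4 (\<lambda>_. [1])) (s1(4 := replicate (length xs * v) 1)) (s1(4 := replicate (length (xs @ [a]) * v) 1))" for xs a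
      by (rule ex_each) (use assms nv in \<open>auto simp: s1_def concat_map_const map_replicate_const fun_eq_iff simp flip: replicate_add\<close>)
  qed (use assms in \<open>auto simp: s1_def s2_def fun_eq_iff\<close>)
  have 3: "ex b (Clr A) s2 (s2(A := []))" by (rule ex_Clr) (use assms nv in \<open>auto simp: s1_def s2_def\<close>)
  have 4: "ex b (each 4 A (\<lambda>_. [1])) (s2(A := [])) (s2(A := replicate (n * v) 1))"
    by (rule ex_each) (use assms nv in \<open>auto simp: s1_def s2_def concat_map_const map_replicate_const fun_eq_iff\<close>)
  have 5: "ex b (Clr 4) (s2(A := replicate (n * v) 1)) (s(A := replicate (n * v) 1))"
    by (rule ex_Clr) (use assms nv in \<open>auto simp: s1_def s2_def fun_eq_iff\<close>)
  have 6: "ex b (emits A (replicate c 1)) (s(A := replicate (n * v) 1)) s'"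
    unfolding Cons.prems(2)[symmetric]
    by (rule ex_emits) (auto simp: v_def fun_eq_iff add.commute simp flip: replicate_add)
  show ?case unfolding peval.simps
    by (rule ex_Cons[OF 1], rule ex_Cons[OF 2], rule ex_Cons[OF 3], rule ex_Cons[OF 4], rule ex_Cons[OF 5],
        rule ex_Cons[OF 6], rule ex_Nil[OF refl])
qed

text \<open>21, 25 and 43 are the kinds 10, 3 and 10 of the cells 0, 1 and \<open>W\<close>,
  combined with the flags 1, 2 and 3.\<close>

definition first_flags :: "nat list \<Rightarrow> nat \<Rightarrow> nat list" where
  "first_flags R T = [21, 25] @ R @ [43, 1] @ replicate (length R) 0 @
     concat (replicate T ([10, 1] @ replicate (length R) 0)) @ [10, 1] @ replicate (length R) 2 @
     [10, 10] @ replicate (length R) 10"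

lemma first_flags: "first_flags R T = flagged (concat (tableau_rows R T)) (length R + 2) 0"
proof -
  define ks where "ks = concat (tableau_rows R T)"
  define W where "W = length R + 2"
  define rest where "rest = replicate (length R) 0 @
     concat (replicate T ([10, 1] @ replicate (length R) 0)) @ [10, 1] @ replicate (length R) 2 @
     [10, 10] @ replicate (length R) (10 :: nat)"
  have ks: "ks = 10 # 3 # R @ 10 # 1 # rest"
    by (simp add: ks_def tableau_rows_def rest_def)
  have W: "ks ! W = 10" "W < length ks" "0 < length ks" "1 < length ks" by (simp_all add: ks W_def nth_append)
  have "flagged ks W 0 = ((ks[0 := 21])[1 := 25])[W := 43]"
  proof (rule nth_equalityI)
    show "length (flagged ks W 0) = length (((ks[0 := 21])[1 := 25])[W := 43])" by (simp add: flagged_def)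
    fix i assume "i < length (flagged ks W 0)"
    then have i: "i < length ks" by (simp add: flagged_def)
    have "ks ! 0 = 10" "ks ! 1 = 3" by (simp_all add: ks)
    then show "flagged ks W 0 ! i = ((ks[0 := 21])[1 := 25])[W := 43] ! i"
      using i W by (auto simp: flagged_def flag_def nth_list_update W_def)
  qed
  also have "\<dots> = 21 # 25 # R @ 43 # 1 # rest" by (simp add: ks W_def list_update_append)
  finally show ?thesis by (simp add: first_flags_def ks_def W_def rest_def)
qed

text \<open>Registers 2 and 3 receive the bounds on certificate and time in unary, register 6 the
  kinds of the first row behind its left end, and register 8 the number of cells in unary.\<close>

definition prep :: "nat poly \<Rightarrow> nat poly \<Rightarrow> nat \<Rightarrow> prog" where
  "prep p q g = seqs [peval (coeffs p) 2, peval (coeffs q) 3,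
     each 0 6 (\<lambda>a. [5, if a = 0 then 4 else 5]), App 6 4, each 2 6 (\<lambda>_. [6, 7]), App 6 8, each 3 6 (\<lambda>_. [9]),
     emits 6 [9, 9, 9, 9, 9],
     emits 7 [21, 25], each 6 7 (\<lambda>a. [a]), emits 7 [43, 1], each 6 7 (\<lambda>_. [0]),
     For 3 (\<lambda>_. seqs [emits 7 [10, 1], each 6 7 (\<lambda>_. [0])]), emits 7 [10, 1], each 6 7 (\<lambda>_. [2]),
     emits 7 [10, 10], each 6 7 (\<lambda>_. [10]), each 7 8 (\<lambda>_. [0]),
     emits 11 (concat (replicate 2 (point_code (ipos 0 Zi))) @ concat (replicate (4 * g - 1) (point_code (ipos 0 Fi))) @
       concat (replicate (4 * g - 1) (point_code (ipos 0 Ui)))),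
     emits 12 (point_code (spos Es) @ point_code (spos Ss)), App 10 1]"

lemma set_point_code: "set (point_code z) \<subseteq> {0, 1}"
  unfolding point_code_def by (rule set_bits)

lemma wf_prep: "wf_prog 16 44 {} (prep p q g)"
proof -
  have "c < 44" if "c \<in> set (point_code z)" for c z using that set_point_code[of z] by force
  then show ?thesis by (auto simp: prep_def intro!: wf_peval)
qed

definition header_src :: "nat \<Rightarrow> nat list" where
  "header_src g = concat (replicate 2 (point_code (ipos 0 Zi))) @ concat (replicate (4 * g - 1) (point_code (ipos 0 Fi))) @
       concat (replicate (4 * g - 1) (point_code (ipos 0 Ui)))"

definition header_snk :: "nat list" where
  "header_snk = point_code (spos Es) @ point_code (spos Ss)"

lemma ex_prep:
  fixes x :: "bool list" and p q :: "nat poly"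
  defines "n \<equiv> length x"
  defines "P \<equiv> poly p n" and "T \<equiv> poly q n"
  defines "R \<equiv> input_kinds x @ guess_kinds P (T + 5)"
  defines "ks \<equiv> concat (tableau_rows R T)"
  assumes b: "n \<le> b" "poly p (Suc n) \<le> b" "poly q (Suc n) \<le> b" "length R \<le> b" "length ks \<le> b"
  shows "ex b (prep p q g) (init_store x) ((\<lambda>_. [])(0 := bits x, 2 := replicate P 1, 3 := replicate T 1, 6 := R,
     7 := flagged ks (length R + 2) 0, 8 := replicate (length ks) 0, 10 := enc 1, 11 := header_src g, 12 := header_snk))"
proof -
  define s0 where "s0 = init_store x"
  have P: "P \<le> b" "T \<le> b"
  proof -
    have "poly p n \<le> poly p (Suc n)" "poly q n \<le> poly q (Suc n)"
      unfolding hval_coeffs[symmetric] by (intro hval_mono; simp)+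
    then show "P \<le> b" "T \<le> b" using b by (auto simp: P_def T_def)
  qed
  define s2 where "s2 = s0(2 := replicate P 1, 3 := replicate T 1)"
  have 1: "ex b (peval (coeffs p) 2) s0 (s0(2 := replicate P 1))"
    by (rule ex_peval[where n = n]) (use b in \<open>auto simp: s0_def init_store_def bits_def n_def hval_coeffs P_def\<close>)
  have 2: "ex b (peval (coeffs q) 3) (s0(2 := replicate P 1)) s2"
    by (rule ex_peval[where n = n]) (use b in \<open>auto simp: s2_def s0_def init_store_def bits_def n_def hval_coeffs T_def\<close>)
  have R: "R = concat (map (\<lambda>a. [5, if a = 0 then 4 else 5]) (bits x)) @ [4] @
     concat (map (\<lambda>_. [6, 7]) (replicate P (1 :: nat))) @ [8] @ concat (map (\<lambda>_. [9]) (replicate T (1 :: nat))) @ [9, 9, 9, 9, 9]"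
  proof -
    have "concat (map (\<lambda>b. [5, if b then 5 else 4]) x) = concat (map (\<lambda>a. [5, if a = 0 then 4 else 5 :: nat]) (bits x))"
      by (induction x) (auto simp: bits_def)
    moreover have "replicate (T + 5) (9 :: nat) = concat (map (\<lambda>_. [9]) (replicate T (1 :: nat))) @ [9, 9, 9, 9, 9]"
    proof -
      have "replicate (T + 5) (9 :: nat) = replicate T 9 @ replicate 5 9" by (rule replicate_add)
      moreover have "replicate 5 (9 :: nat) = [9, 9, 9, 9, 9]" by (simp add: numeral_eq_Suc)
      ultimately show ?thesis by (simp add: concat_map_const)
    qed
    ultimately show ?thesis by (simp add: R_def input_kinds_def guess_kinds_def)
  qed
  define s6 where "s6 = s2(6 := R)"
  have 3: "ex b (seqs [each 0 6 (\<lambda>a. [5, if a = 0 then 4 else 5]), App 6 4, each 2 6 (\<lambda>_. [6, 7]), App 6 8, each 3 6 (\<lambda>_. [9]),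
     emits 6 [9, 9, 9, 9, 9]]) s2 s6"
    unfolding s6_def R
    by (rule ex_Cons[OF ex_each[OF _ _ refl]] ex_Cons[OF ex_App[OF refl]] ex_Cons[OF ex_emits[OF refl]] ex_Nil |
        (use b P in \<open>simp add: s2_def s0_def init_store_def bits_def n_def; fail\<close>) |
        (simp add: s2_def s0_def init_store_def fun_eq_iff; fail))+
  define z where "z = replicate (length R) (0 :: nat)"
  define s7 where "s7 = s6(7 := [21, 25] @ R @ [43, 1] @ z)"
  have s6v: "s6 6 = R" "s6 7 = []" "s6 3 = replicate T 1" by (simp_all add: s6_def s2_def s0_def init_store_def)
  have 4: "ex b (seqs [emits 7 [21, 25], each 6 7 (\<lambda>a. [a]), emits 7 [43, 1], each 6 7 (\<lambda>_. [0])]) s6 s7"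
    by (intro ex_Cons[OF ex_emits[OF refl]] ex_Cons[OF ex_each[OF _ _ refl]] ex_Nil)
       (use b s6v in \<open>auto simp: s7_def z_def concat_map_const map_replicate_const fun_eq_iff\<close>)
  define s8 where "s8 = s7(7 := [21, 25] @ R @ [43, 1] @ z @ concat (replicate T ([10, 1] @ z)))"
  have 5: "ex b (For 3 (\<lambda>_. seqs [emits 7 [10, 1], each 6 7 (\<lambda>_. [0])])) s7 s8"
  proof (rule ex_For[where F = "\<lambda>xs. s7(7 := [21, 25] @ R @ [43, 1] @ z @ concat (replicate (length xs) ([10, 1] @ z)))"])
    have rep: "concat (replicate m ([10, 1] @ z)) @ 10 # 1 # z = 10 # 1 # z @ concat (replicate m ([10, 1] @ z))" for m
      by (induction m) auto
    show "ex b (seqs [emits 7 [10, 1], each 6 7 (\<lambda>_. [0])])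
        (s7(7 := [21, 25] @ R @ [43, 1] @ z @ concat (replicate (length xs) ([10, 1] @ z))))
        (s7(7 := [21, 25] @ R @ [43, 1] @ z @ concat (replicate (length (xs @ [a])) ([10, 1] @ z))))" for xs a
      by (intro ex_Cons[OF ex_emits[OF refl]] ex_Cons[OF ex_each[OF _ _ refl]] ex_Nil)
         (use b s6v rep[of "length xs"] in \<open>auto simp: s7_def z_def[symmetric] concat_map_const map_replicate_const fun_eq_iff\<close>)
  qed (use P s6v in \<open>auto simp: s7_def s8_def fun_eq_iff\<close>)
  define s9 where "s9 = s6(7 := flagged ks (length R + 2) 0)"
  have 6: "ex b (seqs [emits 7 [10, 1], each 6 7 (\<lambda>_. [2]), emits 7 [10, 10], each 6 7 (\<lambda>_. [10])]) s8 s9"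
    unfolding s9_def ks_def first_flags[symmetric] first_flags_def
    by (intro ex_Cons[OF ex_emits[OF refl]] ex_Cons[OF ex_each[OF _ _ refl]] ex_Nil)
       (use b s6v in \<open>auto simp: s8_def s7_def z_def concat_map_const map_replicate_const fun_eq_iff\<close>)
  have len7: "length (flagged ks W 0) = length ks" for W by (simp add: flagged_def)
  have 7: "ex b (seqs [each 7 8 (\<lambda>_. [0]), emits 11 (header_src g), emits 12 header_snk, App 10 1]) s9
    ((\<lambda>_. [])(0 := bits x, 2 := replicate P 1, 3 := replicate T 1, 6 := R,
     7 := flagged ks (length R + 2) 0, 8 := replicate (length ks) 0, 10 := enc 1, 11 := header_src g, 12 := header_snk))"
  proof -
    have "enc 1 = [1]" by (simp add: enc_def bits_def encode_nat.simps[of "Suc 0"] encode_nat.simps[of 0])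
    then show ?thesis
      by (intro ex_Cons[OF ex_emits[OF refl]] ex_Cons[OF ex_each[OF _ _ refl]] ex_Cons[OF ex_App[OF refl]] ex_Nil)
         (use b len7 in \<open>auto simp: s9_def s6_def s2_def s0_def init_store_def concat_map_const map_replicate_const fun_eq_iff\<close>)
  qed
  have "ex b (seqs ([peval (coeffs p) 2, peval (coeffs q) 3] @
     [each 0 6 (\<lambda>a. [5, if a = 0 then 4 else 5]), App 6 4, each 2 6 (\<lambda>_. [6, 7]), App 6 8, each 3 6 (\<lambda>_. [9]), emits 6 [9, 9, 9, 9, 9]] @
     [emits 7 [21, 25], each 6 7 (\<lambda>a. [a]), emits 7 [43, 1], each 6 7 (\<lambda>_. [0])] @
     [For 3 (\<lambda>_. seqs [emits 7 [10, 1], each 6 7 (\<lambda>_. [0])])] @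
     [emits 7 [10, 1], each 6 7 (\<lambda>_. [2]), emits 7 [10, 10], each 6 7 (\<lambda>_. [10])] @
     [each 7 8 (\<lambda>_. [0]), emits 11 (header_src g), emits 12 header_snk, App 10 1])) s0
    ((\<lambda>_. [])(0 := bits x, 2 := replicate P 1, 3 := replicate T 1, 6 := R,
     7 := flagged ks (length R + 2) 0, 8 := replicate (length ks) 0, 10 := enc 1, 11 := header_src g, 12 := header_snk))"
    by (rule ex_append[OF ex_Cons[OF 1 ex_Cons[OF 2 ex_Nil[OF refl]]]],
        rule ex_append[OF 3], rule ex_append[OF 4], rule ex_append[OF ex_Cons[OF 5 ex_Nil[OF refl]]],
        rule ex_append[OF 6], rule 7)
  then show ?thesis by (simp only: prep_def s0_def header_src_def header_snk_def append_Cons append_Nil)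
qed

subsection \<open>The printed instance\<close>

definition lit_bits :: "(nat \<Rightarrow> nat \<Rightarrow> bool) \<Rightarrow> nat \<Rightarrow> row_type \<Rightarrow> nat \<Rightarrow> bool list" where
  "lit_bits ok N rt a = concat (map (\<lambda>\<tau>. [lit_inc ok rt (a div 11) (a mod 11) \<tau> True,
     lit_inc ok rt (a div 11) (a mod 11) \<tau> False]) [0..<N])"

lemma length_lit_bits: "length (lit_bits ok N rt a) = 2 * N"
proof -
  have "length (concat (map (\<lambda>\<tau>. [f \<tau>, h \<tau>]) xs)) = 2 * length xs" for f h :: "nat \<Rightarrow> bool" and xs
    by (induction xs) auto
  then show ?thesis by (simp add: lit_bits_def)
qed

lemma nth_lit_bits:
  assumes "l < 2 * N"
  shows "lit_bits ok N rt a ! l \<longleftrightarrow> lit_inc ok rt (a div 11) (a mod 11) (l div 2) (even l)"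
proof -
  let ?L = "map (\<lambda>\<tau>. [lit_inc ok rt (a div 11) (a mod 11) \<tau> True, lit_inc ok rt (a div 11) (a mod 11) \<tau> False]) [0..<N]"
  have "concat ?L ! (l div 2 * 2 + l mod 2) = ?L ! (l div 2) ! (l mod 2)"
    by (rule concat_uniform(2)) (use assms in auto)
  moreover have "l div 2 < N" using assms by simp
  moreover have "even l \<and> l mod 2 = 0 \<or> odd l \<and> l mod 2 = 1" by presburger
  ultimately show ?thesis by (auto simp: lit_bits_def)
qed

lemma length_row_bits:
  assumes "RT \<noteq> []"
  shows "length (row_bits (map (lit_bits ok N) RT) ks W i) = 2 * (length ks * N) + 1"
proof -
  have "i mod length RT < length RT" using assms by simp
  then have "length (concat (map (map (lit_bits ok N) RT ! (i mod length RT)) (flagged ks W (i div length RT))))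
    = length (map (map (lit_bits ok N) RT ! (i mod length RT)) (flagged ks W (i div length RT))) * (2 * N)"
    by (intro concat_uniform(1)) (auto simp: length_lit_bits)
  then show ?thesis by (simp add: row_bits_def flagged_def)
qed

lemma nth_row_bits:
  assumes ks: "set ks \<subseteq> {..<11}" and j: "j < 2 * (length ks * N) + 1" and RT: "RT \<noteq> []"
  shows "row_bits (map (lit_bits ok N) RT) ks W i ! j \<longleftrightarrow> tile_inc ok RT N W ks i j"
proof (cases j)
  case 0
  then show ?thesis by (simp add: row_bits_def tile_inc_def)
next
  case (Suc l)
  define rt where "rt = RT ! (i mod length RT)"
  define fl where "fl = flagged ks W (i div length RT)"
  have l: "l < length ks * (2 * N)" using j Suc by simp
  then have N: "0 < 2 * N" by (cases N) auto
  define c where "c = l div (2 * N)"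
  have c: "c < length ks" unfolding c_def using l by (rule less_mult_imp_div_less)
  have f: "map (lit_bits ok N) RT ! (i mod length RT) = lit_bits ok N rt" using RT by (simp add: rt_def)
  have "row_bits (map (lit_bits ok N) RT) ks W i ! j = concat (map (lit_bits ok N rt) fl) ! (c * (2 * N) + l mod (2 * N))"
  proof -
    have "c * (2 * N) + l mod (2 * N) = l" unfolding c_def by (rule div_mult_mod_eq)
    then show ?thesis using f by (simp add: row_bits_def Suc fl_def)
  qed
  also have "\<dots> = map (lit_bits ok N rt) fl ! c ! (l mod (2 * N))"
    by (rule concat_uniform(2)) (use N c in \<open>auto simp: fl_def flagged_def length_lit_bits\<close>)
  also have "\<dots> = lit_bits ok N rt (fl ! c) ! (l mod (2 * N))" using c by (simp add: fl_def flagged_def)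
  also have "\<dots> \<longleftrightarrow> lit_inc ok rt (fl ! c div 11) (fl ! c mod 11) (l mod (2 * N) div 2) (even (l mod (2 * N)))"
    using N by (intro nth_lit_bits) simp
  also have "fl ! c = ks ! c + 11 * flag W (i div length RT) c" using c by (simp add: fl_def flagged_def)
  also have "l mod (2 * N) div 2 = l div 2 mod N" by (simp add: mod_mult2_eq)
  also have "even (l mod (2 * N)) \<longleftrightarrow> even l" by (simp add: dvd_mod_iff)
  finally have *: "row_bits (map (lit_bits ok N) RT) ks W i ! j \<longleftrightarrow>
     lit_inc ok rt ((ks ! c + 11 * flag W (i div length RT) c) div 11) ((ks ! c + 11 * flag W (i div length RT) c) mod 11)
       (l div 2 mod N) (even l)" .
  have "ks ! c < 11" using ks c by (meson lessThan_iff nth_mem subsetD)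
  moreover have "c = l div 2 div N" by (simp add: c_def div_mult2_eq)
  ultimately show ?thesis using * Suc by (simp add: tile_inc_def rt_def)
qed

lemma bits_encode_list: "bits (encode_list ws) = concat (map (\<lambda>w. bits (delimit w)) ws)"
  by (simp add: encode_list_def bits_def map_concat comp_def)

lemma bits_points: "bits (encode_list (map encode_point (map (\<lambda>it. rat_pt (h it)) L))) = concat (map (\<lambda>it. point_code (h it)) L)"
  by (simp add: bits_encode_list point_code_def comp_def)

lemma concat_map_replicates:
  "concat (map f (concat (map (\<lambda>x. replicate (w x) x) L))) = concat (map (\<lambda>x. concat (replicate (w x) (f x))) L)"
  by (induction L) auto

lemma concat_map_concat_map: "concat (map f (concat (map h xs))) = concat (map (\<lambda>x. concat (map f (h x))) xs)"
  by (induction xs) auto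

lemma grid_sources_code:
  assumes "\<And>i. i < m \<Longrightarrow> length (ws i) = 2 * v + 1" "\<And>i j. i < m \<Longrightarrow> j < 2 * v + 1 \<Longrightarrow> ws i ! j \<longleftrightarrow> inc i j"
  shows "bits (encode_list (map encode_point (grid_sources g m v inc))) =
     header_src g @ concat (map (edge_src g 0) [0..<v]) @ concat (map (\<lambda>i. row_src g i (ws i)) [0..<m]) @
     concat (map (edge_src g m) [0..<v])"
proof -
  define code where "code it = concat (replicate (wgt g inc it) (point_code (ipos m it)))" for it
  have "bits (encode_list (map encode_point (grid_sources g m v inc))) = concat (map code (item_list m v))"
    unfolding grid_sources_def bits_points src_items_def concat_map_replicates code_def ..
  also have "\<dots> = concat (map code [Zi, Fi, Ui]) @ concat (map (\<lambda>q. code (Ct q)) [0..<v]) @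
     concat (map (\<lambda>i. concat (map (\<lambda>j. concat (map code [Hi i j, Ti i j, Bi i j])) [0..<2 * v + 1]) @ code (Hi i (2 * v + 1))) [0..<m]) @
     concat (map (\<lambda>q. code (Cb q)) [0..<v])"
    unfolding item_list_def by (simp add: concat_map_concat_map comp_def del: upt_Suc)
  also have "concat (map code [Zi, Fi, Ui]) = header_src g"
    by (simp add: code_def header_src_def)
  also have "(\<lambda>q. code (Ct q)) = edge_src g 0" by (simp add: code_def edge_src_def fun_eq_iff)
  also have "(\<lambda>q. code (Cb q)) = edge_src g m" by (simp add: code_def edge_src_def fun_eq_iff)
  also have "map (\<lambda>i. concat (map (\<lambda>j. concat (map code [Hi i j, Ti i j, Bi i j])) [0..<2 * v + 1]) @ code (Hi i (2 * v + 1))) [0..<m] =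
     map (\<lambda>i. row_src g i (ws i)) [0..<m]"
  proof (rule map_cong[OF refl])
    fix i assume "i \<in> set [0..<m]"
    then have i: "i < m" by simp
    have "concat (map code [Hi i j, Ti i j, Bi i j]) = blk_src g i (0 + j) (ws i ! j)" if "j < 2 * v + 1" for j
      using assms(2)[OF i that] by (simp add: code_def blk_src_def)
    then have *: "map (\<lambda>j. concat (map code [Hi i j, Ti i j, Bi i j])) [0..<2 * v + 1] =
       map (\<lambda>j. blk_src g i (0 + j) (ws i ! j)) [0..<2 * v + 1]" by (intro map_cong) auto
    show "concat (map (\<lambda>j. concat (map code [Hi i j, Ti i j, Bi i j])) [0..<2 * v + 1]) @ code (Hi i (2 * v + 1)) = row_src g i (ws i)"
      unfolding row_src_def cols_src_nth assms(1)[OF i] * by (simp only: code_def wgt.simps ipos.simps)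
  qed
  finally show ?thesis .
qed

lemma upt_pairs: "[0..<2 * v + 1] = 0 # concat (map (\<lambda>q. [2 * q + 1, 2 * q + 2]) [0..<v])"
  by (induction v) auto

lemma grid_sinks_code:
  "bits (encode_list (map encode_point (grid_sinks m v))) =
     header_snk @ concat (map (\<lambda>i. cols_snk i 0 (2 * v + 1)) [0..<m]) @
     point_code (spos (Bo m 0)) @ concat (map (edge_snk True m) [0..<v])"
proof -
  define code where "code t = point_code (spos t)" for t
  have "bits (encode_list (map encode_point (grid_sinks m v))) = concat (map code (sink_list m v))"
    unfolding grid_sinks_def bits_points code_def ..
  also have "\<dots> = concat (map code [Es, Ss]) @
     concat (map (\<lambda>i. concat (map (\<lambda>j. concat (map code [Bo i j, Hu i j])) [0..<2 * v + 1])) [0..<m]) @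
     concat (map (\<lambda>j. code (Bo m j)) [0..<2 * v + 1])"
    unfolding sink_list_def by (simp add: concat_map_concat_map comp_def del: upt_Suc)
  also have "concat (map (\<lambda>j. code (Bo m j)) [0..<2 * v + 1]) = code (Bo m 0) @ concat (map (edge_snk True m) [0..<v])"
  proof -
    have "concat (map (\<lambda>j. code (Bo m j)) (concat (map (\<lambda>q. [2 * q + 1, 2 * q + 2]) qs))) = concat (map (edge_snk True m) qs)" for qs
      by (induction qs) (auto simp: edge_snk_def code_def simp del: spos.simps)
    then show ?thesis unfolding upt_pairs by simp
  qed
  also have "(\<lambda>i. concat (map (\<lambda>j. concat (map code [Bo i j, Hu i j])) [0..<2 * v + 1])) = (\<lambda>i. cols_snk i 0 (2 * v + 1))"
    unfolding cols_snk_nth by (simp add: blk_snk_def code_def)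
  finally show ?thesis by (simp add: header_snk_def code_def)
qed

subsection \<open>The whole program\<close>

definition print_grid :: "(nat \<Rightarrow> nat \<Rightarrow> bool) \<Rightarrow> row_type list \<Rightarrow> nat \<Rightarrow> nat \<Rightarrow> nat poly \<Rightarrow> nat poly \<Rightarrow> prog" where
  "print_grid ok RT N g p q = seqs [prep p q g, edge g N False, all_rows g (map (lit_bits ok N) RT), edge g N True]"

definition print_caps :: "nat \<Rightarrow> prog" where
  "print_caps g = seqs [each 11 1 (\<lambda>a. [1, a]), App 1 0, each 12 1 (\<lambda>a. [1, a]), App 1 0,
     emits 1 (bits (delimit (encode_list (map encode_nat [4 * g, 4 * g, 4 * g]))))]"

definition tile_reduction :: "(nat \<Rightarrow> nat \<Rightarrow> bool) \<Rightarrow> row_type list \<Rightarrow> nat \<Rightarrow> nat \<Rightarrow> nat poly \<Rightarrow> nat poly \<Rightarrow> bool list \<Rightarrow> bool list" where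
  "tile_reduction ok RT N g p q x =
     (let R = input_kinds x @ guess_kinds (poly p (length x)) (poly q (length x) + 5);
          ks = concat (tableau_rows R (poly q (length x)));
          m = length ks * length RT; v = length ks * N
      in encode_flamecast (grid_sources g m v (tile_inc ok RT N (length R + 2) ks)) (grid_sinks m v) [4 * g, 4 * g, 4 * g])"

lemma wf_print_grid: "wf_prog 16 44 {} (print_grid ok RT N g p q)"
  unfolding print_grid_def wf_seqs by (auto intro!: wf_prep wf_edge wf_all_rows)

lemma wf_print_caps: "wf_prog 16 44 {} (print_caps g)"
proof -
  have "c < 44" if "c \<in> set (bits w)" for c w using that set_bits[of w] by force
  then show ?thesis by (auto simp: print_caps_def)
qed

lemma kinds_lt: "set (concat (tableau_rows (input_kinds x @ guess_kinds P r) T)) \<subseteq> {..<11}"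
proof -
  have "set (input_kinds x @ guess_kinds P r) \<subseteq> {..<11}"
    by (auto simp: input_kinds_def guess_kinds_def split: if_splits)
  then show ?thesis by (auto simp: tableau_rows_def split: if_splits)
qed

lemma ex_print_grid:
  fixes x :: "bool list" and p q :: "nat poly" and RT :: "row_type list" and N :: nat and ok :: "nat \<Rightarrow> nat \<Rightarrow> bool"
  defines "n \<equiv> length x"
  defines "T \<equiv> poly q n"
  defines "R \<equiv> input_kinds x @ guess_kinds (poly p n) (T + 5)"
  defines "ks \<equiv> concat (tableau_rows R T)"
  defines "m \<equiv> length ks * length RT" and "v \<equiv> length ks * N" and "inc \<equiv> tile_inc ok RT N (length R + 2) ks"
  assumes RT: "RT \<noteq> []"
    and b: "n \<le> b" "poly p (Suc n) \<le> b" "poly q (Suc n) \<le> b" "length R \<le> b" "length ks \<le> b" "2 * v + 1 \<le> b" "Suc m \<le> b"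
  shows "\<exists>s. ex b (print_grid ok RT N g p q) (init_store x) s \<and> s 1 = [] \<and>
     s 11 = bits (encode_list (map encode_point (grid_sources g m v inc))) \<and>
     s 12 = bits (encode_list (map encode_point (grid_sinks m v)))"
proof -
  define fs where "fs = map (lit_bits ok N) RT"
  define W where "W = length R + 2"
  define s1 :: store where "s1 = (\<lambda>_. [])(0 := bits x, 2 := replicate (poly p n) 1, 3 := replicate T 1, 6 := R,
     7 := flagged ks W 0, 8 := replicate (length ks) 0, 10 := enc 1, 11 := header_src g, 12 := header_snk)"
  have lenfl: "length (flagged ks W c) = length ks" for c by (simp add: flagged_def)
  have 1: "ex b (prep p q g) (init_store x) s1"
    using ex_prep[of x b p q g] b unfolding s1_def n_def T_def R_def ks_def W_def by blast
  define s2 where "s2 = s1(11 := header_src g @ concat (map (edge_src g 0) [0..<v]))"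
  have 2: "ex b (edge g N False) s1 s2"
  proof (rule ex_edge[where i = 0])
    have e: "concat (map (edge_snk False 0) qs) = []" for qs by (induction qs) (auto simp: edge_snk_def)
    show "s1(11 := s1 11 @ concat (map (edge_src g 0) [0..<length (s1 7) * N]),
       12 := s1 12 @ (if False then point_code (spos (Bo 0 0)) else []) @ concat (map (edge_snk False 0) [0..<length (s1 7) * N])) = s2"
      by (simp add: s1_def s2_def e lenfl v_def[symmetric] fun_eq_iff)
  qed (use b lenfl in \<open>simp_all add: s1_def clean_def v_def\<close>)
  define s3 where "s3 = s2(7 := flagged ks W (length ks), 10 := enc (Suc m),
       11 := s2 11 @ concat (map (\<lambda>i. row_src g i (row_bits fs ks W i)) [0..<m]),
       12 := s2 12 @ concat (map (\<lambda>i. cols_snk i 0 (2 * v + 1)) [0..<m]))"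
  have 3: "ex b (all_rows g fs) s2 s3"
  proof (rule ex_all_rows[where ks = ks and W = W and L = "2 * N"])
    show "set ks \<subseteq> {..<11}" unfolding ks_def R_def by (rule kinds_lt)
    show "fs \<noteq> []" using RT by (simp add: fs_def)
    show "length (f a) = 2 * N" if "f \<in> set fs" for f a using that by (auto simp: fs_def length_lit_bits)
    show "1 \<le> W" by (simp add: W_def)
    show "1 \<le> b" using b by simp
    show "s2(7 := flagged ks W (length ks), 10 := enc (Suc (length ks * length fs)),
       11 := s2 11 @ concat (map (\<lambda>i. row_src g i (row_bits fs ks W i)) [0..<length ks * length fs]),
       12 := s2 12 @ concat (map (\<lambda>i. cols_snk i 0 (Suc (length ks * (2 * N)))) [0..<length ks * length fs])) = s3"
      by (simp add: s3_def m_def v_def fs_def mult.left_commute)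
  qed (use b in \<open>simp_all add: s1_def s2_def clean_def v_def m_def fs_def mult.left_commute\<close>)
  define s4 where "s4 = s3(11 := s3 11 @ concat (map (edge_src g m) [0..<v]),
     12 := s3 12 @ point_code (spos (Bo m 0)) @ concat (map (edge_snk True m) [0..<v]))"
  have 4: "ex b (edge g N True) s3 s4"
    by (rule ex_edge[where i = m]) (use b lenfl in \<open>simp_all add: s1_def s2_def s3_def s4_def clean_def v_def\<close>)
  have "ex b (print_grid ok RT N g p q) (init_store x) s4"
    unfolding print_grid_def fs_def[symmetric]
    by (rule ex_Cons[OF 1 ex_Cons[OF 2 ex_Cons[OF 3 ex_Cons[OF 4 ex_Nil[OF refl]]]]])
  moreover have "s4 1 = []" by (simp add: s1_def s2_def s3_def s4_def)
  moreover have "s4 11 = bits (encode_list (map encode_point (grid_sources g m v inc)))"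
  proof -
    have "bits (encode_list (map encode_point (grid_sources g m v inc))) =
     header_src g @ concat (map (edge_src g 0) [0..<v]) @ concat (map (\<lambda>i. row_src g i (row_bits fs ks W i)) [0..<m]) @
     concat (map (edge_src g m) [0..<v])"
    proof (rule grid_sources_code)
      show "length (row_bits fs ks W i) = 2 * v + 1" for i
        unfolding fs_def v_def by (rule length_row_bits[OF RT])
      show "row_bits fs ks W i ! j \<longleftrightarrow> inc i j" if "j < 2 * v + 1" for i j
        unfolding fs_def inc_def W_def[symmetric]
      proof (rule nth_row_bits)
        show "set ks \<subseteq> {..<11}" unfolding ks_def R_def by (rule kinds_lt)
      qed (use that RT v_def in auto)
    qed
    then show ?thesis by (simp add: s1_def s2_def s3_def s4_def)
  qed
  moreover have "s4 12 = bits (encode_list (map encode_point (grid_sinks m v)))"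
    unfolding grid_sinks_code by (simp add: s1_def s2_def s3_def s4_def del: spos.simps)
  ultimately show ?thesis by blast
qed

lemma ex_print_caps:
  assumes "s 1 = []" "s 11 = bits (encode_list (map encode_point ss))" "s 12 = bits (encode_list (map encode_point ts))"
    "length (s 11) \<le> b" "length (s 12) \<le> b"
  shows "ex b (print_caps g) s (s(1 := bits (encode_flamecast ss ts [4 * g, 4 * g, 4 * g])))"
proof -
  have "bits (encode_flamecast ss ts [4 * g, 4 * g, 4 * g]) = stuff (s 11) @ [0] @ stuff (s 12) @ [0] @
     bits (delimit (encode_list (map encode_nat [4 * g, 4 * g, 4 * g])))"
    unfolding encode_flamecast_def encode_list_def[of "[_, _, _]"] assms(2,3)
    by (simp only: list.map concat.simps bits_append bits_delimit append_Nil2 append_assoc append_Cons append_Nil)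
  then show ?thesis unfolding print_caps_def
    by (intro ex_Cons[OF ex_each[OF _ _ refl]] ex_Cons[OF ex_App[OF refl]] ex_Cons[OF ex_emits[OF refl]] ex_Nil)
       (use assms(1,4,5) in \<open>auto simp: stuff_def fun_eq_iff\<close>)
qed

text \<open>The second stage scans what the first one has printed. Instead of computing the length
  of this output, one bounds it by the input length plus the running time of the first stage, hence
  the composition of polynomials.\<close>

lemma polytime_two_stages:
  fixes p :: "nat poly"
  assumes wf: "wf_prog k S {} P" "wf_prog k S {} Q" and kS: "2 \<le> k" "2 \<le> S"
    and P: "\<And>w. loop_bounded (poly p (length w)) P (init_store w)"
    and Q: "\<And>w. loop_bounded (length w + cost P (init_store w)) Q (sem P (init_store w))"
    and out: "\<And>w. sem Q (sem P (init_store w)) 1 = bits (f w)"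
  shows "polytime f"
proof -
  define b1 where "b1 = pcompose (prog_bound S P) p"
  define b2 where "b2 = pcompose (prog_bound S Q) ([:0, 1:] + b1)"
  have "cost (Seq P Q) (init_store w) \<le> poly (b1 + b2) (length w)" for w
  proof -
    have ws: "wf_store S (init_store w)"
      using set_bits[of w] kS by (auto simp: wf_store_def init_store_def)
    have 1: "cost P (init_store w) \<le> poly b1 (length w)"
      unfolding b1_def poly_pcompose by (rule cost_le_bound[OF wf(1) ws P])
    have "cost Q (sem P (init_store w)) \<le> poly (prog_bound S Q) (length w + cost P (init_store w))"
      by (rule cost_le_bound[OF wf(2) wf_store_sem[OF wf(1) ws] Q])
    also have "\<dots> \<le> poly (prog_bound S Q) (length w + poly b1 (length w))"
      unfolding hval_coeffs[symmetric] using 1 by (intro hval_mono) (simp add: hval_coeffs)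
    also have "\<dots> = poly b2 (length w)" by (simp add: b2_def poly_pcompose)
    finally show ?thesis using 1 by simp
  qed
  then show ?thesis using wf kS out by (intro polytime_prog[of k S "Seq P Q" f "b1 + b2"]) auto
qed

theorem polytime_tile_reduction:
  assumes RT: "RT \<noteq> []"
  shows "polytime (tile_reduction ok RT N g p q)"
proof -
  \<comment> \<open>\<open>pR\<close> is the length of the first row behind its left end:
    \<open>2 * n + 1\<close> cells for the input, \<open>2 * P + 1\<close> for the guess and
    \<open>T + 5\<close> blanks. \<open>pk\<close> counts the cells of \<open>T + 4\<close> rows,
    each of which has two further cells.\<close>
  define pR where "pR = [:0, 2:] + [:2:] * p + q + [:7 :: nat:]"
  define pk where "pk = (q + [:4:]) * (pR + [:2:])"
  define B where "B = [:0, 1:] + pcompose p [:1, 1:] + pcompose q [:1, 1:] + pR + pk * [:2 * N + length RT + 1:] + [:1:]"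
  have main: "\<exists>s. ex (poly B (length x)) (print_grid ok RT N g p q) (init_store x) s \<and>
     (\<forall>b. length (s 11) \<le> b \<longrightarrow> length (s 12) \<le> b \<longrightarrow>
       ex b (print_caps g) s (s(1 := bits (tile_reduction ok RT N g p q x))))" for x
  proof -
    define n where "n = length x"
    define T where "T = poly q n"
    define R where "R = input_kinds x @ guess_kinds (poly p n) (T + 5)"
    define ks where "ks = concat (tableau_rows R T)"
    have lenR: "length R = poly pR n"
      by (simp add: R_def length_guess_kinds length_input_kinds pR_def n_def T_def)
    have lenk: "length ks = poly pk n"
    proof -
      have "length ks = length (tableau_rows R T) * (length R + 2)"
        unfolding ks_def by (rule concat_uniform(1)) (auto simp: tableau_rows_def split: if_splits)
      then show ?thesis by (simp add: tableau_rows_def pk_def T_def lenR algebra_simps)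
    qed
    have B: "poly B n = n + poly p (Suc n) + poly q (Suc n) + length R + length ks * (2 * N + length RT + 1) + 1"
      by (simp add: B_def poly_pcompose lenR lenk)
    have *: "length ks * (2 * N + length RT + 1) = 2 * (length ks * N) + length ks * length RT + length ks"
      by (simp add: algebra_simps)
    obtain s where s: "ex (poly B n) (print_grid ok RT N g p q) (init_store x) s" "s 1 = []"
       "s 11 = bits (encode_list (map encode_point (grid_sources g (length ks * length RT) (length ks * N) (tile_inc ok RT N (length R + 2) ks))))"
       "s 12 = bits (encode_list (map encode_point (grid_sinks (length ks * length RT) (length ks * N))))"
      using ex_print_grid[OF RT, of x "poly B n" p q N ok g] B unfolding * n_def[symmetric] T_def[symmetric] R_def[symmetric] ks_def[symmetric]
      by auto
    have "ex b (print_caps g) s (s(1 := bits (tile_reduction ok RT N g p q x)))" if "length (s 11) \<le> b" "length (s 12) \<le> b" for b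
      using ex_print_caps[OF s(2-4) that]
      by (simp add: tile_reduction_def Let_def n_def[symmetric] T_def[symmetric] R_def[symmetric] ks_def[symmetric])
    then show ?thesis using s(1) unfolding n_def by blast
  qed
  show ?thesis
  proof (rule polytime_two_stages[OF wf_print_grid wf_print_caps])
    fix x
    obtain s where s: "ex (poly B (length x)) (print_grid ok RT N g p q) (init_store x) s"
      "\<And>b. length (s 11) \<le> b \<Longrightarrow> length (s 12) \<le> b \<Longrightarrow>
       ex b (print_caps g) s (s(1 := bits (tile_reduction ok RT N g p q x)))" using main by blast
    have sem: "sem (print_grid ok RT N g p q) (init_store x) = s" using s(1) by (simp add: ex_def)
    have len: "length (s r) \<le> length x + cost (print_grid ok RT N g p q) (init_store x)" for r
      using length_sem_le[of "print_grid ok RT N g p q" "init_store x" r] sem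
      by (auto simp: init_store_def bits_def split: if_splits)
    show "loop_bounded (poly B (length x)) (print_grid ok RT N g p q) (init_store x)" using s(1) by (simp add: ex_def)
    show "loop_bounded (length x + cost (print_grid ok RT N g p q) (init_store x)) (print_caps g)
       (sem (print_grid ok RT N g p q) (init_store x))"
      using s(2)[OF len len] sem by (simp add: ex_def)
    show "sem (print_caps g) (sem (print_grid ok RT N g p q) (init_store x)) 1 = bits (tile_reduction ok RT N g p q x)"
      using s(2)[OF len len] sem by (simp add: ex_def)
  qed simp_all
qed

section \<open>Inspecting a solution\<close>

text \<open>Selects the second component of an encoded pair: the states 0 and 1 skip the first
  component, 2 and 3 print the second one without its markers, and 4 is final.\<close>

definition field_step :: "nat \<Rightarrow> nat \<Rightarrow> nat \<times> nat list" where
  "field_step q a = (if q = 0 then (if a = 1 then 1 else 2, []) else if q = 1 then (0, [])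
     else if q = 2 then (if a = 1 then 3 else 4, []) else if q = 3 then (2, [a]) else (4, []))"

text \<open>The symbol 2 is not a bit and therefore can mark the end of an item once the markers are
  removed.\<close>

definition unstuff_step :: "nat \<Rightarrow> nat \<Rightarrow> nat \<times> nat list" where
  "unstuff_step q a = (if q = 0 then (if a = 1 then (1, []) else (0, [2])) else (0, [a]))"

text \<open>On a list of edges that are terminated by the symbol 2, this transducer prints the second
  component of the first edge with first component \<open>v \<in> {0, 1}\<close>. State 2 skips an edge, the states
  3 and 4 print, and state 6 is final.\<close>

definition find_step :: "nat \<Rightarrow> nat \<Rightarrow> nat \<Rightarrow> nat \<times> nat list" where
  "find_step v q a =
     (if q = 0 then (if v = 0 then (if a = 0 then 3 else 2) else (if a = 1 then 7 else 2), [])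
      else if q = 2 then (if a = 2 then 0 else 2, [])
      else if q = 7 then (if a = 1 then 8 else 2, [])
      else if q = 8 then (if a = 0 then 3 else 2, [])
      else if q = 3 then (if a = 1 then 4 else 6, [])
      else if q = 4 then (3, [a]) else (6, []))"

text \<open>Two words are compared by a loop over one of them that removes the same letters from the
  front of the other. After a mismatch the front letter is 2, which differs from every bit and so
  remains until the end.\<close>

definition pop_step :: "nat \<Rightarrow> nat \<Rightarrow> nat \<Rightarrow> nat \<times> nat list" where
  "pop_step a q c = (1, if q = 0 then (if c = a then [] else [2]) else [c])"

definition pop_fin :: "nat \<Rightarrow> nat list" where
  "pop_fin q = (if q = 0 then [2] else [])"

definition popped :: "nat \<Rightarrow> nat list \<Rightarrow> nat list" where
  "popped a B = run (pop_step a) pop_fin 0 B"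

lemma popped_simps:
  "popped a [] = [2]" "popped a (c # B) = (if c = a then B else 2 # B)"
proof -
  have "run (pop_step a) pop_fin (Suc 0) B = B"
    by (induction B) (auto simp: pop_step_def pop_fin_def)
  then show "popped a (c # B) = (if c = a then B else 2 # B)"
    by (simp add: popped_def pop_step_def)
qed (simp add: popped_def pop_fin_def)

lemma fold_popped_mismatch:
  assumes "set A \<subseteq> {0, 1}"
  shows "fold popped A (2 # B) \<noteq> []"
  using assms by (induction A) (auto simp: popped_simps)

lemma fold_popped_Nil:
  assumes "set A \<subseteq> {0, 1}"
  shows "fold popped A B = [] \<longleftrightarrow> A = B"
  using assms
proof (induction A arbitrary: B)
  case (Cons a A)
  then show ?case using fold_popped_mismatch[of A] by (cases B) (auto simp: popped_simps)
qed auto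

lemma length_fold_popped: "length B \<le> b \<Longrightarrow> 1 \<le> b \<Longrightarrow> length (fold popped A B) \<le> b"
proof (induction A arbitrary: B)
  case (Cons a A)
  have "length (popped a B) \<le> b" using Cons.prems by (cases B) (auto simp: popped_simps)
  then show ?case using Cons by simp
qed simp

lemma length_run_le:
  assumes "\<And>q a. length (snd (\<delta> q a)) \<le> 1"
  shows "length (run \<delta> (\<lambda>_. []) q w) \<le> length w"
proof (induction w arbitrary: q)
  case (Cons a w)
  show ?case using Cons[of "fst (\<delta> q a)"] assms[of q a] by simp
qed simp

definition field2 :: "nat list \<Rightarrow> nat list" where
  "field2 w = run field_step (\<lambda>_. []) 0 w"

definition items_of :: "nat list \<Rightarrow> nat list" where
  "items_of w = run unstuff_step (\<lambda>_. []) 0 w"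

definition parent_of :: "nat \<Rightarrow> nat list \<Rightarrow> nat list" where
  "parent_of v w = run (find_step v) (\<lambda>_. []) 0 w"

lemma length_stages: "length (field2 w) \<le> length w" "length (items_of w) \<le> length w" "length (parent_of v w) \<le> length w"
  unfolding field2_def items_of_def parent_of_def
  by (rule length_run_le, simp add: field_step_def unstuff_step_def find_step_def)+

definition same_parent :: "nat list \<Rightarrow> bool" where
  "same_parent w \<longleftrightarrow> fold popped (parent_of 0 (items_of (field2 w))) (parent_of 1 (items_of (field2 w))) = []"

text \<open>The last loop replaces the answer 1 by 0 if the comparison leaves anything in register
  5.\<close>

definition parent_prog :: prog where
  "parent_prog = seqs [trans field_step (\<lambda>_. []) 0 0 2, trans unstuff_step (\<lambda>_. []) 0 2 3,
     trans (find_step 0) (\<lambda>_. []) 0 3 4, trans (find_step 1) (\<lambda>_. []) 0 3 5,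
     For 4 (\<lambda>a. upd (pop_step a) pop_fin 0 5), App 1 1, For 5 (\<lambda>_. seqs [Clr 1, App 1 0])]"

lemma wf_parent_prog: "wf_prog 16 10 {} parent_prog"
  unfolding parent_prog_def
  by (auto intro!: wf_trans wf_upd simp: field_step_def unstuff_step_def find_step_def pop_step_def pop_fin_def split: if_splits)

lemma ex_parent_prog:
  assumes b: "length w < b"
  shows "\<exists>s. ex b parent_prog (init_store w) s \<and> s 1 = [of_bool (same_parent (bits w))]"
proof -
  define y where "y = field2 (bits w)"
  define z where "z = items_of y"
  define A where "A = parent_of 0 z"
  define B where "B = parent_of 1 z"
  have len: "length (bits w) \<le> b" "length y \<le> b" "length z \<le> b" "length A \<le> b" "length B \<le> b" "1 \<le> b"
  proof -
    have "length (bits w) = length w" by (simp add: bits_def)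
    moreover have "length y \<le> length (bits w)" "length z \<le> length y" "length A \<le> length z" "length B \<le> length z"
      unfolding y_def z_def A_def B_def by (rule length_stages)+
    ultimately show "length (bits w) \<le> b" "length y \<le> b" "length z \<le> b" "length A \<le> b" "length B \<le> b" "1 \<le> b"
      using b by linarith+
  qed
  define s1 where "s1 = (init_store w)(2 := y)"
  define s2 where "s2 = s1(3 := z)"
  define s3 where "s3 = s2(4 := A)"
  define s4 where "s4 = s3(5 := B)"
  define s5 where "s5 = s4(5 := fold popped A B)"
  define s6 where "s6 = s5(1 := [1])"
  define s7 where "s7 = s6(1 := [of_bool (fold popped A B = [])])"
  note d = s1_def s2_def s3_def s4_def s5_def init_store_def
  have 1: "ex b (trans field_step (\<lambda>_. []) 0 0 2) (init_store w) s1"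
    by (rule ex_trans) (use len in \<open>auto simp: d y_def field2_def\<close>)
  have 2: "ex b (trans unstuff_step (\<lambda>_. []) 0 2 3) s1 s2"
    by (rule ex_trans) (use len in \<open>auto simp: d z_def items_of_def\<close>)
  have 3: "ex b (trans (find_step 0) (\<lambda>_. []) 0 3 4) s2 s3"
    by (rule ex_trans) (use len in \<open>auto simp: d A_def parent_of_def\<close>)
  have 4: "ex b (trans (find_step 1) (\<lambda>_. []) 0 3 5) s3 s4"
    by (rule ex_trans) (use len in \<open>auto simp: d B_def parent_of_def\<close>)
  have 5: "ex b (For 4 (\<lambda>a. upd (pop_step a) pop_fin 0 5)) s4 s5"
  proof (rule ex_For[where F = "\<lambda>xs. s4(5 := fold popped xs B)"])
    fix xs a
    show "ex b (upd (pop_step a) pop_fin 0 5) (s4(5 := fold popped xs B)) (s4(5 := fold popped (xs @ [a]) B))"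
      using length_fold_popped[OF len(5,6), of xs] length_fold_popped[OF len(5,6), of "xs @ [a]"] len(6)
      by (intro ex_upd) (auto simp: d popped_def)
  qed (use len in \<open>auto simp: d\<close>)
  have 6: "ex b (App 1 1) s5 s6" by (rule ex_App) (simp add: d s6_def)
  have 7: "ex b (For 5 (\<lambda>_. seqs [Clr 1, App 1 0])) s6 s7"
  proof (rule ex_For[where F = "\<lambda>xs. s6(1 := [of_bool (xs = [])])"])
    fix xs a
    show "ex b (seqs [Clr 1, App 1 0]) (s6(1 := [of_bool (xs = [])])) (s6(1 := [of_bool (xs @ [a] = [])]))"
      by (intro ex_Cons[OF ex_Clr[OF _ refl]] ex_Cons[OF ex_App[OF refl]] ex_Nil) (use len in \<open>auto simp: fun_eq_iff\<close>)
  qed (use length_fold_popped[OF len(5,6), of A] in \<open>auto simp: s6_def s7_def s5_def\<close>)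
  have "ex b parent_prog (init_store w) s7" unfolding parent_prog_def
    by (rule ex_Cons[OF 1 ex_Cons[OF 2 ex_Cons[OF 3 ex_Cons[OF 4 ex_Cons[OF 5 ex_Cons[OF 6 ex_Cons[OF 7 ex_Nil[OF refl]]]]]]]])
  moreover have "s7 1 = [of_bool (same_parent (bits w))]"
    by (simp add: s7_def same_parent_def A_def B_def z_def y_def)
  ultimately show ?thesis by blast
qed

lemma decidable_same_parent: "polytime_decidable {w. same_parent (bits w)}"
  unfolding polytime_decidable_def
proof (rule polytime_prog[OF wf_parent_prog, where p = "pcompose (prog_bound 10 parent_prog) [:1, 1:]"])
  fix w
  obtain s where s: "ex (Suc (length w)) parent_prog (init_store w) s" "s 1 = [of_bool (same_parent (bits w))]"
    using ex_parent_prog[of w "Suc (length w)"] by blast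
  then show "sem parent_prog (init_store w) 1 = bits [w \<in> {w. same_parent (bits w)}]" by (simp add: ex_def bits_def)
  have "wf_store 10 (init_store w)" using set_bits[of w] by (auto simp: wf_store_def init_store_def)
  from cost_le_bound[OF wf_parent_prog this] s(1)
  show "cost parent_prog (init_store w) \<le> poly (pcompose (prog_bound 10 parent_prog) [:1, 1:]) (length w)"
    by (simp add: poly_pcompose ex_def)
qed simp_all

section \<open>Correctness of the inspection on encoded edge lists\<close>

lemma field2_encode: "field2 (bits (encode_list [x, y])) = bits y"
proof -
  have 1: "run field_step (\<lambda>_. []) 0 (stuff u @ 0 # w) = run field_step (\<lambda>_. []) 2 w" for u w
    by (induction u) (auto simp: stuff_Cons stuff_Nil field_step_def)
  have 2: "run field_step (\<lambda>_. []) 2 (stuff u @ [0]) = u" for u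
    by (induction u) (auto simp: stuff_Cons stuff_Nil field_step_def)
  have "bits (encode_list [x, y]) = stuff (bits x) @ 0 # stuff (bits y) @ [0]"
    by (simp add: encode_list_def bits_delimit)
  then show ?thesis by (simp add: field2_def 1 2)
qed

lemma items_of_encode: "items_of (bits (encode_list ws)) = concat (map (\<lambda>w. bits w @ [2]) ws)"
proof -
  have "run unstuff_step (\<lambda>_. []) 0 (stuff u @ 0 # w) = u @ 2 # run unstuff_step (\<lambda>_. []) 0 w" for u w
    by (induction u) (auto simp: stuff_Cons stuff_Nil unstuff_step_def)
  then show ?thesis unfolding items_of_def bits_encode_list by (induction ws) (auto simp: bits_delimit)
qed

lemma enc_Cons: "0 < n \<Longrightarrow> enc n = of_bool (odd n) # enc (n div 2)"
  by (simp add: enc_def bits_def encode_nat.simps[of n])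

lemma enc_0: "enc 0 = []"
  by (simp add: enc_def bits_def encode_nat.simps)

lemma inj_enc: "enc m = enc n \<Longrightarrow> m = n"
proof (induction m arbitrary: n rule: less_induct)
  case (less m)
  show ?case
  proof (cases "m = 0 \<or> n = 0")
    case True
    then show ?thesis using less.prems enc_0 enc_Cons[of m] enc_Cons[of n] by (cases "m = 0"; cases "n = 0") auto
  next
    case False
    then have "odd m = odd n" "enc (m div 2) = enc (n div 2)"
      using less.prems enc_Cons[of m] enc_Cons[of n] by auto
    then have "odd m = odd n" "m div 2 = n div 2" using less.IH[of "m div 2"] False by auto
    then show ?thesis by presburger
  qed
qed

lemma bits_edge: "bits (encode_edge e) = stuff (enc (fst e)) @ 0 # stuff (enc (snd e)) @ [0]"
  by (simp add: encode_edge_def encode_list_def bits_delimit enc_def)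

lemma find_print: "run (find_step v) (\<lambda>_. []) 3 (stuff u @ 0 # w) = u"
proof -
  have "run (find_step v) (\<lambda>_. []) 6 w = []" by (induction w) (auto simp: find_step_def)
  then show ?thesis by (induction u) (auto simp: stuff_Cons stuff_Nil find_step_def)
qed

lemma find_skip: "2 \<notin> set u \<Longrightarrow> run (find_step v) (\<lambda>_. []) 2 (u @ 2 # w) = run (find_step v) (\<lambda>_. []) 0 w"
  by (induction u) (auto simp: find_step_def)

lemma two_notin_stuff: "2 \<notin> set (stuff (enc n))"
proof
  assume "2 \<in> set (stuff (enc n))"
  then have "2 \<in> {0, 1 :: nat}" using set_stuff[of "enc n"] set_enc[of n] by blast
  then show False by simp
qed

text \<open>The code of 0 is empty and that of 1 is a single digit, so these two children are
  recognised from the first symbol 0 or from the first three symbols 1, 1, 0.\<close>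

lemma parent_of_hit:
  assumes "v = 0 \<or> v = 1"
  shows "parent_of v (stuff (enc v) @ 0 # stuff u @ 0 # w) = u"
proof -
  have "enc 1 = [1]" using enc_Cons[of 1] enc_0 by simp
  then show ?thesis using assms enc_0 find_print[of v u w]
    by (auto simp: parent_of_def stuff_Cons stuff_Nil) (simp_all add: find_step_def)
qed

lemma parent_of_miss:
  assumes "v = 0 \<or> v = 1" "a \<noteq> v"
  shows "parent_of v (stuff (enc a) @ 0 # stuff (enc b) @ 0 # 2 # w) = parent_of v w"
proof -
  have skip: "run (find_step v) (\<lambda>_. []) 2 (stuff (enc a') @ 0 # stuff (enc b) @ 0 # 2 # w) = parent_of v w" for a'
    using find_skip[of "stuff (enc a') @ 0 # stuff (enc b) @ [0]" v w] two_notin_stuff by (auto simp: parent_of_def)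
  have skip0: "run (find_step v) (\<lambda>_. []) 2 (stuff (enc b) @ 0 # 2 # w) = parent_of v w"
    using find_skip[of "stuff (enc b) @ [0]" v w] two_notin_stuff by (auto simp: parent_of_def)
  have st: "find_step 0 0 (Suc 0) = (2, [])" "find_step (Suc 0) 0 0 = (2, [])" "find_step (Suc 0) 0 (Suc 0) = (7, [])"
    "find_step (Suc 0) 7 0 = (2, [])" "find_step (Suc 0) 7 (Suc 0) = (8, [])" "find_step (Suc 0) 8 (Suc 0) = (2, [])"
    "c \<noteq> 2 \<Longrightarrow> find_step v 2 c = (2, [])" for c
    by (simp_all add: find_step_def)
  show ?thesis
  proof (cases "a = 0")
    case True
    then have "v = 1" using assms by simp
    then show ?thesis using skip0 True enc_0 by (simp add: parent_of_def stuff_Nil st)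
  next
    case a: False
    note e = enc_Cons[of a]
    show ?thesis
    proof (cases "v = 0")
      case True
      then show ?thesis using a e skip[of "a div 2"] st(7)[of "of_bool (odd a)"]
        by (simp add: parent_of_def stuff_Cons st)
    next
      case False
      then have v: "v = 1" and "a div 2 \<noteq> 0" using assms a by auto
      then have e2: "enc (a div 2) = of_bool (odd (a div 2)) # enc (a div 2 div 2)" by (intro enc_Cons) simp
      show ?thesis
        using v a e e2 skip[of "a div 2"] skip[of "a div 2 div 2"] st(7)[of "of_bool (odd (a div 2))"]
        by (cases "odd a") (simp_all add: parent_of_def stuff_Cons st)
    qed
  qed
qed

lemma parent_of_edges:
  assumes "v = 0 \<or> v = 1" "v \<in> fst ` set es"
  shows "\<exists>u. (v, u) \<in> set es \<and> parent_of v (concat (map (\<lambda>e. bits (encode_edge e) @ [2]) es)) = enc u"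
  using assms(2)
proof (induction es)
  case (Cons e es)
  obtain a b where e: "e = (a, b)" by (cases e)
  show ?case
  proof (cases "a = v")
    case True
    then show ?thesis using parent_of_hit[OF assms(1), of "enc b"] by (auto simp: e bits_edge)
  next
    case False
    then have "v \<in> fst ` set es" using Cons.prems e by auto
    then show ?thesis using Cons.IH parent_of_miss[OF assms(1) False] by (auto simp: e bits_edge)
  qed
qed simp

theorem same_parent_iff:
  assumes "single_valued (set es)" "0 \<in> fst ` set es" "1 \<in> fst ` set es"
  shows "same_parent (bits (encode_list [x, encode_list (map encode_edge es)])) \<longleftrightarrow> (\<exists>u. (0, u) \<in> set es \<and> (1, u) \<in> set es)"
proof -
  define z where "z = concat (map (\<lambda>e. bits (encode_edge e) @ [2]) es)"
  obtain a where a: "(0, a) \<in> set es" "parent_of 0 z = enc a"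
    using parent_of_edges[of 0 es] assms unfolding z_def by blast
  obtain b where b: "(1, b) \<in> set es" "parent_of 1 z = enc b"
    using parent_of_edges[of 1 es] assms unfolding z_def by blast
  have "items_of (field2 (bits (encode_list [x, encode_list (map encode_edge es)]))) = z"
    by (simp add: field2_encode items_of_encode z_def comp_def)
  then have "same_parent (bits (encode_list [x, encode_list (map encode_edge es)])) \<longleftrightarrow> enc a = enc b"
    unfolding same_parent_def using fold_popped_Nil[OF set_enc] a b by simp
  also have "\<dots> \<longleftrightarrow> a = b" using inj_enc by blast
  also have "\<dots> \<longleftrightarrow> (\<exists>u. (0, u) \<in> set es \<and> (1, u) \<in> set es)"
    using a(1) b(1) single_valuedD[OF assms(1)] by blast
  finally show ?thesis .
qed

section \<open>Hardness\<close>

lemma inj_encode_nat: "inj encode_nat"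
proof (rule injI)
  fix m n :: nat
  assume "encode_nat m = encode_nat n"
  then have "enc m = enc n" by (simp add: enc_def)
  then show "m = n" by (rule inj_enc)
qed

lemma inj_encode_rat: "inj encode_rat"
proof (rule injI)
  have int: "i = j" if "encode_int i = encode_int j" for i j
  proof -
    have "nat \<bar>i\<bar> = nat \<bar>j\<bar>" "(i < 0) = (j < 0)"
      using that injD[OF inj_encode_nat] by (auto simp: encode_int_def)
    then show ?thesis by linarith
  qed
  fix a b assume "encode_rat a = encode_rat b"
  then have "fst (quotient_of a) = fst (quotient_of b)" "snd (quotient_of a) = snd (quotient_of b)"
    using injD[OF inj_encode_list] int unfolding encode_rat_def by blast+
  then show "a = b" by (intro quotient_of_inject prod_eqI)
qed

lemma inj_encode_point: "inj encode_point"
proof (rule injI)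
  fix y z assume "encode_point y = encode_point z"
  then have "encode_rat (fst y) = encode_rat (fst z)" "encode_rat (snd y) = encode_rat (snd z)"
    using injD[OF inj_encode_list] unfolding encode_point_def by blast+
  then show "y = z" using injD[OF inj_encode_rat] by (intro prod_eqI) blast+
qed

text \<open>\<open>flamecast_problem\<close> speaks of some instance with the given code;
  injectivity identifies it with the grid instance.\<close>

lemma encode_flamecast_inject:
  assumes "encode_flamecast ss ts cs = encode_flamecast ss' ts' cs'"
  shows "ss = ss' \<and> ts = ts' \<and> cs = cs'"
proof -
  have "encode_list (map encode_point ss) = encode_list (map encode_point ss')"
    "encode_list (map encode_point ts) = encode_list (map encode_point ts')"
    "encode_list (map encode_nat cs) = encode_list (map encode_nat cs')"
    using injD[OF inj_encode_list] assms unfolding encode_flamecast_def by blast+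
  then have "map encode_point ss = map encode_point ss'" "map encode_point ts = map encode_point ts'"
    "map encode_nat cs = map encode_nat cs'" using injD[OF inj_encode_list] by blast+
  then show ?thesis using inj_map_eq_map[OF inj_encode_point] inj_map_eq_map[OF inj_encode_nat] by blast
qed

text \<open>A halted configuration is a fixed point of \<open>step\<close>, so a tableau of uniform
  height may run longer than the verifier.\<close>

lemma accepts_halted:
  assumes "t \<le> t'" "(step M ^^ t) (initial_config k w) = (q, tps)" "length M \<le> q" "fst (tps ! 1) = contents [b]"
  shows "accepts M k t' w \<longleftrightarrow> b"
proof -
  have "(step M ^^ d) (q, tps) = (q, tps)" for d using assms(3) by (induction d) (auto simp: step_def)
  moreover have "(step M ^^ t') (initial_config k w) = (step M ^^ (t' - t)) ((step M ^^ t) (initial_config k w))"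
    using assms(1) by (metis comp_apply funpow_add le_add_diff_inverse2)
  ultimately show ?thesis using assms(2,4) by (simp add: accepts_def contents_def)
qed

lemma length_encode_pair: "length (encode_list [x, u]) = 2 * length x + 2 * length u + 2"
proof -
  have "length (delimit w) = 2 * length w + 1" for w by (induction w) auto
  then show ?thesis by (simp add: encode_list_def)
qed

lemma poly_mono_nat: "m \<le> n \<Longrightarrow> poly p m \<le> poly p n" for p :: "nat poly"
  unfolding hval_coeffs[symmetric] by (rule hval_mono)

lemma group_size_exists:
  fixes \<alpha> :: real
  assumes "0 \<le> \<alpha>" "\<alpha> < 1"
  obtains g :: nat where "1 \<le> g" "\<And>w. g \<le> w \<Longrightarrow> 4 * real w powr \<alpha> \<le> real w"
proof
  \<comment> \<open>The solution of \<open>c powr (1 - \<alpha>) = 4\<close>.\<close>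
  define c where "c = (4 :: real) powr (1 / (1 - \<alpha>))"
  define g where "g = nat \<lceil>c\<rceil>"
  have c: "0 < c" by (simp add: c_def)
  then show "1 \<le> g" by (simp add: g_def Suc_le_eq)
  have gc: "c \<le> real g" unfolding g_def by linarith
  show "4 * real w powr \<alpha> \<le> real w" if "g \<le> w" for w
  proof -
    have cw: "c \<le> real w" using gc that by simp
    have "4 = c powr (1 - \<alpha>)" using assms by (simp add: c_def powr_powr)
    also have "\<dots> \<le> real w powr (1 - \<alpha>)" using c cw assms by (intro powr_mono2) auto
    finally have "4 * real w powr \<alpha> \<le> real w powr (1 - \<alpha>) * real w powr \<alpha>" by (intro mult_right_mono) auto
    also have "\<dots> = real w" using c cw by (simp flip: powr_add)
    finally show ?thesis .
  qed
qed

lemma (in grid) instance_I: "flamecast_instance I"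
  using \<alpha> g by (auto simp: flamecast_instance_def I_def flamecast_of_def)

lemma (in grid) optimal_edges:
  assumes "optimal_layout I V E p"
  shows "single_valued E" "0 \<in> fst ` E" "1 \<in> fst ` E"
proof -
  have top: "topology I V E" using assms by (simp add: optimal_layout_def valid_layout_def valid_topology_def)
  then show "single_valued E" by (simp add: topology_def rooted_forest_def)
  have "a \<in> Domain E" if "a \<in> sources I" for a
  proof -
    have "a \<notin> sinks I" using instance_I that by (auto simp: flamecast_instance_def)
    moreover have "a \<in> V" using top that by (auto simp: topology_def leaves_def)
    ultimately show ?thesis using top by (auto simp: topology_def roots_def)
  qed
  moreover have "0 \<in> sources I" "1 \<in> sources I"
    using special_sources by (auto simp: I_def flamecast_of_def grid_sources_def ns_def)
  ultimately show "0 \<in> fst ` E" "1 \<in> fst ` E" by (auto simp: fst_eq_Domain)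
qed

lemma (in grid) grid_search:
  defines "w \<equiv> encode_flamecast (grid_sources g m v inc) (grid_sinks m v) [4 * g, 4 * g, 4 * g]"
  shows "\<exists>y. flamecast_problem 1 \<alpha> w y"
    and "flamecast_problem 1 \<alpha> w y \<Longrightarrow> same_parent (bits (encode_list [x, y])) \<longleftrightarrow> formula_sat m v inc"
proof -
  obtain E p where E: "finite E" "optimal_layout I (Field E) E p" using grid_optimal by blast
  obtain es where "set es = E" using finite_list[OF E(1)] by blast
  then have "flamecast_problem 1 \<alpha> w (encode_list (map encode_edge es))"
    unfolding flamecast_problem_def w_def using E(2) instance_I unfolding I_def
    by (intro exI[of _ "grid_sources g m v inc"] exI[of _ "grid_sinks m v"] exI[of _ "[4 * g, 4 * g, 4 * g]"] exI[of _ es]) auto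
  then show "\<exists>y. flamecast_problem 1 \<alpha> w y" by blast
  assume "flamecast_problem 1 \<alpha> w y"
  then obtain ss ts cs es p where y: "w = encode_flamecast ss ts cs" "y = encode_list (map encode_edge es)"
    "optimal_layout (flamecast_of \<alpha> ss ts cs) (Field (set es)) (set es) p"
    unfolding flamecast_problem_def by blast
  have o: "optimal_layout I (Field (set es)) (set es) p"
    using encode_flamecast_inject[OF y(1)[unfolded w_def]] y(3) unfolding I_def by blast
  then have "(\<exists>u. (0, u) \<in> set es \<and> (1, u) \<in> set es) \<longleftrightarrow> formula_sat m v inc" using grid_optimal by blast
  then show "same_parent (bits (encode_list [x, y])) \<longleftrightarrow> formula_sat m v inc"
    unfolding y(2) same_parent_iff[OF optimal_edges[OF o]] .
qed

theorem theorem15: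
  fixes \<alpha> :: real
  assumes "0 \<le> \<alpha>" and "\<alpha> < 1"
  shows "NP_hard_search (flamecast_problem 1 \<alpha>)"
  unfolding NP_hard_search_def
proof
  fix L assume "L \<in> NP"
  then obtain V and p :: "nat poly" where V: "polytime_decidable V"
    and L: "\<And>x. x \<in> L \<longleftrightarrow> (\<exists>u. length u \<le> poly p (length x) \<and> encode_list [x, u] \<in> V)"
    unfolding NP_def by blast
  obtain k G M and pt :: "nat poly" where tm: "turing_machine k G M"
    and run: "\<And>w. \<exists>t\<le>poly pt (length w). \<exists>q tps. (step M ^^ t) (initial_config k w) = (q, tps) \<and>
       q \<ge> length M \<and> fst (tps ! 1) = contents [w \<in> V]"
    using V unfolding polytime_decidable_def polytime_def by blast
  \<comment> \<open>The verifier runs on the encoded pair, of length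
    \<open>2 + 2 * length x + 2 * length u\<close>; \<open>q\<close> bounds its time for all
    admissible certificates.\<close>
  define q where "q = pcompose pt ([:2, 2:] + [:2:] * p)"
  have acc: "accepts M k (poly q (length x) + 2) (encode_list [x, u]) \<longleftrightarrow> encode_list [x, u] \<in> V"
    if "length u \<le> poly p (length x)" for x u
  proof -
    have "length (encode_list [x, u]) \<le> 2 + 2 * length x + 2 * poly p (length x)"
      using that by (simp add: length_encode_pair)
    from poly_mono_nat[OF this, of pt] have "poly pt (length (encode_list [x, u])) \<le> poly q (length x)"
      by (simp add: q_def poly_pcompose algebra_simps)
    moreover obtain t q' tps where "t \<le> poly pt (length (encode_list [x, u]))"
      "(step M ^^ t) (initial_config k (encode_list [x, u])) = (q', tps)" "q' \<ge> length M"
      "fst (tps ! 1) = contents [encode_list [x, u] \<in> V]" using run by blast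
    ultimately show ?thesis by (intro accepts_halted[of t _ _ _ _ q' tps]) auto
  qed
  \<comment> \<open>The tiles depend on the verifier but not on \<open>x\<close>. The list of tiles,
    the conflicts and \<open>g\<close> are thus constants of the printing program.\<close>
  obtain tls where tls: "set tls = tile_set k G (length M)" "distinct tls"
    using finite_distinct_list[OF finite_tile_set] by blast
  then have tls_ne: "tls \<noteq> []" by (auto simp: tile_set_def)
  define RT where "RT = conflict_rows tls (hcon k) (vcon M k)"
  have RT: "RT \<noteq> []" by (simp add: RT_def conflict_rows_def)
  define ok where "ok = (\<lambda>kd \<tau>. tile_ok k kd (tls ! \<tau>))"
  obtain g where g: "1 \<le> g" "\<And>w. g \<le> w \<Longrightarrow> 4 * real w powr \<alpha> \<le> real w"
    using group_size_exists[OF assms] by blast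
  define f where "f = tile_reduction ok RT (length tls) g p q"
  have "(\<exists>y. flamecast_problem 1 \<alpha> (f x) y) \<and>
     (\<forall>y. flamecast_problem 1 \<alpha> (f x) y \<longrightarrow> (encode_list [x, y] \<in> {w. same_parent (bits w)} \<longleftrightarrow> x \<in> L))" for x
  proof -
    define P where "P = poly p (length x)"
    define T where "T = poly q (length x)"
    interpret tb: tableau k G M x P "T + 5" T by unfold_locales (use tm in auto)
    define m where "m = length tb.ks * length RT"
    define v where "v = length tb.ks * length tls"
    define inc where "inc = tile_inc ok RT (length tls) tb.W tb.ks"
    interpret gr: grid \<alpha> g m v inc
    proof
      show "1 \<le> m" using RT tb.length_ks tb.W by (simp add: m_def Suc_le_eq)
    qed (use assms g in \<open>auto simp: inc_def tile_inc_def\<close>)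
    have fx: "f x = encode_flamecast (grid_sources g m v inc) (grid_sinks m v) [4 * g, 4 * g, 4 * g]"
      unfolding f_def tile_reduction_def Let_def m_def v_def inc_def
      unfolding tb.ks_def tb.W_def tb.R_def unfolding P_def T_def ..
    have "formula_sat m v inc \<longleftrightarrow> (\<exists>a. tiling (set tls) (tile_ok k) (hcon k) (vcon M k) tb.ks tb.W a)"
      unfolding m_def v_def inc_def RT_def ok_def using tb.W by (intro tile_formula tls(2) tls_ne) simp
    also have "\<dots> \<longleftrightarrow> (\<exists>u. length u \<le> P \<and> accepts M k (T + 2) (encode_list [x, u]))"
      unfolding tls(1) by (rule tb.tiling_iff)
    also have "\<dots> \<longleftrightarrow> x \<in> L" unfolding L P_def T_def using acc by blast
    finally have "formula_sat m v inc \<longleftrightarrow> x \<in> L" .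
    then show ?thesis unfolding fx using gr.grid_search by auto
  qed
  then show "reduces_to_search L (flamecast_problem 1 \<alpha>)"
    unfolding reduces_to_search_def
    using polytime_tile_reduction[OF RT, of ok "length tls" g p q] decidable_same_parent f_def by blast
qed

end
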